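(* Let $\mathcal{K}$ be a 2-category with finite limits and $p:E\to B$ an exponentiable morphism of $\mathcal{K}$. There is a bijection between the following types of data: (1) Unit and multiplication 2-cells in $\mathbf{Poly}_{\mathcal{K}}$ making the polynomial $$1\longleftarrow E\xrightarrow{\ p\ }B\longrightarrow1$$ the underlying endoarrow of a 2-monad in $\mathbf{Poly}_{\mathcal{K}}$. (2) Double 2-category structures on $\mathcal{D}(p)$ making $\mathcal{U}_p:\mathcal{D}(p)\to\mathcal{D}(\mathcal{K})$ a double 2-functor.
   Context: Limits in $\mathcal{K}$ have their 2-dimensional universal property. A morphism $f:X\to Y$ of $\mathcal{K}$ is exponentiable when the pullback 2-functor $\Delta_f:\mathcal{K}/Y\to\mathcal{K}/X$ has a right 2-adjoint $\Pi_f$. $\mathbf{Poly}_{\mathcal{K}}$: objects are those of $\mathcal{K}$; 1-cells $X\to Y$ are polynomials $X\xleftarrow{p_1}A\xrightarrow{p_2}C\xrightarrow{p_3}Y$ with $p_2$ exponentiable; 2-cells from this to $X\xleftarrow{q_1}A'\xrightarrow{q_2}C'\xrightarrow{q_3}Y$ are pairs $f_0:A\to A'$, $f_1:C\to C'$ with $q_1f_0=p_1$, $q_3f_1=p_3$ and $q_2f_0=f_1p_2$ a pullback square. Identities have all three maps identities. The composite $q\circ p$ of $p=(X\xleftarrow{p_1}A\xrightarrow{p_2}C\xrightarrow{p_3}Y)$ and $q=(Y\xleftarrow{q_1}A'\xrightarrow{q_2}C'\xrightarrow{q_3}Z)$ is: form the pullback $P=C\times_YA'$ with projections $\pi_1:P\to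 C$, $\pi_2:P\to A'$; form a distributivity pullback $(\varepsilon:F\to P,\ e:F\to G,\ r:G\to C')$ around $(q_2,\pi_2)$; form the pullback $H$ of $p_2$ and $\pi_1\varepsilon$; then $q\circ p=(X\leftarrow H\to G\to Z)$ with maps $H\to A\xrightarrow{p_1}X$, $H\to F\xrightarrow{e}G$, $q_3r$. Horizontal composition of 2-cells and coherence isomorphisms are induced by the universal properties. A distributivity pullback around composable $(f:U\to V,\ g:Z\to U)$ is a terminal object of the 2-category of triples $(a:X\to Z,\ b:X\to Y,\ c:Y\to V)$ such that $fga=cb$ is a pullback square exhibiting $X$ as the pullback of $f$ and $c$; arrows to $(a',b',c')$ are pairs $(s:X\to X',\ t:Y\to Y')$ with $a's=a$, $b's=tb$, $c't=c$; 2-cells $(s,t)\to(s_1,t_1)$ are pairs of 2-cells $\sigma:s\to s_1$, $\tau:t\to t_1$ with $a'\sigma=\mathrm{id}$, $b'\sigma=\tau b$, $c'\tau=\mathrm{id}$. A 2-monad on $X$ in $\mathbf{Poly}_{\mathcal{K}}$ is an endoarrow $M$ of $X$ with a unit 2-cell $1_X\to M$ and multiplication 2-cell $M\circ M\to M$ satisfying the monad axioms. A $p$-fibration is an arrow $f:X\to Y$ of $\mathcal{K}$ together with $u:X\to E$, $v:Y\to B$ such that $pu=vf$ is a pullback square. A morphism of $p$-fibrations $(f_1,u_1,v_1)\to(f_2,u_2,v_2)$, with $f_i:X_i\to Y_i$, is a pair $u_3:X_1\to X_2$, $v_3:Y_1\to Y_2$ with $f_2u_3=v_3f_1$, $u_2u_3=u_1$,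 $v_2v_3=v_1$. A 2-cell $(u_3,v_3)\to(u_4,v_4)$ of such morphisms is a pair of 2-cells $\alpha:u_3\to u_4$, $\beta:v_3\to v_4$ with $f_2\alpha=\beta f_1$, $u_2\alpha=\mathrm{id}$, $v_2\beta=\mathrm{id}$. A double 2-category (double 2-functor) is a category (functor) internal to the category of 2-categories and 2-functors. $\mathcal{D}(\mathcal{K})$ is the double 2-category with 2-category of objects $\mathcal{K}$, 2-category of horizontal arrows the arrow 2-category $\mathcal{K}^{[1]}$, source and target the domain and codomain 2-functors, and horizontal composition and identities those of $\mathcal{K}$. $\mathcal{D}(p)$ is the internal graph with $\mathcal{D}(p)_0=\mathcal{K}$, with $\mathcal{D}(p)_1$ the 2-category of $p$-fibrations, their morphisms and 2-cells, and with source and target the domain and codomain of the underlying arrow. $\mathcal{U}_p:\mathcal{D}(p)\to\mathcal{D}(\mathcal{K})$ is the morphism of internal graphs with $(\mathcal{U}_p)_0=1_{\mathcal{K}}$ and $(\mathcal{U}_p)_1$ the 2-functor forgetting $p$-fibration structures. A double 2-category structure on $\mathcal{D}(p)$ consists of horizontal identity and horizontal composition 2-functors making this internal graph an internal category. *)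

theory Defs
  imports "HOL-Library.FuncSet"
begin

section \<open>Categories and strict 2-categories\<close>

record ('o, 'a) cat =
  Ob :: "'o set"
  Ar :: "'a set"
  Dom :: "'a \<Rightarrow> 'o"
  Cod :: "'a \<Rightarrow> 'o"
  Idn :: "'o \<Rightarrow> 'a"
  Comp :: "'a \<Rightarrow> 'a \<Rightarrow> 'a"  (infixr "\<cdot>\<index>" 75)

text \<open>Composition is written in the order of functions: \<open>g \<cdot> f\<close> is defined when \<open>Dom g = Cod f\<close>.\<close>

definition hom :: "('o, 'a, 'm) cat_scheme \<Rightarrow> 'o \<Rightarrow> 'o \<Rightarrow> 'a set" where
  "hom C X Y = {f \<in> Ar C. Dom C f = X \<and> Cod C f = Y}"

locale category =
  fixes C :: "('o, 'a, 'm) cat_scheme" (structure)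
  assumes Dom_Ob: "f \<in> Ar C \<Longrightarrow> Dom C f \<in> Ob C"
    and Cod_Ob: "f \<in> Ar C \<Longrightarrow> Cod C f \<in> Ob C"
    and Idn_hom: "X \<in> Ob C \<Longrightarrow> Idn C X \<in> hom C X X"
    and Comp_hom: "f \<in> hom C X Y \<Longrightarrow> g \<in> hom C Y Z \<Longrightarrow> g \<cdot> f \<in> hom C X Z"
    and Comp_Idn: "f \<in> hom C X Y \<Longrightarrow> f \<cdot> Idn C X = f"
    and Idn_Comp: "f \<in> hom C X Y \<Longrightarrow> Idn C Y \<cdot> f = f"
    and Comp_assoc: "f \<in> hom C W X \<Longrightarrow> g \<in> hom C X Y \<Longrightarrow> h \<in> hom C Y Z
      \<Longrightarrow> (h \<cdot> g) \<cdot> f = h \<cdot> (g \<cdot> f)"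

definition is_functor :: "('o, 'a, 'm) cat_scheme \<Rightarrow> ('p, 'b, 'n) cat_scheme
    \<Rightarrow> ('o \<Rightarrow> 'p) \<Rightarrow> ('a \<Rightarrow> 'b) \<Rightarrow> bool" where
  "is_functor C D F0 F1 \<longleftrightarrow>
     F0 \<in> Ob C \<rightarrow>\<^sub>E Ob D \<and> F1 \<in> Ar C \<rightarrow>\<^sub>E Ar D \<and>
     (\<forall>f\<in>Ar C. Dom D (F1 f) = F0 (Dom C f) \<and> Cod D (F1 f) = F0 (Cod C f)) \<and>
     (\<forall>X\<in>Ob C. F1 (Idn C X) = Idn D (F0 X)) \<and>
     (\<forall>f\<in>Ar C. \<forall>g\<in>Ar C. Dom C g = Cod C f \<longrightarrow>
        F1 (g \<cdot>\<^bsub>C\<^esub> f) = F1 g \<cdot>\<^bsub>D\<^esub> F1 f)"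

record ('o, 'a, 'c) twocat = "('o, 'a) cat" +
  Ce :: "'c set"
  Src :: "'c \<Rightarrow> 'a"
  Trg :: "'c \<Rightarrow> 'a"
  Id2 :: "'a \<Rightarrow> 'c"
  VComp :: "'c \<Rightarrow> 'c \<Rightarrow> 'c"  (infixr "\<diamondop>\<index>" 75)
  HComp :: "'c \<Rightarrow> 'c \<Rightarrow> 'c"  (infixr "\<star>\<index>" 75)

text \<open>A strict 2-category consists of its category of objects and arrows, the category of arrows
  and 2-cells under vertical composition (\<open>vcat\<close>), and the category of objects and 2-cells under
  horizontal composition (\<open>hcat\<close>). Whiskering \<open>f \<alpha>\<close> is \<open>Id2 f \<star> \<alpha>\<close>.\<close>

definition vcat :: "('o, 'a, 'c, 'm) twocat_scheme \<Rightarrow> ('a, 'c) cat" where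
  "vcat K = \<lparr>Ob = Ar K, Ar = Ce K, Dom = Src K, Cod = Trg K, Idn = Id2 K, Comp = VComp K\<rparr>"

definition hcat :: "('o, 'a, 'c, 'm) twocat_scheme \<Rightarrow> ('o, 'c) cat" where
  "hcat K = \<lparr>Ob = Ob K, Ar = Ce K, Dom = (\<lambda>\<alpha>. Dom K (Src K \<alpha>)), Cod = (\<lambda>\<alpha>. Cod K (Src K \<alpha>)),
     Idn = (\<lambda>X. Id2 K (Idn K X)), Comp = HComp K\<rparr>"

locale two_category = category K + vertical: category "vcat K" + horizontal: category "hcat K"
  for K :: "('o, 'a, 'c, 'm) twocat_scheme" (structure) +
  assumes parallel: "\<alpha> \<in> Ce K \<Longrightarrow> Dom K (Trg K \<alpha>) = Dom K (Src K \<alpha>) \<and> Cod K (Trg K \<alpha>) = Cod K (Src K \<alpha>)"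
    and Src_HComp: "\<alpha> \<in> hom (hcat K) X Y \<Longrightarrow> \<beta> \<in> hom (hcat K) Y Z
      \<Longrightarrow> Src K (\<beta> \<star> \<alpha>) = Src K \<beta> \<cdot> Src K \<alpha>"
    and Trg_HComp: "\<alpha> \<in> hom (hcat K) X Y \<Longrightarrow> \<beta> \<in> hom (hcat K) Y Z
      \<Longrightarrow> Trg K (\<beta> \<star> \<alpha>) = Trg K \<beta> \<cdot> Trg K \<alpha>"
    and Id2_Comp: "f \<in> hom K X Y \<Longrightarrow> g \<in> hom K Y Z \<Longrightarrow> Id2 K g \<star> Id2 K f = Id2 K (g \<cdot> f)"
    and interchange: "\<alpha> \<in> hom (hcat K) X Y \<Longrightarrow> \<alpha>' \<in> hom (hcat K) X Y
      \<Longrightarrow> \<beta> \<in> hom (hcat K) Y Z \<Longrightarrow> \<beta>' \<in> hom (hcat K) Y Z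
      \<Longrightarrow> Trg K \<alpha> = Src K \<alpha>' \<Longrightarrow> Trg K \<beta> = Src K \<beta>'
      \<Longrightarrow> (\<beta>' \<diamondop> \<beta>) \<star> (\<alpha>' \<diamondop> \<alpha>) = (\<beta>' \<star> \<alpha>') \<diamondop> (\<beta> \<star> \<alpha>)"

abbreviation cells :: "('o, 'a, 'c, 'm) twocat_scheme \<Rightarrow> 'o \<Rightarrow> 'o \<Rightarrow> 'c set" where
  "cells K X Y \<equiv> hom (hcat K) X Y"


section \<open>2-functors, 2-natural transformations and 2-adjunctions\<close>

record ('o, 'p, 'a, 'b, 'c, 'd) twofun =
  fob :: "'o \<Rightarrow> 'p"
  far :: "'a \<Rightarrow> 'b"
  fce :: "'c \<Rightarrow> 'd"

text \<open>The three maps are extensional (they take the value \<open>undefined\<close> outside the carriers), so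
  equality of 2-functors in the sense of mathematics is equality of these records.\<close>

definition two_functor :: "('o, 'a, 'c, 'm) twocat_scheme \<Rightarrow> ('p, 'b, 'd, 'n) twocat_scheme
    \<Rightarrow> ('o, 'p, 'a, 'b, 'c, 'd) twofun \<Rightarrow> bool" where
  "two_functor A B F \<longleftrightarrow>
     is_functor A B (fob F) (far F) \<and>
     is_functor (vcat A) (vcat B) (far F) (fce F) \<and>
     is_functor (hcat A) (hcat B) (fob F) (fce F)"

definition fun_id :: "('o, 'a, 'c, 'm) twocat_scheme \<Rightarrow> ('o, 'o, 'a, 'a, 'c, 'c) twofun" where
  "fun_id A = \<lparr>fob = (\<lambda>x\<in>Ob A. x), far = (\<lambda>f\<in>Ar A. f), fce = (\<lambda>\<alpha>\<in>Ce A. \<alpha>)\<rparr>"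

text \<open>\<open>fun_comp A G F\<close> is the composite \<open>G F\<close> of 2-functors, \<open>A\<close> being the domain of \<open>F\<close>.\<close>

definition fun_comp :: "('o, 'a, 'c, 'm) twocat_scheme \<Rightarrow> ('p, 'q, 'b, 'b1, 'd, 'd1) twofun
    \<Rightarrow> ('o, 'p, 'a, 'b, 'c, 'd) twofun \<Rightarrow> ('o, 'q, 'a, 'b1, 'c, 'd1) twofun" where
  "fun_comp A G F = \<lparr>fob = compose (Ob A) (fob G) (fob F), far = compose (Ar A) (far G) (far F),
     fce = compose (Ce A) (fce G) (fce F)\<rparr>"

definition two_natural :: "('o, 'a, 'c, 'm) twocat_scheme \<Rightarrow> ('p, 'b, 'd, 'n) twocat_scheme
    \<Rightarrow> ('o, 'p, 'a, 'b, 'c, 'd) twofun \<Rightarrow> ('o, 'p, 'a, 'b, 'c, 'd) twofun \<Rightarrow> ('o \<Rightarrow> 'b) \<Rightarrow> bool" where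
  "two_natural A B F G \<tau> \<longleftrightarrow>
     (\<forall>X\<in>Ob A. \<tau> X \<in> hom B (fob F X) (fob G X)) \<and>
     (\<forall>X\<in>Ob A. \<forall>Y\<in>Ob A. \<forall>f\<in>hom A X Y. far G f \<cdot>\<^bsub>B\<^esub> \<tau> X = \<tau> Y \<cdot>\<^bsub>B\<^esub> far F f) \<and>
     (\<forall>X\<in>Ob A. \<forall>Y\<in>Ob A. \<forall>\<alpha>\<in>cells A X Y.
        fce G \<alpha> \<star>\<^bsub>B\<^esub> Id2 B (\<tau> X) = Id2 B (\<tau> Y) \<star>\<^bsub>B\<^esub> fce F \<alpha>)"

definition right_two_adjoint :: "('o, 'a, 'c, 'm) twocat_scheme \<Rightarrow> ('p, 'b, 'd, 'n) twocat_scheme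
    \<Rightarrow> ('o, 'p, 'a, 'b, 'c, 'd) twofun \<Rightarrow> ('p, 'o, 'b, 'a, 'd, 'c) twofun \<Rightarrow> bool" where
  "right_two_adjoint A B F G \<longleftrightarrow>
     two_functor A B F \<and> two_functor B A G \<and>
     (\<exists>\<eta> \<epsilon>. two_natural A A (fun_id A) (fun_comp A G F) \<eta> \<and>
            two_natural B B (fun_comp B F G) (fun_id B) \<epsilon> \<and>
            (\<forall>X\<in>Ob A. \<epsilon> (fob F X) \<cdot>\<^bsub>B\<^esub> far F (\<eta> X) = Idn B (fob F X)) \<and>
            (\<forall>Y\<in>Ob B. far G (\<epsilon> Y) \<cdot>\<^bsub>A\<^esub> \<eta> (fob G Y) = Idn A (fob G Y)))"


section \<open>2-dimensional limits\<close>

text \<open>Conical limits of functors from an ordinary category, with 2-dimensional universal property: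
  composition with the cone is bijective on arrows and on 2-cells from every \<open>X\<close>.\<close>

definition is_limit :: "('o, 'a, 'c, 'm) twocat_scheme \<Rightarrow> ('i, 'u) cat
    \<Rightarrow> ('i \<Rightarrow> 'o) \<Rightarrow> ('u \<Rightarrow> 'a) \<Rightarrow> 'o \<Rightarrow> ('i \<Rightarrow> 'a) \<Rightarrow> bool" where
  "is_limit K J D0 D1 L \<pi> \<longleftrightarrow>
     L \<in> Ob K \<and> (\<forall>j\<in>Ob J. \<pi> j \<in> hom K L (D0 j)) \<and>
     (\<forall>u\<in>Ar J. D1 u \<cdot>\<^bsub>K\<^esub> \<pi> (Dom J u) = \<pi> (Cod J u)) \<and>
     (\<forall>X\<in>Ob K.
        (\<forall>\<xi>. (\<forall>j\<in>Ob J. \<xi> j \<in> hom K X (D0 j)) \<and> (\<forall>u\<in>Ar J. D1 u \<cdot>\<^bsub>K\<^esub> \<xi> (Dom J u) = \<xi> (Cod J u)) \<longrightarrow>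
          (\<exists>!h. h \<in> hom K X L \<and> (\<forall>j\<in>Ob J. \<pi> j \<cdot>\<^bsub>K\<^esub> h = \<xi> j))) \<and>
        (\<forall>\<xi>. (\<forall>j\<in>Ob J. \<xi> j \<in> cells K X (D0 j)) \<and>
             (\<forall>u\<in>Ar J. Id2 K (D1 u) \<star>\<^bsub>K\<^esub> \<xi> (Dom J u) = \<xi> (Cod J u)) \<longrightarrow>
          (\<exists>!\<theta>. \<theta> \<in> cells K X L \<and> (\<forall>j\<in>Ob J. Id2 K (\<pi> j) \<star>\<^bsub>K\<^esub> \<theta> = \<xi> j))))"

text \<open>Every finite category is isomorphic to one whose objects and arrows are natural numbers.\<close>

definition has_finite_limits :: "('o, 'a, 'c, 'm) twocat_scheme \<Rightarrow> bool" where
  "has_finite_limits K \<longleftrightarrow>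
     (\<forall>(J :: (nat, nat) cat) D0 D1.
        category J \<and> finite (Ob J) \<and> finite (Ar J) \<and> is_functor J K D0 D1 \<longrightarrow>
        (\<exists>L \<pi>. is_limit K J D0 D1 L \<pi>))"

definition is_terminal :: "('o, 'a, 'c, 'm) twocat_scheme \<Rightarrow> 'o \<Rightarrow> bool" where
  "is_terminal K T \<longleftrightarrow>
     T \<in> Ob K \<and> (\<forall>X\<in>Ob K. (\<exists>!h. h \<in> hom K X T) \<and> (\<exists>!\<theta>. \<theta> \<in> cells K X T))"

definition bang :: "('o, 'a, 'c, 'm) twocat_scheme \<Rightarrow> 'o \<Rightarrow> 'o \<Rightarrow> 'a" where
  "bang K X T = (THE h. h \<in> hom K X T)"

text \<open>\<open>is_pullback K f g a b\<close>: the square \<open>f a = g b\<close> is a pullback.\<close>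

definition is_pullback :: "('o, 'a, 'c, 'm) twocat_scheme \<Rightarrow> 'a \<Rightarrow> 'a \<Rightarrow> 'a \<Rightarrow> 'a \<Rightarrow> bool" where
  "is_pullback K f g a b \<longleftrightarrow>
     f \<in> Ar K \<and> g \<in> Ar K \<and> Cod K f = Cod K g \<and>
     a \<in> hom K (Dom K a) (Dom K f) \<and> b \<in> hom K (Dom K a) (Dom K g) \<and>
     f \<cdot>\<^bsub>K\<^esub> a = g \<cdot>\<^bsub>K\<^esub> b \<and>
     (\<forall>X\<in>Ob K.
        (\<forall>x\<in>hom K X (Dom K f). \<forall>y\<in>hom K X (Dom K g). f \<cdot>\<^bsub>K\<^esub> x = g \<cdot>\<^bsub>K\<^esub> y \<longrightarrow>
          (\<exists>!h. h \<in> hom K X (Dom K a) \<and> a \<cdot>\<^bsub>K\<^esub> h = x \<and> b \<cdot>\<^bsub>K\<^esub> h = y)) \<and>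
        (\<forall>\<xi>\<in>cells K X (Dom K f). \<forall>\<upsilon>\<in>cells K X (Dom K g).
          Id2 K f \<star>\<^bsub>K\<^esub> \<xi> = Id2 K g \<star>\<^bsub>K\<^esub> \<upsilon> \<longrightarrow>
          (\<exists>!\<theta>. \<theta> \<in> cells K X (Dom K a) \<and> Id2 K a \<star>\<^bsub>K\<^esub> \<theta> = \<xi> \<and> Id2 K b \<star>\<^bsub>K\<^esub> \<theta> = \<upsilon>)))"

text \<open>The arrow and the 2-cell into a pullback with projections \<open>a\<close>, \<open>b\<close> induced by its universal
  property.\<close>

definition pb_lift :: "('o, 'a, 'c, 'm) twocat_scheme \<Rightarrow> 'a \<Rightarrow> 'a \<Rightarrow> 'a \<Rightarrow> 'a \<Rightarrow> 'a" where
  "pb_lift K a b x y =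
     (THE h. h \<in> hom K (Dom K x) (Dom K a) \<and> a \<cdot>\<^bsub>K\<^esub> h = x \<and> b \<cdot>\<^bsub>K\<^esub> h = y)"

definition pb_lift2 :: "('o, 'a, 'c, 'm) twocat_scheme \<Rightarrow> 'a \<Rightarrow> 'a \<Rightarrow> 'c \<Rightarrow> 'c \<Rightarrow> 'c" where
  "pb_lift2 K a b \<xi> \<upsilon> =
     (THE \<theta>. \<theta> \<in> cells K (Dom (hcat K) \<xi>) (Dom K a) \<and>
             Id2 K a \<star>\<^bsub>K\<^esub> \<theta> = \<xi> \<and> Id2 K b \<star>\<^bsub>K\<^esub> \<theta> = \<upsilon>)"

text \<open>Composition of polynomials depends on a choice of pullbacks. A choice is a function that
  returns the two projections of a pullback of \<open>f\<close> and \<open>g\<close> whenever there is one; this condition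
  can always be met and does not assert that pullbacks exist.\<close>

definition pullback_choice :: "('o, 'a, 'c, 'm) twocat_scheme \<Rightarrow> ('a \<Rightarrow> 'a \<Rightarrow> 'a \<times> 'a) \<Rightarrow> bool" where
  "pullback_choice K pb \<longleftrightarrow>
     (\<forall>f g. (\<exists>a b. is_pullback K f g a b) \<longrightarrow> is_pullback K f g (fst (pb f g)) (snd (pb f g)))"


section \<open>Exponentiable arrows\<close>

definition slice :: "('o, 'a, 'c, 'm) twocat_scheme \<Rightarrow> 'o
    \<Rightarrow> ('a, 'a \<times> 'a \<times> 'a, 'a \<times> 'a \<times> 'c) twocat" where
  "slice K X =
    (let Os = {a \<in> Ar K. Cod K a = X};
         As = {(a, b, h). a \<in> Os \<and> b \<in> Os \<and> h \<in> hom K (Dom K a) (Dom K b) \<and> b \<cdot>\<^bsub>K\<^esub> h = a}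
     in \<lparr>Ob = Os, Ar = As,
         Dom = (\<lambda>(a, b, h). a), Cod = (\<lambda>(a, b, h). b),
         Idn = (\<lambda>a. (a, a, Idn K (Dom K a))),
         Comp = (\<lambda>(b', c, h') (a, b, h). (a, c, h' \<cdot>\<^bsub>K\<^esub> h)),
         Ce = {(a, b, \<gamma>). \<gamma> \<in> Ce K \<and> (a, b, Src K \<gamma>) \<in> As \<and> (a, b, Trg K \<gamma>) \<in> As \<and>
                 Id2 K b \<star>\<^bsub>K\<^esub> \<gamma> = Id2 K a},
         Src = (\<lambda>(a, b, \<gamma>). (a, b, Src K \<gamma>)), Trg = (\<lambda>(a, b, \<gamma>). (a, b, Trg K \<gamma>)),
         Id2 = (\<lambda>(a, b, h). (a, b, Id2 K h)),
         VComp = (\<lambda>(a', b', \<gamma>') (a, b, \<gamma>). (a, b, \<gamma>' \<diamondop>\<^bsub>K\<^esub> \<gamma>)),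
         HComp = (\<lambda>(b', c, \<gamma>') (a, b, \<gamma>). (a, c, \<gamma>' \<star>\<^bsub>K\<^esub> \<gamma>))\<rparr>)"

text \<open>\<open>\<Delta>\<^sub>f\<close> from the slice over \<open>Cod f\<close> to the slice over \<open>Dom f\<close>.\<close>

definition pullback_functor :: "('o, 'a, 'c, 'm) twocat_scheme \<Rightarrow> ('a \<Rightarrow> 'a \<Rightarrow> 'a \<times> 'a) \<Rightarrow> 'a
    \<Rightarrow> ('a, 'a, 'a \<times> 'a \<times> 'a, 'a \<times> 'a \<times> 'a, 'a \<times> 'a \<times> 'c, 'a \<times> 'a \<times> 'c) twofun" where
  "pullback_functor K pb f =
    (let S = slice K (Cod K f); \<Delta> = (\<lambda>a. fst (pb f a)); \<pi> = (\<lambda>a. snd (pb f a))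
     in \<lparr>fob = (\<lambda>a\<in>Ob S. \<Delta> a),
         far = (\<lambda>(a, b, h)\<in>Ar S. (\<Delta> a, \<Delta> b, pb_lift K (\<Delta> b) (\<pi> b) (\<Delta> a) (h \<cdot>\<^bsub>K\<^esub> \<pi> a))),
         fce = (\<lambda>(a, b, \<gamma>)\<in>Ce S. (\<Delta> a, \<Delta> b,
                  pb_lift2 K (\<Delta> b) (\<pi> b) (Id2 K (\<Delta> a)) (\<gamma> \<star>\<^bsub>K\<^esub> Id2 K (\<pi> a))))\<rparr>)"

definition exponentiable :: "('o, 'a, 'c, 'm) twocat_scheme \<Rightarrow> ('a \<Rightarrow> 'a \<Rightarrow> 'a \<times> 'a) \<Rightarrow> 'a \<Rightarrow> bool" where
  "exponentiable K pb f \<longleftrightarrow> f \<in> Ar K \<and>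
     (\<exists>G. right_two_adjoint (slice K (Cod K f)) (slice K (Dom K f)) (pullback_functor K pb f) G)"


section \<open>2-categories of structured pairs\<close>

text \<open>Arrow 2-categories, \<open>p\<close>-fibrations and the triples of which distributivity pullbacks are
  terminal all have the same shape: every object \<open>x\<close> has two underlying objects \<open>d0 x\<close> and \<open>d1 x\<close>
  of \<open>K\<close>, and arrows and 2-cells are pairs of arrows and 2-cells of \<open>K\<close> subject to conditions \<open>R\<close>
  and \<open>S\<close>, with all operations componentwise. An arrow \<open>(u, v)\<close> from \<open>x\<close> to \<open>y\<close> is recorded
  as \<open>(x, y, u, v)\<close>, and likewise for 2-cells.\<close>

definition pair_twocat :: "('o, 'a, 'c, 'm) twocat_scheme \<Rightarrow> 'x set \<Rightarrow> ('x \<Rightarrow> 'o) \<Rightarrow> ('x \<Rightarrow> 'o)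
    \<Rightarrow> ('x \<Rightarrow> 'x \<Rightarrow> 'a \<Rightarrow> 'a \<Rightarrow> bool) \<Rightarrow> ('x \<Rightarrow> 'x \<Rightarrow> 'c \<Rightarrow> 'c \<Rightarrow> bool)
    \<Rightarrow> ('x, 'x \<times> 'x \<times> 'a \<times> 'a, 'x \<times> 'x \<times> 'c \<times> 'c) twocat" where
  "pair_twocat K Os d0 d1 R S =
    (let As = {(x, y, u, v). x \<in> Os \<and> y \<in> Os \<and>
                 u \<in> hom K (d0 x) (d0 y) \<and> v \<in> hom K (d1 x) (d1 y) \<and> R x y u v}
     in \<lparr>Ob = Os, Ar = As,
         Dom = (\<lambda>(x, y, u, v). x), Cod = (\<lambda>(x, y, u, v). y),
         Idn = (\<lambda>x. (x, x, Idn K (d0 x), Idn K (d1 x))),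
         Comp = (\<lambda>(y', z, u', v') (x, y, u, v). (x, z, u' \<cdot>\<^bsub>K\<^esub> u, v' \<cdot>\<^bsub>K\<^esub> v)),
         Ce = {(x, y, \<alpha>, \<beta>). \<alpha> \<in> Ce K \<and> \<beta> \<in> Ce K \<and>
                 (x, y, Src K \<alpha>, Src K \<beta>) \<in> As \<and> (x, y, Trg K \<alpha>, Trg K \<beta>) \<in> As \<and> S x y \<alpha> \<beta>},
         Src = (\<lambda>(x, y, \<alpha>, \<beta>). (x, y, Src K \<alpha>, Src K \<beta>)),
         Trg = (\<lambda>(x, y, \<alpha>, \<beta>). (x, y, Trg K \<alpha>, Trg K \<beta>)),
         Id2 = (\<lambda>(x, y, u, v). (x, y, Id2 K u, Id2 K v)),
         VComp = (\<lambda>(x', y', \<alpha>', \<beta>') (x, y, \<alpha>, \<beta>). (x, y, \<alpha>' \<diamondop>\<^bsub>K\<^esub> \<alpha>, \<beta>' \<diamondop>\<^bsub>K\<^esub> \<beta>)),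
         HComp = (\<lambda>(y', z, \<alpha>', \<beta>') (x, y, \<alpha>, \<beta>). (x, z, \<alpha>' \<star>\<^bsub>K\<^esub> \<alpha>, \<beta>' \<star>\<^bsub>K\<^esub> \<beta>))\<rparr>)"

text \<open>The two projections to \<open>K\<close> of such a 2-category \<open>P\<close>.\<close>

definition pair_fst :: "('x, 'x \<times> 'x \<times> 'a \<times> 'a, 'x \<times> 'x \<times> 'c \<times> 'c) twocat \<Rightarrow> ('x \<Rightarrow> 'o)
    \<Rightarrow> ('x, 'o, 'x \<times> 'x \<times> 'a \<times> 'a, 'a, 'x \<times> 'x \<times> 'c \<times> 'c, 'c) twofun" where
  "pair_fst P d0 = \<lparr>fob = (\<lambda>x\<in>Ob P. d0 x), far = (\<lambda>(x, y, u, v)\<in>Ar P. u),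
     fce = (\<lambda>(x, y, \<alpha>, \<beta>)\<in>Ce P. \<alpha>)\<rparr>"

definition pair_snd :: "('x, 'x \<times> 'x \<times> 'a \<times> 'a, 'x \<times> 'x \<times> 'c \<times> 'c) twocat \<Rightarrow> ('x \<Rightarrow> 'o)
    \<Rightarrow> ('x, 'o, 'x \<times> 'x \<times> 'a \<times> 'a, 'a, 'x \<times> 'x \<times> 'c \<times> 'c, 'c) twofun" where
  "pair_snd P d1 = \<lparr>fob = (\<lambda>x\<in>Ob P. d1 x), far = (\<lambda>(x, y, u, v)\<in>Ar P. v),
     fce = (\<lambda>(x, y, \<alpha>, \<beta>)\<in>Ce P. \<beta>)\<rparr>"


section \<open>Distributivity pullbacks\<close>

text \<open>The 2-category of triples \<open>(a, b, c)\<close> around \<open>(f, g)\<close>: the square \<open>f (g a) = c b\<close> is a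
  pullback.\<close>

definition dtriples :: "('o, 'a, 'c, 'm) twocat_scheme \<Rightarrow> 'a \<Rightarrow> 'a \<Rightarrow> ('a \<times> 'a \<times> 'a,
    ('a \<times> 'a \<times> 'a) \<times> ('a \<times> 'a \<times> 'a) \<times> 'a \<times> 'a,
    ('a \<times> 'a \<times> 'a) \<times> ('a \<times> 'a \<times> 'a) \<times> 'c \<times> 'c) twocat" where
  "dtriples K f g = pair_twocat K
     {(a, b, c). a \<in> Ar K \<and> Cod K a = Dom K g \<and> is_pullback K f c (g \<cdot>\<^bsub>K\<^esub> a) b}
     (\<lambda>(a, b, c). Dom K a) (\<lambda>(a, b, c). Dom K c)
     (\<lambda>(a, b, c) (a', b', c') s t. a' \<cdot>\<^bsub>K\<^esub> s = a \<and> b' \<cdot>\<^bsub>K\<^esub> s = t \<cdot>\<^bsub>K\<^esub> b \<and> c' \<cdot>\<^bsub>K\<^esub> t = c)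
     (\<lambda>(a, b, c) (a', b', c') \<sigma> \<tau>. Id2 K a' \<star>\<^bsub>K\<^esub> \<sigma> = Id2 K a \<and>
        Id2 K b' \<star>\<^bsub>K\<^esub> \<sigma> = \<tau> \<star>\<^bsub>K\<^esub> Id2 K b \<and> Id2 K c' \<star>\<^bsub>K\<^esub> \<tau> = Id2 K c)"

definition is_distributivity_pullback ::
    "('o, 'a, 'c, 'm) twocat_scheme \<Rightarrow> 'a \<Rightarrow> 'a \<Rightarrow> 'a \<times> 'a \<times> 'a \<Rightarrow> bool" where
  "is_distributivity_pullback K f g d \<longleftrightarrow>
     f \<in> Ar K \<and> g \<in> Ar K \<and> Cod K g = Dom K f \<and> is_terminal (dtriples K f g) d"

definition dpullback_choice :: "('o, 'a, 'c, 'm) twocat_scheme \<Rightarrow> ('a \<Rightarrow> 'a \<Rightarrow> 'a \<times> 'a \<times> 'a) \<Rightarrow> bool" where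
  "dpullback_choice K dpb \<longleftrightarrow>
     (\<forall>f g. (\<exists>d. is_distributivity_pullback K f g d) \<longrightarrow> is_distributivity_pullback K f g (dpb f g))"


section \<open>Monads in a bicategory\<close>

text \<open>\<open>BAssoc h g f\<close> goes from \<open>(h g) f\<close> to \<open>h (g f)\<close>, \<open>BLunit f\<close> from \<open>1 f\<close> to \<open>f\<close> and
  \<open>BRunit f\<close> from \<open>f 1\<close> to \<open>f\<close>.\<close>

record ('o, 'p, 't) bicat =
  B0 :: "'o set"
  B1 :: "'p set"
  B2 :: "'t set"
  BDom :: "'p \<Rightarrow> 'o"
  BCod :: "'p \<Rightarrow> 'o"
  BSrc :: "'t \<Rightarrow> 'p"
  BTrg :: "'t \<Rightarrow> 'p"
  BId1 :: "'o \<Rightarrow> 'p"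
  BComp :: "'p \<Rightarrow> 'p \<Rightarrow> 'p"
  BId2 :: "'p \<Rightarrow> 't"
  BVComp :: "'t \<Rightarrow> 't \<Rightarrow> 't"
  BHComp :: "'t \<Rightarrow> 't \<Rightarrow> 't"
  BAssoc :: "'p \<Rightarrow> 'p \<Rightarrow> 'p \<Rightarrow> 't"
  BLunit :: "'p \<Rightarrow> 't"
  BRunit :: "'p \<Rightarrow> 't"

definition is_monad :: "('o, 'p, 't, 'm) bicat_scheme \<Rightarrow> 'o \<Rightarrow> 'p \<Rightarrow> 't \<Rightarrow> 't \<Rightarrow> bool" where
  "is_monad B X M \<eta> \<mu> \<longleftrightarrow>
     X \<in> B0 B \<and> M \<in> B1 B \<and> BDom B M = X \<and> BCod B M = X \<and>
     \<eta> \<in> B2 B \<and> BSrc B \<eta> = BId1 B X \<and> BTrg B \<eta> = M \<and>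
     \<mu> \<in> B2 B \<and> BSrc B \<mu> = BComp B M M \<and> BTrg B \<mu> = M \<and>
     BVComp B \<mu> (BHComp B \<mu> (BId2 B M)) =
       BVComp B \<mu> (BVComp B (BHComp B (BId2 B M) \<mu>) (BAssoc B M M M)) \<and>
     BVComp B \<mu> (BHComp B \<eta> (BId2 B M)) = BLunit B M \<and>
     BVComp B \<mu> (BHComp B (BId2 B M) \<eta>) = BRunit B M"


section \<open>Polynomials\<close>

text \<open>A polynomial is the triple of its arrows \<open>(p1, p2, p3)\<close>; a 2-cell from \<open>p\<close> to \<open>q\<close> is recorded
  as \<open>(p, q, f0, f1)\<close>.\<close>

type_synonym 'a poly = "'a \<times> 'a \<times> 'a"
type_synonym 'a polycell = "'a poly \<times> 'a poly \<times> 'a \<times> 'a"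

definition polynomials :: "('o, 'a, 'c, 'm) twocat_scheme \<Rightarrow> ('a \<Rightarrow> 'a \<Rightarrow> 'a \<times> 'a) \<Rightarrow> 'a poly set" where
  "polynomials K pb = {(p1, p2, p3). p1 \<in> Ar K \<and> p2 \<in> Ar K \<and> p3 \<in> Ar K \<and>
     Dom K p1 = Dom K p2 \<and> Cod K p2 = Dom K p3 \<and> exponentiable K pb p2}"

definition polycells :: "('o, 'a, 'c, 'm) twocat_scheme \<Rightarrow> ('a \<Rightarrow> 'a \<Rightarrow> 'a \<times> 'a) \<Rightarrow> 'a polycell set" where
  "polycells K pb = {((p1, p2, p3), (q1, q2, q3), f0, f1).
     (p1, p2, p3) \<in> polynomials K pb \<and> (q1, q2, q3) \<in> polynomials K pb \<and>
     Cod K p1 = Cod K q1 \<and> Cod K p3 = Cod K q3 \<and>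
     f0 \<in> hom K (Dom K p2) (Dom K q2) \<and> f1 \<in> hom K (Cod K p2) (Cod K q2) \<and>
     q1 \<cdot>\<^bsub>K\<^esub> f0 = p1 \<and> q3 \<cdot>\<^bsub>K\<^esub> f1 = p3 \<and> is_pullback K q2 f1 f0 p2}"

text \<open>The arrows constructed in forming the composite \<open>q \<circ> p\<close>.\<close>

record 'a polycomp =
  pr1 :: 'a  \<comment> \<open>\<open>\<pi>\<^sub>1 : P \<rightarrow> C\<close>\<close>
  pr2 :: 'a  \<comment> \<open>\<open>\<pi>\<^sub>2 : P \<rightarrow> A'\<close>\<close>
  eps :: 'a  \<comment> \<open>\<open>\<epsilon> : F \<rightarrow> P\<close>\<close>
  ee  :: 'a  \<comment> \<open>\<open>e : F \<rightarrow> G\<close>\<close>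
  rr  :: 'a  \<comment> \<open>\<open>r : G \<rightarrow> C'\<close>\<close>
  hA  :: 'a  \<comment> \<open>\<open>H \<rightarrow> A\<close>\<close>
  hF  :: 'a  \<comment> \<open>\<open>H \<rightarrow> F\<close>\<close>

locale poly_ops =
  fixes K :: "('o, 'a, 'c) twocat" (structure)
    and pb :: "'a \<Rightarrow> 'a \<Rightarrow> 'a \<times> 'a"
    and dpb :: "'a \<Rightarrow> 'a \<Rightarrow> 'a \<times> 'a \<times> 'a"
begin

definition cdata :: "'a poly \<Rightarrow> 'a poly \<Rightarrow> 'a polycomp" where
  "cdata q p =
    (let (p1, p2, p3) = p; (q1, q2, q3) = q;
         (\<pi>1, \<pi>2) = pb p3 q1;
         (\<epsilon>, e, r) = dpb q2 \<pi>2;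
         (a, h) = pb p2 (\<pi>1 \<cdot> \<epsilon>)
     in \<lparr>pr1 = \<pi>1, pr2 = \<pi>2, eps = \<epsilon>, ee = e, rr = r, hA = a, hF = h\<rparr>)"

definition pcomp :: "'a poly \<Rightarrow> 'a poly \<Rightarrow> 'a poly" where
  "pcomp q p =
    (let (p1, p2, p3) = p; (q1, q2, q3) = q; D = cdata q p
     in (p1 \<cdot> hA D, ee D \<cdot> hF D, q3 \<cdot> rr D))"

definition pid :: "'o \<Rightarrow> 'a poly" where
  "pid X = (Idn K X, Idn K X, Idn K X)"

definition pid2 :: "'a poly \<Rightarrow> 'a polycell" where
  "pid2 p = (let (p1, p2, p3) = p in (p, p, Idn K (Dom K p2), Idn K (Cod K p2)))"

definition pvcomp :: "'a polycell \<Rightarrow> 'a polycell \<Rightarrow> 'a polycell" where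
  "pvcomp \<psi> \<phi> =
    (let (p, q, f0, f1) = \<phi>; (q', r, g0, g1) = \<psi> in (p, r, g0 \<cdot> f0, g1 \<cdot> f1))"

text \<open>The horizontal composite of \<open>(f0, f1) : p \<Rightarrow> p'\<close> and \<open>(g0, g1) : q \<Rightarrow> q'\<close> is induced in three
  steps: \<open>P \<rightarrow> P'\<close> by a pullback, \<open>(F \<rightarrow> F', G \<rightarrow> G')\<close> by a distributivity pullback,
  and \<open>H \<rightarrow> H'\<close> by a pullback.\<close>

definition phcomp :: "'a polycell \<Rightarrow> 'a polycell \<Rightarrow> 'a polycell" where
  "phcomp \<psi> \<phi> =
    (let (p, p', f0, f1) = \<phi>; (q, q', g0, g1) = \<psi>; (q1', q2', q3') = q';
         D = cdata q p; D' = cdata q' p';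
         t = pb_lift K (pr1 D') (pr2 D') (f1 \<cdot> pr1 D) (g0 \<cdot> pr2 D);
         (_, _, s, h1) = bang (dtriples K q2' (pr2 D')) (t \<cdot> eps D, ee D, g1 \<cdot> rr D) (eps D', ee D', rr D');
         h0 = pb_lift K (hA D') (hF D') (f0 \<cdot> hA D) (s \<cdot> hF D)
     in (pcomp q p, pcomp q' p', h0, h1))"

text \<open>For \<open>1 \<circ> p\<close>, the arrow \<open>e\<close> is a pullback of an identity, hence invertible, and \<open>G \<rightarrow> C\<close> is
  \<open>\<pi>\<^sub>1 \<epsilon> e\<^sup>-\<^sup>1\<close>. For \<open>p \<circ> 1\<close> the two components are the composite \<open>H \<rightarrow> F \<rightarrow> P \<rightarrow> A\<close> and
  \<open>r : G \<rightarrow> C\<close>.\<close>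

definition plunit :: "'a poly \<Rightarrow> 'a polycell" where
  "plunit p =
    (let (p1, p2, p3) = p; D = cdata (pid (Cod K p3)) p
     in (pcomp (pid (Cod K p3)) p, p, hA D,
         THE f1. f1 \<in> hom K (Cod K (ee D)) (Cod K p2) \<and> f1 \<cdot> ee D = pr1 D \<cdot> eps D))"

definition prunit :: "'a poly \<Rightarrow> 'a polycell" where
  "prunit p =
    (let (p1, p2, p3) = p; D = cdata p (pid (Cod K p1))
     in (pcomp p (pid (Cod K p1)), p, pr2 D \<cdot> eps D \<cdot> hF D, rr D))"

end

text \<open>For the associativity isomorphism, both bracketings of a composite of three polynomials
  \<open>X\<^sub>i\<^sub>-\<^sub>1 \<leftarrow> A\<^sub>i \<rightarrow> C\<^sub>i \<rightarrow> X\<^sub>i\<close> are resolved into three steps \<open>y\<^sub>i : Y\<^sub>i\<^sub>-\<^sub>1 \<rightarrow> Y\<^sub>i\<close>, each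
  being the pullback of \<open>A\<^sub>i \<rightarrow> C\<^sub>i\<close> along \<open>c\<^sub>i : Y\<^sub>i \<rightarrow> C\<^sub>i\<close> with projection
  \<open>a\<^sub>i : Y\<^sub>i\<^sub>-\<^sub>1 \<rightarrow> A\<^sub>i\<close>, such that \<open>c\<^sub>i\<close> and \<open>a\<^sub>i\<^sub>+\<^sub>1\<close> agree over \<open>X\<^sub>i\<close>. Both resolutions are
  terminal among such ladders, and the isomorphism is the unique comparison between them.\<close>

record 'a ladder =
  y1 :: 'a
  y2 :: 'a
  y3 :: 'a
  a1 :: 'a
  a2 :: 'a
  a3 :: 'a
  c1 :: 'a
  c2 :: 'a
  c3 :: 'a

definition ladder_map :: "('o, 'a, 'c, 'm) twocat_scheme \<Rightarrow> 'a ladder \<Rightarrow> 'a ladder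
    \<Rightarrow> 'a \<Rightarrow> 'a \<Rightarrow> 'a \<Rightarrow> 'a \<Rightarrow> bool" where
  "ladder_map K S T n0 n1 n2 n3 \<longleftrightarrow>
     n0 \<in> hom K (Dom K (y1 S)) (Dom K (y1 T)) \<and> n1 \<in> hom K (Cod K (y1 S)) (Cod K (y1 T)) \<and>
     n2 \<in> hom K (Cod K (y2 S)) (Cod K (y2 T)) \<and> n3 \<in> hom K (Cod K (y3 S)) (Cod K (y3 T)) \<and>
     y1 T \<cdot>\<^bsub>K\<^esub> n0 = n1 \<cdot>\<^bsub>K\<^esub> y1 S \<and> y2 T \<cdot>\<^bsub>K\<^esub> n1 = n2 \<cdot>\<^bsub>K\<^esub> y2 S \<and> y3 T \<cdot>\<^bsub>K\<^esub> n2 = n3 \<cdot>\<^bsub>K\<^esub> y3 S \<and>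
     a1 T \<cdot>\<^bsub>K\<^esub> n0 = a1 S \<and> a2 T \<cdot>\<^bsub>K\<^esub> n1 = a2 S \<and> a3 T \<cdot>\<^bsub>K\<^esub> n2 = a3 S \<and>
     c1 T \<cdot>\<^bsub>K\<^esub> n1 = c1 S \<and> c2 T \<cdot>\<^bsub>K\<^esub> n2 = c2 S \<and> c3 T \<cdot>\<^bsub>K\<^esub> n3 = c3 S"

context poly_ops
begin

text \<open>\<open>ladder_left r q p\<close> resolves \<open>(r \<circ> q) \<circ> p\<close> and \<open>ladder_right r q p\<close> resolves
  \<open>r \<circ> (q \<circ> p)\<close>; the missing object of each is a pullback over the object \<open>G\<close> of the inner
  composite.\<close>

definition ladder_left :: "'a poly \<Rightarrow> 'a poly \<Rightarrow> 'a poly \<Rightarrow> 'a ladder" where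
  "ladder_left r q p =
    (let D = cdata r q; D' = cdata (pcomp r q) p;
         (m, n) = pb (ee D) (rr D');
         z = pr2 D' \<cdot> eps D'
     in \<lparr>y1 = hF D', y2 = pb_lift K m n (hF D \<cdot> z) (ee D'), y3 = n,
         a1 = hA D', a2 = hA D \<cdot> z, a3 = pr2 D \<cdot> eps D \<cdot> m,
         c1 = pr1 D' \<cdot> eps D', c2 = pr1 D \<cdot> eps D \<cdot> m, c3 = rr D \<cdot> rr D'\<rparr>)"

definition ladder_right :: "'a poly \<Rightarrow> 'a poly \<Rightarrow> 'a poly \<Rightarrow> 'a ladder" where
  "ladder_right r q p =
    (let D = cdata q p; D' = cdata r (pcomp q p);
         w = pr1 D' \<cdot> eps D';
         (m, n) = pb (ee D) w
     in \<lparr>y1 = pb_lift K m n (hF D \<cdot> hA D') (hF D'), y2 = n, y3 = ee D',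
         a1 = hA D \<cdot> hA D', a2 = pr2 D \<cdot> eps D \<cdot> m, a3 = pr2 D' \<cdot> eps D',
         c1 = pr1 D \<cdot> eps D \<cdot> m, c2 = rr D \<cdot> w, c3 = rr D'\<rparr>)"

definition passoc :: "'a poly \<Rightarrow> 'a poly \<Rightarrow> 'a poly \<Rightarrow> 'a polycell" where
  "passoc r q p =
    (let (n0, n1, n2, n3) =
       (THE (n0, n1, n2, n3). ladder_map K (ladder_left r q p) (ladder_right r q p) n0 n1 n2 n3)
     in (pcomp (pcomp r q) p, pcomp r (pcomp q p), n0, n3))"

definition Poly :: "('o, 'a poly, 'a polycell) bicat" where
  "Poly =
    \<lparr>B0 = Ob K, B1 = polynomials K pb, B2 = polycells K pb,
     BDom = (\<lambda>(p1, p2, p3). Cod K p1), BCod = (\<lambda>(p1, p2, p3). Cod K p3),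
     BSrc = (\<lambda>(p, q, f0, f1). p), BTrg = (\<lambda>(p, q, f0, f1). q),
     BId1 = pid, BComp = pcomp, BId2 = pid2, BVComp = pvcomp, BHComp = phcomp,
     BAssoc = passoc, BLunit = plunit, BRunit = prunit\<rparr>"

end


section \<open>Double 2-categories\<close>

text \<open>The pullback of 2-categories along 2-functors \<open>F\<close> and \<open>G\<close> with common codomain.\<close>

definition fibprod :: "('o, 'a, 'c, 'm) twocat_scheme \<Rightarrow> ('p, 'b, 'd, 'n) twocat_scheme
    \<Rightarrow> ('o, 'q, 'a, 'e, 'c, 'f) twofun \<Rightarrow> ('p, 'q, 'b, 'e, 'd, 'f) twofun
    \<Rightarrow> ('o \<times> 'p, 'a \<times> 'b, 'c \<times> 'd) twocat" where
  "fibprod A B F G =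
    \<lparr>Ob = {(x, y). x \<in> Ob A \<and> y \<in> Ob B \<and> fob F x = fob G y},
     Ar = {(f, g). f \<in> Ar A \<and> g \<in> Ar B \<and> far F f = far G g},
     Dom = map_prod (Dom A) (Dom B), Cod = map_prod (Cod A) (Cod B),
     Idn = map_prod (Idn A) (Idn B),
     Comp = (\<lambda>(f', g') (f, g). (f' \<cdot>\<^bsub>A\<^esub> f, g' \<cdot>\<^bsub>B\<^esub> g)),
     Ce = {(\<alpha>, \<beta>). \<alpha> \<in> Ce A \<and> \<beta> \<in> Ce B \<and> fce F \<alpha> = fce G \<beta>},
     Src = map_prod (Src A) (Src B), Trg = map_prod (Trg A) (Trg B),
     Id2 = map_prod (Id2 A) (Id2 B),
     VComp = (\<lambda>(\<alpha>', \<beta>') (\<alpha>, \<beta>). (\<alpha>' \<diamondop>\<^bsub>A\<^esub> \<alpha>, \<beta>' \<diamondop>\<^bsub>B\<^esub> \<beta>)),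
     HComp = (\<lambda>(\<alpha>', \<beta>') (\<alpha>, \<beta>). (\<alpha>' \<star>\<^bsub>A\<^esub> \<alpha>, \<beta>' \<star>\<^bsub>B\<^esub> \<beta>))\<rparr>"

definition proj1 :: "('o \<times> 'p, 'a \<times> 'b, 'c \<times> 'd, 'm) twocat_scheme
    \<Rightarrow> ('o \<times> 'p, 'o, 'a \<times> 'b, 'a, 'c \<times> 'd, 'c) twofun" where
  "proj1 P = \<lparr>fob = restrict fst (Ob P), far = restrict fst (Ar P), fce = restrict fst (Ce P)\<rparr>"

definition proj2 :: "('o \<times> 'p, 'a \<times> 'b, 'c \<times> 'd, 'm) twocat_scheme
    \<Rightarrow> ('o \<times> 'p, 'p, 'a \<times> 'b, 'b, 'c \<times> 'd, 'd) twofun" where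
  "proj2 P = \<lparr>fob = restrict snd (Ob P), far = restrict snd (Ar P), fce = restrict snd (Ce P)\<rparr>"

text \<open>The 2-functor from \<open>X\<close> into a pullback of 2-categories with components \<open>F\<close> and \<open>G\<close>.\<close>

definition pairing :: "('q, 'e, 'f, 'm) twocat_scheme \<Rightarrow> ('q, 'o, 'e, 'a, 'f, 'c) twofun
    \<Rightarrow> ('q, 'p, 'e, 'b, 'f, 'd) twofun \<Rightarrow> ('q, 'o \<times> 'p, 'e, 'a \<times> 'b, 'f, 'c \<times> 'd) twofun" where
  "pairing X F G = \<lparr>fob = (\<lambda>x\<in>Ob X. (fob F x, fob G x)), far = (\<lambda>u\<in>Ar X. (far F u, far G u)),
     fce = (\<lambda>\<alpha>\<in>Ce X. (fce F \<alpha>, fce G \<alpha>))\<rparr>"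

text \<open>Internal graphs and internal categories in the category of 2-categories and 2-functors. The
  horizontal composition \<open>DCmp\<close> is defined on pairs \<open>(g, f)\<close> with \<open>DSrc g = DTgt f\<close>.\<close>

record ('o, 'a, 'c, 'p, 'b, 'd) dgraph =
  D0 :: "('o, 'a, 'c) twocat"
  D1 :: "('p, 'b, 'd) twocat"
  DSrc :: "('p, 'o, 'b, 'a, 'd, 'c) twofun"
  DTgt :: "('p, 'o, 'b, 'a, 'd, 'c) twofun"

record ('o, 'a, 'c, 'p, 'b, 'd) dcat = "('o, 'a, 'c, 'p, 'b, 'd) dgraph" +
  DIde :: "('o, 'p, 'a, 'b, 'c, 'd) twofun"
  DCmp :: "('p \<times> 'p, 'p, 'b \<times> 'b, 'b, 'd \<times> 'd, 'd) twofun"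

definition dpairs :: "('o, 'a, 'c, 'p, 'b, 'd, 'm) dgraph_scheme
    \<Rightarrow> ('p \<times> 'p, 'b \<times> 'b, 'd \<times> 'd) twocat" where
  "dpairs D = fibprod (D1 D) (D1 D) (DSrc D) (DTgt D)"

definition dtriplets :: "('o, 'a, 'c, 'p, 'b, 'd, 'm) dgraph_scheme
    \<Rightarrow> ('p \<times> 'p \<times> 'p, 'b \<times> 'b \<times> 'b, 'd \<times> 'd \<times> 'd) twocat" where
  "dtriplets D = fibprod (D1 D) (dpairs D) (DSrc D) (fun_comp (dpairs D) (DTgt D) (proj1 (dpairs D)))"

definition internal_graph :: "('o, 'a, 'c, 'p, 'b, 'd, 'm) dgraph_scheme \<Rightarrow> bool" where
  "internal_graph D \<longleftrightarrow> two_category (D0 D) \<and> two_category (D1 D) \<and>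
     two_functor (D1 D) (D0 D) (DSrc D) \<and> two_functor (D1 D) (D0 D) (DTgt D)"

definition double_2category :: "('o, 'a, 'c, 'p, 'b, 'd) dcat \<Rightarrow> bool" where
  "double_2category D \<longleftrightarrow>
     internal_graph D \<and>
     two_functor (D0 D) (D1 D) (DIde D) \<and> two_functor (dpairs D) (D1 D) (DCmp D) \<and>
     fun_comp (D0 D) (DSrc D) (DIde D) = fun_id (D0 D) \<and>
     fun_comp (D0 D) (DTgt D) (DIde D) = fun_id (D0 D) \<and>
     fun_comp (dpairs D) (DSrc D) (DCmp D) = fun_comp (dpairs D) (DSrc D) (proj2 (dpairs D)) \<and>
     fun_comp (dpairs D) (DTgt D) (DCmp D) = fun_comp (dpairs D) (DTgt D) (proj1 (dpairs D)) \<and>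
     fun_comp (D1 D) (DCmp D) (pairing (D1 D) (fun_comp (D1 D) (DIde D) (DTgt D)) (fun_id (D1 D))) =
       fun_id (D1 D) \<and>
     fun_comp (D1 D) (DCmp D) (pairing (D1 D) (fun_id (D1 D)) (fun_comp (D1 D) (DIde D) (DSrc D))) =
       fun_id (D1 D) \<and>
     (let T = dtriplets D; h = proj1 T; gf = proj2 T;
          g = fun_comp T (proj1 (dpairs D)) gf; f = fun_comp T (proj2 (dpairs D)) gf
      in fun_comp T (DCmp D) (pairing T (fun_comp T (DCmp D) (pairing T h g)) f) =
         fun_comp T (DCmp D) (pairing T h (fun_comp T (DCmp D) gf)))"

definition double_2functor :: "('o, 'a, 'c, 'p, 'b, 'd) dcat \<Rightarrow> ('o1, 'a1, 'c1, 'p1, 'b1, 'd1) dcat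
    \<Rightarrow> ('o, 'o1, 'a, 'a1, 'c, 'c1) twofun \<Rightarrow> ('p, 'p1, 'b, 'b1, 'd, 'd1) twofun \<Rightarrow> bool" where
  "double_2functor D D' U0 U1 \<longleftrightarrow>
     double_2category D \<and> double_2category D' \<and>
     two_functor (D0 D) (D0 D') U0 \<and> two_functor (D1 D) (D1 D') U1 \<and>
     fun_comp (D1 D) (DSrc D') U1 = fun_comp (D1 D) U0 (DSrc D) \<and>
     fun_comp (D1 D) (DTgt D') U1 = fun_comp (D1 D) U0 (DTgt D) \<and>
     fun_comp (D0 D) U1 (DIde D) = fun_comp (D0 D) (DIde D') U0 \<and>
     fun_comp (dpairs D) U1 (DCmp D) =
       fun_comp (dpairs D) (DCmp D')
         (pairing (dpairs D) (fun_comp (dpairs D) U1 (proj1 (dpairs D)))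
                             (fun_comp (dpairs D) U1 (proj2 (dpairs D))))"


section \<open>The double 2-category of arrows and the internal graph of p-fibrations\<close>

text \<open>The arrow 2-category; an arrow from \<open>f\<close> to \<open>g\<close> is \<open>(f, g, u, v)\<close> with \<open>g u = v f\<close>.\<close>

definition arrow2cat :: "('o, 'a, 'c, 'm) twocat_scheme
    \<Rightarrow> ('a, 'a \<times> 'a \<times> 'a \<times> 'a, 'a \<times> 'a \<times> 'c \<times> 'c) twocat" where
  "arrow2cat K = pair_twocat K (Ar K) (Dom K) (Cod K)
     (\<lambda>f g u v. g \<cdot>\<^bsub>K\<^esub> u = v \<cdot>\<^bsub>K\<^esub> f)
     (\<lambda>f g \<alpha> \<beta>. Id2 K g \<star>\<^bsub>K\<^esub> \<alpha> = \<beta> \<star>\<^bsub>K\<^esub> Id2 K f)"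

definition DK :: "('o, 'a, 'c) twocat
    \<Rightarrow> ('o, 'a, 'c, 'a, 'a \<times> 'a \<times> 'a \<times> 'a, 'a \<times> 'a \<times> 'c \<times> 'c) dcat" where
  "DK K =
    (let A = arrow2cat K; P = fibprod A A (pair_fst A (Dom K)) (pair_snd A (Cod K))
     in \<lparr>D0 = K, D1 = A, DSrc = pair_fst A (Dom K), DTgt = pair_snd A (Cod K),
         DIde = \<lparr>fob = (\<lambda>X\<in>Ob K. Idn K X),
                 far = (\<lambda>u\<in>Ar K. (Idn K (Dom K u), Idn K (Cod K u), u, u)),
                 fce = (\<lambda>\<alpha>\<in>Ce K. (Idn K (Dom K (Src K \<alpha>)), Idn K (Cod K (Src K \<alpha>)), \<alpha>, \<alpha>))\<rparr>,
         DCmp = \<lparr>fob = (\<lambda>(g, f)\<in>Ob P. g \<cdot>\<^bsub>K\<^esub> f),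
                 far = (\<lambda>((g, g', v, w), (f, f', u, v'))\<in>Ar P. (g \<cdot>\<^bsub>K\<^esub> f, g' \<cdot>\<^bsub>K\<^esub> f', u, w)),
                 fce = (\<lambda>((g, g', \<beta>, \<gamma>), (f, f', \<alpha>, \<beta>'))\<in>Ce P. (g \<cdot>\<^bsub>K\<^esub> f, g' \<cdot>\<^bsub>K\<^esub> f', \<alpha>, \<gamma>))\<rparr>\<rparr>)"

definition pfib2cat :: "('o, 'a, 'c, 'm) twocat_scheme \<Rightarrow> 'a \<Rightarrow> ('a \<times> 'a \<times> 'a,
    ('a \<times> 'a \<times> 'a) \<times> ('a \<times> 'a \<times> 'a) \<times> 'a \<times> 'a,
    ('a \<times> 'a \<times> 'a) \<times> ('a \<times> 'a \<times> 'a) \<times> 'c \<times> 'c) twocat" where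
  "pfib2cat K p = pair_twocat K
     {(f, u, v). is_pullback K p v u f}
     (\<lambda>(f, u, v). Dom K f) (\<lambda>(f, u, v). Cod K f)
     (\<lambda>(f1, u1, v1) (f2, u2, v2) u v. f2 \<cdot>\<^bsub>K\<^esub> u = v \<cdot>\<^bsub>K\<^esub> f1 \<and> u2 \<cdot>\<^bsub>K\<^esub> u = u1 \<and> v2 \<cdot>\<^bsub>K\<^esub> v = v1)
     (\<lambda>(f1, u1, v1) (f2, u2, v2) \<alpha> \<beta>. Id2 K f2 \<star>\<^bsub>K\<^esub> \<alpha> = \<beta> \<star>\<^bsub>K\<^esub> Id2 K f1 \<and>
        Id2 K u2 \<star>\<^bsub>K\<^esub> \<alpha> = Id2 K u1 \<and> Id2 K v2 \<star>\<^bsub>K\<^esub> \<beta> = Id2 K v1)"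

definition Dp :: "('o, 'a, 'c) twocat \<Rightarrow> 'a \<Rightarrow> ('o, 'a, 'c, 'a \<times> 'a \<times> 'a,
    ('a \<times> 'a \<times> 'a) \<times> ('a \<times> 'a \<times> 'a) \<times> 'a \<times> 'a,
    ('a \<times> 'a \<times> 'a) \<times> ('a \<times> 'a \<times> 'a) \<times> 'c \<times> 'c) dgraph" where
  "Dp K p = \<lparr>D0 = K, D1 = pfib2cat K p,
     DSrc = pair_fst (pfib2cat K p) (\<lambda>(f, u, v). Dom K f),
     DTgt = pair_snd (pfib2cat K p) (\<lambda>(f, u, v). Cod K f)\<rparr>"

definition Up1 :: "('o, 'a, 'c) twocat \<Rightarrow> 'a \<Rightarrow> ('a \<times> 'a \<times> 'a, 'a,
    ('a \<times> 'a \<times> 'a) \<times> ('a \<times> 'a \<times> 'a) \<times> 'a \<times> 'a, 'a \<times> 'a \<times> 'a \<times> 'a,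
    ('a \<times> 'a \<times> 'a) \<times> ('a \<times> 'a \<times> 'a) \<times> 'c \<times> 'c, 'a \<times> 'a \<times> 'c \<times> 'c) twofun" where
  "Up1 K p =
     \<lparr>fob = (\<lambda>(f, u, v)\<in>Ob (pfib2cat K p). f),
      far = (\<lambda>((f1, u1, v1), (f2, u2, v2), u3, v3)\<in>Ar (pfib2cat K p). (f1, f2, u3, v3)),
      fce = (\<lambda>((f1, u1, v1), (f2, u2, v2), \<alpha>, \<beta>)\<in>Ce (pfib2cat K p). (f1, f2, \<alpha>, \<beta>))\<rparr>"

text \<open>The internal graph \<open>G\<close> equipped with horizontal identities \<open>I\<close> and horizontal composition \<open>H\<close>.\<close>

definition with_structure :: "('o, 'a, 'c, 'p, 'b, 'd) dgraph \<Rightarrow> ('o, 'p, 'a, 'b, 'c, 'd) twofun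
    \<Rightarrow> ('p \<times> 'p, 'p, 'b \<times> 'b, 'b, 'd \<times> 'd, 'd) twofun \<Rightarrow> ('o, 'a, 'c, 'p, 'b, 'd) dcat" where
  "with_structure G I H =
     \<lparr>D0 = D0 G, D1 = D1 G, DSrc = DSrc G, DTgt = DTgt G, DIde = I, DCmp = H\<rparr>"


section \<open>The two types of data\<close>

text \<open>The polynomial \<open>1 \<leftarrow> E \<rightarrow> B \<rightarrow> 1\<close> with middle arrow \<open>p\<close>, where \<open>one\<close> is the terminal object.\<close>

definition end_poly :: "('o, 'a, 'c, 'm) twocat_scheme \<Rightarrow> 'o \<Rightarrow> 'a \<Rightarrow> 'a poly" where
  "end_poly K one p = (bang K (Dom K p) one, p, bang K (Cod K p) one)"

definition monad_structures :: "('o, 'a, 'c) twocat \<Rightarrow> ('a \<Rightarrow> 'a \<Rightarrow> 'a \<times> 'a)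
    \<Rightarrow> ('a \<Rightarrow> 'a \<Rightarrow> 'a \<times> 'a \<times> 'a) \<Rightarrow> 'o \<Rightarrow> 'a \<Rightarrow> ('a polycell \<times> 'a polycell) set" where
  "monad_structures K pb dpb one p =
     {(\<eta>, \<mu>). is_monad (poly_ops.Poly K pb dpb) one (end_poly K one p) \<eta> \<mu>}"

definition double_structures :: "('o, 'a, 'c) twocat \<Rightarrow> 'a \<Rightarrow>
    (('o, 'a \<times> 'a \<times> 'a, 'a, ('a \<times> 'a \<times> 'a) \<times> ('a \<times> 'a \<times> 'a) \<times> 'a \<times> 'a,
      'c, ('a \<times> 'a \<times> 'a) \<times> ('a \<times> 'a \<times> 'a) \<times> 'c \<times> 'c) twofun \<times>
     (('a \<times> 'a \<times> 'a) \<times> ('a \<times> 'a \<times> 'a), 'a \<times> 'a \<times> 'a,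
      (('a \<times> 'a \<times> 'a) \<times> ('a \<times> 'a \<times> 'a) \<times> 'a \<times> 'a) \<times> (('a \<times> 'a \<times> 'a) \<times> ('a \<times> 'a \<times> 'a) \<times> 'a \<times> 'a),
      ('a \<times> 'a \<times> 'a) \<times> ('a \<times> 'a \<times> 'a) \<times> 'a \<times> 'a,
      (('a \<times> 'a \<times> 'a) \<times> ('a \<times> 'a \<times> 'a) \<times> 'c \<times> 'c) \<times> (('a \<times> 'a \<times> 'a) \<times> ('a \<times> 'a \<times> 'a) \<times> 'c \<times> 'c),
      ('a \<times> 'a \<times> 'a) \<times> ('a \<times> 'a \<times> 'a) \<times> 'c \<times> 'c) twofun) set" where
  "double_structures K p =
     {(I, H). double_2category (with_structure (Dp K p) I H) \<and>
              double_2functor (with_structure (Dp K p) I H) (DK K) (fun_id K) (Up1 K p)}"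

end

theory Submission imports Defs begin

text \<open>
  If vertical composition is forgotten, a 2-category is an ordinary category: its 2-cells compose
  horizontally, the arrows of \<open>K\<close> are the identity 2-cells among them, and sending a 2-cell to the
  identity of its source is a functor that retracts 2-cells onto arrows. A 2-dimensional universal
  property asks for unique factorizations of arrows and of 2-cells; since that retraction turns the
  factorization of an arrow into another one, the factorization is an arrow itself, and the
  condition on 2-cells implies the one on arrows. So pullbacks and distributivity pullbacks of
  \<open>K\<close> are 1-dimensional notions in the category of 2-cells with its distinguished \<^emph>\<open>tight\<close>
  elements (\<open>is_pullback_iff\<close>, \<open>is_distributivity_pullback_iff\<close>), and most of the argument takes
  place there. An arrow \<open>f\<close> is exponentiable exactly when all the distributivity pullbacks around
  \<open>(f, g)\<close> exist in a form that also tests 2-cells (\<open>exponentiable_iff\<close>); in this form they are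
  inherited by pullbacks and composites of \<open>f\<close>, which makes polynomials composable.

  Let \<open>M\<close> be the polynomial \<open>1 \<leftarrow> E \<rightarrow> B \<rightarrow> 1\<close>. Over the terminal object the outer legs of a
  polynomial carry no information, so a 2-cell into \<open>M\<close> is a p-fibration structure on the middle
  arrow of its source: a unit is such a structure on the identity of \<open>1\<close>, and a multiplication is
  one on the middle arrow of \<open>M \<circ> M\<close>. That middle arrow is by construction a composite of two
  p-fibrations, and these form the terminal composable pair of p-fibrations (\<open>up_lo_universal\<close>).
  By a Yoneda argument a structure on the composite of this pair is the same thing as a natural
  choice of structures on the composites of all composable pairs, and a structure on the identity
  of \<open>1\<close> is a natural choice of structures on all identities (\<open>uni\<close>, \<open>cmp\<close>,
  \<open>double_structure_obtain\<close>).

  A double 2-category structure over that of all arrows of \<open>K\<close> is exactly such a pair of choices,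
  subject to equations: its 2-functors are determined by their values on objects, and that these
  values extend to 2-functors says that they are natural (\<open>double_structures_iff\<close>). Finally,
  equations between natural operations hold everywhere once they hold in the universal instance,
  and there they are the monad laws (\<open>left_unit_iff\<close>, \<open>right_unit_iff\<close>, \<open>assoc_iff\<close>). For
  associativity the universal instance is the ladder of three p-fibrations that resolves
  \<open>(M \<circ> M) \<circ> M\<close>, and its comparison with the ladder of \<open>M \<circ> (M \<circ> M)\<close> is the associativity
  isomorphism.
\<close>

section \<open>Pullbacks and distributivity pullbacks relative to tight elements\<close>

text \<open>The instance to think of has the 2-cells of a 2-category as elements and horizontal
  composition; the tight elements are the identity 2-cells, and \<open>tighten\<close> passes to the identity of
  the source. Composition is total and associative without side conditions, elements that do not
  satisfy \<open>arr\<close> standing for undefined composites, so that composites can be reassociated by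
  rewriting alone.\<close>

locale tight_category =
  fixes comp :: "'c \<Rightarrow> 'c \<Rightarrow> 'c"  (infixr "\<bullet>" 75)
    and arr :: "'c \<Rightarrow> bool" and dm cd :: "'c \<Rightarrow> 'o" and ide :: "'o \<Rightarrow> 'c"
    and tighten :: "'c \<Rightarrow> 'c"
  assumes assoc: "(h \<bullet> g) \<bullet> f = h \<bullet> (g \<bullet> f)"
    and arr_comp: "arr (g \<bullet> f) \<longleftrightarrow> arr g \<and> arr f \<and> dm g = cd f"
    and dm_comp: "arr (g \<bullet> f) \<Longrightarrow> dm (g \<bullet> f) = dm f"
    and cd_comp: "arr (g \<bullet> f) \<Longrightarrow> cd (g \<bullet> f) = cd g"
    and comp_ide: "arr f \<Longrightarrow> f \<bullet> ide (dm f) = f"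
    and ide_comp: "arr f \<Longrightarrow> ide (cd f) \<bullet> f = f"
    and tighten_comp: "tighten (g \<bullet> f) = tighten g \<bullet> tighten f"
    and tighten_idem: "tighten (tighten f) = tighten f"
    and tighten_arr: "arr f \<Longrightarrow> arr (tighten f) \<and> dm (tighten f) = dm f \<and> cd (tighten f) = cd f"
    and tighten_ide: "arr f \<Longrightarrow> tighten (ide (dm f)) = ide (dm f) \<and> tighten (ide (cd f)) = ide (cd f)"
begin

definition tight :: "'c \<Rightarrow> bool" where
  "tight f \<longleftrightarrow> arr f \<and> tighten f = f"

lemma tight_arr: "tight f \<Longrightarrow> arr f"
  by (simp add: tight_def)

lemma tight_comp: "tight g \<Longrightarrow> tight f \<Longrightarrow> arr (g \<bullet> f) \<Longrightarrow> tight (g \<bullet> f)"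
  by (simp add: tight_def tighten_comp)

lemma arr_ide: "arr f \<Longrightarrow> arr (ide (dm f)) \<and> dm (ide (dm f)) = dm f \<and> cd (ide (dm f)) = dm f"
  by (metis arr_comp comp_ide dm_comp)

lemma arr_ide': "arr f \<Longrightarrow> arr (ide (cd f)) \<and> dm (ide (cd f)) = cd f \<and> cd (ide (cd f)) = cd f"
  by (metis arr_comp ide_comp cd_comp)

lemma tight_ide: "arr f \<Longrightarrow> tight (ide (dm f))" "arr f \<Longrightarrow> tight (ide (cd f))"
  by (simp_all add: tight_def arr_ide arr_ide' tighten_ide)

text \<open>The square consists of tight elements, but the universal property is tested on all elements. In the
  instance of 2-cells this is the 2-dimensional universal property.\<close>

definition pbk :: "'c \<Rightarrow> 'c \<Rightarrow> 'c \<Rightarrow> 'c \<Rightarrow> bool" where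
  "pbk f g a b \<longleftrightarrow> tight f \<and> tight g \<and> tight a \<and> tight b \<and> arr (f \<bullet> a) \<and> f \<bullet> a = g \<bullet> b \<and>
     (\<forall>x y. arr (f \<bullet> x) \<and> f \<bullet> x = g \<bullet> y \<longrightarrow> (\<exists>!h. a \<bullet> h = x \<and> b \<bullet> h = y))"

lemma pbk_tight: "pbk f g a b \<Longrightarrow> tight f \<and> tight g \<and> tight a \<and> tight b"
  and pbk_comm: "pbk f g a b \<Longrightarrow> f \<bullet> a = g \<bullet> b"
  and pbk_arr: "pbk f g a b \<Longrightarrow> arr (f \<bullet> a) \<and> arr (g \<bullet> b)"
  unfolding pbk_def by metis+

lemma pbk_types:
  assumes "pbk f g a b"
  shows "arr f" "arr g" "arr a" "arr b" "dm f = cd a" "dm g = cd b" "cd f = cd g" "dm a = dm b"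
proof -
  from assms have *: "arr (f \<bullet> a)" "arr (g \<bullet> b)" "f \<bullet> a = g \<bullet> b" "tight f" "tight g" "tight a" "tight b"
    by (auto simp: pbk_def)
  then show "arr f" "arr g" "arr a" "arr b" "dm f = cd a" "dm g = cd b" "cd f = cd g" "dm a = dm b"
    by (metis tight_arr arr_comp dm_comp cd_comp)+
qed

lemma pbk_lift:
  assumes "pbk f g a b" "f \<bullet> x = g \<bullet> y" "arr (f \<bullet> x)"
  obtains h where "a \<bullet> h = x" "b \<bullet> h = y"
  using assms unfolding pbk_def by blast

lemma pbk_eq:
  assumes "pbk f g a b" "a \<bullet> h = a \<bullet> k" "b \<bullet> h = b \<bullet> k" "arr (a \<bullet> h)"
  shows "h = k"
proof -
  have "arr (f \<bullet> (a \<bullet> h))"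
    using assms pbk_types[OF assms(1)] by (simp add: arr_comp cd_comp)
  moreover have "f \<bullet> (a \<bullet> h) = g \<bullet> (b \<bullet> h)"
    using pbk_comm[OF assms(1)] by (metis assoc)
  ultimately show ?thesis
    using assms unfolding pbk_def by metis
qed

lemma pbk_eq':
  assumes "pbk f g a b" "a \<bullet> h = a \<bullet> k" "b \<bullet> h = b \<bullet> k" "arr (b \<bullet> h)"
  shows "h = k"
  by (rule pbk_eq[OF assms(1-3)]) (use assms(4) pbk_types[OF assms(1)] in \<open>simp add: arr_comp\<close>)

text \<open>If \<open>h\<close> is a factorization of tight elements, so is \<open>tighten h\<close>; uniqueness does the rest. This is
  why the universal property for 2-cells contains the one for arrows.\<close>

lemma pbk_lift_tight:
  assumes "pbk f g a b" "a \<bullet> h = x" "b \<bullet> h = y" "tight x" "tight y"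
  shows "tight h"
proof -
  have ab: "tighten a = a" "tighten b = b"
    using pbk_tight[OF assms(1)] by (auto simp: tight_def)
  have h: "arr h"
    using assms by (metis arr_comp tight_arr)
  have "a \<bullet> tighten h = x" "b \<bullet> tighten h = y"
    using assms(2-5) ab by (metis tight_def tighten_comp)+
  then have "tighten h = h"
    using pbk_eq[OF assms(1), of "tighten h" h] assms by (simp add: tight_arr)
  with h show ?thesis
    by (simp add: tight_def)
qed

lemma pbkI:
  assumes "tight f" "tight g" "tight a" "tight b" "arr (f \<bullet> a)" "f \<bullet> a = g \<bullet> b"
    and "\<And>x y. arr (f \<bullet> x) \<Longrightarrow> f \<bullet> x = g \<bullet> y \<Longrightarrow> \<exists>h. a \<bullet> h = x \<and> b \<bullet> h = y"
    and "\<And>h k. arr (a \<bullet> h) \<Longrightarrow> a \<bullet> h = a \<bullet> k \<Longrightarrow> b \<bullet> h = b \<bullet> k \<Longrightarrow> h = k"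
  shows "pbk f g a b"
proof -
  have "\<exists>!h. a \<bullet> h = x \<and> b \<bullet> h = y" if xy: "arr (f \<bullet> x)" "f \<bullet> x = g \<bullet> y" for x y
  proof -
    obtain h where h: "a \<bullet> h = x \<and> b \<bullet> h = y"
      using assms(7)[OF xy] by blast
    moreover have "arr (a \<bullet> h)"
      using h xy(1) by (simp add: arr_comp)
    ultimately show ?thesis
      using assms(8)[of h] by (intro ex1I[of _ h]) (assumption, metis)
  qed
  with assms(1-6) show ?thesis
    unfolding pbk_def by blast
qed

lemma pbk_sym: "pbk f g a b \<Longrightarrow> pbk g f b a"
  unfolding pbk_def by metis

lemma pbk_paste:
  assumes P: "pbk q v u f" and Q: "pbk f t s k"
  shows "pbk q (v \<bullet> t) (u \<bullet> s) k"
proof (rule pbkI)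
  note P' = pbk_types[OF P] and Q' = pbk_types[OF Q]
  have vt: "arr (v \<bullet> t)" and us: "arr (u \<bullet> s)"
    using P' Q' by (simp_all add: arr_comp)
  then show "tight q" "tight (v \<bullet> t)" "tight (u \<bullet> s)" "tight k"
    using pbk_tight[OF P] pbk_tight[OF Q] by (auto intro: tight_comp)
  show "arr (q \<bullet> u \<bullet> s)"
    using us P' by (simp add: arr_comp cd_comp)
  show "q \<bullet> u \<bullet> s = (v \<bullet> t) \<bullet> k"
    by (metis assoc pbk_comm P Q)
  show "\<exists>h. (u \<bullet> s) \<bullet> h = x \<and> k \<bullet> h = y" if xy: "arr (q \<bullet> x)" "q \<bullet> x = (v \<bullet> t) \<bullet> y" for x y
  proof -
    obtain w where w: "u \<bullet> w = x" "f \<bullet> w = t \<bullet> y"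
      using pbk_lift[OF P, of x "t \<bullet> y"] xy by (auto simp: assoc)
    have "arr (f \<bullet> w)"
      using xy w P' by (metis arr_comp assoc)
    then obtain h where "s \<bullet> h = w" "k \<bullet> h = y"
      using pbk_lift[OF Q, of w y] w by auto
    then show ?thesis
      using w by (auto simp: assoc)
  qed
  show "h = l" if xy: "arr ((u \<bullet> s) \<bullet> h)" "(u \<bullet> s) \<bullet> h = (u \<bullet> s) \<bullet> l" "k \<bullet> h = k \<bullet> l" for h l
  proof -
    have "f \<bullet> (s \<bullet> h) = f \<bullet> (s \<bullet> l)"
      using xy(3) pbk_comm[OF Q] by (metis assoc)
    then have "s \<bullet> h = s \<bullet> l"
      using pbk_eq[OF P, of "s \<bullet> h" "s \<bullet> l"] xy by (simp add: assoc)
    then show ?thesis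
      using pbk_eq[OF Q, of h l] xy by (metis arr_comp assoc)
  qed
qed

lemma pbk_cancel:
  assumes P: "pbk q v u f" and Q: "pbk q (v \<bullet> t) (u \<bullet> s) k"
    and eq: "f \<bullet> s = t \<bullet> k" and st: "tight s" "tight t"
  shows "pbk f t s k"
proof (rule pbkI)
  note P' = pbk_types[OF P] and Q' = pbk_types[OF Q]
  show "tight f" "tight t" "tight s" "tight k"
    using st pbk_tight[OF P] pbk_tight[OF Q] by auto
  have us: "dm u = cd s"
    using Q' by (simp add: arr_comp)
  then show "arr (f \<bullet> s)"
    using st P' by (simp add: arr_comp tight_arr)
  show "f \<bullet> s = t \<bullet> k" by fact
  show "\<exists>h. s \<bullet> h = x \<and> k \<bullet> h = y" if xy: "arr (f \<bullet> x)" "f \<bullet> x = t \<bullet> y" for x y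
  proof -
    have "arr x" "dm f = cd x"
      using xy(1) by (simp_all add: arr_comp)
    then have ux: "arr (u \<bullet> x)" "arr (q \<bullet> u \<bullet> x)"
      using P' by (simp_all add: arr_comp cd_comp)
    have "q \<bullet> (u \<bullet> x) = (v \<bullet> t) \<bullet> y"
      using xy pbk_comm[OF P] by (metis assoc)
    then obtain h where h: "(u \<bullet> s) \<bullet> h = u \<bullet> x" "k \<bullet> h = y"
      using pbk_lift[OF Q _ ux(2)] by auto
    have "s \<bullet> h = x"
    proof (rule pbk_eq[OF P])
      show "u \<bullet> s \<bullet> h = u \<bullet> x"
        using h by (simp add: assoc)
      show "f \<bullet> s \<bullet> h = f \<bullet> x"
        using h eq xy by (metis assoc)
      show "arr (u \<bullet> s \<bullet> h)"
        using h ux by (simp add: assoc)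
    qed
    with h show ?thesis by blast
  qed
  show "h = l" if xy: "arr (s \<bullet> h)" "s \<bullet> h = s \<bullet> l" "k \<bullet> h = k \<bullet> l" for h l
    by (rule pbk_eq[OF Q, of h l]) (use xy us P' in \<open>simp_all add: assoc arr_comp cd_comp\<close>)
qed

lemma pbk_vpaste:
  assumes P: "pbk f1 t1 s k1" and Q: "pbk f2 t2 t1 k2"
  shows "pbk (f2 \<bullet> f1) t2 s (k2 \<bullet> k1)"
proof (rule pbkI)
  note P' = pbk_types[OF P] and Q' = pbk_types[OF Q]
  show "tight (f2 \<bullet> f1)" "tight t2" "tight s" "tight (k2 \<bullet> k1)"
    using pbk_tight[OF P] pbk_tight[OF Q] P' Q' by (auto intro!: tight_comp simp: arr_comp)
  show "arr ((f2 \<bullet> f1) \<bullet> s)"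
    using P' Q' by (simp add: arr_comp dm_comp)
  show "(f2 \<bullet> f1) \<bullet> s = t2 \<bullet> (k2 \<bullet> k1)"
    by (metis assoc pbk_comm P Q)
  show "\<exists>h. s \<bullet> h = x \<and> (k2 \<bullet> k1) \<bullet> h = y" if xy: "arr ((f2 \<bullet> f1) \<bullet> x)" "(f2 \<bullet> f1) \<bullet> x = t2 \<bullet> y" for x y
  proof -
    obtain w where w: "t1 \<bullet> w = f1 \<bullet> x" "k2 \<bullet> w = y"
      using pbk_lift[OF Q, of "f1 \<bullet> x" y] xy by (auto simp: assoc)
    have "arr (f1 \<bullet> x)"
      using xy by (metis assoc arr_comp)
    then obtain h where "s \<bullet> h = x" "k1 \<bullet> h = w"
      using pbk_lift[OF P, of x w] w by auto
    with w show ?thesis by (auto simp: assoc)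
  qed
  show "h = l" if xy: "arr (s \<bullet> h)" "s \<bullet> h = s \<bullet> l" "(k2 \<bullet> k1) \<bullet> h = (k2 \<bullet> k1) \<bullet> l" for h l
  proof -
    have "arr (f1 \<bullet> s \<bullet> h)"
      using xy P' by (simp add: arr_comp cd_comp)
    then have "arr (t1 \<bullet> k1 \<bullet> h)" "t1 \<bullet> k1 \<bullet> h = t1 \<bullet> k1 \<bullet> l"
      using xy(2) pbk_comm[OF P] by (metis assoc)+
    moreover have "k2 \<bullet> k1 \<bullet> h = k2 \<bullet> k1 \<bullet> l"
      using xy(3) by (simp add: assoc)
    ultimately have "k1 \<bullet> h = k1 \<bullet> l"
      using pbk_eq[OF Q] by blast
    then show ?thesis
      by (rule pbk_eq[OF P xy(2) _ xy(1)])
  qed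
qed

lemma pbk_ide:
  assumes "tight t"
  shows "pbk (ide (cd t)) t t (ide (dm t))"
  using assms tight_arr[OF assms]
  by (intro pbkI) (auto simp: tight_ide comp_ide ide_comp arr_comp arr_ide arr_ide'
      assoc[symmetric], metis assoc arr_comp ide_comp, metis arr_comp ide_comp)

text \<open>Terminality among the competing squares formed by tight elements; the comparisons \<open>s\<close>, \<open>t\<close> range over
  all elements. In the instance of 2-cells this is a distributivity pullback.\<close>

definition dpbk :: "'c \<Rightarrow> 'c \<Rightarrow> 'c \<Rightarrow> 'c \<Rightarrow> 'c \<Rightarrow> bool" where
  "dpbk f g a b c \<longleftrightarrow> tight g \<and> tight a \<and> pbk f c (g \<bullet> a) b \<and>
     (\<forall>a' b' c'. tight a' \<and> pbk f c' (g \<bullet> a') b' \<longrightarrow>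
        (\<exists>!(s, t). a \<bullet> s = a' \<and> b \<bullet> s = t \<bullet> b' \<and> c \<bullet> t = c'))"

text \<open>Here \<open>a'\<close> is not required to be tight, although \<open>g \<bullet> a'\<close> is, being a side of a pullback square. Such
  an \<open>a'\<close> is a 2-cell between arrows over the codomain of \<open>g\<close>; admitting it amounts to the
  2-dimensional part of the universal property of a right 2-adjoint to pulling back along \<open>f\<close>.\<close>

definition sdpbk :: "'c \<Rightarrow> 'c \<Rightarrow> 'c \<Rightarrow> 'c \<Rightarrow> 'c \<Rightarrow> bool" where
  "sdpbk f g a b c \<longleftrightarrow> tight g \<and> tight a \<and> pbk f c (g \<bullet> a) b \<and>
     (\<forall>a' b' c'. pbk f c' (g \<bullet> a') b' \<longrightarrow>
        (\<exists>!(s, t). a \<bullet> s = a' \<and> b \<bullet> s = t \<bullet> b' \<and> c \<bullet> t = c'))"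

definition expo :: "'c \<Rightarrow> bool" where
  "expo f \<longleftrightarrow> tight f \<and> (\<forall>g. tight g \<and> cd g = dm f \<longrightarrow> (\<exists>a b c. sdpbk f g a b c))"

lemma sdpbk_dpbk: "sdpbk f g a b c \<Longrightarrow> dpbk f g a b c"
  unfolding sdpbk_def dpbk_def by auto

lemma sdpbkD:
  assumes "sdpbk f g a b c"
  shows "tight g" "tight a" "pbk f c (g \<bullet> a) b"
  using assms by (auto simp: sdpbk_def)

lemma sdpbk_lift:
  assumes "sdpbk f g a b c" "pbk f c' (g \<bullet> a') b'"
  obtains s t where "a \<bullet> s = a'" "b \<bullet> s = t \<bullet> b'" "c \<bullet> t = c'"
  using assms unfolding sdpbk_def by blast

lemma sdpbk_eq:
  assumes "sdpbk f g a b c" "pbk f c' (g \<bullet> a') b'"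
    "a \<bullet> s = a'" "b \<bullet> s = t \<bullet> b'" "c \<bullet> t = c'"
    "a \<bullet> s' = a'" "b \<bullet> s' = t' \<bullet> b'" "c \<bullet> t' = c'"
  shows "s = s'" "t = t'"
proof -
  have "\<exists>!(s, t). a \<bullet> s = a' \<and> b \<bullet> s = t \<bullet> b' \<and> c \<bullet> t = c'"
    using assms(1,2) unfolding sdpbk_def by blast
  then have "(s, t) = (s', t')"
    using assms(3-) by auto
  then show "s = s'" "t = t'" by auto
qed

lemma sdpbkI:
  assumes "tight g" "tight a" "pbk f c (g \<bullet> a) b"
    and "\<And>a' b' c'. pbk f c' (g \<bullet> a') b' \<Longrightarrow> \<exists>s t. a \<bullet> s = a' \<and> b \<bullet> s = t \<bullet> b' \<and> c \<bullet> t = c'"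
    and "\<And>a' b' c' s t s' t'. pbk f c' (g \<bullet> a') b' \<Longrightarrow> a \<bullet> s = a' \<Longrightarrow> b \<bullet> s = t \<bullet> b' \<Longrightarrow> c \<bullet> t = c' \<Longrightarrow>
      a \<bullet> s' = a' \<Longrightarrow> b \<bullet> s' = t' \<bullet> b' \<Longrightarrow> c \<bullet> t' = c' \<Longrightarrow> s = s' \<and> t = t'"
  shows "sdpbk f g a b c"
proof -
  have "\<exists>!(s, t). a \<bullet> s = a' \<and> b \<bullet> s = t \<bullet> b' \<and> c \<bullet> t = c'" if xy: "pbk f c' (g \<bullet> a') b'" for a' b' c'
  proof -
    obtain s t where st: "a \<bullet> s = a'" "b \<bullet> s = t \<bullet> b'" "c \<bullet> t = c'"
      using assms(4)[OF xy] by blast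
    have "(s', t') = (s, t)" if "a \<bullet> s' = a'" "b \<bullet> s' = t' \<bullet> b'" "c \<bullet> t' = c'" for s' t'
      using assms(5)[OF xy that st] by simp
    with st show ?thesis by blast
  qed
  with assms(1-3) show ?thesis
    unfolding sdpbk_def by blast
qed

lemma sdpbk_tight:
  assumes "sdpbk f g a b c" "pbk f c' (g \<bullet> a') b'" "tight a'"
    "a \<bullet> s = a'" "b \<bullet> s = t \<bullet> b'" "c \<bullet> t = c'"
  shows "tight s" "tight t"
proof -
  have t: "tighten a = a" "tighten b = b" "tighten c = c" "tighten a' = a'" "tighten b' = b'" "tighten c' = c'"
    using assms(3) sdpbkD[OF assms(1)] pbk_tight[OF sdpbkD(3)[OF assms(1)]] pbk_tight[OF assms(2)]
    by (auto simp: tight_def)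
  have "tighten s = s" "tighten t = t"
    using sdpbk_eq[OF assms(1,2) _ _ _ assms(4-6), of "tighten s" "tighten t"] t assms(4-6)
    by (metis tighten_comp)+
  moreover have "arr s" "arr t"
    using assms(3,4,6) pbk_types[OF assms(2)] by (metis arr_comp tight_arr)+
  ultimately show "tight s" "tight t"
    by (auto simp: tight_def)
qed

lemma expo_ide:
  assumes f: "arr f"
  shows "expo (ide (dm f))"
  unfolding expo_def
proof (intro conjI allI impI)
  show "tight (ide (dm f))" using f by (rule tight_ide)
  fix g assume g: "tight g \<and> cd g = dm (ide (dm f))"
  then have cdg: "cd g = dm f" and ag: "arr g" and tg: "tight g"
    using f by (auto simp: arr_ide tight_arr)
  have P: "pbk (ide (dm f)) g g (ide (dm g))"
    using pbk_ide[of g] g cdg by simp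
  have "sdpbk (ide (dm f)) g (ide (dm g)) (ide (dm g)) g"
  proof (rule sdpbkI)
    show "tight g" "tight (ide (dm g))"
      using tg ag by (auto simp: tight_ide)
    show "pbk (ide (dm f)) g (g \<bullet> ide (dm g)) (ide (dm g))"
      using P ag by (simp add: comp_ide)
    fix a' b' c' assume Q: "pbk (ide (dm f)) c' (g \<bullet> a') b'"
    note Q' = pbk_types[OF Q]
    have aa: "arr a'" and da: "cd a' = dm g"
      using Q' by (auto simp: arr_comp)
    have e: "g \<bullet> a' = c' \<bullet> b'"
      using pbk_comm[OF Q] ide_comp[OF Q'(3)] cd_comp[OF Q'(3)] cdg by simp
    have cc: "dm f = cd c'"
      using Q'(7) f by (simp add: arr_ide)
    obtain i where i: "(g \<bullet> a') \<bullet> i = c'" "b' \<bullet> i = ide (dm c')"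
    proof (rule pbk_lift[OF Q])
      show "ide (dm f) \<bullet> c' = c' \<bullet> ide (dm c')"
        using Q'(2) cc ide_comp[of c'] comp_ide[of c'] by simp
      show "arr (ide (dm f) \<bullet> c')"
        using Q'(2) cc ide_comp[of c'] comp_ide[of c'] by simp
    qed
    have di: "arr i" "dm i = dm c'"
      using i(2) Q' arr_comp[of b' i] dm_comp[of b' i] arr_ide[of c'] by auto
    have ib: "i \<bullet> b' = ide (dm b')"
    proof (rule pbk_eq'[OF Q])
      show "b' \<bullet> i \<bullet> b' = b' \<bullet> ide (dm b')"
        using i(2) Q' by (metis assoc comp_ide ide_comp)
      show "(g \<bullet> a') \<bullet> i \<bullet> b' = (g \<bullet> a') \<bullet> ide (dm b')"
        using i(1) Q' e by (metis assoc comp_ide)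
      show "arr (b' \<bullet> i \<bullet> b')"
        using i(2) Q' by (metis assoc ide_comp)
    qed
    have ab: "dm a' = dm b'"
      using Q'(8) Q'(3) by (simp add: dm_comp)
    show "\<exists>s t. ide (dm g) \<bullet> s = a' \<and> ide (dm g) \<bullet> s = t \<bullet> b' \<and> g \<bullet> t = c'"
    proof (intro exI conjI)
      show "ide (dm g) \<bullet> a' = a'"
        using aa da ide_comp[of a'] by simp
      then show "ide (dm g) \<bullet> a' = (a' \<bullet> i) \<bullet> b'"
        using ib ab comp_ide[OF aa] by (simp add: assoc)
      show "g \<bullet> a' \<bullet> i = c'"
        using i by (simp add: assoc)
    qed
    fix s t s' t'
    assume H: "ide (dm g) \<bullet> s = a'" "ide (dm g) \<bullet> s = t \<bullet> b'" "g \<bullet> t = c'"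
      "ide (dm g) \<bullet> s' = a'" "ide (dm g) \<bullet> s' = t' \<bullet> b'" "g \<bullet> t' = c'"
    have s: "s = a'" "s' = a'"
      using H aa by (metis arr_comp arr_ide ag ide_comp)+
    have "t \<bullet> b' \<bullet> i = t' \<bullet> b' \<bullet> i"
      using H by (metis assoc)
    moreover have "arr t" "arr t'" "dm t = dm c'" "dm t' = dm c'"
      using H(3,6) Q' by (metis arr_comp dm_comp)+
    ultimately show "s = s' \<and> t = t'"
      using s i(2) by (metis comp_ide)
  qed
  then show "\<exists>a b c. sdpbk (ide (dm f)) g a b c" by blast
qed

end

locale tight_category_with_pullbacks = tight_category +
  assumes pullback_exists: "tight f \<Longrightarrow> tight g \<Longrightarrow> cd f = cd g \<Longrightarrow> \<exists>a b. pbk f g a b"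
begin

text \<open>Let \<open>f'\<close> be the pullback of \<open>f\<close> along \<open>c\<close>, with projection \<open>x\<close>. The distributivity pullback around
  \<open>(f, x \<bullet> g)\<close> is defined over the codomain of \<open>f\<close>. It maps to the one around \<open>(f, x)\<close>, over which \<open>c\<close>
  determines an element, namely the one that corresponds to the identity of \<open>x\<close>; the fibre over this
  element is the distributivity pullback around \<open>(f', g)\<close>.\<close>

lemma expo_pullback:
  assumes f: "expo f" and P: "pbk f c x f'"
  shows "expo f'"
  unfolding expo_def
proof (intro conjI allI impI)
  note P' = pbk_types[OF P] pbk_tight[OF P]
  show "tight f'" using P' by auto
  fix g assume g: "tight g \<and> cd g = dm f'"
  have xg: "arr (x \<bullet> g)" "tight (x \<bullet> g)" and ag: "arr g"
    using P' g by (auto simp: arr_comp tight_arr intro!: tight_comp)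
  obtain a b r where D: "sdpbk f (x \<bullet> g) a b r"
    using f xg P' unfolding expo_def by (metis cd_comp)
  obtain \<alpha> \<beta> \<rho> where D1: "sdpbk f x \<alpha> \<beta> \<rho>"
    using f P' unfolding expo_def by metis
  note D' = sdpbkD[OF D] and D1' = sdpbkD[OF D1]
  have pD: "pbk f r (x \<bullet> (g \<bullet> a)) b"
    using D'(3) by (simp add: assoc)
  note pD' = pbk_types[OF pD]
  have ga: "tight (g \<bullet> a)"
    using g D' pD' by (auto intro!: tight_comp simp: arr_comp)
  \<comment> \<open>\<open>t1\<close> maps to the distributivity pullback around \<open>(f, x)\<close>, over which \<open>t2\<close> is the element given by \<open>c\<close>\<close>
  obtain s1 t1 where 1: "\<alpha> \<bullet> s1 = g \<bullet> a" "\<beta> \<bullet> s1 = t1 \<bullet> b" "\<rho> \<bullet> t1 = r"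
    using sdpbk_lift[OF D1 pD] by blast
  have t1: "tight t1"
    using sdpbk_tight[OF D1 pD ga 1] by blast
  have pI: "pbk f c (x \<bullet> ide (dm x)) f'"
    using P comp_ide[of x] P'(3) by simp
  obtain s2 t2 where 2: "\<alpha> \<bullet> s2 = ide (dm x)" "\<beta> \<bullet> s2 = t2 \<bullet> f'" "\<rho> \<bullet> t2 = c"
    using sdpbk_lift[OF D1 pI] by blast
  have t2: "tight t2"
    using sdpbk_tight[OF D1 pI _ 2] P' by (auto simp: tight_ide)
  have "cd t1 = cd t2"
    using 1(3) 2(3) P' pD' by (metis arr_comp)
  then obtain \<gamma> c' where G: "pbk t1 t2 \<gamma> c'"
    using pullback_exists t1 t2 by blast
  note G' = pbk_types[OF G]
  have t2': "arr t2" "dm t2 = dm c"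
    using 2(3) P' by (metis arr_comp dm_comp)+
  have "cd c' = cd f'"
    using G' t2' P' by simp
  then obtain x' b' where F: "pbk f' c' x' b'"
    using pullback_exists[of f' c'] P' pbk_tight[OF G] by metis
  note F' = pbk_types[OF F]
  have cG: "\<rho> \<bullet> t1 \<bullet> \<gamma> = c \<bullet> c'"
    using pbk_comm[OF G] 2(3) by (metis assoc)
  have FG: "pbk f (c \<bullet> c') (x \<bullet> x') b'"
    by (rule pbk_paste[OF P F])
  then have FG': "pbk f (r \<bullet> \<gamma>) (x \<bullet> x') b'"
    using cG 1(3) by (simp add: assoc[symmetric])
  obtain \<phi> where \<phi>: "(x \<bullet> g \<bullet> a) \<bullet> \<phi> = x \<bullet> x'" "b \<bullet> \<phi> = \<gamma> \<bullet> b'"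
    using pbk_lift[OF pD, of "x \<bullet> x'" "\<gamma> \<bullet> b'"] pbk_comm[OF FG'] pbk_arr[OF FG'] by (metis assoc)
  have ax': "arr (x \<bullet> x')" using pbk_types[OF FG] by simp
  have tx': "tight x'" using pbk_tight[OF F] by simp
  have "s1 \<bullet> \<phi> = s2 \<bullet> x'"
  proof (rule pbk_eq[OF D1'(3)])
    show "(x \<bullet> \<alpha>) \<bullet> s1 \<bullet> \<phi> = (x \<bullet> \<alpha>) \<bullet> s2 \<bullet> x'"
      using \<phi>(1) 1(1) 2(1) by (metis assoc comp_ide P'(3))
    show "arr ((x \<bullet> \<alpha>) \<bullet> s1 \<bullet> \<phi>)"
      using \<phi>(1) 1(1) ax' by (metis assoc)
    show "\<beta> \<bullet> s1 \<bullet> \<phi> = \<beta> \<bullet> s2 \<bullet> x'"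
      using \<phi>(2) 1(2) 2(2) pbk_comm[OF F] pbk_comm[OF G] by (metis assoc)
  qed
  then have gx: "g \<bullet> a \<bullet> \<phi> = x'"
    using 1(1) 2(1) F' P' by (metis assoc ide_comp)
  have "arr (\<gamma> \<bullet> b')"
    using G' F' by (simp add: arr_comp)
  then have "tight (\<gamma> \<bullet> b')"
    using pbk_tight[OF G] pbk_tight[OF F] by (intro tight_comp) auto
  then have t\<phi>: "tight \<phi>"
    using pbk_lift_tight[OF pD \<phi>] pbk_tight[OF FG'] by auto
  have a\<phi>: "tight (a \<bullet> \<phi>)"
    using t\<phi> D'(2) gx F'(3) by (intro tight_comp) (auto simp: arr_comp)
  have "sdpbk f' g (a \<bullet> \<phi>) b' c'"
  proof (rule sdpbkI)
    show "tight g" "tight (a \<bullet> \<phi>)" using g a\<phi> by auto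
    show "pbk f' c' (g \<bullet> a \<bullet> \<phi>) b'"
      using F gx by (simp add: assoc)
    fix a0 b0 c0 assume Q: "pbk f' c0 (g \<bullet> a0) b0"
    note Q' = pbk_types[OF Q]
    have Q1: "pbk f (c \<bullet> c0) ((x \<bullet> g) \<bullet> a0) b0"
      using pbk_paste[OF P Q] by (simp add: assoc)
    then have Q2: "pbk f (c \<bullet> c0) (x \<bullet> (g \<bullet> a0)) b0"
      by (simp add: assoc)
    \<comment> \<open>both sides classify \<open>g \<bullet> a0\<close> in the distributivity pullback around \<open>(f, x)\<close>\<close>
    have key: "t1 \<bullet> t = t2 \<bullet> c0"
      if xy: "a \<bullet> s = a0" "b \<bullet> s = t \<bullet> b0" "r \<bullet> t = c \<bullet> c0" for s t
    proof (rule sdpbk_eq(2)[OF D1 Q2, of "s1 \<bullet> s" _ "s2 \<bullet> g \<bullet> a0"])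
      show "\<alpha> \<bullet> s1 \<bullet> s = g \<bullet> a0" using xy 1 by (metis assoc)
      show "\<beta> \<bullet> s1 \<bullet> s = (t1 \<bullet> t) \<bullet> b0" using xy 1 by (metis assoc)
      show "\<rho> \<bullet> t1 \<bullet> t = c \<bullet> c0" using xy 1 by (metis assoc)
      show "\<alpha> \<bullet> s2 \<bullet> g \<bullet> a0 = g \<bullet> a0" using 2 Q' P' by (metis assoc ide_comp)
      show "\<beta> \<bullet> s2 \<bullet> g \<bullet> a0 = (t2 \<bullet> c0) \<bullet> b0" using 2 pbk_comm[OF Q] by (metis assoc)
      show "\<rho> \<bullet> t2 \<bullet> c0 = c \<bullet> c0" using 2 by (metis assoc)
    qed
    show "\<exists>s t. (a \<bullet> \<phi>) \<bullet> s = a0 \<and> b' \<bullet> s = t \<bullet> b0 \<and> c' \<bullet> t = c0"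
    proof -
      obtain s t where st: "a \<bullet> s = a0" "b \<bullet> s = t \<bullet> b0" "r \<bullet> t = c \<bullet> c0"
        using sdpbk_lift[OF D Q1] by blast
      have tt: "arr (t2 \<bullet> c0)"
        using t2' Q' P' by (simp add: arr_comp)
      then obtain t' where t': "\<gamma> \<bullet> t' = t" "c' \<bullet> t' = c0"
        using pbk_lift[OF G key[OF st]] key[OF st] by auto
      have "f' \<bullet> (g \<bullet> a0) = c' \<bullet> (t' \<bullet> b0)"
        using t' pbk_comm[OF Q] by (metis assoc)
      then obtain s' where s': "x' \<bullet> s' = g \<bullet> a0" "b' \<bullet> s' = t' \<bullet> b0"
        using pbk_lift[OF F] pbk_arr[OF Q] by metis
      have "\<phi> \<bullet> s' = s"
      proof (rule pbk_eq[OF pD])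
        show "(x \<bullet> g \<bullet> a) \<bullet> \<phi> \<bullet> s' = (x \<bullet> g \<bullet> a) \<bullet> s"
          using \<phi> s' st by (metis assoc)
        show "b \<bullet> \<phi> \<bullet> s' = b \<bullet> s"
          using \<phi> s' st t' by (metis assoc)
        show "arr ((x \<bullet> g \<bullet> a) \<bullet> \<phi> \<bullet> s')"
          using \<phi> s' pbk_types(3)[OF Q2] by (metis assoc)
      qed
      then show ?thesis
        using st s' t' by (metis assoc)
    qed
    fix s t s' t'
    assume H: "(a \<bullet> \<phi>) \<bullet> s = a0" "b' \<bullet> s = t \<bullet> b0" "c' \<bullet> t = c0"
      "(a \<bullet> \<phi>) \<bullet> s' = a0" "b' \<bullet> s' = t' \<bullet> b0" "c' \<bullet> t' = c0"
    have big: "a \<bullet> \<phi> \<bullet> s = a0" "b \<bullet> \<phi> \<bullet> s = (\<gamma> \<bullet> t) \<bullet> b0" "r \<bullet> \<gamma> \<bullet> t = c \<bullet> c0"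
      if xy: "(a \<bullet> \<phi>) \<bullet> s = a0" "b' \<bullet> s = t \<bullet> b0" "c' \<bullet> t = c0" for s t
      using xy \<phi> cG 1(3) by (metis assoc)+
    have "\<gamma> \<bullet> t = \<gamma> \<bullet> t'"
      using sdpbk_eq(2)[OF D Q1 big[OF H(1-3)] big[OF H(4-6)]] .
    then have "t = t'"
      using pbk_eq'[OF G, of t t'] H(3,6) Q' by simp
    moreover have "x' \<bullet> s = g \<bullet> a0" "x' \<bullet> s' = g \<bullet> a0"
      using H gx by (metis assoc)+
    ultimately show "s = s' \<and> t = t'"
      using pbk_eq[OF F, of s s'] H Q' by simp
  qed
  then show "\<exists>a b c. sdpbk f' g a b c" by blast
qed

text \<open>Distributivity pullbacks paste: if \<open>(a, b, c)\<close> is one around \<open>(f1, g)\<close>, then one around \<open>(f2, c)\<close>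
  completes it, after pulling \<open>b\<close> back, to one around \<open>(f2 \<bullet> f1, g)\<close>.\<close>

lemma expo_comp:
  assumes f1: "expo f1" and f2: "expo f2" and c: "arr (f2 \<bullet> f1)"
  shows "expo (f2 \<bullet> f1)"
  unfolding expo_def
proof (intro conjI allI impI)
  have t12: "tight f1" "tight f2" using f1 f2 by (auto simp: expo_def)
  then show "tight (f2 \<bullet> f1)" using c by (intro tight_comp)
  fix g assume g: "tight g \<and> cd g = dm (f2 \<bullet> f1)"
  obtain a b c where D1: "sdpbk f1 g a b c"
    using f1 g c unfolding expo_def by (metis dm_comp)
  note D1' = sdpbkD[OF D1] and P1 = pbk_types[OF sdpbkD(3)[OF D1]]
  have "tight c" "cd c = dm f2"
    using pbk_tight[OF D1'(3)] P1 \<open>arr (f2 \<bullet> f1)\<close> by (auto simp: arr_comp)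
  then obtain a2 b2 c2 where D2: "sdpbk f2 c a2 b2 c2"
    using f2 unfolding expo_def by metis
  note D2' = sdpbkD[OF D2] and P2 = pbk_types[OF sdpbkD(3)[OF D2]]
  have a2: "cd a2 = dm c" using P2(3) by (simp add: arr_comp)
  then obtain m n where M: "pbk b a2 m n"
    using pullback_exists[of b a2] D2' pbk_tight[OF D1'(3)] P1 by metis
  note M' = pbk_types[OF M]
  have am: "tight (a \<bullet> m)"
    using D1'(2) M' pbk_tight[OF M] P1(3,8) by (intro tight_comp) (auto simp: arr_comp dm_comp)
  have P3: "pbk (f2 \<bullet> f1) c2 (g \<bullet> a \<bullet> m) (b2 \<bullet> n)"
    using pbk_vpaste[OF pbk_paste[OF D1'(3) M] D2'(3)] by (simp add: assoc)
  have "sdpbk (f2 \<bullet> f1) g (a \<bullet> m) (b2 \<bullet> n) c2"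
  proof (rule sdpbkI)
    show "tight g" "tight (a \<bullet> m)" "pbk (f2 \<bullet> f1) c2 (g \<bullet> a \<bullet> m) (b2 \<bullet> n)"
      using g am P3 by auto
    fix a0 b0 c0 assume Q: "pbk (f2 \<bullet> f1) c0 (g \<bullet> a0) b0"
    note Q' = pbk_types[OF Q]
    have "cd f2 = cd c0" using Q' by (simp add: cd_comp)
    then obtain k l where KL: "pbk f2 c0 k l"
      using pullback_exists[of f2 c0] t12 pbk_tight[OF Q] by metis
    note KL' = pbk_types[OF KL]
    have fg: "f2 \<bullet> (f1 \<bullet> g \<bullet> a0) = c0 \<bullet> b0" "arr (f2 \<bullet> (f1 \<bullet> g \<bullet> a0))"
      using pbk_comm[OF Q] pbk_arr[OF Q] by (metis assoc)+
    \<comment> \<open>a pullback of \<open>f2 \<bullet> f1\<close> splits into a pullback of \<open>f1\<close> over the pullback \<open>(k, l)\<close> of \<open>f2\<close>\<close>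
    obtain j where j: "k \<bullet> j = f1 \<bullet> g \<bullet> a0" "l \<bullet> j = b0"
      using pbk_lift[OF KL fg] by blast
    have tg: "tight (f1 \<bullet> g \<bullet> a0)"
      using pbk_tight[OF Q] t12 fg(2) tight_comp[of f1 "g \<bullet> a0"] by (auto simp: arr_comp)
    then have tj: "tight j"
      using pbk_lift_tight[OF KL j] pbk_tight[OF Q] by auto
    have J: "pbk f1 k (g \<bullet> a0) j"
    proof (rule pbkI)
      show "tight f1" "tight k" "tight (g \<bullet> a0)" "tight j"
        using t12 tj pbk_tight[OF KL] pbk_tight[OF Q] by auto
      show "arr (f1 \<bullet> g \<bullet> a0)" "f1 \<bullet> g \<bullet> a0 = k \<bullet> j"
        using tg j by (auto simp: tight_arr)
      show "\<exists>h. (g \<bullet> a0) \<bullet> h = x \<and> j \<bullet> h = y" if xy: "arr (f1 \<bullet> x)" "f1 \<bullet> x = k \<bullet> y" for x y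
      proof -
        have "arr (f2 \<bullet> f1 \<bullet> x)"
          using xy(1) Q'(1) cd_comp[of f1 x] arr_comp[of f2 "f1 \<bullet> x"] arr_comp[of f2 f1] by auto
        moreover have "(f2 \<bullet> f1) \<bullet> x = c0 \<bullet> (l \<bullet> y)"
          using xy pbk_comm[OF KL] by (metis assoc)
        ultimately obtain h where h: "(g \<bullet> a0) \<bullet> h = x" "b0 \<bullet> h = l \<bullet> y"
          using pbk_lift[OF Q, of x "l \<bullet> y"] by (auto simp: assoc)
        have "j \<bullet> h = y"
        proof (rule pbk_eq[OF KL])
          show "k \<bullet> j \<bullet> h = k \<bullet> y" using h j xy by (metis assoc)
          then show "arr (k \<bullet> j \<bullet> h)" using xy by simp
          show "l \<bullet> j \<bullet> h = l \<bullet> y" using h j by (metis assoc)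
        qed
        with h show ?thesis by blast
      qed
      show "h = h'" if xy: "arr ((g \<bullet> a0) \<bullet> h)" "(g \<bullet> a0) \<bullet> h = (g \<bullet> a0) \<bullet> h'" "j \<bullet> h = j \<bullet> h'" for h h'
        by (rule pbk_eq[OF Q]) (use xy j in \<open>metis assoc\<close>)+
    qed
    show "\<exists>s t. (a \<bullet> m) \<bullet> s = a0 \<and> (b2 \<bullet> n) \<bullet> s = t \<bullet> b0 \<and> c2 \<bullet> t = c0"
    proof -
      obtain s t where st: "a \<bullet> s = a0" "b \<bullet> s = t \<bullet> j" "c \<bullet> t = k"
        using sdpbk_lift[OF D1 J] by blast
      have T: "pbk f2 c0 (c \<bullet> t) l" using KL st by simp
      obtain s2 t2 where st2: "a2 \<bullet> s2 = t" "b2 \<bullet> s2 = t2 \<bullet> l" "c2 \<bullet> t2 = c0"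
        using sdpbk_lift[OF D2 T] by blast
      have "arr ((g \<bullet> a) \<bullet> s)" using st(1) Q' by (simp add: assoc)
      then have "arr (b \<bullet> s)" using P1 by (simp add: arr_comp)
      moreover have "b \<bullet> s = a2 \<bullet> (s2 \<bullet> j)" using st st2 by (metis assoc)
      ultimately obtain w where w: "m \<bullet> w = s" "n \<bullet> w = s2 \<bullet> j"
        using pbk_lift[OF M, of s "s2 \<bullet> j"] by auto
      then show ?thesis
        using st st2 j by (metis assoc)
    qed
    have split: "\<exists>s2. n \<bullet> w = s2 \<bullet> j \<and> a \<bullet> m \<bullet> w = a0 \<and> b \<bullet> m \<bullet> w = (a2 \<bullet> s2) \<bullet> j \<and>
        c \<bullet> a2 \<bullet> s2 = k \<and> b2 \<bullet> s2 = t2 \<bullet> l"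
      if H: "(a \<bullet> m) \<bullet> w = a0" "(b2 \<bullet> n) \<bullet> w = t2 \<bullet> b0" "c2 \<bullet> t2 = c0" for w t2
    proof -
      have "f2 \<bullet> k = c2 \<bullet> (t2 \<bullet> l)" using pbk_comm[OF KL] H by (metis assoc)
      then obtain s2 where s2: "(c \<bullet> a2) \<bullet> s2 = k" "b2 \<bullet> s2 = t2 \<bullet> l"
        using pbk_lift[OF D2'(3)] pbk_arr[OF KL] by metis
      have e: "(c \<bullet> a2) \<bullet> n \<bullet> w = f1 \<bullet> g \<bullet> a0"
        using pbk_comm[OF M] pbk_comm[OF D1'(3)] H(1) by (metis assoc)
      have "n \<bullet> w = s2 \<bullet> j"
      proof (rule pbk_eq[OF D2'(3)])
        show "(c \<bullet> a2) \<bullet> n \<bullet> w = (c \<bullet> a2) \<bullet> s2 \<bullet> j" using e s2 j by (metis assoc)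
        show "b2 \<bullet> n \<bullet> w = b2 \<bullet> s2 \<bullet> j" using H s2 j by (metis assoc)
        show "arr ((c \<bullet> a2) \<bullet> n \<bullet> w)" using e tg by (simp add: tight_arr)
      qed
      then show ?thesis using s2 H pbk_comm[OF M] by (metis assoc)
    qed
    fix w t2 w' t2'
    assume H: "(a \<bullet> m) \<bullet> w = a0" "(b2 \<bullet> n) \<bullet> w = t2 \<bullet> b0" "c2 \<bullet> t2 = c0"
      "(a \<bullet> m) \<bullet> w' = a0" "(b2 \<bullet> n) \<bullet> w' = t2' \<bullet> b0" "c2 \<bullet> t2' = c0"
    obtain s2 where s2: "n \<bullet> w = s2 \<bullet> j" "a \<bullet> m \<bullet> w = a0" "b \<bullet> m \<bullet> w = (a2 \<bullet> s2) \<bullet> j"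
        "c \<bullet> a2 \<bullet> s2 = k" "b2 \<bullet> s2 = t2 \<bullet> l"
      using split[OF H(1-3)] by blast
    obtain s2' where s2': "n \<bullet> w' = s2' \<bullet> j" "a \<bullet> m \<bullet> w' = a0" "b \<bullet> m \<bullet> w' = (a2 \<bullet> s2') \<bullet> j"
        "c \<bullet> a2 \<bullet> s2' = k" "b2 \<bullet> s2' = t2' \<bullet> l"
      using split[OF H(4-6)] by blast
    note e1 = sdpbk_eq[OF D1 J s2(2-4) s2'(2-4)]
    have T: "pbk f2 c0 (c \<bullet> (a2 \<bullet> s2)) l" using KL s2 by simp
    have e2: "s2 = s2'" "t2 = t2'"
      using sdpbk_eq[OF D2 T refl s2(5) H(3) e1(2)[symmetric] s2'(5) H(6)] by auto
    have "arr (m \<bullet> w)" using s2(2) Q' by (metis arr_comp)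
    then have "w = w'"
      using pbk_eq[OF M, of w w'] e1 e2 s2 s2' by simp
    with e2 show "w = w' \<and> t2 = t2'" by simp
  qed
  then show "\<exists>a b c. sdpbk (f2 \<bullet> f1) g a b c" by blast
qed

end

context tight_category begin

lemma dpbkD:
  assumes "dpbk f g a b c"
  shows "tight g" "tight a" "pbk f c (g \<bullet> a) b"
  using assms by (auto simp: dpbk_def)

text \<open>The steps in the construction of a composite of polynomials, for a pullback \<open>f1\<close> of \<open>p\<close> followed
  by a pullback \<open>f2\<close> of \<open>q\<close>. The classifying arrows \<open>v1\<close> and \<open>u2\<close> agree over \<open>one\<close>, into which
  there is at most one element from any object, so they induce \<open>y\<close> into the pullback. The distributivity pullback
  lifts \<open>y\<close>, and the last pullback lifts \<open>u1\<close>. Each lift is unique.\<close>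

lemma composite_terminal:
  assumes sub: "\<And>x y. arr x \<Longrightarrow> arr y \<Longrightarrow> cd x = one \<Longrightarrow> cd y = one \<Longrightarrow> dm x = dm y \<Longrightarrow> x = y"
    and P: "pbk k1 k2 \<pi>1 \<pi>2" "cd k1 = one"
    and D: "dpbk q \<pi>2 \<epsilon> e r"
    and H: "pbk p (\<pi>1 \<bullet> \<epsilon>) a h"
    and F2: "pbk q v2 u2 f2" "dm k2 = dm q" and F1: "pbk p v1 u1 f1" "dm k1 = cd p"
    and F21: "arr (f2 \<bullet> f1)"
  shows "\<exists>!(n0, n1, n2). e \<bullet> n1 = n2 \<bullet> f2 \<and> h \<bullet> n0 = n1 \<bullet> f1 \<and>
     \<pi>2 \<bullet> \<epsilon> \<bullet> n1 = u2 \<and> r \<bullet> n2 = v2 \<and> a \<bullet> n0 = u1 \<and> \<pi>1 \<bullet> \<epsilon> \<bullet> n1 = v1"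
proof -
  note P' = pbk_types[OF P(1)] and F2' = pbk_types[OF F2(1)] and F1' = pbk_types[OF F1(1)]
  have eq: "k1 \<bullet> v1 = k2 \<bullet> u2" "arr (k1 \<bullet> v1)"
  proof -
    show "arr (k1 \<bullet> v1)" using P' F1' F1 by (simp add: arr_comp)
    moreover have "arr (k2 \<bullet> u2)" using P' F2' F2 by (simp add: arr_comp)
    moreover have "dm v1 = dm u2" using F1' F2' F21 by (simp add: arr_comp)
    ultimately show "k1 \<bullet> v1 = k2 \<bullet> u2"
      using P' P(2) by (intro sub) (simp_all add: cd_comp dm_comp)
  qed
  obtain y where y: "\<pi>1 \<bullet> y = v1" "\<pi>2 \<bullet> y = u2"
    using pbk_lift[OF P(1) eq] by blast
  have ty: "tight y"
    using pbk_lift_tight[OF P(1) y] pbk_tight[OF F1(1)] pbk_tight[OF F2(1)] by auto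
  have uniq: "\<exists>!(s, t). \<epsilon> \<bullet> s = y \<and> e \<bullet> s = t \<bullet> f2 \<and> r \<bullet> t = v2"
    using D F2(1) ty y unfolding dpbk_def by blast
  obtain s t where st: "\<epsilon> \<bullet> s = y" "e \<bullet> s = t \<bullet> f2" "r \<bullet> t = v2"
    using uniq by blast
  have "p \<bullet> u1 = (\<pi>1 \<bullet> \<epsilon>) \<bullet> (s \<bullet> f1)"
    using pbk_comm[OF F1(1)] y st by (metis assoc)
  then obtain n0 where n0: "a \<bullet> n0 = u1" "h \<bullet> n0 = s \<bullet> f1"
    using pbk_lift[OF H] pbk_arr[OF F1(1)] by metis
  show ?thesis
  proof (rule ex1I[of _ "(n0, s, t)"], simp)
    show "e \<bullet> s = t \<bullet> f2 \<and> h \<bullet> n0 = s \<bullet> f1 \<and> \<pi>2 \<bullet> \<epsilon> \<bullet> s = u2 \<and> r \<bullet> t = v2 \<and> a \<bullet> n0 = u1 \<and> \<pi>1 \<bullet> \<epsilon> \<bullet> s = v1"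
      using st n0 y by simp
    fix n :: "'c \<times> 'c \<times> 'c"
    obtain m0 m1 m2 where n: "n = (m0, m1, m2)" by (cases n) auto
    assume "case n of (n0, n1, n2) \<Rightarrow> e \<bullet> n1 = n2 \<bullet> f2 \<and> h \<bullet> n0 = n1 \<bullet> f1 \<and>
     \<pi>2 \<bullet> \<epsilon> \<bullet> n1 = u2 \<and> r \<bullet> n2 = v2 \<and> a \<bullet> n0 = u1 \<and> \<pi>1 \<bullet> \<epsilon> \<bullet> n1 = v1"
    then have m: "e \<bullet> m1 = m2 \<bullet> f2" "h \<bullet> m0 = m1 \<bullet> f1" "\<pi>2 \<bullet> \<epsilon> \<bullet> m1 = u2" "r \<bullet> m2 = v2"
        "a \<bullet> m0 = u1" "\<pi>1 \<bullet> \<epsilon> \<bullet> m1 = v1"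
      by (auto simp: n)
    have "\<epsilon> \<bullet> m1 = y"
      using pbk_eq[OF P(1), of "\<epsilon> \<bullet> m1" y] m y F1' by simp
    then have "(m1, m2) = (s, t)"
      using uniq m(1,4) st by blast
    then have "m1 = s" "m2 = t" by auto
    moreover have "m0 = n0"
      using pbk_eq[OF H, of m0 n0] m n0 \<open>m1 = s\<close> F1' by simp
    ultimately show "n = (n0, s, t)" by (simp add: n)
  qed
qed

lemma pbk_vcancel:
  assumes Q: "pbk f2 t2 t1 k2" and R: "pbk (f2 \<bullet> f1) t2 s (k2 \<bullet> k1)"
    and e: "f1 \<bullet> s = t1 \<bullet> k1" and t: "tight f1" "tight k1"
  shows "pbk f1 t1 s k1"
proof (rule pbkI)
  note Q' = pbk_types[OF Q] and R' = pbk_types[OF R]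
  show "tight f1" "tight t1" "tight s" "tight k1"
    using t pbk_tight[OF Q] pbk_tight[OF R] by auto
  have f21: "arr (f2 \<bullet> f1)" using R' by simp
  show "arr (f1 \<bullet> s)" using pbk_arr[OF R] by (simp add: assoc arr_comp)
  show "f1 \<bullet> s = t1 \<bullet> k1" by fact
  show "\<exists>h. s \<bullet> h = x \<and> k1 \<bullet> h = y" if xy: "arr (f1 \<bullet> x)" "f1 \<bullet> x = t1 \<bullet> y" for x y
  proof -
    have "arr ((f2 \<bullet> f1) \<bullet> x)"
      using xy(1) f21 cd_comp[OF xy(1)] by (simp add: assoc arr_comp[of f2 "f1 \<bullet> x"]) (simp add: arr_comp)
    moreover have "(f2 \<bullet> f1) \<bullet> x = t2 \<bullet> (k2 \<bullet> y)"
      using xy(2) pbk_comm[OF Q] by (metis assoc)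
    ultimately obtain h where h: "s \<bullet> h = x" "(k2 \<bullet> k1) \<bullet> h = k2 \<bullet> y"
      using pbk_lift[OF R] by metis
    have "k1 \<bullet> h = y"
    proof (rule pbk_eq[OF Q])
      show "t1 \<bullet> k1 \<bullet> h = t1 \<bullet> y" using h(1) e xy(2) by (metis assoc)
      then show "arr (t1 \<bullet> k1 \<bullet> h)" using xy by simp
      show "k2 \<bullet> k1 \<bullet> h = k2 \<bullet> y" using h(2) by (simp add: assoc)
    qed
    with h show ?thesis by blast
  qed
  show "h = h'" if xy: "arr (s \<bullet> h)" "s \<bullet> h = s \<bullet> h'" "k1 \<bullet> h = k1 \<bullet> h'" for h h'
    by (rule pbk_eq[OF R xy(2) _ xy(1)]) (use xy(3) in \<open>simp add: assoc\<close>)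
qed

lemma pbk_ide_inverse:
  assumes P: "pbk (ide (cd f)) c x e" and f: "arr f"
  obtains i where "tight i" "e \<bullet> i = ide (dm c)" "i \<bullet> e = ide (dm e)"
proof -
  note t = pbk_types[OF P] and tt = pbk_tight[OF P]
  have cc: "cd c = cd f" using t(7) arr_ide'[OF f] by simp
  have e: "ide (cd f) \<bullet> c = c \<bullet> ide (dm c)" "arr (ide (cd f) \<bullet> c)"
    using ide_comp[OF t(2)] comp_ide[OF t(2)] cc t(2) by simp_all
  obtain i where i: "x \<bullet> i = c" "e \<bullet> i = ide (dm c)" using pbk_lift[OF P e] by blast
  have ti: "tight i" using pbk_lift_tight[OF P i] tt tight_ide[OF t(2)] by blast
  have x: "ide (cd f) \<bullet> x = x" using ide_comp[OF t(3)] t(5) arr_ide'[OF f] by simp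
  have "i \<bullet> e = ide (dm e)"
  proof (rule pbk_eq[OF P])
    show "x \<bullet> i \<bullet> e = x \<bullet> ide (dm e)" using i pbk_comm[OF P] x comp_ide[OF t(3)] t(8) by (metis assoc)
    show "e \<bullet> i \<bullet> e = e \<bullet> ide (dm e)" using i comp_ide[OF t(4)] ide_comp[OF t(4)] t(6) by (metis assoc)
    have "x \<bullet> i \<bullet> e = c \<bullet> e" using i by (metis assoc)
    then show "arr (x \<bullet> i \<bullet> e)" using pbk_arr[OF P] by simp
  qed
  with ti i that show ?thesis by blast
qed

end

section \<open>The category of 2-cells and their horizontal composition\<close>

lemma hcat_simps [simp]:
  "Ob (hcat K) = Ob K" "Ar (hcat K) = Ce K" "Dom (hcat K) \<alpha> = Dom K (Src K \<alpha>)"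
  "Cod (hcat K) \<alpha> = Cod K (Src K \<alpha>)" "Idn (hcat K) X = Id2 K (Idn K X)" "Comp (hcat K) = HComp K"
  by (simp_all add: hcat_def)

lemma vcat_simps [simp]:
  "Ob (vcat K) = Ar K" "Ar (vcat K) = Ce K" "Dom (vcat K) = Src K" "Cod (vcat K) = Trg K"
  "Idn (vcat K) = Id2 K" "Comp (vcat K) = VComp K"
  by (simp_all add: vcat_def)

lemma pair_twocat_cells:
  "\<theta> \<in> cells (pair_twocat K Os d0 d1 R S) x y \<longleftrightarrow>
   (\<exists>\<alpha> \<beta>. \<theta> = (x, y, \<alpha>, \<beta>) \<and> x \<in> Os \<and> y \<in> Os \<and> \<alpha> \<in> Ce K \<and> \<beta> \<in> Ce K \<and>
      Src K \<alpha> \<in> hom K (d0 x) (d0 y) \<and> Src K \<beta> \<in> hom K (d1 x) (d1 y) \<and>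
      Trg K \<alpha> \<in> hom K (d0 x) (d0 y) \<and> Trg K \<beta> \<in> hom K (d1 x) (d1 y) \<and>
      R x y (Src K \<alpha>) (Src K \<beta>) \<and> R x y (Trg K \<alpha>) (Trg K \<beta>) \<and> S x y \<alpha> \<beta>)"
  by (cases \<theta>) (auto simp: hom_def pair_twocat_def Let_def)

lemma pair_twocat_hom:
  "h \<in> hom (pair_twocat K Os d0 d1 R S) x y \<longleftrightarrow>
   (\<exists>u v. h = (x, y, u, v) \<and> x \<in> Os \<and> y \<in> Os \<and>
      u \<in> hom K (d0 x) (d0 y) \<and> v \<in> hom K (d1 x) (d1 y) \<and> R x y u v)"
  by (cases h) (auto simp: hom_def pair_twocat_def Let_def)

context category begin

lemma comp_arr [simp]:
  assumes "f \<in> Ar C" "g \<in> Ar C" "Dom C g = Cod C f"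
  shows "g \<cdot> f \<in> Ar C" "Dom C (g \<cdot> f) = Dom C f" "Cod C (g \<cdot> f) = Cod C g"
  using Comp_hom[of f "Dom C f" "Cod C f" g "Cod C g"] assms by (auto simp: hom_def)

lemma comp_assoc:
  assumes "f \<in> Ar C" "g \<in> Ar C" "h \<in> Ar C" "Dom C g = Cod C f" "Dom C h = Cod C g"
  shows "(h \<cdot> g) \<cdot> f = h \<cdot> (g \<cdot> f)"
  using assms by (intro Comp_assoc) (auto simp: hom_def)

lemma idn_arr [simp]:
  assumes "X \<in> Ob C"
  shows "Idn C X \<in> Ar C" "Dom C (Idn C X) = X" "Cod C (Idn C X) = X"
  using Idn_hom[OF assms] by (auto simp: hom_def)

lemma comp_idn [simp]: "f \<in> Ar C \<Longrightarrow> Dom C f = X \<Longrightarrow> f \<cdot> Idn C X = f"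
  and idn_comp [simp]: "f \<in> Ar C \<Longrightarrow> Cod C f = X \<Longrightarrow> Idn C X \<cdot> f = f"
  using Comp_Idn Idn_Comp by (auto simp: hom_def)

end

context two_category begin

lemma cell_arr [simp]:
  assumes "\<alpha> \<in> Ce K"
  shows "Src K \<alpha> \<in> Ar K" "Trg K \<alpha> \<in> Ar K"
    "Dom K (Trg K \<alpha>) = Dom K (Src K \<alpha>)" "Cod K (Trg K \<alpha>) = Cod K (Src K \<alpha>)"
  using assms vertical.Dom_Ob[of \<alpha>] vertical.Cod_Ob[of \<alpha>] parallel[of \<alpha>] by auto

lemma id2_cell [simp]:
  assumes "f \<in> Ar K"
  shows "Id2 K f \<in> Ce K" "Src K (Id2 K f) = f" "Trg K (Id2 K f) = f"
  using vertical.Idn_hom[of f] assms by (auto simp: hom_def)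

lemma hcomp_cell [simp]:
  assumes "\<alpha> \<in> Ce K" "\<beta> \<in> Ce K" "Dom K (Src K \<beta>) = Cod K (Src K \<alpha>)"
  shows "\<beta> \<star> \<alpha> \<in> Ce K" "Src K (\<beta> \<star> \<alpha>) = Src K \<beta> \<cdot> Src K \<alpha>" "Trg K (\<beta> \<star> \<alpha>) = Trg K \<beta> \<cdot> Trg K \<alpha>"
proof -
  have "\<alpha> \<in> cells K (Dom K (Src K \<alpha>)) (Cod K (Src K \<alpha>))" "\<beta> \<in> cells K (Cod K (Src K \<alpha>)) (Cod K (Src K \<beta>))"
    using assms by (auto simp: hom_def)
  then show "Src K (\<beta> \<star> \<alpha>) = Src K \<beta> \<cdot> Src K \<alpha>" "Trg K (\<beta> \<star> \<alpha>) = Trg K \<beta> \<cdot> Trg K \<alpha>"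
    using Src_HComp Trg_HComp by blast+
  show "\<beta> \<star> \<alpha> \<in> Ce K"
    using horizontal.comp_arr(1)[of \<alpha> \<beta>] assms by simp
qed

lemma hcomp_assoc:
  assumes "\<alpha> \<in> Ce K" "\<beta> \<in> Ce K" "\<gamma> \<in> Ce K"
    "Dom K (Src K \<beta>) = Cod K (Src K \<alpha>)" "Dom K (Src K \<gamma>) = Cod K (Src K \<beta>)"
  shows "(\<gamma> \<star> \<beta>) \<star> \<alpha> = \<gamma> \<star> (\<beta> \<star> \<alpha>)"
  using horizontal.comp_assoc[of \<alpha> \<beta> \<gamma>] assms by simp

lemma id2_hcomp [simp]:
  assumes "f \<in> Ar K" "g \<in> Ar K" "Dom K g = Cod K f"
  shows "Id2 K g \<star> Id2 K f = Id2 K (g \<cdot> f)"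
  using assms by (intro Id2_Comp) (auto simp: hom_def)

lemma hcomp_id [simp]: "\<alpha> \<in> Ce K \<Longrightarrow> Dom K (Src K \<alpha>) = X \<Longrightarrow> \<alpha> \<star> Id2 K (Idn K X) = \<alpha>"
  and id_hcomp [simp]: "\<alpha> \<in> Ce K \<Longrightarrow> Cod K (Src K \<alpha>) = X \<Longrightarrow> Id2 K (Idn K X) \<star> \<alpha> = \<alpha>"
  using horizontal.comp_idn[of \<alpha> X] horizontal.idn_comp[of \<alpha> X] by simp_all

lemma vcomp_cell [simp]:
  assumes "\<alpha> \<in> Ce K" "\<beta> \<in> Ce K" "Src K \<beta> = Trg K \<alpha>"
  shows "\<beta> \<diamondop> \<alpha> \<in> Ce K" "Src K (\<beta> \<diamondop> \<alpha>) = Src K \<alpha>" "Trg K (\<beta> \<diamondop> \<alpha>) = Trg K \<beta>"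
  using vertical.comp_arr[of \<alpha> \<beta>] assms by simp_all

lemma vcomp_id [simp]: "\<alpha> \<in> Ce K \<Longrightarrow> Src K \<alpha> = f \<Longrightarrow> \<alpha> \<diamondop> Id2 K f = \<alpha>"
  and id_vcomp [simp]: "\<alpha> \<in> Ce K \<Longrightarrow> Trg K \<alpha> = f \<Longrightarrow> Id2 K f \<diamondop> \<alpha> = \<alpha>"
  using vertical.comp_idn[of \<alpha> f] vertical.idn_comp[of \<alpha> f] by simp_all

lemma whisker_vcomp:
  assumes "\<alpha> \<in> Ce K" "\<alpha>' \<in> Ce K" "Src K \<alpha>' = Trg K \<alpha>" "f \<in> Ar K"
  shows "Dom K f = Cod K (Src K \<alpha>) \<Longrightarrow> Id2 K f \<star> (\<alpha>' \<diamondop> \<alpha>) = (Id2 K f \<star> \<alpha>') \<diamondop> (Id2 K f \<star> \<alpha>)"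
    and "Cod K f = Dom K (Src K \<alpha>) \<Longrightarrow> (\<alpha>' \<diamondop> \<alpha>) \<star> Id2 K f = (\<alpha>' \<star> Id2 K f) \<diamondop> (\<alpha> \<star> Id2 K f)"
proof -
  have s: "Dom K (Src K \<alpha>') = Dom K (Src K \<alpha>)" "Cod K (Src K \<alpha>') = Cod K (Src K \<alpha>)"
    using assms by simp_all
  show "Id2 K f \<star> (\<alpha>' \<diamondop> \<alpha>) = (Id2 K f \<star> \<alpha>') \<diamondop> (Id2 K f \<star> \<alpha>)" if "Dom K f = Cod K (Src K \<alpha>)"
  proof -
    have "(Id2 K f \<diamondop> Id2 K f) \<star> (\<alpha>' \<diamondop> \<alpha>) = (Id2 K f \<star> \<alpha>') \<diamondop> (Id2 K f \<star> \<alpha>)"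
      by (rule interchange[where X = "Dom K (Src K \<alpha>)" and Y = "Cod K (Src K \<alpha>)" and Z = "Cod K f"])
        (use assms s that in \<open>simp_all add: hom_def\<close>)
    then show ?thesis using assms(4) by simp
  qed
  show "(\<alpha>' \<diamondop> \<alpha>) \<star> Id2 K f = (\<alpha>' \<star> Id2 K f) \<diamondop> (\<alpha> \<star> Id2 K f)" if "Cod K f = Dom K (Src K \<alpha>)"
  proof -
    have "(\<alpha>' \<diamondop> \<alpha>) \<star> (Id2 K f \<diamondop> Id2 K f) = (\<alpha>' \<star> Id2 K f) \<diamondop> (\<alpha> \<star> Id2 K f)"
      by (rule interchange[where X = "Dom K f" and Y = "Dom K (Src K \<alpha>)" and Z = "Cod K (Src K \<alpha>)"])
        (use assms s that in \<open>simp_all add: hom_def\<close>)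
    then show ?thesis using assms(4) by simp
  qed
qed

text \<open>\<open>None\<close> is the value of undefined composites, which makes horizontal composition total and
  associative without side conditions.\<close>

definition tcomp :: "'c option \<Rightarrow> 'c option \<Rightarrow> 'c option"  (infixr "\<bullet>" 75) where
  "y \<bullet> x = (case (y, x) of (Some \<beta>, Some \<alpha>) \<Rightarrow>
     if \<alpha> \<in> Ce K \<and> \<beta> \<in> Ce K \<and> Dom K (Src K \<beta>) = Cod K (Src K \<alpha>) then Some (\<beta> \<star> \<alpha>) else None
   | _ \<Rightarrow> None)"

definition tarr :: "'c option \<Rightarrow> bool" where
  "tarr x \<longleftrightarrow> (\<exists>\<alpha>\<in>Ce K. x = Some \<alpha>)"

definition tdm :: "'c option \<Rightarrow> 'o" where "tdm x = Dom K (Src K (the x))"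

definition tcd :: "'c option \<Rightarrow> 'o" where "tcd x = Cod K (Src K (the x))"

definition tide :: "'o \<Rightarrow> 'c option" where "tide X = Some (Id2 K (Idn K X))"

definition ttight :: "'c option \<Rightarrow> 'c option" where
  "ttight x = (case x of Some \<alpha> \<Rightarrow> if \<alpha> \<in> Ce K then Some (Id2 K (Src K \<alpha>)) else None | None \<Rightarrow> None)"

lemma tarr_tcomp: "tarr (g \<bullet> f) \<longleftrightarrow> tarr g \<and> tarr f \<and> tdm g = tcd f"
  by (auto simp: tcomp_def tarr_def tdm_def tcd_def split: option.splits)

sublocale T: tight_category tcomp tarr tdm tcd tide ttight
proof
  fix f g h :: "'c option"
  show "(h \<bullet> g) \<bullet> f = h \<bullet> (g \<bullet> f)"
    by (auto simp: tcomp_def hcomp_assoc split: option.splits)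
  show "tarr (g \<bullet> f) \<longleftrightarrow> tarr g \<and> tarr f \<and> tdm g = tcd f"
    by (rule tarr_tcomp)
  show "tarr (g \<bullet> f) \<Longrightarrow> tdm (g \<bullet> f) = tdm f" "tarr (g \<bullet> f) \<Longrightarrow> tcd (g \<bullet> f) = tcd g"
    by (auto simp: tcomp_def tarr_def tdm_def tcd_def split: option.splits if_splits)
  show "tarr f \<Longrightarrow> f \<bullet> tide (tdm f) = f" "tarr f \<Longrightarrow> tide (tcd f) \<bullet> f = f"
    by (auto simp: tcomp_def tarr_def tdm_def tcd_def tide_def Dom_Ob Cod_Ob)
  show "ttight (g \<bullet> f) = ttight g \<bullet> ttight f"
    by (auto simp: tcomp_def ttight_def split: option.splits)
  show "ttight (ttight f) = ttight f"
    by (auto simp: ttight_def split: option.splits)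
  show "tarr f \<Longrightarrow> tarr (ttight f) \<and> tdm (ttight f) = tdm f \<and> tcd (ttight f) = tcd f"
    by (auto simp: tarr_def ttight_def tdm_def tcd_def)
  show "tarr f \<Longrightarrow> ttight (tide (tdm f)) = tide (tdm f) \<and> ttight (tide (tcd f)) = tide (tcd f)"
    by (auto simp: tarr_def ttight_def tdm_def tcd_def tide_def Dom_Ob Cod_Ob)
qed

text \<open>Arrows as identity 2-cells. The value outside the arrows is \<open>None\<close>, so that \<open>tarr (j f)\<close> holds only
  for arrows \<open>f\<close>.\<close>

definition j :: "'a \<Rightarrow> 'c option" where
  "j f = (if f \<in> Ar K then Some (Id2 K f) else None)"

lemma tarr_None [simp]: "\<not> tarr None"
  by (simp add: tarr_def)

lemma j_arr [simp]: "tarr (j f) \<longleftrightarrow> f \<in> Ar K"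
  by (auto simp: j_def tarr_def)

lemma j_dm [simp]: "f \<in> Ar K \<Longrightarrow> tdm (j f) = Dom K f" and j_cd [simp]: "f \<in> Ar K \<Longrightarrow> tcd (j f) = Cod K f"
  by (simp_all add: j_def tdm_def tcd_def)

lemma j_comp: "f \<in> Ar K \<Longrightarrow> g \<in> Ar K \<Longrightarrow> Dom K g = Cod K f \<Longrightarrow> j (g \<cdot> f) = j g \<bullet> j f"
  by (simp add: j_def tcomp_def)

lemma j_inj: "j f = j g \<Longrightarrow> f \<in> Ar K \<Longrightarrow> f = g"
  by (metis id2_cell(2) j_def option.distinct(1) option.sel)

lemma Some_arr [simp]: "tarr (Some \<alpha>) \<longleftrightarrow> \<alpha> \<in> Ce K"
  by (auto simp: tarr_def)

lemma Some_dm [simp]: "tdm (Some \<alpha>) = Dom K (Src K \<alpha>)" and Some_cd [simp]: "tcd (Some \<alpha>) = Cod K (Src K \<alpha>)"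
  by (simp_all add: tdm_def tcd_def)

lemma Some_comp: "\<alpha> \<in> Ce K \<Longrightarrow> \<beta> \<in> Ce K \<Longrightarrow> Dom K (Src K \<beta>) = Cod K (Src K \<alpha>) \<Longrightarrow>
    Some \<beta> \<bullet> Some \<alpha> = Some (\<beta> \<star> \<alpha>)"
  by (simp add: tcomp_def)

lemma j_Some: "f \<in> Ar K \<Longrightarrow> j f = Some (Id2 K f)"
  by (simp add: j_def)

lemma tight_j [simp]: "T.tight (j f) \<longleftrightarrow> f \<in> Ar K"
  by (auto simp: T.tight_def j_def ttight_def)

lemma tight_iff: "T.tight x \<longleftrightarrow> (\<exists>f\<in>Ar K. x = j f)"
  by (auto simp: T.tight_def j_def ttight_def tarr_def split: if_splits) (metis cell_arr(1))

lemma tight_obtain: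
  assumes "T.tight x" obtains f where "f \<in> Ar K" "x = j f"
  using assms tight_iff by blast

lemma j_whiskerE:
  assumes "tarr (j f \<bullet> x)"
  obtains \<xi> where "x = Some \<xi>" "\<xi> \<in> Ce K" "Cod K (Src K \<xi>) = Dom K f"
proof -
  have "tarr x" "f \<in> Ar K" "tdm (j f) = tcd x" using assms by (simp_all add: tarr_tcomp)
  then show ?thesis using that by (auto simp: tarr_def)
qed

lemma j_comp_eq:
  assumes "j g \<bullet> j f = j h" "h \<in> Ar K"
  shows "g \<cdot> f = h" "f \<in> Ar K" "g \<in> Ar K" "Dom K g = Cod K f"
proof -
  have "tarr (j g \<bullet> j f)" using assms by simp
  then show *: "f \<in> Ar K" "g \<in> Ar K" "Dom K g = Cod K f" by (auto simp: tarr_tcomp)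
  then have "j (g \<cdot> f) = j h" using assms j_comp by simp
  then show "g \<cdot> f = h" using * j_inj by simp
qed

lemma whisker_eq:
  assumes "f \<in> Ar K" "g \<in> Ar K" "\<xi> \<in> Ce K" "\<upsilon> \<in> Ce K" "Dom K f = Cod K (Src K \<xi>)" "Dom K g = Cod K (Src K \<upsilon>)"
  shows "j f \<bullet> Some \<xi> = j g \<bullet> Some \<upsilon> \<longleftrightarrow> Id2 K f \<star> \<xi> = Id2 K g \<star> \<upsilon>"
  using assms by (simp add: j_Some Some_comp)

lemma whisker_eq1:
  assumes "f \<in> Ar K" "\<xi> \<in> Ce K" "Dom K f = Cod K (Src K \<xi>)"
  shows "j f \<bullet> Some \<xi> = Some \<upsilon> \<longleftrightarrow> Id2 K f \<star> \<xi> = \<upsilon>"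
  using assms by (simp add: j_Some Some_comp)

text \<open>The condition on arrows in the definition follows from that on 2-cells, because the factorization of
  a pair of tight elements is tight.\<close>

lemma is_pullback_iff: "is_pullback K f g a b \<longleftrightarrow> T.pbk (j f) (j g) (j a) (j b)"
proof
  assume L: "is_pullback K f g a b"
  then have t: "f \<in> Ar K" "g \<in> Ar K" "a \<in> Ar K" "b \<in> Ar K" "Cod K f = Cod K g" "Cod K a = Dom K f"
      "Dom K b = Dom K a" "Cod K b = Dom K g" "f \<cdot> a = g \<cdot> b"
    by (auto simp: is_pullback_def hom_def)
  have U: "\<exists>!\<theta>. \<theta> \<in> cells K X (Dom K a) \<and> Id2 K a \<star> \<theta> = \<xi> \<and> Id2 K b \<star> \<theta> = \<upsilon>"
    if "X \<in> Ob K" "\<xi> \<in> cells K X (Dom K f)" "\<upsilon> \<in> cells K X (Dom K g)" "Id2 K f \<star> \<xi> = Id2 K g \<star> \<upsilon>" for X \<xi> \<upsilon>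
    using L that unfolding is_pullback_def by blast
  show "T.pbk (j f) (j g) (j a) (j b)"
  proof (rule T.pbkI)
    show "T.tight (j f)" "T.tight (j g)" "T.tight (j a)" "T.tight (j b)" "tarr (j f \<bullet> j a)"
      using t by (simp_all add: tarr_tcomp)
    show "j f \<bullet> j a = j g \<bullet> j b"
      using t by (metis j_comp)
    show "\<exists>h. j a \<bullet> h = x \<and> j b \<bullet> h = y" if x: "tarr (j f \<bullet> x)" and xy: "j f \<bullet> x = j g \<bullet> y" for x y
    proof -
      have y: "tarr (j g \<bullet> y)" using x xy by simp
      obtain \<xi> where xi: "x = Some \<xi>" "\<xi> \<in> Ce K" "Cod K (Src K \<xi>) = Dom K f"
        using j_whiskerE[OF x] by blast
      obtain \<upsilon> where yi: "y = Some \<upsilon>" "\<upsilon> \<in> Ce K" "Cod K (Src K \<upsilon>) = Dom K g"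
        using j_whiskerE[OF y] by blast
      have "tdm (j f \<bullet> x) = tdm (j g \<bullet> y)" using xy by simp
      then have d: "Dom K (Src K \<xi>) = Dom K (Src K \<upsilon>)"
        using x y xi yi by (simp add: T.dm_comp)
      have "Id2 K f \<star> \<xi> = Id2 K g \<star> \<upsilon>"
        using xy xi yi t whisker_eq[of f g \<xi> \<upsilon>] by simp
      then obtain \<theta> where \<theta>: "\<theta> \<in> cells K (Dom K (Src K \<xi>)) (Dom K a)" "Id2 K a \<star> \<theta> = \<xi>" "Id2 K b \<star> \<theta> = \<upsilon>"
        using U[of "Dom K (Src K \<xi>)" \<xi> \<upsilon>] xi yi d by (auto simp: hom_def Dom_Ob)
      then have "j a \<bullet> Some \<theta> = x" "j b \<bullet> Some \<theta> = y"
        using t xi yi by (auto simp: hom_def j_Some Some_comp)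
      then show ?thesis by blast
    qed
    show "h = k" if h: "tarr (j a \<bullet> h)" "j a \<bullet> h = j a \<bullet> k" "j b \<bullet> h = j b \<bullet> k" for h k
    proof -
      have k: "tarr (j a \<bullet> k)" using h by simp
      obtain \<theta> where \<theta>: "h = Some \<theta>" "\<theta> \<in> Ce K" "Cod K (Src K \<theta>) = Dom K a"
        using j_whiskerE[OF h(1)] by blast
      obtain \<theta>' where \<theta>': "k = Some \<theta>'" "\<theta>' \<in> Ce K" "Cod K (Src K \<theta>') = Dom K a"
        using j_whiskerE[OF k] by blast
      have "tdm h = tdm k" using T.dm_comp[OF h(1)] T.dm_comp[OF k] h(2) by simp
      then have d: "Dom K (Src K \<theta>) = Dom K (Src K \<theta>')"
        using \<theta> \<theta>' by simp
      let ?\<xi> = "Id2 K a \<star> \<theta>" and ?\<upsilon> = "Id2 K b \<star> \<theta>"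
      have "\<exists>!\<theta>''. \<theta>'' \<in> cells K (Dom K (Src K \<theta>)) (Dom K a) \<and> Id2 K a \<star> \<theta>'' = ?\<xi> \<and> Id2 K b \<star> \<theta>'' = ?\<upsilon>"
      proof (rule U)
        show "Dom K (Src K \<theta>) \<in> Ob K" using \<theta> by (simp add: Dom_Ob)
        show "?\<xi> \<in> cells K (Dom K (Src K \<theta>)) (Dom K f)" "?\<upsilon> \<in> cells K (Dom K (Src K \<theta>)) (Dom K g)"
          using \<theta> t by (simp_all add: hom_def)
        show "Id2 K f \<star> ?\<xi> = Id2 K g \<star> ?\<upsilon>"
          using \<theta> t by (simp add: hcomp_assoc[symmetric])
      qed
      moreover have "Id2 K a \<star> \<theta>' = ?\<xi>" "Id2 K b \<star> \<theta>' = ?\<upsilon>"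
        using h \<theta> \<theta>' t by (simp_all add: j_Some Some_comp)
      ultimately have "\<theta> = \<theta>'"
        using \<theta> \<theta>' d by (auto simp: hom_def)
      then show ?thesis using \<theta> \<theta>' by simp
    qed
  qed
next
  assume P: "T.pbk (j f) (j g) (j a) (j b)"
  note P' = T.pbk_types[OF P]
  have t: "f \<in> Ar K" "g \<in> Ar K" "a \<in> Ar K" "b \<in> Ar K"
    using P' by auto
  with P' have t': "Cod K f = Cod K g" "Cod K a = Dom K f" "Dom K b = Dom K a" "Cod K b = Dom K g"
    by auto
  have "j (f \<cdot> a) = j (g \<cdot> b)"
    using T.pbk_comm[OF P] t t' by (simp add: j_comp)
  then have e: "f \<cdot> a = g \<cdot> b"
    using t t' j_inj by simp
  have ex2: "\<exists>!\<theta>. \<theta> \<in> cells K X (Dom K a) \<and> Id2 K a \<star> \<theta> = \<xi> \<and> Id2 K b \<star> \<theta> = \<upsilon>"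
    if c: "\<xi> \<in> cells K X (Dom K f)" "\<upsilon> \<in> cells K X (Dom K g)" "Id2 K f \<star> \<xi> = Id2 K g \<star> \<upsilon>" for X \<xi> \<upsilon>
  proof -
    have c': "\<xi> \<in> Ce K" "\<upsilon> \<in> Ce K" "Cod K (Src K \<xi>) = Dom K f" "Cod K (Src K \<upsilon>) = Dom K g"
        "Dom K (Src K \<xi>) = X" "Dom K (Src K \<upsilon>) = X"
      using c by (auto simp: hom_def)
    have "j f \<bullet> Some \<xi> = j g \<bullet> Some \<upsilon>" "tarr (j f \<bullet> Some \<xi>)"
      using c c' t by (simp_all add: whisker_eq tarr_tcomp)
    then obtain h where h: "j a \<bullet> h = Some \<xi>" "j b \<bullet> h = Some \<upsilon>"
      using T.pbk_lift[OF P] by blast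
    have ah: "tarr (j a \<bullet> h)" using h c' by simp
    then obtain \<theta> where \<theta>: "h = Some \<theta>" "\<theta> \<in> Ce K" "Cod K (Src K \<theta>) = Dom K a"
      using j_whiskerE[OF ah] by blast
    have "Dom K (Src K \<theta>) = X"
      using T.dm_comp[OF ah] h \<theta> c' by simp
    moreover have "Id2 K a \<star> \<theta> = \<xi>" "Id2 K b \<star> \<theta> = \<upsilon>"
      using h \<theta> t t' by (simp_all add: whisker_eq1)
    moreover have "\<theta>' = \<theta>" if u: "\<theta>' \<in> cells K X (Dom K a)" "Id2 K a \<star> \<theta>' = \<xi>" "Id2 K b \<star> \<theta>' = \<upsilon>" for \<theta>'
    proof -
      have u': "\<theta>' \<in> Ce K" "Cod K (Src K \<theta>') = Dom K a" using u by (auto simp: hom_def)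
      have "j a \<bullet> Some \<theta>' = j a \<bullet> h" "j b \<bullet> Some \<theta>' = j b \<bullet> h"
        using h u u' t t' by (simp_all add: whisker_eq1)
      then have "h = Some \<theta>'" using T.pbk_eq[OF P, of h "Some \<theta>'"] ah by metis
      then show ?thesis using \<theta> by simp
    qed
    moreover have "\<theta> \<in> cells K X (Dom K a)" using \<theta> calculation(1) by (simp add: hom_def)
    ultimately show ?thesis by blast
  qed
  have ex1: "\<exists>!h. h \<in> hom K X (Dom K a) \<and> a \<cdot> h = x \<and> b \<cdot> h = y"
    if c: "x \<in> hom K X (Dom K f)" "y \<in> hom K X (Dom K g)" "f \<cdot> x = g \<cdot> y" for X x y
  proof -
    have c': "x \<in> Ar K" "y \<in> Ar K" "Cod K x = Dom K f" "Cod K y = Dom K g" "Dom K x = X" "Dom K y = X"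
      using c by (auto simp: hom_def)
    have "j f \<bullet> j x = j g \<bullet> j y" "tarr (j f \<bullet> j x)"
      using c c' t by (simp_all add: j_comp[symmetric])
    then obtain h where h: "j a \<bullet> h = j x" "j b \<bullet> h = j y"
      using T.pbk_lift[OF P] by blast
    then have "T.tight h"
      using T.pbk_lift_tight[OF P] c' by simp
    then obtain k where k: "k \<in> Ar K" "h = j k"
      using tight_obtain by blast
    have e: "a \<cdot> k = x" "b \<cdot> k = y" "Dom K a = Cod K k"
      using j_comp_eq h k c' by metis+
    have "k' = k" if u: "k' \<in> hom K X (Dom K a)" "a \<cdot> k' = x" "b \<cdot> k' = y" for k'
    proof -
      have u': "k' \<in> Ar K" "Cod K k' = Dom K a" using u by (auto simp: hom_def)
      have "j a \<bullet> j k' = j x" "j b \<bullet> j k' = j y"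
        using u u' t t' j_comp[of k' a] j_comp[of k' b] by simp_all
      then have "j k' = j k"
        using T.pbk_eq[OF P, of "j k'" "j k"] h k c' by (metis j_arr)
      then show ?thesis using j_inj u' by simp
    qed
    moreover have "k \<in> hom K X (Dom K a)" using comp_arr(2)[of k a] e c' k t by (simp add: hom_def)
    ultimately show ?thesis using e by blast
  qed
  show "is_pullback K f g a b"
    unfolding is_pullback_def
    by (intro conjI ballI impI ex1 ex2) (use t t' e in \<open>simp_all add: hom_def\<close>)
qed

lemma dtriples_Ob:
  "(a, b, c) \<in> Ob (dtriples K f g) \<longleftrightarrow> a \<in> Ar K \<and> Cod K a = Dom K g \<and> is_pullback K f c (g \<cdot> a) b"
  by (simp add: dtriples_def pair_twocat_def Let_def)

lemma dtriples_Ob_iff: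
  assumes "g \<in> Ar K"
  shows "(a, b, c) \<in> Ob (dtriples K f g) \<longleftrightarrow> a \<in> Ar K \<and> T.pbk (j f) (j c) (j g \<bullet> j a) (j b)"
proof
  assume "(a, b, c) \<in> Ob (dtriples K f g)"
  then show "a \<in> Ar K \<and> T.pbk (j f) (j c) (j g \<bullet> j a) (j b)"
    using assms j_comp[of a g] by (simp add: dtriples_Ob is_pullback_iff)
next
  assume R: "a \<in> Ar K \<and> T.pbk (j f) (j c) (j g \<bullet> j a) (j b)"
  then have "tarr (j g \<bullet> j a)" using T.pbk_types(3) by blast
  then have "Cod K a = Dom K g" using assms R by (simp add: tarr_tcomp)
  then show "(a, b, c) \<in> Ob (dtriples K f g)"
    using R assms j_comp[of a g] by (simp add: dtriples_Ob is_pullback_iff)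
qed

lemma dtriples_hom:
  assumes "g \<in> Ar K"
  shows "h \<in> hom (dtriples K f g) (a, b, c) (a', b', c') \<longleftrightarrow>
   (\<exists>s t. h = ((a, b, c), (a', b', c'), s, t) \<and> (a, b, c) \<in> Ob (dtriples K f g) \<and>
      (a', b', c') \<in> Ob (dtriples K f g) \<and> s \<in> Ar K \<and> t \<in> Ar K \<and>
      j a' \<bullet> j s = j a \<and> j b' \<bullet> j s = j t \<bullet> j b \<and> j c' \<bullet> j t = j c)" (is "?L \<longleftrightarrow> ?R")
proof
  assume ?L
  then obtain s t where st: "h = ((a, b, c), (a', b', c'), s, t)"
      "s \<in> hom K (Dom K a) (Dom K a')" "t \<in> hom K (Dom K c) (Dom K c')"
      "a' \<cdot> s = a" "b' \<cdot> s = t \<cdot> b" "c' \<cdot> t = c"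
    and o: "(a, b, c) \<in> Ob (dtriples K f g)" "(a', b', c') \<in> Ob (dtriples K f g)"
    unfolding dtriples_def pair_twocat_hom by (auto simp: pair_twocat_def Let_def)
  have o': "T.pbk (j f) (j c) (j g \<bullet> j a) (j b)" "T.pbk (j f) (j c') (j g \<bullet> j a') (j b')" "a \<in> Ar K" "a' \<in> Ar K"
    using o assms by (auto simp: dtriples_Ob_iff)
  note p1 = T.pbk_types[OF o'(1)] and p2 = T.pbk_types[OF o'(2)]
  have d: "b \<in> Ar K" "c \<in> Ar K" "Cod K b = Dom K c" "b' \<in> Ar K" "c' \<in> Ar K" "Cod K b' = Dom K c'"
      "Dom K b' = Dom K a'"
    using p1 p2 o' assms by (auto simp: T.dm_comp)
  have "j a' \<bullet> j s = j a" "j b' \<bullet> j s = j t \<bullet> j b" "j c' \<bullet> j t = j c"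
    using st d o' by (auto simp: hom_def j_comp[symmetric])
  then show ?R using st o by (auto simp: hom_def)
next
  assume ?R
  then obtain s t where st: "h = ((a, b, c), (a', b', c'), s, t)" "s \<in> Ar K" "t \<in> Ar K"
      "j a' \<bullet> j s = j a" "j b' \<bullet> j s = j t \<bullet> j b" "j c' \<bullet> j t = j c"
    and o: "(a, b, c) \<in> Ob (dtriples K f g)" "(a', b', c') \<in> Ob (dtriples K f g)"
    by blast
  have o': "T.pbk (j f) (j c) (j g \<bullet> j a) (j b)" "T.pbk (j f) (j c') (j g \<bullet> j a') (j b')" "a \<in> Ar K" "a' \<in> Ar K"
    using o assms by (auto simp: dtriples_Ob_iff)
  note p1 = T.pbk_types[OF o'(1)] and p2 = T.pbk_types[OF o'(2)]
  have d: "b \<in> Ar K" "c \<in> Ar K" "Cod K b = Dom K c" "b' \<in> Ar K" "c' \<in> Ar K" "Cod K b' = Dom K c'"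
      "Dom K b' = Dom K a'"
    using p1 p2 o' assms by (auto simp: T.dm_comp)
  have e: "a' \<cdot> s = a" "c' \<cdot> t = c" "Dom K a' = Cod K s" "Dom K c' = Cod K t"
    using j_comp_eq st o' d by metis+
  then have "Dom K s = Dom K a" "Dom K t = Dom K c" using st o' d by auto
  moreover from this have "b' \<cdot> s = t \<cdot> b"
    using st(5) e st(2,3) d j_inj[of "b' \<cdot> s" "t \<cdot> b"] by (simp add: j_comp)
  ultimately show ?L
    unfolding dtriples_def pair_twocat_hom
    by (intro exI conjI) (use st o[unfolded dtriples_Ob] e in \<open>simp_all add: hom_def\<close>)
qed

lemma dtriples_cells:
  assumes "g \<in> Ar K"
  shows "h \<in> cells (dtriples K f g) (a, b, c) (a', b', c') \<longleftrightarrow>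
   (\<exists>s t. h = ((a, b, c), (a', b', c'), s, t) \<and> (a, b, c) \<in> Ob (dtriples K f g) \<and>
      (a', b', c') \<in> Ob (dtriples K f g) \<and> s \<in> Ce K \<and> t \<in> Ce K \<and>
      j a' \<bullet> Some s = j a \<and> j b' \<bullet> Some s = Some t \<bullet> j b \<and> j c' \<bullet> Some t = j c)" (is "?L \<longleftrightarrow> ?R")
proof
  assume ?L
  then obtain s t where st: "h = ((a, b, c), (a', b', c'), s, t)" "s \<in> Ce K" "t \<in> Ce K"
      "Src K s \<in> hom K (Dom K a) (Dom K a')" "Src K t \<in> hom K (Dom K c) (Dom K c')"
      "Id2 K a' \<star> s = Id2 K a" "Id2 K b' \<star> s = t \<star> Id2 K b" "Id2 K c' \<star> t = Id2 K c"
    and o: "(a, b, c) \<in> Ob (dtriples K f g)" "(a', b', c') \<in> Ob (dtriples K f g)"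
    unfolding dtriples_def pair_twocat_cells by (auto simp: pair_twocat_def Let_def)
  have o': "T.pbk (j f) (j c) (j g \<bullet> j a) (j b)" "T.pbk (j f) (j c') (j g \<bullet> j a') (j b')" "a \<in> Ar K" "a' \<in> Ar K"
    using o assms by (auto simp: dtriples_Ob_iff)
  note p1 = T.pbk_types[OF o'(1)] and p2 = T.pbk_types[OF o'(2)]
  have d: "b \<in> Ar K" "c \<in> Ar K" "Cod K b = Dom K c" "b' \<in> Ar K" "c' \<in> Ar K" "Cod K b' = Dom K c'"
      "Dom K b' = Dom K a'"
    using p1 p2 o' assms by (auto simp: T.dm_comp)
  have "j a' \<bullet> Some s = j a" "j b' \<bullet> Some s = Some t \<bullet> j b" "j c' \<bullet> Some t = j c"
    using st d o' by (auto simp: hom_def j_Some Some_comp)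
  then show ?R using st o by (auto simp: hom_def)
next
  assume ?R
  then obtain s t where st: "h = ((a, b, c), (a', b', c'), s, t)" "s \<in> Ce K" "t \<in> Ce K"
      "j a' \<bullet> Some s = j a" "j b' \<bullet> Some s = Some t \<bullet> j b" "j c' \<bullet> Some t = j c"
    and o: "(a, b, c) \<in> Ob (dtriples K f g)" "(a', b', c') \<in> Ob (dtriples K f g)"
    by blast
  have o': "T.pbk (j f) (j c) (j g \<bullet> j a) (j b)" "T.pbk (j f) (j c') (j g \<bullet> j a') (j b')" "a \<in> Ar K" "a' \<in> Ar K"
    using o assms by (auto simp: dtriples_Ob_iff)
  note p1 = T.pbk_types[OF o'(1)] and p2 = T.pbk_types[OF o'(2)]
  have d: "b \<in> Ar K" "c \<in> Ar K" "Cod K b = Dom K c" "b' \<in> Ar K" "c' \<in> Ar K" "Cod K b' = Dom K c'"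
      "Dom K b' = Dom K a'" "Dom K b = Dom K a"
    using p1 p2 o' assms by (auto simp: T.dm_comp)
  have q: "tarr (j a' \<bullet> Some s)" "tarr (j c' \<bullet> Some t)" using st d o' by auto
  then have q1: "Cod K (Src K s) = Dom K a'" "Cod K (Src K t) = Dom K c'"
    using o' d by (auto simp: tarr_tcomp)
  have q2: "Dom K (Src K s) = Dom K a" "Dom K (Src K t) = Dom K c"
    using T.dm_comp[OF q(1)] T.dm_comp[OF q(2)] st o' d by auto
  have i: "Id2 K a' \<star> s = Id2 K a" "Id2 K b' \<star> s = t \<star> Id2 K b" "Id2 K c' \<star> t = Id2 K c"
    using st q1 q2 d o' by (simp_all add: j_Some Some_comp)
  have r: "a' \<cdot> Src K s = a" "b' \<cdot> Src K s = Src K t \<cdot> b" "c' \<cdot> Src K t = c"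
    "a' \<cdot> Trg K s = a" "b' \<cdot> Trg K s = Trg K t \<cdot> b" "c' \<cdot> Trg K t = c"
    using arg_cong[OF i(1), of "Src K"] arg_cong[OF i(2), of "Src K"] arg_cong[OF i(3), of "Src K"]
      arg_cong[OF i(1), of "Trg K"] arg_cong[OF i(2), of "Trg K"] arg_cong[OF i(3), of "Trg K"]
      st(2,3) q1 q2 d o'(3,4) by simp_all
  show ?L
    unfolding dtriples_def pair_twocat_cells
    by (intro exI conjI) (use st(1-3) o[unfolded dtriples_Ob] i q1 q2 d o'(3,4) r in \<open>simp_all add: hom_def\<close>)
qed

text \<open>As for pullbacks, terminality with respect to arrows of triples is a consequence of terminality with
  respect to their 2-cells, applied to identities.\<close>

lemma is_distributivity_pullback_iff:
  "is_distributivity_pullback K f g (a, b, c) \<longleftrightarrow>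
     f \<in> Ar K \<and> g \<in> Ar K \<and> Cod K g = Dom K f \<and> T.dpbk (j f) (j g) (j a) (j b) (j c)"
proof (cases "f \<in> Ar K \<and> g \<in> Ar K \<and> Cod K g = Dom K f")
  case True
  then have fg: "f \<in> Ar K" "g \<in> Ar K" "Cod K g = Dom K f" by auto
  note obi = dtriples_Ob_iff[OF fg(2)] and hom = dtriples_hom[OF fg(2)] and cel = dtriples_cells[OF fg(2)]
  have "is_terminal (dtriples K f g) (a, b, c) \<longleftrightarrow> T.dpbk (j f) (j g) (j a) (j b) (j c)"
  proof
    assume t: "is_terminal (dtriples K f g) (a, b, c)"
    have o: "(a, b, c) \<in> Ob (dtriples K f g)" using t by (simp add: is_terminal_def)
    show "T.dpbk (j f) (j g) (j a) (j b) (j c)"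
      unfolding T.dpbk_def
    proof (intro conjI allI impI)
      show "T.tight (j g)" "T.tight (j a)" "T.pbk (j f) (j c) (j g \<bullet> j a) (j b)"
        using fg o obi by auto
      fix a' b' c' assume A: "T.tight a' \<and> T.pbk (j f) c' (j g \<bullet> a') b'"
      then obtain x y z where xyz: "a' = j x" "b' = j y" "c' = j z" "x \<in> Ar K" "y \<in> Ar K" "z \<in> Ar K"
        using T.pbk_tight by (metis tight_obtain)
      then have o2: "(x, y, z) \<in> Ob (dtriples K f g)" using A obi by simp
      then have ex: "\<exists>!\<theta>. \<theta> \<in> cells (dtriples K f g) (x, y, z) (a, b, c)"
        using t by (simp add: is_terminal_def)
      then obtain s t where st: "s \<in> Ce K" "t \<in> Ce K" "j a \<bullet> Some s = j x" "j b \<bullet> Some s = Some t \<bullet> j y" "j c \<bullet> Some t = j z"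
          "((x, y, z), (a, b, c), s, t) \<in> cells (dtriples K f g) (x, y, z) (a, b, c)"
        using cel by auto
      have uni: "(s', t') = (Some s, Some t)"
        if u: "j a \<bullet> s' = j x" "j b \<bullet> s' = t' \<bullet> j y" "j c \<bullet> t' = j z" for s' t'
      proof -
        have "tarr s'" "tarr t'" using u xyz by (metis T.arr_comp j_arr)+
        then obtain \<sigma> \<tau> where i: "s' = Some \<sigma>" "t' = Some \<tau>" "\<sigma> \<in> Ce K" "\<tau> \<in> Ce K" by (auto simp: tarr_def)
        then have "((x, y, z), (a, b, c), \<sigma>, \<tau>) \<in> cells (dtriples K f g) (x, y, z) (a, b, c)"
          using u o o2 cel by auto
        then show ?thesis using ex st i by blast
      qed
      show "\<exists>!(s, t). j a \<bullet> s = a' \<and> j b \<bullet> s = t \<bullet> b' \<and> j c \<bullet> t = c'"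
        unfolding xyz
      proof (rule ex1I[of _ "(Some s, Some t)"])
        show "case (Some s, Some t) of (s, t) \<Rightarrow> j a \<bullet> s = j x \<and> j b \<bullet> s = t \<bullet> j y \<and> j c \<bullet> t = j z"
          using st by simp
        fix z' assume z': "case z' of (s, t) \<Rightarrow> j a \<bullet> s = j x \<and> j b \<bullet> s = t \<bullet> j y \<and> j c \<bullet> t = j z"
        obtain s' t' where "z' = (s', t')" by (cases z')
        with z' uni show "z' = (Some s, Some t)" by blast
      qed
    qed
  next
    assume d: "T.dpbk (j f) (j g) (j a) (j b) (j c)"
    note d' = T.dpbkD[OF d]
    have o: "(a, b, c) \<in> Ob (dtriples K f g)" using d' obi by simp
    have "(\<exists>!h. h \<in> hom (dtriples K f g) X (a, b, c)) \<and> (\<exists>!\<theta>. \<theta> \<in> cells (dtriples K f g) X (a, b, c))"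
      if X: "X \<in> Ob (dtriples K f g)" for X
    proof -
      obtain x y z where x: "X = (x, y, z)" by (cases X)
      have o2: "(x, y, z) \<in> Ob (dtriples K f g)" using X x by simp
      have p: "T.tight (j x)" "T.pbk (j f) (j z) (j g \<bullet> j x) (j y)" using o2 obi by auto
      have tz: "T.tight (j z)" using T.pbk_tight[OF p(2)] by simp
      have ex: "\<exists>!(s, t). j a \<bullet> s = j x \<and> j b \<bullet> s = t \<bullet> j y \<and> j c \<bullet> t = j z"
        using d p unfolding T.dpbk_def by blast
      then obtain s t where st: "j a \<bullet> s = j x" "j b \<bullet> s = t \<bullet> j y" "j c \<bullet> t = j z" by auto
      have uni: "s' = s \<and> t' = t" if u: "j a \<bullet> s' = j x" "j b \<bullet> s' = t' \<bullet> j y" "j c \<bullet> t' = j z" for s' t'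
        using ex st u by blast
      have ar: "tarr s" "tarr t" using st p tz by (metis T.arr_comp T.tight_arr)+
      have tt: "ttight (j w) = j w" for w by (auto simp: j_def ttight_def)
      have "ttight s = s \<and> ttight t = t"
        by (rule uni) (metis st tt T.tighten_comp)+
      then have "T.tight s" "T.tight t" using ar by (simp_all add: T.tight_def)
      then obtain u v where uv: "s = j u" "t = j v" "u \<in> Ar K" "v \<in> Ar K" by (metis tight_obtain)
      have "\<exists>!h. h \<in> hom (dtriples K f g) X (a, b, c)"
      proof (rule ex1I[of _ "((x, y, z), (a, b, c), u, v)"])
        show "((x, y, z), (a, b, c), u, v) \<in> hom (dtriples K f g) X (a, b, c)"
          unfolding x hom using uv st o o2 by auto
        fix h assume "h \<in> hom (dtriples K f g) X (a, b, c)"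
        then obtain u' v' where h: "h = ((x, y, z), (a, b, c), u', v')" "u' \<in> Ar K" "v' \<in> Ar K"
            "j a \<bullet> j u' = j x" "j b \<bullet> j u' = j v' \<bullet> j y" "j c \<bullet> j v' = j z"
          unfolding x hom by auto
        then have "j u' = j u" "j v' = j v" using uni uv by auto
        then show "h = ((x, y, z), (a, b, c), u, v)" using h j_inj by simp
      qed
      moreover obtain \<sigma> \<tau> where i: "s = Some \<sigma>" "t = Some \<tau>" "\<sigma> \<in> Ce K" "\<tau> \<in> Ce K"
        using ar by (auto simp: tarr_def)
      have "\<exists>!h. h \<in> cells (dtriples K f g) X (a, b, c)"
      proof (rule ex1I[of _ "((x, y, z), (a, b, c), \<sigma>, \<tau>)"])
        show "((x, y, z), (a, b, c), \<sigma>, \<tau>) \<in> cells (dtriples K f g) X (a, b, c)"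
          unfolding x cel using i st o o2 by auto
        fix h assume "h \<in> cells (dtriples K f g) X (a, b, c)"
        then obtain u' v' where h: "h = ((x, y, z), (a, b, c), u', v')" "u' \<in> Ce K" "v' \<in> Ce K"
            "j a \<bullet> Some u' = j x" "j b \<bullet> Some u' = Some v' \<bullet> j y" "j c \<bullet> Some v' = j z"
          unfolding x cel by auto
        then have "Some u' = s" "Some v' = t" using uni by auto
        then show "h = ((x, y, z), (a, b, c), \<sigma>, \<tau>)" using h i by simp
      qed
      ultimately show ?thesis by blast
    qed
    then show "is_terminal (dtriples K f g) (a, b, c)"
      using o by (simp add: is_terminal_def)
  qed
  with True show ?thesis by (simp add: is_distributivity_pullback_def)
qed (auto simp: is_distributivity_pullback_def)

end

text \<open>The objects are the numbers below 3, the arrow \<open>i < 3\<close> is the identity of the object \<open>i\<close>, and the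
  arrows 3 and 4 go from the objects 0 and 1 to the object 2.\<close>

definition cospan :: "(nat, nat) cat" where
  "cospan = \<lparr>Ob = {0, 1, 2}, Ar = {0, 1, 2, 3, 4}, Dom = (\<lambda>u. if u = 3 then 0 else if u = 4 then 1 else u),
     Cod = (\<lambda>u. if u = 3 \<or> u = 4 then 2 else u), Idn = (\<lambda>x. x),
     Comp = (\<lambda>v u. if u = 3 \<or> u = 4 then u else v)\<rparr>"

lemma category_cospan: "category cospan"
  by unfold_locales (auto simp: cospan_def hom_def split: if_splits)

lemma (in two_category) pullbacks_exist:
  assumes L: "has_finite_limits K" and f: "f \<in> Ar K" and g: "g \<in> Ar K" and fg: "Cod K f = Cod K g"
  shows "\<exists>a b. is_pullback K f g a b"
proof -
  define F0 where "F0 = (\<lambda>x\<in>{0, 1, 2 :: nat}. if x = 0 then Dom K f else if x = 1 then Dom K g else Cod K f)"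
  define F1 where "F1 = (\<lambda>u\<in>{0, 1, 2, 3, 4 :: nat}. if u = 3 then f else if u = 4 then g else Idn K (F0 u))"
  have F0s [simp]: "F0 0 = Dom K f" "F0 1 = Dom K g" "F0 (Suc 0) = Dom K g" "F0 2 = Cod K f"
    by (simp_all add: F0_def)
  have F1s [simp]: "F1 0 = Idn K (Dom K f)" "F1 1 = Idn K (Dom K g)" "F1 (Suc 0) = Idn K (Dom K g)"
      "F1 2 = Idn K (Cod K f)" "F1 3 = f" "F1 4 = g"
    by (simp_all add: F1_def)
  have cs [simp]: "Ob cospan = {0, 1, 2}" "Ar cospan = {0, 1, 2, 3, 4}" by (simp_all add: cospan_def)
  have dc [simp]: "Dom cospan u = (if u = 3 then 0 else if u = 4 then 1 else u)"
      "Cod cospan u = (if u = 3 \<or> u = 4 then 2 else u)" "Idn cospan u = u" for u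
    by (simp_all add: cospan_def)
  have o [simp]: "Dom K f \<in> Ob K" "Dom K g \<in> Ob K" "Cod K f \<in> Ob K" "Cod K g \<in> Ob K"
    using f g by (simp_all add: Dom_Ob Cod_Ob)
  have "is_functor cospan K F0 F1"
    unfolding is_functor_def
  proof (intro conjI ballI impI)
    show "F0 \<in> Ob cospan \<rightarrow>\<^sub>E Ob K" by (auto simp: F0_def)
    show "F1 \<in> Ar cospan \<rightarrow>\<^sub>E Ar K" using f g by (auto simp: F1_def)
    fix u assume u: "u \<in> Ar cospan"
    then show "Dom K (F1 u) = F0 (Dom cospan u)" "Cod K (F1 u) = F0 (Cod cospan u)"
      using f g fg by auto
    fix v assume "v \<in> Ar cospan" "Dom cospan v = Cod cospan u"
    then show "F1 (v \<cdot>\<^bsub>cospan\<^esub> u) = F1 v \<cdot> F1 u"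
      using u f g fg by (auto simp: cospan_def split: if_splits)
  next
    fix x assume "x \<in> Ob cospan"
    then show "F1 (Idn cospan x) = Idn K (F0 x)" by auto
  qed
  then obtain P \<pi> where P: "is_limit K cospan F0 F1 P \<pi>"
    using L category_cospan unfolding has_finite_limits_def by (metis cs finite.emptyI finite_insert)
  have t: "\<pi> 0 \<in> hom K P (Dom K f)" "\<pi> 1 \<in> hom K P (Dom K g)" "\<pi> 2 \<in> hom K P (Cod K f)" "P \<in> Ob K"
    using P unfolding is_limit_def by auto
  have e: "f \<cdot> \<pi> 0 = \<pi> 2" "g \<cdot> \<pi> 1 = \<pi> 2"
    using P unfolding is_limit_def by (auto dest!: bspec[of _ _ 3] bspec[of _ _ 4])
  have ex1: "\<exists>!h. h \<in> hom K X P \<and> \<pi> 0 \<cdot> h = x \<and> \<pi> 1 \<cdot> h = y"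
    if X: "X \<in> Ob K" and x: "x \<in> hom K X (Dom K f)" and y: "y \<in> hom K X (Dom K g)" and xy: "f \<cdot> x = g \<cdot> y" for X x y
  proof -
    define \<xi> where "\<xi> i = (if i = 0 then x else if i = 1 then y else f \<cdot> x)" for i :: nat
    have "\<exists>!h. h \<in> hom K X P \<and> (\<forall>i\<in>{0, 1, 2}. \<pi> i \<cdot> h = \<xi> i)"
    proof -
      have "\<forall>i\<in>{0, 1, 2}. \<xi> i \<in> hom K X (F0 i)" "\<forall>u\<in>{0, 1, 2, 3, 4}. F1 u \<cdot> \<xi> (Dom cospan u) = \<xi> (Cod cospan u)"
        using x y xy f g fg by (auto simp: \<xi>_def hom_def)
      then show ?thesis using P X unfolding is_limit_def cs by blast
    qed
    moreover have "(\<forall>i\<in>{0, 1, 2}. \<pi> i \<cdot> h = \<xi> i) \<longleftrightarrow> \<pi> 0 \<cdot> h = x \<and> \<pi> 1 \<cdot> h = y" if h: "h \<in> hom K X P" for h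
      using h t(1,2) x y f by (auto simp: \<xi>_def hom_def e(1)[symmetric] comp_assoc)
    ultimately show ?thesis by (metis (no_types, lifting))
  qed
  have ex2: "\<exists>!\<theta>. \<theta> \<in> cells K X P \<and> Id2 K (\<pi> 0) \<star> \<theta> = x \<and> Id2 K (\<pi> 1) \<star> \<theta> = y"
    if X: "X \<in> Ob K" and x: "x \<in> cells K X (Dom K f)" and y: "y \<in> cells K X (Dom K g)"
      and xy: "Id2 K f \<star> x = Id2 K g \<star> y" for X x y
  proof -
    define \<xi> where "\<xi> i = (if i = 0 then x else if i = 1 then y else Id2 K f \<star> x)" for i :: nat
    have "\<exists>!\<theta>. \<theta> \<in> cells K X P \<and> (\<forall>i\<in>{0, 1, 2}. Id2 K (\<pi> i) \<star> \<theta> = \<xi> i)"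
    proof -
      have "\<forall>i\<in>{0, 1, 2}. \<xi> i \<in> cells K X (F0 i)" "\<forall>u\<in>{0, 1, 2, 3, 4}. Id2 K (F1 u) \<star> \<xi> (Dom cospan u) = \<xi> (Cod cospan u)"
        using x y xy f g fg by (auto simp: \<xi>_def hom_def)
      then show ?thesis using P X unfolding is_limit_def cs by blast
    qed
    moreover have "(\<forall>i\<in>{0, 1, 2}. Id2 K (\<pi> i) \<star> \<theta> = \<xi> i) \<longleftrightarrow> Id2 K (\<pi> 0) \<star> \<theta> = x \<and> Id2 K (\<pi> 1) \<star> \<theta> = y"
      if h: "\<theta> \<in> cells K X P" for \<theta>
      using h t(1,2) x y f by (auto simp: \<xi>_def hom_def e(1)[symmetric] hcomp_assoc id2_hcomp[symmetric] simp del: id2_hcomp)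
    ultimately show ?thesis by (metis (no_types, lifting))
  qed
  have dP: "Dom K (\<pi> 0) = P" using t by (simp add: hom_def)
  have "is_pullback K f g (\<pi> 0) (\<pi> 1)"
    unfolding is_pullback_def dP
    by (intro conjI ballI impI ex1 ex2) (use f g fg t e in \<open>simp_all add: hom_def\<close>)
  then show ?thesis by blast
qed

locale two_category_with_pullbacks = two_category +
  assumes pullbacks: "f \<in> Ar K \<Longrightarrow> g \<in> Ar K \<Longrightarrow> Cod K f = Cod K g \<Longrightarrow> \<exists>a b. is_pullback K f g a b"
begin

sublocale T: tight_category_with_pullbacks tcomp tarr tdm tcd tide ttight
proof
  fix f g assume "T.tight f" "T.tight g" "tcd f = tcd g"
  then show "\<exists>a b. T.pbk f g a b"
    using pullbacks unfolding tight_iff is_pullback_iff by (metis j_cd)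
qed

end

section \<open>Right 2-adjoints and universal arrows\<close>

lemma (in two_category) id2_inj: "Id2 K f = Id2 K g \<Longrightarrow> f \<in> Ar K \<Longrightarrow> g \<in> Ar K \<Longrightarrow> f = g"
  by (metis id2_cell(2))

lemma two_functorD:
  assumes "two_functor A B F"
  shows "X \<in> Ob A \<Longrightarrow> fob F X \<in> Ob B"
    "f \<in> Ar A \<Longrightarrow> far F f \<in> Ar B" "f \<in> Ar A \<Longrightarrow> Dom B (far F f) = fob F (Dom A f)"
    "f \<in> Ar A \<Longrightarrow> Cod B (far F f) = fob F (Cod A f)"
    "\<alpha> \<in> Ce A \<Longrightarrow> fce F \<alpha> \<in> Ce B" "\<alpha> \<in> Ce A \<Longrightarrow> Src B (fce F \<alpha>) = far F (Src A \<alpha>)"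
    "\<alpha> \<in> Ce A \<Longrightarrow> Trg B (fce F \<alpha>) = far F (Trg A \<alpha>)"
    "f \<in> Ar A \<Longrightarrow> fce F (Id2 A f) = Id2 B (far F f)"
    "X \<in> Ob A \<Longrightarrow> far F (Idn A X) = Idn B (fob F X)"
    "\<alpha> \<in> Ce A \<Longrightarrow> \<beta> \<in> Ce A \<Longrightarrow> Dom A (Src A \<beta>) = Cod A (Src A \<alpha>) \<Longrightarrow>
      fce F (\<beta> \<star>\<^bsub>A\<^esub> \<alpha>) = fce F \<beta> \<star>\<^bsub>B\<^esub> fce F \<alpha>"
    "\<alpha> \<in> Ce A \<Longrightarrow> \<beta> \<in> Ce A \<Longrightarrow> Src A \<beta> = Trg A \<alpha> \<Longrightarrow>
      fce F (\<beta> \<diamondop>\<^bsub>A\<^esub> \<alpha>) = fce F \<beta> \<diamondop>\<^bsub>B\<^esub> fce F \<alpha>"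
    "f \<in> Ar A \<Longrightarrow> g \<in> Ar A \<Longrightarrow> Dom A g = Cod A f \<Longrightarrow> far F (g \<cdot>\<^bsub>A\<^esub> f) = far F g \<cdot>\<^bsub>B\<^esub> far F f"
    "fob F \<in> extensional (Ob A)" "far F \<in> extensional (Ar A)" "fce F \<in> extensional (Ce A)"
  using assms by (auto simp: two_functor_def is_functor_def PiE_def)

text \<open>Arrows embed into 2-cells as identities, so that it suffices to know that composites of 2-cells are
  preserved.\<close>

lemma two_functorI:
  assumes "two_category A" "two_category B"
    and "fob F \<in> extensional (Ob A)" "far F \<in> extensional (Ar A)" "fce F \<in> extensional (Ce A)"
    and "\<And>X. X \<in> Ob A \<Longrightarrow> fob F X \<in> Ob B"
    and "\<And>\<alpha>. \<alpha> \<in> Ce A \<Longrightarrow> fce F \<alpha> \<in> Ce B" "\<And>\<alpha>. \<alpha> \<in> Ce A \<Longrightarrow> Src B (fce F \<alpha>) = far F (Src A \<alpha>)"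
    and "\<And>\<alpha>. \<alpha> \<in> Ce A \<Longrightarrow> Trg B (fce F \<alpha>) = far F (Trg A \<alpha>)"
    and "\<And>f. f \<in> Ar A \<Longrightarrow> Dom B (far F f) = fob F (Dom A f)"
    and "\<And>f. f \<in> Ar A \<Longrightarrow> Cod B (far F f) = fob F (Cod A f)"
    and "\<And>f. f \<in> Ar A \<Longrightarrow> fce F (Id2 A f) = Id2 B (far F f)"
    and "\<And>X. X \<in> Ob A \<Longrightarrow> far F (Idn A X) = Idn B (fob F X)"
    and "\<And>\<alpha> \<beta>. \<alpha> \<in> Ce A \<Longrightarrow> \<beta> \<in> Ce A \<Longrightarrow> Dom A (Src A \<beta>) = Cod A (Src A \<alpha>) \<Longrightarrow>
      fce F (\<beta> \<star>\<^bsub>A\<^esub> \<alpha>) = fce F \<beta> \<star>\<^bsub>B\<^esub> fce F \<alpha>"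
    and "\<And>\<alpha> \<beta>. \<alpha> \<in> Ce A \<Longrightarrow> \<beta> \<in> Ce A \<Longrightarrow> Src A \<beta> = Trg A \<alpha> \<Longrightarrow>
      fce F (\<beta> \<diamondop>\<^bsub>A\<^esub> \<alpha>) = fce F \<beta> \<diamondop>\<^bsub>B\<^esub> fce F \<alpha>"
  shows "two_functor A B F"
proof -
  interpret A: two_category A by fact
  interpret B: two_category B by fact
  have ar: "far F f \<in> Ar B" if f: "f \<in> Ar A" for f
    using assms(7,8)[of "Id2 A f"] f B.cell_arr(1)[of "fce F (Id2 A f)"] by simp
  have comp: "far F (g \<cdot>\<^bsub>A\<^esub> f) = far F g \<cdot>\<^bsub>B\<^esub> far F f"
    if fg: "f \<in> Ar A" "g \<in> Ar A" "Dom A g = Cod A f" for f g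
  proof -
    have "fce F (Id2 A g \<star>\<^bsub>A\<^esub> Id2 A f) = Id2 B (far F g \<cdot>\<^bsub>B\<^esub> far F f)"
      using assms(14)[of "Id2 A f" "Id2 A g"] fg ar assms(10,11,12) by simp
    then have "Src B (fce F (Id2 A g \<star>\<^bsub>A\<^esub> Id2 A f)) = far F g \<cdot>\<^bsub>B\<^esub> far F f"
      using fg ar assms(10,11) by simp
    then show ?thesis using fg assms(8) by simp
  qed
  show ?thesis
    unfolding two_functor_def is_functor_def using assms(3-15) ar comp by (auto simp: PiE_def)
qed

text \<open>The condition mentions 2-cells only. For arrows it follows by the same argument as for pullbacks.\<close>

definition universal_arrow :: "('o, 'a, 'c, 'm) twocat_scheme \<Rightarrow> ('p, 'b, 'd, 'n) twocat_scheme
    \<Rightarrow> ('o, 'p, 'a, 'b, 'c, 'd) twofun \<Rightarrow> 'p \<Rightarrow> 'o \<Rightarrow> 'b \<Rightarrow> bool" where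
  "universal_arrow A B F Y U e \<longleftrightarrow> U \<in> Ob A \<and> e \<in> hom B (fob F U) Y \<and>
     (\<forall>X\<in>Ob A. \<forall>\<theta>\<in>cells B (fob F X) Y.
        \<exists>!\<phi>. \<phi> \<in> cells A X U \<and> Id2 B e \<star>\<^bsub>B\<^esub> fce F \<phi> = \<theta>)"

text \<open>The counit at \<open>Y\<close> is universal: by the triangle identities and naturality, the factorization of
  \<open>\<theta>\<close> is \<open>G \<theta>\<close> composed with the unit.\<close>

lemma adjoint_universal_arrow:
  assumes A: "two_category A" and B: "two_category B" and adj: "right_two_adjoint A B F G" and Y: "Y \<in> Ob B"
  shows "\<exists>U e. universal_arrow A B F Y U e"
proof -
  interpret A: two_category A by fact
  interpret B: two_category B by fact
  obtain \<eta> \<epsilon> where FF: "two_functor A B F" and GG: "two_functor B A G"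
    and n1: "two_natural A A (fun_id A) (fun_comp A G F) \<eta>"
    and n2: "two_natural B B (fun_comp B F G) (fun_id B) \<epsilon>"
    and t1: "\<And>X. X \<in> Ob A \<Longrightarrow> \<epsilon> (fob F X) \<cdot>\<^bsub>B\<^esub> far F (\<eta> X) = Idn B (fob F X)"
    and t2: "\<And>Y. Y \<in> Ob B \<Longrightarrow> far G (\<epsilon> Y) \<cdot>\<^bsub>A\<^esub> \<eta> (fob G Y) = Idn A (fob G Y)"
    using adj unfolding right_two_adjoint_def by blast
  note F = two_functorD[OF FF] and G = two_functorD[OF GG]
  have eta: "\<eta> X \<in> Ar A" "Dom A (\<eta> X) = X" "Cod A (\<eta> X) = fob G (fob F X)" if "X \<in> Ob A" for X
    using n1 that unfolding two_natural_def by (auto simp: fun_id_def fun_comp_def compose_def hom_def)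
  have eps: "\<epsilon> Y \<in> Ar B" "Dom B (\<epsilon> Y) = fob F (fob G Y)" "Cod B (\<epsilon> Y) = Y" if "Y \<in> Ob B" for Y
    using n2 that unfolding two_natural_def by (auto simp: fun_id_def fun_comp_def compose_def hom_def)
  have etan: "fce G (fce F \<alpha>) \<star>\<^bsub>A\<^esub> Id2 A (\<eta> (Dom A (Src A \<alpha>))) = Id2 A (\<eta> (Cod A (Src A \<alpha>))) \<star>\<^bsub>A\<^esub> \<alpha>"
    if a: "\<alpha> \<in> Ce A" for \<alpha>
  proof -
    have "\<alpha> \<in> cells A (Dom A (Src A \<alpha>)) (Cod A (Src A \<alpha>))" "Dom A (Src A \<alpha>) \<in> Ob A" "Cod A (Src A \<alpha>) \<in> Ob A"
      using a by (simp_all add: hom_def A.Dom_Ob A.Cod_Ob)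
    then have "fce (fun_comp A G F) \<alpha> \<star>\<^bsub>A\<^esub> Id2 A (\<eta> (Dom A (Src A \<alpha>))) =
        Id2 A (\<eta> (Cod A (Src A \<alpha>))) \<star>\<^bsub>A\<^esub> fce (fun_id A) \<alpha>"
      using n1 unfolding two_natural_def by blast
    then show ?thesis using a by (simp add: fun_id_def fun_comp_def compose_def)
  qed
  have epsn: "\<theta> \<star>\<^bsub>B\<^esub> Id2 B (\<epsilon> (Dom B (Src B \<theta>))) = Id2 B (\<epsilon> (Cod B (Src B \<theta>))) \<star>\<^bsub>B\<^esub> fce F (fce G \<theta>)"
    if a: "\<theta> \<in> Ce B" for \<theta>
  proof -
    have "\<theta> \<in> cells B (Dom B (Src B \<theta>)) (Cod B (Src B \<theta>))" "Dom B (Src B \<theta>) \<in> Ob B" "Cod B (Src B \<theta>) \<in> Ob B"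
      using a by (simp_all add: hom_def B.Dom_Ob B.Cod_Ob)
    then have "fce (fun_id B) \<theta> \<star>\<^bsub>B\<^esub> Id2 B (\<epsilon> (Dom B (Src B \<theta>))) =
        Id2 B (\<epsilon> (Cod B (Src B \<theta>))) \<star>\<^bsub>B\<^esub> fce (fun_comp B F G) \<theta>"
      using n2 unfolding two_natural_def by blast
    then show ?thesis using a by (simp add: fun_id_def fun_comp_def compose_def)
  qed
  have "universal_arrow A B F Y (fob G Y) (\<epsilon> Y)"
    unfolding universal_arrow_def
  proof (intro conjI ballI)
    show "fob G Y \<in> Ob A" "\<epsilon> Y \<in> hom B (fob F (fob G Y)) Y"
      using Y G(1) eps by (simp_all add: hom_def)
    fix X \<theta> assume X: "X \<in> Ob A" and th: "\<theta> \<in> cells B (fob F X) Y"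
    then have th': "\<theta> \<in> Ce B" "Dom B (Src B \<theta>) = fob F X" "Cod B (Src B \<theta>) = Y" by (auto simp: hom_def)
    let ?\<phi> = "fce G \<theta> \<star>\<^bsub>A\<^esub> Id2 A (\<eta> X)"
    have g: "fce G \<theta> \<in> Ce A" "Dom A (Src A (fce G \<theta>)) = fob G (fob F X)" "Cod A (Src A (fce G \<theta>)) = fob G Y"
      using th' G(2-6) by simp_all
    have c: "?\<phi> \<in> cells A X (fob G Y)"
      using g eta[OF X] by (simp add: hom_def)
    have FX: "fob F X \<in> Ob B" using X F by simp
    have ff: "fce F (fce G \<theta>) \<in> Ce B" "Dom B (Src B (fce F (fce G \<theta>))) = fob F (fob G (fob F X))"
        "Cod B (Src B (fce F (fce G \<theta>))) = fob F (fob G Y)"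
      using g F(2-6) by simp_all
    have fe: "far F (\<eta> X) \<in> Ar B" "Dom B (far F (\<eta> X)) = fob F X" "Cod B (far F (\<eta> X)) = fob F (fob G (fob F X))"
      using eta[OF X] F(2-4) by simp_all
    have "Id2 B (\<epsilon> Y) \<star>\<^bsub>B\<^esub> fce F ?\<phi> = Id2 B (\<epsilon> Y) \<star>\<^bsub>B\<^esub> (fce F (fce G \<theta>) \<star>\<^bsub>B\<^esub> Id2 B (far F (\<eta> X)))"
      using F(8)[of "\<eta> X"] F(10)[of "Id2 A (\<eta> X)" "fce G \<theta>"] g eta[OF X] by simp
    also have "\<dots> = (Id2 B (\<epsilon> Y) \<star>\<^bsub>B\<^esub> fce F (fce G \<theta>)) \<star>\<^bsub>B\<^esub> Id2 B (far F (\<eta> X))"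
      using B.hcomp_assoc[of "Id2 B (far F (\<eta> X))" "fce F (fce G \<theta>)" "Id2 B (\<epsilon> Y)"] ff fe eps[OF Y] by simp
    also have "\<dots> = (\<theta> \<star>\<^bsub>B\<^esub> Id2 B (\<epsilon> (fob F X))) \<star>\<^bsub>B\<^esub> Id2 B (far F (\<eta> X))"
      using epsn[OF th'(1)] th' by simp
    also have "\<dots> = \<theta> \<star>\<^bsub>B\<^esub> (Id2 B (\<epsilon> (fob F X)) \<star>\<^bsub>B\<^esub> Id2 B (far F (\<eta> X)))"
      using B.hcomp_assoc[of "Id2 B (far F (\<eta> X))" "Id2 B (\<epsilon> (fob F X))" \<theta>] th' fe eps[OF FX] by simp
    also have "\<dots> = \<theta>"
      using t1[OF X] fe eps[OF FX] th' by simp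
    finally have ex: "Id2 B (\<epsilon> Y) \<star>\<^bsub>B\<^esub> fce F ?\<phi> = \<theta>" .
    have un: "\<phi> = ?\<phi>" if h: "\<phi> \<in> cells A X (fob G Y)" "Id2 B (\<epsilon> Y) \<star>\<^bsub>B\<^esub> fce F \<phi> = \<theta>" for \<phi>
    proof -
      have p: "\<phi> \<in> Ce A" "Dom A (Src A \<phi>) = X" "Cod A (Src A \<phi>) = fob G Y" using h by (auto simp: hom_def)
      have GY: "fob G Y \<in> Ob A" using Y G by simp
      have fp: "fce F \<phi> \<in> Ce B" "Dom B (Src B (fce F \<phi>)) = fob F X" "Cod B (Src B (fce F \<phi>)) = fob F (fob G Y)"
        using p F(2-6) by simp_all
      have gp: "fce G (fce F \<phi>) \<in> Ce A" "Dom A (Src A (fce G (fce F \<phi>))) = fob G (fob F X)"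
          "Cod A (Src A (fce G (fce F \<phi>))) = fob G (fob F (fob G Y))"
        using fp G(2-6) by simp_all
      have ge: "far G (\<epsilon> Y) \<in> Ar A" "Dom A (far G (\<epsilon> Y)) = fob G (fob F (fob G Y))" "Cod A (far G (\<epsilon> Y)) = fob G Y"
        using eps[OF Y] G(2-4) by simp_all
      have "fce G \<theta> = Id2 A (far G (\<epsilon> Y)) \<star>\<^bsub>A\<^esub> fce G (fce F \<phi>)"
        using h(2)[symmetric] G(8)[of "\<epsilon> Y"] G(10)[of "fce F \<phi>" "Id2 B (\<epsilon> Y)"] fp eps[OF Y] by simp
      then have "?\<phi> = Id2 A (far G (\<epsilon> Y)) \<star>\<^bsub>A\<^esub> (fce G (fce F \<phi>) \<star>\<^bsub>A\<^esub> Id2 A (\<eta> X))"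
        using A.hcomp_assoc[of "Id2 A (\<eta> X)" "fce G (fce F \<phi>)" "Id2 A (far G (\<epsilon> Y))"] gp ge eta[OF X] by simp
      also have "\<dots> = Id2 A (far G (\<epsilon> Y)) \<star>\<^bsub>A\<^esub> (Id2 A (\<eta> (fob G Y)) \<star>\<^bsub>A\<^esub> \<phi>)"
        using etan[OF p(1)] p by simp
      also have "\<dots> = (Id2 A (far G (\<epsilon> Y)) \<star>\<^bsub>A\<^esub> Id2 A (\<eta> (fob G Y))) \<star>\<^bsub>A\<^esub> \<phi>"
        using A.hcomp_assoc[of \<phi> "Id2 A (\<eta> (fob G Y))" "Id2 A (far G (\<epsilon> Y))"] p ge eta[OF GY] by simp
      also have "\<dots> = \<phi>"
        using t2[OF Y] ge eta[OF GY] p by simp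
      finally show ?thesis by simp
    qed
    show "\<exists>!\<phi>. \<phi> \<in> cells A X (fob G Y) \<and> Id2 B (\<epsilon> Y) \<star>\<^bsub>B\<^esub> fce F \<phi> = \<theta>"
      using c ex un by blast
  qed
  then show ?thesis by blast
qed

text \<open>The adjoint sends a 2-cell \<open>\<theta>\<close> from \<open>Y\<close> to \<open>Y'\<close> to the unique 2-cell from \<open>U Y\<close> to \<open>U Y'\<close> whose image, composed
  with the universal arrow at \<open>Y'\<close>, is \<open>\<theta>\<close> composed with the universal arrow at \<open>Y\<close>. That this respects all compositions, the triangle identities and naturality
  are equations between 2-cells into an object \<open>U Y\<close>, and these can be checked after composition with
  the universal arrow at \<open>Y\<close>.\<close>

lemma universal_arrows_adjoint:
  assumes A: "two_category A" and B: "two_category B" and FF: "two_functor A B F"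
    and U: "\<And>Y. Y \<in> Ob B \<Longrightarrow> \<exists>U e. universal_arrow A B F Y U e"
  shows "\<exists>G. right_two_adjoint A B F G"
proof -
  interpret A: two_category A by fact
  interpret B: two_category B by fact
  note F = two_functorD[OF FF]
  obtain U e where Ue: "\<And>Y. Y \<in> Ob B \<Longrightarrow> universal_arrow A B F Y (U Y) (e Y)"
    using U by metis
  have UO: "U Y \<in> Ob A" if "Y \<in> Ob B" for Y
    using Ue[OF that] by (simp add: universal_arrow_def)
  have e: "e Y \<in> Ar B" "Dom B (e Y) = fob F (U Y)" "Cod B (e Y) = Y" if "Y \<in> Ob B" for Y
    using Ue[OF that] by (auto simp: universal_arrow_def hom_def)
  have ex1: "\<exists>!\<phi>. \<phi> \<in> cells A X (U Y) \<and> Id2 B (e Y) \<star>\<^bsub>B\<^esub> fce F \<phi> = \<theta>"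
    if "X \<in> Ob A" "Y \<in> Ob B" "\<theta> \<in> cells B (fob F X) Y" for X Y \<theta>
    using Ue[of Y] that unfolding universal_arrow_def by blast
  define tr where "tr X Y \<theta> = (THE \<phi>. \<phi> \<in> cells A X (U Y) \<and> Id2 B (e Y) \<star>\<^bsub>B\<^esub> fce F \<phi> = \<theta>)" for X Y \<theta>
  have tr: "tr X Y \<theta> \<in> cells A X (U Y)" "Id2 B (e Y) \<star>\<^bsub>B\<^esub> fce F (tr X Y \<theta>) = \<theta>"
    if "X \<in> Ob A" "Y \<in> Ob B" "\<theta> \<in> cells B (fob F X) Y" for X Y \<theta>
    using theI'[OF ex1[OF that]] unfolding tr_def by blast+
  have uni: "\<phi> = \<psi>"
    if "Y \<in> Ob B" "\<phi> \<in> Ce A" "\<psi> \<in> Ce A" "Dom A (Src A \<phi>) = Dom A (Src A \<psi>)"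
      "Cod A (Src A \<phi>) = U Y" "Cod A (Src A \<psi>) = U Y"
      "Id2 B (e Y) \<star>\<^bsub>B\<^esub> fce F \<phi> = Id2 B (e Y) \<star>\<^bsub>B\<^esub> fce F \<psi>" for \<phi> \<psi> Y
  proof -
    let ?X = "Dom A (Src A \<phi>)" and ?\<theta> = "Id2 B (e Y) \<star>\<^bsub>B\<^esub> fce F \<phi>"
    have "?X \<in> Ob A" using that by (simp add: A.Dom_Ob)
    moreover have "?\<theta> \<in> cells B (fob F ?X) Y"
      using that e[of Y] F(2-6) by (simp add: hom_def)
    moreover have "\<phi> \<in> cells A ?X (U Y)" "\<psi> \<in> cells A ?X (U Y)" using that by (simp_all add: hom_def)
    ultimately show ?thesis using ex1[of ?X Y ?\<theta>] that(1,7) by metis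
  qed
  define gc where "gc \<theta> = tr (U (Dom B (Src B \<theta>))) (Cod B (Src B \<theta>)) (\<theta> \<star>\<^bsub>B\<^esub> Id2 B (e (Dom B (Src B \<theta>))))" for \<theta>
  have gc: "gc \<theta> \<in> Ce A" "Dom A (Src A (gc \<theta>)) = U (Dom B (Src B \<theta>))" "Cod A (Src A (gc \<theta>)) = U (Cod B (Src B \<theta>))"
    "Id2 B (e (Cod B (Src B \<theta>))) \<star>\<^bsub>B\<^esub> fce F (gc \<theta>) = \<theta> \<star>\<^bsub>B\<^esub> Id2 B (e (Dom B (Src B \<theta>)))"
    if th: "\<theta> \<in> Ce B" for \<theta>
  proof -
    have o: "Dom B (Src B \<theta>) \<in> Ob B" "Cod B (Src B \<theta>) \<in> Ob B" using th by (simp_all add: B.Dom_Ob B.Cod_Ob)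
    have c: "\<theta> \<star>\<^bsub>B\<^esub> Id2 B (e (Dom B (Src B \<theta>))) \<in> cells B (fob F (U (Dom B (Src B \<theta>)))) (Cod B (Src B \<theta>))"
      using e[OF o(1)] th by (simp add: hom_def)
    show "gc \<theta> \<in> Ce A" "Dom A (Src A (gc \<theta>)) = U (Dom B (Src B \<theta>))" "Cod A (Src A (gc \<theta>)) = U (Cod B (Src B \<theta>))"
      "Id2 B (e (Cod B (Src B \<theta>))) \<star>\<^bsub>B\<^esub> fce F (gc \<theta>) = \<theta> \<star>\<^bsub>B\<^esub> Id2 B (e (Dom B (Src B \<theta>)))"
      using tr[OF UO[OF o(1)] o(2) c] unfolding gc_def by (auto simp: hom_def)
  qed
  define ga where "ga f = Src A (gc (Id2 B f))" for f
  \<comment> \<open>the universal property determines sources and targets as well\<close>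
  have bdry: "Id2 A (Src A (gc \<theta>)) = gc (Id2 B (Src B \<theta>))" "Id2 A (Trg A (gc \<theta>)) = gc (Id2 B (Trg B \<theta>))"
    if th: "\<theta> \<in> Ce B" for \<theta>
  proof -
    note g = gc[OF th]
    have o: "Dom B (Src B \<theta>) \<in> Ob B" "Cod B (Src B \<theta>) \<in> Ob B" using th by (simp_all add: B.Dom_Ob B.Cod_Ob)
    note e1 = e[OF o(1)] and e2 = e[OF o(2)]
    have s: "e (Cod B (Src B \<theta>)) \<cdot>\<^bsub>B\<^esub> far F (Src A (gc \<theta>)) = Src B \<theta> \<cdot>\<^bsub>B\<^esub> e (Dom B (Src B \<theta>))"
      using arg_cong[OF g(4), of "Src B"] g(1-3) e1 e2 th F(2-6) by simp
    have t: "e (Cod B (Src B \<theta>)) \<cdot>\<^bsub>B\<^esub> far F (Trg A (gc \<theta>)) = Trg B \<theta> \<cdot>\<^bsub>B\<^esub> e (Dom B (Src B \<theta>))"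
      using arg_cong[OF g(4), of "Trg B"] g(1-3) e1 e2 th F(2-7) by simp
    have s1: "Src B \<theta> \<in> Ar B" "Trg B \<theta> \<in> Ar B" using th by simp_all
    note gs = gc[of "Id2 B (Src B \<theta>)"] and gt = gc[of "Id2 B (Trg B \<theta>)"]
    show "Id2 A (Src A (gc \<theta>)) = gc (Id2 B (Src B \<theta>))"
    proof (rule uni[OF o(2)])
      show "Id2 B (e (Cod B (Src B \<theta>))) \<star>\<^bsub>B\<^esub> fce F (Id2 A (Src A (gc \<theta>))) =
          Id2 B (e (Cod B (Src B \<theta>))) \<star>\<^bsub>B\<^esub> fce F (gc (Id2 B (Src B \<theta>)))"
        using gs(4) s s1 g(1-3) e1 e2 F(2,3,4,8) th by simp
    qed (use g(1-3) gs s1 th in simp_all)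
    show "Id2 A (Trg A (gc \<theta>)) = gc (Id2 B (Trg B \<theta>))"
    proof (rule uni[OF o(2)])
      show "Id2 B (e (Cod B (Src B \<theta>))) \<star>\<^bsub>B\<^esub> fce F (Id2 A (Trg A (gc \<theta>))) =
          Id2 B (e (Cod B (Src B \<theta>))) \<star>\<^bsub>B\<^esub> fce F (gc (Id2 B (Trg B \<theta>)))"
        using gt(4) t s1 g(1-3) e1 e2 F(2,3,4,8) th by simp
    qed (use g(1-3) gt s1 th in simp_all)
  qed
  have ga: "ga f \<in> Ar A" "Dom A (ga f) = U (Dom B f)" "Cod A (ga f) = U (Cod B f)" "gc (Id2 B f) = Id2 A (ga f)"
    if "f \<in> Ar B" for f
    using gc[of "Id2 B f"] bdry(1)[of "Id2 B f"] that unfolding ga_def by simp_all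
  have src: "Src A (gc \<theta>) = ga (Src B \<theta>)" "Trg A (gc \<theta>) = ga (Trg B \<theta>)" if th: "\<theta> \<in> Ce B" for \<theta>
    using arg_cong[OF bdry(1)[OF th], of "Src A"] arg_cong[OF bdry(2)[OF th], of "Src A"] gc[OF th] th
    unfolding ga_def by simp_all
  define G where "G = \<lparr>fob = (\<lambda>Y\<in>Ob B. U Y), far = (\<lambda>f\<in>Ar B. ga f), fce = (\<lambda>\<theta>\<in>Ce B. gc \<theta>)\<rparr>"
  have Gs [simp]: "Y \<in> Ob B \<Longrightarrow> fob G Y = U Y" "f \<in> Ar B \<Longrightarrow> far G f = ga f" "\<theta> \<in> Ce B \<Longrightarrow> fce G \<theta> = gc \<theta>" for Y f \<theta>
    by (simp_all add: G_def)
  have idn: "gc (Id2 B (Idn B Y)) = Id2 A (Idn A (U Y))" if Y: "Y \<in> Ob B" for Y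
    using gc[of "Id2 B (Idn B Y)"] Y UO[OF Y] e[OF Y] F(1,8,9) by (intro uni[OF Y]) simp_all
  have GG: "two_functor B A G"
  proof (rule two_functorI[OF B A])
    show "fob G \<in> extensional (Ob B)" "far G \<in> extensional (Ar B)" "fce G \<in> extensional (Ce B)"
      by (simp_all add: G_def)
    show "fob G X \<in> Ob A" if "X \<in> Ob B" for X using that UO by simp
    show "fce G \<theta> \<in> Ce A" "Src A (fce G \<theta>) = far G (Src B \<theta>)" "Trg A (fce G \<theta>) = far G (Trg B \<theta>)"
      if "\<theta> \<in> Ce B" for \<theta> using that gc src by simp_all
    show "Dom A (far G f) = fob G (Dom B f)" "Cod A (far G f) = fob G (Cod B f)" "fce G (Id2 B f) = Id2 A (far G f)"
      if "f \<in> Ar B" for f using that ga B.Dom_Ob B.Cod_Ob by simp_all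
    show "far G (Idn B X) = Idn A (fob G X)" if "X \<in> Ob B" for X
      using idn[OF that] that UO[OF that] unfolding ga_def[symmetric] by (simp add: ga_def)
    show "fce G (\<beta> \<star>\<^bsub>B\<^esub> \<alpha>) = fce G \<beta> \<star>\<^bsub>A\<^esub> fce G \<alpha>"
      if ab: "\<alpha> \<in> Ce B" "\<beta> \<in> Ce B" "Dom B (Src B \<beta>) = Cod B (Src B \<alpha>)" for \<alpha> \<beta>
    proof -
      have o: "Dom B (Src B \<alpha>) \<in> Ob B" "Cod B (Src B \<alpha>) \<in> Ob B" "Cod B (Src B \<beta>) \<in> Ob B"
        using ab by (simp_all add: B.Dom_Ob B.Cod_Ob)
      note e1 = e[OF o(1)] and e2 = e[OF o(2)] and e3 = e[OF o(3)]
      note ga = gc[OF ab(1)] and gb = gc[OF ab(2)]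
      have c: "\<beta> \<star>\<^bsub>B\<^esub> \<alpha> \<in> Ce B" using ab by simp
      note gab = gc[OF c]
      have fa: "fce F (gc \<alpha>) \<in> Ce B" "Dom B (Src B (fce F (gc \<alpha>))) = fob F (U (Dom B (Src B \<alpha>)))"
          "Cod B (Src B (fce F (gc \<alpha>))) = fob F (U (Cod B (Src B \<alpha>)))"
        using ga F(2-6) by simp_all
      have fb: "fce F (gc \<beta>) \<in> Ce B" "Dom B (Src B (fce F (gc \<beta>))) = fob F (U (Cod B (Src B \<alpha>)))"
          "Cod B (Src B (fce F (gc \<beta>))) = fob F (U (Cod B (Src B \<beta>)))"
        using gb ab F(2-6) by simp_all
      have "Id2 B (e (Cod B (Src B \<beta>))) \<star>\<^bsub>B\<^esub> fce F (gc \<beta> \<star>\<^bsub>A\<^esub> gc \<alpha>) =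
          (Id2 B (e (Cod B (Src B \<beta>))) \<star>\<^bsub>B\<^esub> fce F (gc \<beta>)) \<star>\<^bsub>B\<^esub> fce F (gc \<alpha>)"
        using F(10)[of "gc \<alpha>" "gc \<beta>"] ga(1-3) gb(1-3) ab e3 fa fb by (simp add: B.hcomp_assoc)
      also have "\<dots> = \<beta> \<star>\<^bsub>B\<^esub> (Id2 B (e (Cod B (Src B \<alpha>))) \<star>\<^bsub>B\<^esub> fce F (gc \<alpha>))"
        using gb(4) ab e2 fa by (simp add: B.hcomp_assoc)
      also have "\<dots> = (\<beta> \<star>\<^bsub>B\<^esub> \<alpha>) \<star>\<^bsub>B\<^esub> Id2 B (e (Dom B (Src B \<alpha>)))"
        using ga(4) ab e1 by (simp add: B.hcomp_assoc)
      finally have "Id2 B (e (Cod B (Src B \<beta>))) \<star>\<^bsub>B\<^esub> fce F (gc (\<beta> \<star>\<^bsub>B\<^esub> \<alpha>)) =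
          Id2 B (e (Cod B (Src B \<beta>))) \<star>\<^bsub>B\<^esub> fce F (gc \<beta> \<star>\<^bsub>A\<^esub> gc \<alpha>)"
        using gab(4) ab by simp
      then have "gc (\<beta> \<star>\<^bsub>B\<^esub> \<alpha>) = gc \<beta> \<star>\<^bsub>A\<^esub> gc \<alpha>"
        by (rule uni[OF o(3), rotated 5]) (use gab(1-3) ga(1-3) gb(1-3) ab in simp_all)
      then show ?thesis using ab by simp
    qed
    show "fce G (\<beta> \<diamondop>\<^bsub>B\<^esub> \<alpha>) = fce G \<beta> \<diamondop>\<^bsub>A\<^esub> fce G \<alpha>"
      if ab: "\<alpha> \<in> Ce B" "\<beta> \<in> Ce B" "Src B \<beta> = Trg B \<alpha>" for \<alpha> \<beta>
    proof -
      have d: "Dom B (Src B \<beta>) = Dom B (Src B \<alpha>)" "Cod B (Src B \<beta>) = Cod B (Src B \<alpha>)" using ab by simp_all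
      have o: "Dom B (Src B \<alpha>) \<in> Ob B" "Cod B (Src B \<alpha>) \<in> Ob B"
        using ab by (simp_all add: B.Dom_Ob B.Cod_Ob)
      note e1 = e[OF o(1)] and e2 = e[OF o(2)]
      note ga = gc[OF ab(1)] and gb = gc[OF ab(2), unfolded d]
      have sg: "Src A (gc \<beta>) = Trg A (gc \<alpha>)" using src ab by simp
      have c: "\<beta> \<diamondop>\<^bsub>B\<^esub> \<alpha> \<in> Ce B" using ab by simp
      have d3: "Src B (\<beta> \<diamondop>\<^bsub>B\<^esub> \<alpha>) = Src B \<alpha>" using ab by simp
      note gab = gc[OF c, unfolded d3]
      have fa: "fce F (gc \<alpha>) \<in> Ce B" "Cod B (Src B (fce F (gc \<alpha>))) = fob F (U (Cod B (Src B \<alpha>)))"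
        using ga F(2-6) by simp_all
      have fb: "fce F (gc \<beta>) \<in> Ce B" "Src B (fce F (gc \<beta>)) = Trg B (fce F (gc \<alpha>))"
        using gb ga ab F(2-7) sg by simp_all
      have "Id2 B (e (Cod B (Src B \<alpha>))) \<star>\<^bsub>B\<^esub> fce F (gc \<beta> \<diamondop>\<^bsub>A\<^esub> gc \<alpha>) =
         (Id2 B (e (Cod B (Src B \<alpha>))) \<star>\<^bsub>B\<^esub> fce F (gc \<beta>)) \<diamondop>\<^bsub>B\<^esub> (Id2 B (e (Cod B (Src B \<alpha>))) \<star>\<^bsub>B\<^esub> fce F (gc \<alpha>))"
        using F(11)[of "gc \<alpha>" "gc \<beta>"] ga(1) gb(1) sg fa fb e2
          B.whisker_vcomp(1)[of "fce F (gc \<alpha>)" "fce F (gc \<beta>)" "e (Cod B (Src B \<alpha>))"] by simp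
      also have "\<dots> = (\<beta> \<diamondop>\<^bsub>B\<^esub> \<alpha>) \<star>\<^bsub>B\<^esub> Id2 B (e (Dom B (Src B \<alpha>)))"
        using ga(4) gb(4) ab e1 B.whisker_vcomp(2)[of \<alpha> \<beta> "e (Dom B (Src B \<alpha>))"] by simp
      finally have "Id2 B (e (Cod B (Src B \<alpha>))) \<star>\<^bsub>B\<^esub> fce F (gc (\<beta> \<diamondop>\<^bsub>B\<^esub> \<alpha>)) =
          Id2 B (e (Cod B (Src B \<alpha>))) \<star>\<^bsub>B\<^esub> fce F (gc \<beta> \<diamondop>\<^bsub>A\<^esub> gc \<alpha>)"
        using gab(4) by simp
      then have "gc (\<beta> \<diamondop>\<^bsub>B\<^esub> \<alpha>) = gc \<beta> \<diamondop>\<^bsub>A\<^esub> gc \<alpha>"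
        by (rule uni[OF o(2), rotated 5]) (use gab(1-3) ga(1-3) gb(1-3) sg in simp_all)
      then show ?thesis using ab by simp
    qed
  qed
  define \<eta>2 where "\<eta>2 X = tr X (fob F X) (Id2 B (Idn B (fob F X)))" for X
  define \<eta> where "\<eta> X = Src A (\<eta>2 X)" for X
  have e2: "\<eta>2 X \<in> Ce A" "Dom A (Src A (\<eta>2 X)) = X" "Cod A (Src A (\<eta>2 X)) = U (fob F X)"
      "Id2 B (e (fob F X)) \<star>\<^bsub>B\<^esub> fce F (\<eta>2 X) = Id2 B (Idn B (fob F X))" if X: "X \<in> Ob A" for X
    using tr[of X "fob F X" "Id2 B (Idn B (fob F X))"] X F(1) unfolding \<eta>2_def by (auto simp: hom_def)
  have eta: "\<eta> X \<in> Ar A" "Dom A (\<eta> X) = X" "Cod A (\<eta> X) = U (fob F X)"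
      "e (fob F X) \<cdot>\<^bsub>B\<^esub> far F (\<eta> X) = Idn B (fob F X)" if X: "X \<in> Ob A" for X
    using e2(1-3)[OF X] arg_cong[OF e2(4)[OF X], of "Src B"] X F e[OF F(1)[OF X]] unfolding \<eta>_def by simp_all
  have "right_two_adjoint A B F G"
    unfolding right_two_adjoint_def
  proof (intro conjI exI[of _ \<eta>] exI[of _ e] ballI)
    show "two_functor A B F" "two_functor B A G" by fact+
    show "e (fob F X) \<cdot>\<^bsub>B\<^esub> far F (\<eta> X) = Idn B (fob F X)" if "X \<in> Ob A" for X using eta that by simp
    show "far G (e Y) \<cdot>\<^bsub>A\<^esub> \<eta> (fob G Y) = Idn A (fob G Y)" if Y: "Y \<in> Ob B" for Y
    proof -
      note eY = e[OF Y] and et = eta[OF UO[OF Y]]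
      note g = gc[of "Id2 B (e Y)"] and ge = ga[OF eY(1)]
      have FU: "fob F (U Y) \<in> Ob B" using UO[OF Y] F by simp
      note eF = e[OF FU]
      have fg: "far F (ga (e Y)) \<in> Ar B" "Dom B (far F (ga (e Y))) = fob F (U (fob F (U Y)))" "Cod B (far F (ga (e Y))) = fob F (U Y)"
        using ge eY F by simp_all
      have fe: "far F (\<eta> (U Y)) \<in> Ar B" "Dom B (far F (\<eta> (U Y))) = fob F (U Y)" "Cod B (far F (\<eta> (U Y))) = fob F (U (fob F (U Y)))"
        using et F by simp_all
      have "Id2 B (e Y) \<star>\<^bsub>B\<^esub> Id2 B (far F (ga (e Y))) = Id2 B (e Y) \<star>\<^bsub>B\<^esub> Id2 B (e (fob F (U Y)))"
        using g(4) eY ge F(8)[of "ga (e Y)"] by simp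
      then have "Id2 B (e Y \<cdot>\<^bsub>B\<^esub> far F (ga (e Y))) = Id2 B (e Y \<cdot>\<^bsub>B\<^esub> e (fob F (U Y)))"
        using eY fg eF by simp
      then have s: "e Y \<cdot>\<^bsub>B\<^esub> far F (ga (e Y)) = e Y \<cdot>\<^bsub>B\<^esub> e (fob F (U Y))"
        by (rule B.id2_inj) (use eY fg eF in simp_all)
      have "e Y \<cdot>\<^bsub>B\<^esub> far F (ga (e Y) \<cdot>\<^bsub>A\<^esub> \<eta> (U Y)) = (e Y \<cdot>\<^bsub>B\<^esub> far F (ga (e Y))) \<cdot>\<^bsub>B\<^esub> far F (\<eta> (U Y))"
        using F(12)[of "\<eta> (U Y)" "ga (e Y)"] ge et eY fg fe by (simp add: B.comp_assoc)
      also have "\<dots> = e Y \<cdot>\<^bsub>B\<^esub> (e (fob F (U Y)) \<cdot>\<^bsub>B\<^esub> far F (\<eta> (U Y)))"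
        using s eY eF fe by (simp add: B.comp_assoc)
      also have "\<dots> = e Y \<cdot>\<^bsub>B\<^esub> far F (Idn A (U Y))"
        using et(4) F(9)[OF UO[OF Y]] by simp
      finally have k: "e Y \<cdot>\<^bsub>B\<^esub> far F (ga (e Y) \<cdot>\<^bsub>A\<^esub> \<eta> (U Y)) = e Y \<cdot>\<^bsub>B\<^esub> far F (Idn A (U Y))" .
      have "Id2 A (ga (e Y) \<cdot>\<^bsub>A\<^esub> \<eta> (U Y)) = Id2 A (Idn A (U Y))"
      proof (rule uni[OF Y])
        show "Id2 B (e Y) \<star>\<^bsub>B\<^esub> fce F (Id2 A (ga (e Y) \<cdot>\<^bsub>A\<^esub> \<eta> (U Y))) = Id2 B (e Y) \<star>\<^bsub>B\<^esub> fce F (Id2 A (Idn A (U Y)))"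
          using k eY ge et UO[OF Y] F(2,3,4,8) by simp
      qed (use ge et eY UO[OF Y] in simp_all)
      then have "ga (e Y) \<cdot>\<^bsub>A\<^esub> \<eta> (U Y) = Idn A (U Y)"
        by (rule A.id2_inj) (use ge et eY UO[OF Y] in simp_all)
      then show ?thesis using Y eY by simp
    qed
    \<comment> \<open>naturality on arrows is naturality on their identity 2-cells\<close>
    have nat1: "gc (fce F \<alpha>) \<star>\<^bsub>A\<^esub> Id2 A (\<eta> X) = Id2 A (\<eta> Y) \<star>\<^bsub>A\<^esub> \<alpha>"
      if XY: "X \<in> Ob A" "Y \<in> Ob A" "\<alpha> \<in> cells A X Y" for X Y \<alpha>
    proof -
      have a: "\<alpha> \<in> Ce A" "Dom A (Src A \<alpha>) = X" "Cod A (Src A \<alpha>) = Y" using XY by (auto simp: hom_def)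
      have FX: "fob F X \<in> Ob B" "fob F Y \<in> Ob B" using XY F by simp_all
      note eX = eta[OF XY(1)] and eY = eta[OF XY(2)] and uX = e[OF FX(1)] and uY = e[OF FX(2)]
      have fa: "fce F \<alpha> \<in> Ce B" "Dom B (Src B (fce F \<alpha>)) = fob F X" "Cod B (Src B (fce F \<alpha>)) = fob F Y"
        using a F(2-6) by simp_all
      note g = gc[OF fa(1), unfolded fa(2,3)]
      have fg: "fce F (gc (fce F \<alpha>)) \<in> Ce B" "Dom B (Src B (fce F (gc (fce F \<alpha>)))) = fob F (U (fob F X))"
        "Cod B (Src B (fce F (gc (fce F \<alpha>)))) = fob F (U (fob F Y))"
        using g F(2-6) by simp_all
      have fX: "far F (\<eta> X) \<in> Ar B" "Dom B (far F (\<eta> X)) = fob F X" "Cod B (far F (\<eta> X)) = fob F (U (fob F X))"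
        "far F (\<eta> Y) \<in> Ar B" "Dom B (far F (\<eta> Y)) = fob F Y" "Cod B (far F (\<eta> Y)) = fob F (U (fob F Y))"
        using eX eY F by simp_all
      have "Id2 B (e (fob F Y)) \<star>\<^bsub>B\<^esub> fce F (gc (fce F \<alpha>) \<star>\<^bsub>A\<^esub> Id2 A (\<eta> X)) =
          Id2 B (e (fob F Y)) \<star>\<^bsub>B\<^esub> (fce F (gc (fce F \<alpha>)) \<star>\<^bsub>B\<^esub> Id2 B (far F (\<eta> X)))"
        using F(10)[of "Id2 A (\<eta> X)" "gc (fce F \<alpha>)"] F(8)[of "\<eta> X"] g(1-3) eX by simp
      also have "\<dots> = (Id2 B (e (fob F Y)) \<star>\<^bsub>B\<^esub> fce F (gc (fce F \<alpha>))) \<star>\<^bsub>B\<^esub> Id2 B (far F (\<eta> X))"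
        using uY fg fX by (simp add: B.hcomp_assoc)
      also have "\<dots> = (fce F \<alpha> \<star>\<^bsub>B\<^esub> Id2 B (e (fob F X))) \<star>\<^bsub>B\<^esub> Id2 B (far F (\<eta> X))"
        using g(4) by simp
      also have "\<dots> = fce F \<alpha> \<star>\<^bsub>B\<^esub> Id2 B (e (fob F X) \<cdot>\<^bsub>B\<^esub> far F (\<eta> X))"
        using fa uX fX by (simp add: B.hcomp_assoc)
      also have "\<dots> = fce F \<alpha>" using eX(4) fa by simp
      also have "\<dots> = Id2 B (e (fob F Y) \<cdot>\<^bsub>B\<^esub> far F (\<eta> Y)) \<star>\<^bsub>B\<^esub> fce F \<alpha>" using eY(4) fa by simp
      also have "\<dots> = Id2 B (e (fob F Y)) \<star>\<^bsub>B\<^esub> (Id2 B (far F (\<eta> Y)) \<star>\<^bsub>B\<^esub> fce F \<alpha>)"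
        using B.hcomp_assoc[of "fce F \<alpha>" "Id2 B (far F (\<eta> Y))" "Id2 B (e (fob F Y))"] fa uY fX by simp
      also have "\<dots> = Id2 B (e (fob F Y)) \<star>\<^bsub>B\<^esub> fce F (Id2 A (\<eta> Y) \<star>\<^bsub>A\<^esub> \<alpha>)"
        using F(10)[of \<alpha> "Id2 A (\<eta> Y)"] F(8)[of "\<eta> Y"] a eY by simp
      finally show ?thesis
        by (rule uni[OF FX(2), rotated 5]) (use g(1-3) eX eY a in simp_all)
    qed
    show "two_natural A A (fun_id A) (fun_comp A G F) \<eta>"
      unfolding two_natural_def
    proof (intro conjI ballI)
      fix X assume X: "X \<in> Ob A"
      then show "\<eta> X \<in> hom A (fob (fun_id A) X) (fob (fun_comp A G F) X)"
        using eta[OF X] F(1) by (simp add: hom_def fun_id_def fun_comp_def compose_def)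
      fix Y assume Y: "Y \<in> Ob A"
      show "fce (fun_comp A G F) \<alpha> \<star>\<^bsub>A\<^esub> Id2 A (\<eta> X) = Id2 A (\<eta> Y) \<star>\<^bsub>A\<^esub> fce (fun_id A) \<alpha>"
        if "\<alpha> \<in> cells A X Y" for \<alpha>
        using nat1[OF X Y that] that F(5) by (simp add: fun_id_def fun_comp_def compose_def hom_def)
      fix f assume "f \<in> hom A X Y"
      then have f: "f \<in> Ar A" "Dom A f = X" "Cod A f = Y" by (auto simp: hom_def)
      then have "gc (Id2 B (far F f)) \<star>\<^bsub>A\<^esub> Id2 A (\<eta> X) = Id2 A (\<eta> Y) \<star>\<^bsub>A\<^esub> Id2 A f"
        using nat1[OF X Y, of "Id2 A f"] F(8) by (simp add: hom_def)
      then have "Id2 A (ga (far F f) \<cdot>\<^bsub>A\<^esub> \<eta> X) = Id2 A (\<eta> Y \<cdot>\<^bsub>A\<^esub> f)"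
        using f F ga[of "far F f"] eta[OF X] eta[OF Y] by simp
      then have "ga (far F f) \<cdot>\<^bsub>A\<^esub> \<eta> X = \<eta> Y \<cdot>\<^bsub>A\<^esub> f"
        by (rule A.id2_inj) (use f F ga[of "far F f"] eta[OF X] eta[OF Y] in simp_all)
      then show "far (fun_comp A G F) f \<cdot>\<^bsub>A\<^esub> \<eta> X = \<eta> Y \<cdot>\<^bsub>A\<^esub> far (fun_id A) f"
        using f F by (simp add: fun_id_def fun_comp_def compose_def)
    qed
    show "two_natural B B (fun_comp B F G) (fun_id B) e"
      unfolding two_natural_def
    proof (intro conjI ballI)
      fix X assume X: "X \<in> Ob B"
      then show "e X \<in> hom B (fob (fun_comp B F G) X) (fob (fun_id B) X)"
        using e[OF X] by (simp add: hom_def fun_id_def fun_comp_def compose_def)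
      fix Y assume Y: "Y \<in> Ob B"
      show "fce (fun_id B) \<alpha> \<star>\<^bsub>B\<^esub> Id2 B (e X) = Id2 B (e Y) \<star>\<^bsub>B\<^esub> fce (fun_comp B F G) \<alpha>"
        if "\<alpha> \<in> cells B X Y" for \<alpha>
        using gc(4)[of \<alpha>] that by (simp add: fun_id_def fun_comp_def compose_def hom_def)
      fix f assume "f \<in> hom B X Y"
      then have f: "f \<in> Ar B" "Dom B f = X" "Cod B f = Y" by (auto simp: hom_def)
      then have "Id2 B (f \<cdot>\<^bsub>B\<^esub> e X) = Id2 B (e Y \<cdot>\<^bsub>B\<^esub> far F (ga f))"
        using gc(4)[of "Id2 B f"] ga[OF f(1)] e[OF X] e[OF Y] F by simp
      then have "f \<cdot>\<^bsub>B\<^esub> e X = e Y \<cdot>\<^bsub>B\<^esub> far F (ga f)"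
        by (rule B.id2_inj) (use f ga[OF f(1)] e[OF X] e[OF Y] F in simp_all)
      then show "far (fun_id B) f \<cdot>\<^bsub>B\<^esub> e X = e Y \<cdot>\<^bsub>B\<^esub> far (fun_comp B F G) f"
        using f by (simp add: fun_id_def fun_comp_def compose_def)
    qed
  qed
  then show ?thesis by blast
qed

section \<open>Slices and pullback 2-functors\<close>

lemma slice_simps [simp]:
  "Ob (slice K X) = {a \<in> Ar K. Cod K a = X}"
  "Dom (slice K X) (a, b, h) = a" "Cod (slice K X) (a, b, h) = b"
  "Idn (slice K X) a = (a, a, Idn K (Dom K a))"
  "Comp (slice K X) (b', c, h') (a, b, h) = (a, c, h' \<cdot>\<^bsub>K\<^esub> h)"
  "Src (slice K X) (a, b, \<gamma>) = (a, b, Src K \<gamma>)" "Trg (slice K X) (a, b, \<gamma>) = (a, b, Trg K \<gamma>)"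
  "Id2 (slice K X) (a, b, h) = (a, b, Id2 K h)"
  "VComp (slice K X) (a', b', \<gamma>') (a, b, \<gamma>) = (a, b, \<gamma>' \<diamondop>\<^bsub>K\<^esub> \<gamma>)"
  "HComp (slice K X) (b', c, \<gamma>') (a, b, \<gamma>) = (a, c, \<gamma>' \<star>\<^bsub>K\<^esub> \<gamma>)"
  by (simp_all add: slice_def Let_def)

context two_category begin

lemma slice_Ar:
  "(a, b, h) \<in> Ar (slice K X) \<longleftrightarrow> a \<in> Ar K \<and> b \<in> Ar K \<and> Cod K a = X \<and> Cod K b = X \<and>
     h \<in> Ar K \<and> Dom K h = Dom K a \<and> Cod K h = Dom K b \<and> b \<cdot> h = a"
  by (auto simp: slice_def Let_def hom_def)

lemma slice_Ce:
  "(a, b, \<gamma>) \<in> Ce (slice K X) \<longleftrightarrow> a \<in> Ar K \<and> b \<in> Ar K \<and> Cod K a = X \<and> Cod K b = X \<and>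
     \<gamma> \<in> Ce K \<and> Dom K (Src K \<gamma>) = Dom K a \<and> Cod K (Src K \<gamma>) = Dom K b \<and> Id2 K b \<star> \<gamma> = Id2 K a"
    (is "?L \<longleftrightarrow> ?R")
proof
  assume ?L then show ?R by (auto simp: slice_def Let_def hom_def)
next
  assume r: ?R
  have "Src K (Id2 K b \<star> \<gamma>) = a" "Trg K (Id2 K b \<star> \<gamma>) = a"
    using r by (simp_all del: hcomp_cell)
  then have "b \<cdot> Src K \<gamma> = a" "b \<cdot> Trg K \<gamma> = a"
    using hcomp_cell(2,3)[of \<gamma> "Id2 K b"] r by (simp_all del: hcomp_cell)
  then show ?L using r by (simp add: slice_def Let_def hom_def)
qed

lemma slice_two_category: "two_category (slice K X)"
proof -
  have 1: "category (slice K X)"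
  proof
    fix f assume "f \<in> Ar (slice K X)"
    then show "Dom (slice K X) f \<in> Ob (slice K X)" "Cod (slice K X) f \<in> Ob (slice K X)"
      by (cases f; simp add: slice_Ar)+
  next
    fix a assume "a \<in> Ob (slice K X)"
    then show "Idn (slice K X) a \<in> hom (slice K X) a a"
      by (simp add: hom_def slice_Ar Dom_Ob)
  next
    fix f g a b c assume "f \<in> hom (slice K X) a b" "g \<in> hom (slice K X) b c"
    then show "g \<cdot>\<^bsub>slice K X\<^esub> f \<in> hom (slice K X) a c"
      by (cases f, cases g) (auto simp: hom_def slice_Ar comp_assoc[symmetric])
  next
    fix f a b assume "f \<in> hom (slice K X) a b"
    then show "f \<cdot>\<^bsub>slice K X\<^esub> Idn (slice K X) a = f" "Idn (slice K X) b \<cdot>\<^bsub>slice K X\<^esub> f = f"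
      by (cases f; auto simp: hom_def slice_Ar)+
  next
    fix f g h a b c d assume "f \<in> hom (slice K X) a b" "g \<in> hom (slice K X) b c" "h \<in> hom (slice K X) c d"
    then show "(h \<cdot>\<^bsub>slice K X\<^esub> g) \<cdot>\<^bsub>slice K X\<^esub> f = h \<cdot>\<^bsub>slice K X\<^esub> (g \<cdot>\<^bsub>slice K X\<^esub> f)"
      by (cases f, cases g, cases h) (auto simp: hom_def slice_Ar comp_assoc)
  qed
  have st: "b \<cdot> Src K \<gamma> = a" "b \<cdot> Trg K \<gamma> = a" if "(a, b, \<gamma>) \<in> Ce (slice K X)" for a b \<gamma>
    using that by (auto simp: slice_def Let_def)
  have 2: "category (vcat (slice K X))"
  proof
    fix f assume "f \<in> Ar (vcat (slice K X))"
    then show "Dom (vcat (slice K X)) f \<in> Ob (vcat (slice K X))" "Cod (vcat (slice K X)) f \<in> Ob (vcat (slice K X))"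
      using st by (cases f; simp add: slice_Ar slice_Ce)+
  next
    fix a assume "a \<in> Ob (vcat (slice K X))"
    then show "Idn (vcat (slice K X)) a \<in> hom (vcat (slice K X)) a a"
      by (cases a) (auto simp: hom_def slice_Ar slice_Ce)
  next
    fix f g a b c assume "f \<in> hom (vcat (slice K X)) a b" "g \<in> hom (vcat (slice K X)) b c"
    then show "g \<cdot>\<^bsub>vcat (slice K X)\<^esub> f \<in> hom (vcat (slice K X)) a c"
      by (cases f, cases g) (auto simp: hom_def slice_Ar slice_Ce whisker_vcomp)
  next
    fix f a b assume "f \<in> hom (vcat (slice K X)) a b"
    then show "f \<cdot>\<^bsub>vcat (slice K X)\<^esub> Idn (vcat (slice K X)) a = f"
      "Idn (vcat (slice K X)) b \<cdot>\<^bsub>vcat (slice K X)\<^esub> f = f"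
      by (cases f; auto simp: hom_def slice_Ce)+
  next
    fix f g h a b c d assume "f \<in> hom (vcat (slice K X)) a b" "g \<in> hom (vcat (slice K X)) b c" "h \<in> hom (vcat (slice K X)) c d"
    then show "(h \<cdot>\<^bsub>vcat (slice K X)\<^esub> g) \<cdot>\<^bsub>vcat (slice K X)\<^esub> f = h \<cdot>\<^bsub>vcat (slice K X)\<^esub> (g \<cdot>\<^bsub>vcat (slice K X)\<^esub> f)"
      using vertical.comp_assoc
      by (cases f, cases g, cases h) (auto simp: hom_def slice_Ce)
  qed
  have 3: "category (hcat (slice K X))"
  proof
    fix f assume "f \<in> Ar (hcat (slice K X))"
    then show "Dom (hcat (slice K X)) f \<in> Ob (hcat (slice K X))" "Cod (hcat (slice K X)) f \<in> Ob (hcat (slice K X))"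
      by (cases f; simp add: slice_Ce)+
  next
    fix a assume "a \<in> Ob (hcat (slice K X))"
    then show "Idn (hcat (slice K X)) a \<in> hom (hcat (slice K X)) a a"
      by (auto simp: hom_def slice_Ce Dom_Ob)
  next
    fix f g a b c assume "f \<in> hom (hcat (slice K X)) a b" "g \<in> hom (hcat (slice K X)) b c"
    then show "g \<cdot>\<^bsub>hcat (slice K X)\<^esub> f \<in> hom (hcat (slice K X)) a c"
      by (cases f, cases g) (auto simp: hom_def slice_Ce hcomp_assoc[symmetric])
  next
    fix f a b assume "f \<in> hom (hcat (slice K X)) a b"
    then show "f \<cdot>\<^bsub>hcat (slice K X)\<^esub> Idn (hcat (slice K X)) a = f"
      "Idn (hcat (slice K X)) b \<cdot>\<^bsub>hcat (slice K X)\<^esub> f = f"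
      by (cases f; auto simp: hom_def slice_Ce)+
  next
    fix f g h a b c d assume "f \<in> hom (hcat (slice K X)) a b" "g \<in> hom (hcat (slice K X)) b c" "h \<in> hom (hcat (slice K X)) c d"
    then show "(h \<cdot>\<^bsub>hcat (slice K X)\<^esub> g) \<cdot>\<^bsub>hcat (slice K X)\<^esub> f = h \<cdot>\<^bsub>hcat (slice K X)\<^esub> (g \<cdot>\<^bsub>hcat (slice K X)\<^esub> f)"
      by (cases f, cases g, cases h) (auto simp: hom_def slice_Ce hcomp_assoc)
  qed
  show ?thesis
  proof (intro two_category.intro 1 2 3 two_category_axioms.intro)
    fix \<alpha> assume "\<alpha> \<in> Ce (slice K X)"
    then show "Dom (slice K X) (Trg (slice K X) \<alpha>) = Dom (slice K X) (Src (slice K X) \<alpha>) \<and>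
        Cod (slice K X) (Trg (slice K X) \<alpha>) = Cod (slice K X) (Src (slice K X) \<alpha>)"
      by (cases \<alpha>) simp
  next
    fix \<alpha> \<beta> a b c assume "\<alpha> \<in> cells (slice K X) a b" "\<beta> \<in> cells (slice K X) b c"
    then show "Src (slice K X) (\<beta> \<star>\<^bsub>slice K X\<^esub> \<alpha>) = Src (slice K X) \<beta> \<cdot>\<^bsub>slice K X\<^esub> Src (slice K X) \<alpha>"
      "Trg (slice K X) (\<beta> \<star>\<^bsub>slice K X\<^esub> \<alpha>) = Trg (slice K X) \<beta> \<cdot>\<^bsub>slice K X\<^esub> Trg (slice K X) \<alpha>"
      by (cases \<alpha>; cases \<beta>; auto simp: hom_def slice_Ce)+
  next
    fix f g a b c assume "f \<in> hom (slice K X) a b" "g \<in> hom (slice K X) b c"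
    then show "Id2 (slice K X) g \<star>\<^bsub>slice K X\<^esub> Id2 (slice K X) f = Id2 (slice K X) (g \<cdot>\<^bsub>slice K X\<^esub> f)"
      by (cases f; cases g; auto simp: hom_def slice_Ar)
  next
    fix \<alpha> \<alpha>' \<beta> \<beta>' a b c
    assume h: "\<alpha> \<in> cells (slice K X) a b" "\<alpha>' \<in> cells (slice K X) a b" "\<beta> \<in> cells (slice K X) b c" "\<beta>' \<in> cells (slice K X) b c"
      "Trg (slice K X) \<alpha> = Src (slice K X) \<alpha>'" "Trg (slice K X) \<beta> = Src (slice K X) \<beta>'"
    obtain x x' y y' where e: "\<alpha> = (a, b, x)" "\<alpha>' = (a, b, x')" "\<beta> = (b, c, y)" "\<beta>' = (b, c, y')"
      using h by (cases \<alpha>, cases \<alpha>', cases \<beta>, cases \<beta>') (auto simp: hom_def)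
    have "(y' \<diamondop> y) \<star> (x' \<diamondop> x) = (y' \<star> x') \<diamondop> (y \<star> x)"
      by (rule interchange[where X = "Dom K a" and Y = "Dom K b" and Z = "Dom K c"])
        (use h in \<open>auto simp: e hom_def slice_Ce\<close>)
    then show "(\<beta>' \<diamondop>\<^bsub>slice K X\<^esub> \<beta>) \<star>\<^bsub>slice K X\<^esub> (\<alpha>' \<diamondop>\<^bsub>slice K X\<^esub> \<alpha>) =
        (\<beta>' \<star>\<^bsub>slice K X\<^esub> \<alpha>') \<diamondop>\<^bsub>slice K X\<^esub> (\<beta> \<star>\<^bsub>slice K X\<^esub> \<alpha>)"
      by (simp add: e)
  qed
qed

text \<open>Passing to the identity of the target is a functor as well as passing to that of the source. Equations
  between 2-cells therefore determine equations between their targets.\<close>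

definition ttrg :: "'c option \<Rightarrow> 'c option" where
  "ttrg x = (case x of Some \<alpha> \<Rightarrow> if \<alpha> \<in> Ce K then Some (Id2 K (Trg K \<alpha>)) else None | None \<Rightarrow> None)"

lemma ttrg_comp: "ttrg (g \<bullet> f) = ttrg g \<bullet> ttrg f"
  by (auto simp: tcomp_def ttrg_def split: option.splits)

lemma ttrg_simps [simp]: "ttrg (j f) = j f" "\<alpha> \<in> Ce K \<Longrightarrow> ttrg (Some \<alpha>) = j (Trg K \<alpha>)"
    "ttight (j f) = j f" "\<alpha> \<in> Ce K \<Longrightarrow> ttight (Some \<alpha>) = j (Src K \<alpha>)"
  by (auto simp: j_def ttrg_def ttight_def)

lemma j_whisker_cod: "tarr (j f \<bullet> Some \<gamma>) \<Longrightarrow> Cod K (Src K \<gamma>) = Dom K f"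
  by (erule j_whiskerE) simp

lemma slice_Ce_T:
  "(a, b, \<gamma>) \<in> Ce (slice K X) \<longleftrightarrow> a \<in> Ar K \<and> b \<in> Ar K \<and> Cod K a = X \<and> Cod K b = X \<and>
     \<gamma> \<in> Ce K \<and> j b \<bullet> Some \<gamma> = j a" (is "?L \<longleftrightarrow> ?R")
proof
  assume ?L then show ?R by (auto simp: slice_Ce j_Some Some_comp)
next
  assume r: ?R
  then have t: "tarr (j b \<bullet> Some \<gamma>)" by simp
  then have "Dom K b = Cod K (Src K \<gamma>)" using j_whisker_cod[OF t] by simp
  moreover have "Dom K (Src K \<gamma>) = Dom K a" using T.dm_comp[OF t] r by simp
  ultimately show ?L using r by (auto simp: slice_Ce j_Some Some_comp)
qed

lemma slice_Ar_T:
  "(a, b, h) \<in> Ar (slice K X) \<longleftrightarrow> a \<in> Ar K \<and> b \<in> Ar K \<and> Cod K a = X \<and> Cod K b = X \<and>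
     h \<in> Ar K \<and> j b \<bullet> j h = j a" (is "?L \<longleftrightarrow> ?R")
proof
  assume ?L then show ?R by (auto simp: slice_Ar j_comp[symmetric])
next
  assume r: ?R
  then have e: "b \<cdot> h = a" "Dom K b = Cod K h" using j_comp_eq[of b h a] by auto
  then have "Dom K h = Dom K a" using comp_arr(2)[of h b] r by simp
  then show ?L using r e by (auto simp: slice_Ar)
qed

lemma is_pullback_arrow:
  assumes "is_pullback K f g a b" "X \<in> Ob K" "x \<in> hom K X (Dom K f)" "y \<in> hom K X (Dom K g)" "f \<cdot> x = g \<cdot> y"
  shows "\<exists>!h. h \<in> hom K X (Dom K a) \<and> a \<cdot> h = x \<and> b \<cdot> h = y"
  using assms by (simp add: is_pullback_def)

lemma is_pullback_cell:
  assumes "is_pullback K f g a b" "X \<in> Ob K" "x \<in> cells K X (Dom K f)" "y \<in> cells K X (Dom K g)"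
    "Id2 K f \<star> x = Id2 K g \<star> y"
  shows "\<exists>!h. h \<in> cells K X (Dom K a) \<and> Id2 K a \<star> h = x \<and> Id2 K b \<star> h = y"
  using assms by (simp add: is_pullback_def)

lemma pb_lift:
  assumes P: "T.pbk (j f) (j g) (j a) (j b)" and xy: "x \<in> Ar K" "y \<in> Ar K" "j f \<bullet> j x = j g \<bullet> j y" "tarr (j f \<bullet> j x)"
  shows "pb_lift K a b x y \<in> Ar K" "j a \<bullet> j (pb_lift K a b x y) = j x" "j b \<bullet> j (pb_lift K a b x y) = j y"
proof -
  note t = T.pbk_types[OF P, simplified]
  have d: "Cod K x = Dom K f" "Cod K y = Dom K g" "Dom K x = Dom K y"
  proof -
    have 2: "tarr (j g \<bullet> j y)" using xy by simp
    show "Cod K x = Dom K f" "Cod K y = Dom K g" using xy(1,2,4) 2 t by (auto simp: tarr_tcomp)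
    show "Dom K x = Dom K y" using T.dm_comp[OF 2] T.dm_comp[OF xy(4)] xy by simp
  qed
  have "j (f \<cdot> x) = j (g \<cdot> y)" using xy d t by (simp add: j_comp)
  then have e: "f \<cdot> x = g \<cdot> y" by (rule j_inj) (use xy d t in simp)
  have "is_pullback K f g a b" using P by (simp add: is_pullback_iff)
  moreover have "x \<in> hom K (Dom K x) (Dom K f)" "y \<in> hom K (Dom K x) (Dom K g)" "Dom K x \<in> Ob K"
    using xy d by (simp_all add: hom_def Dom_Ob)
  ultimately have "\<exists>!h. h \<in> hom K (Dom K x) (Dom K a) \<and> a \<cdot> h = x \<and> b \<cdot> h = y"
    using e by (intro is_pullback_arrow)
  from theI'[OF this] have h: "pb_lift K a b x y \<in> hom K (Dom K x) (Dom K a)" "a \<cdot> pb_lift K a b x y = x" "b \<cdot> pb_lift K a b x y = y"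
    unfolding pb_lift_def by blast+
  then show "pb_lift K a b x y \<in> Ar K" "j a \<bullet> j (pb_lift K a b x y) = j x" "j b \<bullet> j (pb_lift K a b x y) = j y"
    using t j_comp[of "pb_lift K a b x y" a] j_comp[of "pb_lift K a b x y" b] by (auto simp: hom_def)
qed

lemma pb_lift2:
  assumes P: "T.pbk (j f) (j g) (j a) (j b)" and xy: "x \<in> Ce K" "y \<in> Ce K" "j f \<bullet> Some x = j g \<bullet> Some y" "tarr (j f \<bullet> Some x)"
  shows "pb_lift2 K a b x y \<in> Ce K" "j a \<bullet> Some (pb_lift2 K a b x y) = Some x" "j b \<bullet> Some (pb_lift2 K a b x y) = Some y"
proof -
  note t = T.pbk_types[OF P, simplified]
  have d: "Cod K (Src K x) = Dom K f" "Cod K (Src K y) = Dom K g" "Dom K (Src K x) = Dom K (Src K y)"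
  proof -
    have 2: "tarr (j g \<bullet> Some y)" using xy by simp
    show "Cod K (Src K x) = Dom K f" "Cod K (Src K y) = Dom K g" using xy(1,2,4) 2 t by (auto simp: tarr_tcomp)
    show "Dom K (Src K x) = Dom K (Src K y)" using T.dm_comp[OF 2] T.dm_comp[OF xy(4)] xy by simp
  qed
  have e: "Id2 K f \<star> x = Id2 K g \<star> y" using xy d t by (simp add: whisker_eq)
  have "is_pullback K f g a b" using P by (simp add: is_pullback_iff)
  moreover have "x \<in> cells K (Dom K (Src K x)) (Dom K f)" "y \<in> cells K (Dom K (Src K x)) (Dom K g)" "Dom K (Src K x) \<in> Ob K"
    using xy d by (simp_all add: hom_def Dom_Ob)
  ultimately have "\<exists>!h. h \<in> cells K (Dom (hcat K) x) (Dom K a) \<and> Id2 K a \<star> h = x \<and> Id2 K b \<star> h = y"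
    using is_pullback_cell e by simp
  from theI'[OF this] have h: "pb_lift2 K a b x y \<in> cells K (Dom (hcat K) x) (Dom K a)"
      "Id2 K a \<star> pb_lift2 K a b x y = x" "Id2 K b \<star> pb_lift2 K a b x y = y"
    unfolding pb_lift2_def by blast+
  then show "pb_lift2 K a b x y \<in> Ce K" "j a \<bullet> Some (pb_lift2 K a b x y) = Some x" "j b \<bullet> Some (pb_lift2 K a b x y) = Some y"
    using t by (auto simp: hom_def whisker_eq1)
qed

end

locale chosen_pullbacks = two_category_with_pullbacks +
  fixes pb :: "'b \<Rightarrow> 'b \<Rightarrow> 'b \<times> 'b"
  assumes choice: "pullback_choice K pb"
begin

lemma chosen_pbk:
  assumes "f \<in> Ar K" "g \<in> Ar K" "Cod K f = Cod K g"
  shows "T.pbk (j f) (j g) (j (fst (pb f g))) (j (snd (pb f g)))"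
  using pullbacks[OF assms] choice unfolding pullback_choice_def is_pullback_iff by blast

context
  fixes f assumes f: "f \<in> Ar K"
begin

abbreviation (input) "P a \<equiv> fst (pb f a)"
abbreviation (input) "Q a \<equiv> snd (pb f a)"

lemma slice_pbk: "a \<in> Ar K \<Longrightarrow> Cod K a = Cod K f \<Longrightarrow> T.pbk (j f) (j a) (j (P a)) (j (Q a))"
  using chosen_pbk f by simp

lemma slice_pbk_types:
  assumes "a \<in> Ar K" "Cod K a = Cod K f"
  shows "P a \<in> Ar K" "Q a \<in> Ar K" "Cod K (P a) = Dom K f" "Cod K (Q a) = Dom K a" "Dom K (P a) = Dom K (Q a)"
proof -
  note T.pbk_types[OF slice_pbk[OF assms]]
  then show *: "P a \<in> Ar K" "Q a \<in> Ar K" by auto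
  then show "Cod K (P a) = Dom K f" "Cod K (Q a) = Dom K a" "Dom K (P a) = Dom K (Q a)"
    using T.pbk_types[OF slice_pbk[OF assms]] assms f by auto
qed

lemma pullback_functor_ob: "a \<in> Ar K \<Longrightarrow> Cod K a = Cod K f \<Longrightarrow> fob (pullback_functor K pb f) a = P a"
  by (simp add: pullback_functor_def Let_def)

lemma pullback_functor_ar:
  assumes h: "(a, b, h) \<in> Ar (slice K (Cod K f))"
  obtains l where "far (pullback_functor K pb f) (a, b, h) = (P a, P b, l)" "l \<in> Ar K"
    "j (P b) \<bullet> j l = j (P a)" "j (Q b) \<bullet> j l = j h \<bullet> j (Q a)"
proof -
  note h' = h[unfolded slice_Ar_T]
  let ?l = "pb_lift K (P b) (Q b) (P a) (h \<cdot> Q a)"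
  have hk: "h \<in> Ar K" "Dom K h = Dom K a" "a \<in> Ar K" "Cod K a = Cod K f"
    using h by (simp_all add: slice_Ar)
  note q = slice_pbk_types[OF hk(3,4)]
  have fa: "j (h \<cdot> Q a) = j h \<bullet> j (Q a)" "h \<cdot> Q a \<in> Ar K"
    using j_comp[of "Q a" h] hk q by simp_all
  have e: "j f \<bullet> j (P a) = j b \<bullet> j (h \<cdot> Q a)"
    using T.pbk_comm[OF slice_pbk[of a]] h' fa by (metis T.assoc)
  have r: "tarr (j f \<bullet> j (P a))" using T.pbk_arr[OF slice_pbk[of a]] h' by simp
  have "P a \<in> Ar K" using slice_pbk_types h' by simp
  note l = pb_lift[OF slice_pbk[of b] this fa(2) e r, unfolded fa]
  have "far (pullback_functor K pb f) (a, b, h) = (P a, P b, ?l)"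
    using h by (simp add: pullback_functor_def Let_def)
  with l h' that show ?thesis by blast
qed

lemma pullback_functor_ce:
  assumes h: "(a, b, \<gamma>) \<in> Ce (slice K (Cod K f))"
  obtains l where "fce (pullback_functor K pb f) (a, b, \<gamma>) = (P a, P b, l)" "l \<in> Ce K"
    "j (P b) \<bullet> Some l = j (P a)" "j (Q b) \<bullet> Some l = Some \<gamma> \<bullet> j (Q a)"
proof -
  note h' = h[unfolded slice_Ce_T]
  let ?l = "pb_lift2 K (P b) (Q b) (Id2 K (P a)) (\<gamma> \<star> Id2 K (Q a))"
  have q: "P a \<in> Ar K" "Q a \<in> Ar K" "Cod K (Q a) = Dom K a" using slice_pbk_types[of a] h' by auto
  have hk: "\<gamma> \<in> Ce K" "Dom K (Src K \<gamma>) = Dom K a"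
    using h by (simp_all add: slice_Ce)
  have fa: "Some (\<gamma> \<star> Id2 K (Q a)) = Some \<gamma> \<bullet> j (Q a)" "\<gamma> \<star> Id2 K (Q a) \<in> Ce K"
    using hk q by (simp_all add: j_Some Some_comp)
  have e: "j f \<bullet> Some (Id2 K (P a)) = j b \<bullet> Some (\<gamma> \<star> Id2 K (Q a))"
    using T.pbk_comm[OF slice_pbk[of a]] h' fa j_Some[OF q(1)] by (metis T.assoc)
  have r: "tarr (j f \<bullet> Some (Id2 K (P a)))"
    using T.pbk_arr[OF slice_pbk[of a]] h' j_Some[OF q(1)] by simp
  have "Id2 K (P a) \<in> Ce K" using q by simp
  note l = pb_lift2[OF slice_pbk[of b] this fa(2) e r, unfolded fa j_Some[OF q(1), symmetric]]
  have "fce (pullback_functor K pb f) (a, b, \<gamma>) = (P a, P b, ?l)"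
    using h by (simp add: pullback_functor_def Let_def)
  with l h' that show ?thesis by blast
qed

lemma slice_pbk_eq:
  assumes "a \<in> Ar K" "Cod K a = Cod K f" "j (P a) \<bullet> x = j w" "w \<in> Ar K" "j (P a) \<bullet> y = j w" "j (Q a) \<bullet> x = j (Q a) \<bullet> y"
  shows "x = y"
  using T.pbk_eq[OF slice_pbk[OF assms(1,2)], of x y] assms by (metis j_arr)

text \<open>The values on arrows and 2-cells are induced by pullbacks, so each equation can be checked after
  composition with the two projections.\<close>

lemma pullback_two_functor:
  "two_functor (slice K (Cod K f)) (slice K (Dom K f)) (pullback_functor K pb f)"
proof (rule two_functorI[OF slice_two_category slice_two_category])
  let ?F = "pullback_functor K pb f" and ?S = "slice K (Cod K f)" and ?S' = "slice K (Dom K f)"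
  interpret S: two_category ?S by (rule slice_two_category)
  show "fob ?F \<in> extensional (Ob ?S)" "far ?F \<in> extensional (Ar ?S)" "fce ?F \<in> extensional (Ce ?S)"
    by (simp_all add: pullback_functor_def Let_def)
  show "fob ?F X \<in> Ob ?S'" if "X \<in> Ob ?S" for X
    using that slice_pbk_types by (simp add: pullback_functor_ob)
  fix \<alpha> assume al: "\<alpha> \<in> Ce ?S"
  obtain a b x where \<alpha>: "\<alpha> = (a, b, x)" by (cases \<alpha>)
  note x = al[unfolded \<alpha> slice_Ce_T]
  obtain l where l: "fce ?F (a, b, x) = (P a, P b, l)" "l \<in> Ce K" "j (P b) \<bullet> Some l = j (P a)"
      "j (Q b) \<bullet> Some l = Some x \<bullet> j (Q a)"
    using pullback_functor_ce al \<alpha> by blast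
  show "fce ?F \<alpha> \<in> Ce ?S'"
    using l x slice_pbk_types by (simp add: \<alpha> slice_Ce_T)
  have sa: "(a, b, Src K x) \<in> Ar ?S" "(a, b, Trg K x) \<in> Ar ?S"
    using S.cell_arr(1,2)[OF al] by (simp_all add: \<alpha>)
  obtain s where s: "far ?F (a, b, Src K x) = (P a, P b, s)" "s \<in> Ar K" "j (P b) \<bullet> j s = j (P a)"
      "j (Q b) \<bullet> j s = j (Src K x) \<bullet> j (Q a)"
    using pullback_functor_ar[OF sa(1)] by blast
  obtain t where t: "far ?F (a, b, Trg K x) = (P a, P b, t)" "t \<in> Ar K" "j (P b) \<bullet> j t = j (P a)"
      "j (Q b) \<bullet> j t = j (Trg K x) \<bullet> j (Q a)"
    using pullback_functor_ar[OF sa(2)] by blast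
  have "j (P b) \<bullet> j (Src K l) = j (P a)" "j (Q b) \<bullet> j (Src K l) = j (Src K x) \<bullet> j (Q a)"
    using arg_cong[OF l(3), of ttight] arg_cong[OF l(4), of ttight] x l(2) by (simp_all add: T.tighten_comp)
  then have "j (Src K l) = j s"
    using s x slice_pbk_types(1)[of a] by (intro slice_pbk_eq[of b "j (Src K l)" "P a" "j s"]) auto
  then have "Src K l = s" using l(2) j_inj by simp
  then show "Src ?S' (fce ?F \<alpha>) = far ?F (Src ?S \<alpha>)" by (simp add: \<alpha> l s)
  have "j (P b) \<bullet> j (Trg K l) = j (P a)" "j (Q b) \<bullet> j (Trg K l) = j (Trg K x) \<bullet> j (Q a)"
    using arg_cong[OF l(3), of ttrg] arg_cong[OF l(4), of ttrg] x l(2) by (simp_all add: ttrg_comp)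
  then have "j (Trg K l) = j t"
    using t x slice_pbk_types(1)[of a] by (intro slice_pbk_eq[of b "j (Trg K l)" "P a" "j t"]) auto
  then have "Trg K l = t" using l(2) j_inj by simp
  then show "Trg ?S' (fce ?F \<alpha>) = far ?F (Trg ?S \<alpha>)" by (simp add: \<alpha> l t)
  fix \<beta> assume be: "\<beta> \<in> Ce ?S"
  show "fce ?F (\<beta> \<star>\<^bsub>?S\<^esub> \<alpha>) = fce ?F \<beta> \<star>\<^bsub>?S'\<^esub> fce ?F \<alpha>" if c: "Dom ?S (Src ?S \<beta>) = Cod ?S (Src ?S \<alpha>)"
  proof -
    obtain c y where \<beta>: "\<beta> = (b, c, y)" using c by (cases \<beta>) (simp add: \<alpha>)
    note y = be[unfolded \<beta> slice_Ce_T]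
    obtain m where m: "fce ?F (b, c, y) = (P b, P c, m)" "m \<in> Ce K" "j (P c) \<bullet> Some m = j (P b)"
        "j (Q c) \<bullet> Some m = Some y \<bullet> j (Q b)"
      using pullback_functor_ce be \<beta> by blast
    have yx: "(a, c, y \<star> x) \<in> Ce ?S" using S.hcomp_cell(1)[OF al be c] by (simp add: \<alpha> \<beta>)
    obtain n where n: "fce ?F (a, c, y \<star> x) = (P a, P c, n)" "n \<in> Ce K" "j (P c) \<bullet> Some n = j (P a)"
        "j (Q c) \<bullet> Some n = Some (y \<star> x) \<bullet> j (Q a)"
      using pullback_functor_ce[OF yx] by blast
    have d: "Dom K (Src K y) = Cod K (Src K x)" using al be by (simp add: \<alpha> \<beta> slice_Ce)
    have d2: "Dom K (Src K m) = Cod K (Src K l)"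
    proof -
      have t1: "tarr (j (P c) \<bullet> Some m)" "tarr (j (P b) \<bullet> Some l)" using m l x slice_pbk_types by simp_all
      have "Cod K (Src K l) = Dom K (P b)" using j_whisker_cod[OF t1(2)] by simp
      then show ?thesis using T.dm_comp[OF t1(1)] m x slice_pbk_types(1)[of b] by simp
    qed
    have yx': "Some (y \<star> x) = Some y \<bullet> Some x" "Some (m \<star> l) = Some m \<bullet> Some l"
      using x y l m d d2 by (simp_all add: Some_comp)
    have "Some n = Some m \<bullet> Some l"
    proof (rule slice_pbk_eq[of c "Some n" "P a"])
      show "j (P c) \<bullet> Some m \<bullet> Some l = j (P a)" using m l by (metis T.assoc)
      show "j (Q c) \<bullet> Some n = j (Q c) \<bullet> Some m \<bullet> Some l" using n m l yx' by (metis T.assoc)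
    qed (use n x y slice_pbk_types in auto)
    then have "n = m \<star> l" using yx'(2) by (metis option.inject)
    then show ?thesis by (simp add: \<alpha> \<beta> l m n)
  qed
  show "fce ?F (\<beta> \<diamondop>\<^bsub>?S\<^esub> \<alpha>) = fce ?F \<beta> \<diamondop>\<^bsub>?S'\<^esub> fce ?F \<alpha>" if c: "Src ?S \<beta> = Trg ?S \<alpha>"
  proof -
    obtain y where \<beta>: "\<beta> = (a, b, y)" "Src K y = Trg K x" using c by (cases \<beta>) (simp add: \<alpha>)
    note y = be[unfolded \<beta> slice_Ce_T]
    obtain m where m: "fce ?F (a, b, y) = (P a, P b, m)" "m \<in> Ce K" "j (P b) \<bullet> Some m = j (P a)"
        "j (Q b) \<bullet> Some m = Some y \<bullet> j (Q a)"
      using pullback_functor_ce be \<beta> by blast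
    have yx: "(a, b, y \<diamondop> x) \<in> Ce ?S" using S.vcomp_cell(1)[OF al be c] by (simp add: \<alpha> \<beta>)
    obtain n where n: "fce ?F (a, b, y \<diamondop> x) = (P a, P b, n)" "n \<in> Ce K" "j (P b) \<bullet> Some n = j (P a)"
        "j (Q b) \<bullet> Some n = Some (y \<diamondop> x) \<bullet> j (Q a)"
      using pullback_functor_ce[OF yx] by blast
    have o: "P a \<in> Ar K" "Q a \<in> Ar K" "P b \<in> Ar K" "Q b \<in> Ar K" "Cod K (Q a) = Dom K a" "Dom K (P b) = Dom K (Q b)"
      using x slice_pbk_types by auto
    have al': "(P a, P b, l) \<in> Ce ?S'" "(P a, P b, m) \<in> Ce ?S'"
      using x l m slice_pbk_types by (auto simp: slice_Ce_T)
    note al2 = al'[unfolded slice_Ce]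
    have "Src K m = Trg K l"
    proof -
      have "j (P b) \<bullet> j (Src K m) = j (P a)" "j (Q b) \<bullet> j (Src K m) = j (Src K y) \<bullet> j (Q a)"
        using arg_cong[OF m(3), of ttight] arg_cong[OF m(4), of ttight] y m(2) by (simp_all add: T.tighten_comp)
      then have "j (Src K m) = j t"
        using t \<beta> x slice_pbk_types(1)[of a] by (intro slice_pbk_eq[of b "j (Src K m)" "P a" "j t"]) auto
      then show ?thesis using \<open>Trg K l = t\<close> m(2) j_inj by simp
    qed
    then have ml: "m \<diamondop> l \<in> Ce K" "Cod K (Src K (m \<diamondop> l)) = Dom K (P b)" using l m al2 by simp_all
    have xx: "Dom K (Src K x) = Dom K a" "Dom K (Src K y) = Dom K a" using al be by (simp_all add: \<alpha> \<beta> slice_Ce)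
    have q: "Id2 K (Q b) \<star> l = x \<star> Id2 K (Q a)" "Id2 K (Q b) \<star> m = y \<star> Id2 K (Q a)"
      using l(4) m(4) o x y al2 xx by (simp_all add: j_Some Some_comp)
    have "Id2 K (P b) \<star> (m \<diamondop> l) = Id2 K (P a)"
      using whisker_vcomp(1)[of l m "P b"] al2 \<open>Src K m = Trg K l\<close> by simp
    moreover have "Id2 K (Q b) \<star> (m \<diamondop> l) = (y \<diamondop> x) \<star> Id2 K (Q a)"
      using whisker_vcomp(1)[of l m "Q b"] whisker_vcomp(2)[of x y "Q a"] al2 \<open>Src K m = Trg K l\<close> q o x y xx \<beta> by simp
    ultimately have "j (P b) \<bullet> Some (m \<diamondop> l) = j (P a)" "j (Q b) \<bullet> Some (m \<diamondop> l) = Some (y \<diamondop> x) \<bullet> j (Q a)"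
      using o ml x y xx \<beta> by (simp_all add: j_Some Some_comp)
    then have "Some n = Some (m \<diamondop> l)"
      using n o x by (intro slice_pbk_eq[of b "Some n" "P a" "Some (m \<diamondop> l)"]) auto
    then show ?thesis by (simp add: \<alpha> \<beta> l m n)
  qed
next
  let ?F = "pullback_functor K pb f" and ?S = "slice K (Cod K f)" and ?S' = "slice K (Dom K f)"
  interpret S: two_category ?S by (rule slice_two_category)
  fix h assume hh: "h \<in> Ar ?S"
  obtain a b k where h: "h = (a, b, k)" by (cases h)
  note k = hh[unfolded h slice_Ar_T]
  obtain l where l: "far ?F (a, b, k) = (P a, P b, l)" "l \<in> Ar K" "j (P b) \<bullet> j l = j (P a)"
      "j (Q b) \<bullet> j l = j k \<bullet> j (Q a)"
    using pullback_functor_ar hh h by blast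
  show "Dom ?S' (far ?F h) = fob ?F (Dom ?S h)" "Cod ?S' (far ?F h) = fob ?F (Cod ?S h)"
    using l k by (simp_all add: h pullback_functor_ob)
  have i: "(a, b, Id2 K k) \<in> Ce ?S" using S.id2_cell(1)[OF hh] by (simp add: h)
  obtain m where m: "fce ?F (a, b, Id2 K k) = (P a, P b, m)" "m \<in> Ce K" "j (P b) \<bullet> Some m = j (P a)"
      "j (Q b) \<bullet> Some m = Some (Id2 K k) \<bullet> j (Q a)"
    using pullback_functor_ce[OF i] by blast
  have "Some m = j l"
    using m l k slice_pbk_types(1)[of a] by (intro slice_pbk_eq[of b "Some m" "P a" "j l"]) (auto simp: j_Some)
  then show "fce ?F (Id2 ?S h) = Id2 ?S' (far ?F h)" using l by (simp add: h l m j_Some)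
next
  let ?F = "pullback_functor K pb f" and ?S = "slice K (Cod K f)" and ?S' = "slice K (Dom K f)"
  interpret S: two_category ?S by (rule slice_two_category)
  fix a assume aa: "a \<in> Ob ?S"
  then have a: "a \<in> Ar K" "Cod K a = Cod K f" by auto
  have i: "(a, a, Idn K (Dom K a)) \<in> Ar ?S" using S.idn_arr(1)[OF aa] by simp
  obtain l where l: "far ?F (a, a, Idn K (Dom K a)) = (P a, P a, l)" "l \<in> Ar K" "j (P a) \<bullet> j l = j (P a)"
      "j (Q a) \<bullet> j l = j (Idn K (Dom K a)) \<bullet> j (Q a)"
    using pullback_functor_ar[OF i] by blast
  note o = slice_pbk_types[OF a]
  have "j (Idn K (Dom K a)) \<bullet> j (Q a) = j (Q a)" "j (P a) \<bullet> j (Idn K (Dom K (P a))) = j (P a)"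
      "j (Q a) \<bullet> j (Idn K (Dom K (P a))) = j (Q a)"
    using o a by (simp_all add: j_comp[symmetric] Dom_Ob)
  then have "j l = j (Idn K (Dom K (P a)))"
    using l o a by (intro slice_pbk_eq[of a "j l" "P a"]) auto
  then have "l = Idn K (Dom K (P a))" using l(2) by (intro j_inj)
  then show "far ?F (Idn ?S a) = Idn ?S' (fob ?F a)" using l a by (simp add: pullback_functor_ob)
qed

end

end

section \<open>Exponentiable arrows\<close>

context chosen_pullbacks begin

text \<open>Given a competing square, the chosen pullback of \<open>f\<close> and its last component \<open>c\<close> is isomorphic to it by
  \<open>k\<close>, and \<open>a'\<close> becomes a 2-cell \<open>\<gamma>\<close> of the slice from that pullback to \<open>g\<close>. The comparisons of the
  squares then correspond to the factorizations of \<open>\<gamma>\<close> through the universal arrow.\<close>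

lemma universal_arrow_sdpbk:
  assumes f: "f \<in> Ar K" and g: "g \<in> Ar K" "Cod K g = Dom K f"
    and U: "universal_arrow (slice K (Cod K f)) (slice K (Dom K f)) (pullback_functor K pb f) g r e"
  shows "\<exists>a b c. T.sdpbk (j f) (j g) a b c"
proof -
  let ?F = "pullback_functor K pb f" and ?S = "slice K (Cod K f)" and ?S' = "slice K (Dom K f)"
  let ?P = "\<lambda>a. fst (pb f a)" and ?Q = "\<lambda>a. snd (pb f a)"
  have r: "r \<in> Ar K" "Cod K r = Cod K f" using U by (auto simp: universal_arrow_def)
  note rp = slice_pbk[OF f r] and rt = slice_pbk_types[OF f r]
  have "e \<in> hom ?S' (?P r) g" using U r f by (simp add: universal_arrow_def pullback_functor_ob)
  then obtain a0 where e: "e = (?P r, g, a0)" "(?P r, g, a0) \<in> Ar ?S'"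
    by (cases e) (auto simp: hom_def)
  then have a0: "a0 \<in> Ar K" "j g \<bullet> j a0 = j (?P r)" by (auto simp: slice_Ar_T)
  \<comment> \<open>the universal property of \<open>e\<close>, with 2-cells of slices replaced by their components\<close>
  have uni: "\<exists>!t. t \<in> Ce K \<and> j r \<bullet> Some t = j c \<and>
      (\<exists>l. j (?P r) \<bullet> l = j (?P c) \<and> j (?Q r) \<bullet> l = Some t \<bullet> j (?Q c) \<and> j a0 \<bullet> l = Some \<gamma>)"
    if c: "c \<in> Ar K" "Cod K c = Cod K f" and ga: "\<gamma> \<in> Ce K" "j g \<bullet> Some \<gamma> = j (?P c)" for c \<gamma>
  proof -
    note cp = slice_pbk[OF f c] and ct = slice_pbk_types[OF f c]
    have th: "(?P c, g, \<gamma>) \<in> cells ?S' (fob ?F c) g"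
      using c ga f g ct by (simp add: hom_def pullback_functor_ob slice_Ce_T)
    have "c \<in> Ob ?S" using c by simp
    then have ex: "\<exists>!\<phi>. \<phi> \<in> cells ?S c r \<and> Id2 ?S' e \<star>\<^bsub>?S'\<^esub> fce ?F \<phi> = (?P c, g, \<gamma>)"
      using U th unfolding universal_arrow_def by blast
    have char: "Id2 ?S' e \<star>\<^bsub>?S'\<^esub> fce ?F (c, r, t) = (?P c, g, \<gamma>) \<longleftrightarrow>
       (\<exists>l. j (?P r) \<bullet> l = j (?P c) \<and> j (?Q r) \<bullet> l = Some t \<bullet> j (?Q c) \<and> j a0 \<bullet> l = Some \<gamma>)"
      if t: "t \<in> Ce K" "j r \<bullet> Some t = j c" for t
    proof -
      have cc: "(c, r, t) \<in> Ce ?S" using t c r by (simp add: slice_Ce_T)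
      obtain l where l: "fce ?F (c, r, t) = (?P c, ?P r, l)" "l \<in> Ce K"
          "j (?P r) \<bullet> Some l = j (?P c)" "j (?Q r) \<bullet> Some l = Some t \<bullet> j (?Q c)"
        using pullback_functor_ce[OF f cc] by blast
      have lt: "tarr (j (?P r) \<bullet> Some l)" using l ct by simp
      have da: "Dom K a0 = Dom K (?P r)"
        using T.dm_comp[of "j g" "j a0"] a0 rt by simp
      have d: "Cod K (Src K l) = Dom K a0" using j_whisker_cod[OF lt] da by simp
      have "Id2 ?S' e \<star>\<^bsub>?S'\<^esub> fce ?F (c, r, t) = (?P c, g, \<gamma>) \<longleftrightarrow> j a0 \<bullet> Some l = Some \<gamma>"
        using l d a0 by (simp add: e whisker_eq1)
      moreover have "l' = Some l" if "j (?P r) \<bullet> l' = j (?P c)" "j (?Q r) \<bullet> l' = Some t \<bullet> j (?Q c)" for l'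
        using slice_pbk_eq[OF f r that(1) ct(1) l(3)] that(2) l(4) by simp
      ultimately show ?thesis using l by metis
    qed
    have ce: "(c, r, t) \<in> cells ?S c r \<longleftrightarrow> t \<in> Ce K \<and> j r \<bullet> Some t = j c" for t
      using c r by (auto simp: hom_def slice_Ce_T)
    obtain \<phi> where \<phi>: "\<phi> \<in> cells ?S c r" "Id2 ?S' e \<star>\<^bsub>?S'\<^esub> fce ?F \<phi> = (?P c, g, \<gamma>)" using ex by blast
    obtain t where t: "\<phi> = (c, r, t)" using \<phi>(1) by (cases \<phi>) (auto simp: hom_def)
    show ?thesis
    proof (rule ex1I[of _ t])
      show "t \<in> Ce K \<and> j r \<bullet> Some t = j c \<and>
        (\<exists>l. j (?P r) \<bullet> l = j (?P c) \<and> j (?Q r) \<bullet> l = Some t \<bullet> j (?Q c) \<and> j a0 \<bullet> l = Some \<gamma>)"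
        using \<phi> ce char unfolding t by blast
      fix t' assume "t' \<in> Ce K \<and> j r \<bullet> Some t' = j c \<and>
        (\<exists>l. j (?P r) \<bullet> l = j (?P c) \<and> j (?Q r) \<bullet> l = Some t' \<bullet> j (?Q c) \<and> j a0 \<bullet> l = Some \<gamma>)"
      then have "(c, r, t') \<in> cells ?S c r" "Id2 ?S' e \<star>\<^bsub>?S'\<^esub> fce ?F (c, r, t') = (?P c, g, \<gamma>)"
        using ce char by blast+
      then have "(c, r, t') = \<phi>" using ex \<phi> by blast
      then show "t' = t" by (simp add: t)
    qed
  qed
  have "T.sdpbk (j f) (j g) (j a0) (j (?Q r)) (j r)"
  proof (rule T.sdpbkI)
    show "T.tight (j g)" "T.tight (j a0)" using g a0 by simp_all
    show "T.pbk (j f) (j r) (j g \<bullet> j a0) (j (?Q r))" using rp a0 by simp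
    fix a' b' c' assume p: "T.pbk (j f) c' (j g \<bullet> a') b'"
    note p' = T.pbk_types[OF p]
    obtain c where c: "c' = j c" "c \<in> Ar K" using T.pbk_tight[OF p] tight_obtain by metis
    have cf: "Cod K c = Cod K f" using p'(7) c f by simp
    note cp = slice_pbk[OF f c(2) cf] and ct = slice_pbk_types[OF f c(2) cf]
    obtain k where k: "(j g \<bullet> a') \<bullet> k = j (?P c)" "b' \<bullet> k = j (?Q c)"
      using T.pbk_lift[OF p] T.pbk_comm[OF cp] T.pbk_arr[OF cp] c by metis
    obtain k' where k': "j (?P c) \<bullet> k' = j g \<bullet> a'" "j (?Q c) \<bullet> k' = b'"
      using T.pbk_lift[OF cp] T.pbk_comm[OF p] T.pbk_arr[OF p] c by metis
    have "tarr a'" "tdm (j g \<bullet> a') = tdm a'" using p'(3) by (simp_all add: tarr_tcomp T.dm_comp)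
    have "k \<bullet> k' = tide (tdm (j g \<bullet> a'))"
    proof (rule T.pbk_eq[OF p])
      show "(j g \<bullet> a') \<bullet> k \<bullet> k' = (j g \<bullet> a') \<bullet> tide (tdm (j g \<bullet> a'))"
        using k k' T.comp_ide[OF p'(3)] by (metis T.assoc)
      show "b' \<bullet> k \<bullet> k' = b' \<bullet> tide (tdm (j g \<bullet> a'))"
        using k k' T.comp_ide[OF p'(4)] p'(8) by (metis T.assoc)
      show "tarr ((j g \<bullet> a') \<bullet> k \<bullet> k')"
        using k k' p'(3) by (metis T.assoc)
    qed
    then have kk: "a' \<bullet> k \<bullet> k' = a'"
      using T.comp_ide[OF \<open>tarr a'\<close>] \<open>tdm (j g \<bullet> a') = tdm a'\<close> by simp
    have gk: "j g \<bullet> (a' \<bullet> k) = j (?P c)" using k by (simp add: T.assoc)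
    then have "tarr (a' \<bullet> k)" using ct by (metis T.arr_comp j_arr)
    then obtain \<gamma> where \<gamma>: "a' \<bullet> k = Some \<gamma>" "\<gamma> \<in> Ce K" by (auto simp: tarr_def)
    note un = uni[OF c(2) cf \<gamma>(2) gk[unfolded \<gamma>(1)]]
    obtain t l where t: "j r \<bullet> Some t = j c" "j (?P r) \<bullet> l = j (?P c)" "j (?Q r) \<bullet> l = Some t \<bullet> j (?Q c)" "j a0 \<bullet> l = Some \<gamma>"
      using un by blast
    show "\<exists>s t. j a0 \<bullet> s = a' \<and> j (?Q r) \<bullet> s = t \<bullet> b' \<and> j r \<bullet> t = c'"
    proof (intro exI conjI)
      show "j a0 \<bullet> l \<bullet> k' = a'" using t \<gamma> kk by (metis T.assoc)
      show "j (?Q r) \<bullet> l \<bullet> k' = Some t \<bullet> b'" using t k' by (metis T.assoc)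
      show "j r \<bullet> Some t = c'" using t c by simp
    qed
    fix s t s' t'
    assume h: "j a0 \<bullet> s = a'" "j (?Q r) \<bullet> s = t \<bullet> b'" "j r \<bullet> t = c'"
      "j a0 \<bullet> s' = a'" "j (?Q r) \<bullet> s' = t' \<bullet> b'" "j r \<bullet> t' = c'"
    have sat: "\<exists>t0. t = Some t0 \<and> t0 \<in> Ce K \<and> j r \<bullet> Some t0 = j c \<and>
       (\<exists>l. j (?P r) \<bullet> l = j (?P c) \<and> j (?Q r) \<bullet> l = Some t0 \<bullet> j (?Q c) \<and> j a0 \<bullet> l = Some \<gamma>)"
      if h: "j a0 \<bullet> s = a'" "j (?Q r) \<bullet> s = t \<bullet> b'" "j r \<bullet> t = c'" for s t
    proof -
      have "tarr t" using h(3) c by (metis T.arr_comp j_arr)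
      then obtain t0 where t0: "t = Some t0" "t0 \<in> Ce K" by (auto simp: tarr_def)
      have "j (?P r) \<bullet> (s \<bullet> k) = j (?P c)" using h(1) a0 gk by (metis T.assoc)
      moreover have "j (?Q r) \<bullet> (s \<bullet> k) = Some t0 \<bullet> j (?Q c)" using h(2) k t0 by (metis T.assoc)
      moreover have "j a0 \<bullet> (s \<bullet> k) = Some \<gamma>" using h(1) \<gamma> by (metis T.assoc)
      ultimately show ?thesis using t0 h(3) c by blast
    qed
    have "t = t'" using un sat[OF h(1-3)] sat[OF h(4-6)] by blast
    moreover have "s = s'"
    proof (rule T.pbk_eq[OF rp])
      show "j (?P r) \<bullet> s = j (?P r) \<bullet> s'" using h a0 by (metis T.assoc)
      show "j (?Q r) \<bullet> s = j (?Q r) \<bullet> s'" using h \<open>t = t'\<close> by simp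
      have "j (?P r) \<bullet> s = j g \<bullet> a'" using h a0 by (metis T.assoc)
      then show "tarr (j (?P r) \<bullet> s)" using p'(3) by simp
    qed
    ultimately show "s = s' \<and> t = t'" by simp
  qed
  then show ?thesis by blast
qed

text \<open>The first component of the strong distributivity pullback, transported along the isomorphism \<open>k\<close> to
  the chosen pullback of its last component, is the universal arrow.\<close>

lemma sdpbk_universal_arrow:
  assumes f: "f \<in> Ar K" and g: "g \<in> Ar K" "Cod K g = Dom K f"
    and D: "T.sdpbk (j f) (j g) a b c"
  shows "\<exists>r e. universal_arrow (slice K (Cod K f)) (slice K (Dom K f)) (pullback_functor K pb f) g r e"
proof -
  let ?F = "pullback_functor K pb f" and ?S = "slice K (Cod K f)" and ?S' = "slice K (Dom K f)"
  let ?P = "\<lambda>a. fst (pb f a)" and ?Q = "\<lambda>a. snd (pb f a)"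
  note D' = T.sdpbkD[OF D] and p' = T.pbk_types[OF T.sdpbkD(3)[OF D]]
  obtain r where c: "c = j r" and r0: "r \<in> Ar K" using T.pbk_tight[OF D'(3)] tight_obtain by metis
  have r: "r \<in> Ar K" "Cod K r = Cod K f" using p'(7) r0 f c by auto
  note rp = slice_pbk[OF f r] and rt = slice_pbk_types[OF f r]
  obtain k where k: "(j g \<bullet> a) \<bullet> k = j (?P r)" "b \<bullet> k = j (?Q r)"
    using T.pbk_lift[OF D'(3)] T.pbk_comm[OF rp] T.pbk_arr[OF rp] c by metis
  have tk: "T.tight k" using T.pbk_lift_tight[OF D'(3) k] rt by simp
  have gak: "j g \<bullet> (a \<bullet> k) = j (?P r)" using k by (simp add: T.assoc)
  then have "tarr (a \<bullet> k)" using rt by (metis T.arr_comp j_arr)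
  then have "T.tight (a \<bullet> k)" using D'(2) tk by (intro T.tight_comp)
  then obtain a0 where a0: "a0 \<in> Ar K" "a \<bullet> k = j a0" using tight_obtain by metis
  let ?e = "(?P r, g, a0)"
  have ar: "?e \<in> Ar ?S'" using rt g a0 gak by (simp add: slice_Ar_T)
  have da: "Dom K a0 = Dom K (?P r)" using ar by (simp add: slice_Ar)
  have "universal_arrow ?S ?S' ?F g r ?e"
    unfolding universal_arrow_def
  proof (intro conjI ballI)
    show "r \<in> Ob ?S" using r by simp
    show "?e \<in> hom ?S' (fob ?F r) g" using ar r f by (simp add: hom_def pullback_functor_ob)
    fix x \<theta> assume x0: "x \<in> Ob ?S" and th: "\<theta> \<in> cells ?S' (fob ?F x) g"
    then have x: "x \<in> Ar K" "Cod K x = Cod K f" by auto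
    note xp = slice_pbk[OF f x] and xt = slice_pbk_types[OF f x]
    obtain \<gamma> where \<gamma>: "\<theta> = (?P x, g, \<gamma>)" "\<gamma> \<in> Ce K" "j g \<bullet> Some \<gamma> = j (?P x)"
      using th x f by (cases \<theta>) (auto simp: hom_def slice_Ce_T pullback_functor_ob)
    have xq: "T.pbk (j f) (j x) (j g \<bullet> Some \<gamma>) (j (?Q x))" using xp \<gamma> by simp
    have char: "(\<exists>l. fce ?F (x, r, t) = (?P x, ?P r, l) \<and> l \<in> Ce K \<and> j a0 \<bullet> Some l = Some (Id2 K a0 \<star> l) \<and>
        a \<bullet> k \<bullet> Some l = j a0 \<bullet> Some l \<and> b \<bullet> k \<bullet> Some l = Some t \<bullet> j (?Q x) \<and> (j g \<bullet> a) \<bullet> k \<bullet> Some l = j (?P x))"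
      if t: "t \<in> Ce K" "j r \<bullet> Some t = j x" for t
    proof -
      have cc: "(x, r, t) \<in> Ce ?S" using t x r by (simp add: slice_Ce_T)
      obtain l where l: "fce ?F (x, r, t) = (?P x, ?P r, l)" "l \<in> Ce K"
          "j (?P r) \<bullet> Some l = j (?P x)" "j (?Q r) \<bullet> Some l = Some t \<bullet> j (?Q x)"
        using pullback_functor_ce[OF f cc] by blast
      have lt: "tarr (j (?P r) \<bullet> Some l)" using l xt by simp
      have d: "Cod K (Src K l) = Dom K a0" using j_whisker_cod[OF lt] da by simp
      have "j a0 \<bullet> Some l = Some (Id2 K a0 \<star> l)" using d a0 l by (simp add: j_Some Some_comp)
      moreover have "a \<bullet> k \<bullet> Some l = j a0 \<bullet> Some l" using a0 by (metis T.assoc)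
      moreover have "b \<bullet> k \<bullet> Some l = Some t \<bullet> j (?Q x)" using k l by (metis T.assoc)
      moreover have "(j g \<bullet> a) \<bullet> k \<bullet> Some l = j (?P x)" using k l by (metis T.assoc)
      ultimately show ?thesis using l by blast
    qed
    obtain s t1 where st: "a \<bullet> s = Some \<gamma>" "b \<bullet> s = t1 \<bullet> j (?Q x)" "c \<bullet> t1 = j x"
      using T.sdpbk_lift[OF D xq] by blast
    have "tarr t1" using st(3) x by (metis T.arr_comp j_arr)
    then obtain t where t: "t1 = Some t" "t \<in> Ce K" by (auto simp: tarr_def)
    have tr: "j r \<bullet> Some t = j x" using st t c by simp
    obtain l where l: "fce ?F (x, r, t) = (?P x, ?P r, l)" "l \<in> Ce K" "j a0 \<bullet> Some l = Some (Id2 K a0 \<star> l)"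
        "a \<bullet> k \<bullet> Some l = j a0 \<bullet> Some l" "b \<bullet> k \<bullet> Some l = Some t \<bullet> j (?Q x)" "(j g \<bullet> a) \<bullet> k \<bullet> Some l = j (?P x)"
      using char[OF t(2) tr] by blast
    have "k \<bullet> Some l = s"
    proof (rule T.pbk_eq[OF D'(3)])
      show "(j g \<bullet> a) \<bullet> k \<bullet> Some l = (j g \<bullet> a) \<bullet> s" using l(6) st(1) \<gamma>(3) by (metis T.assoc)
      show "b \<bullet> k \<bullet> Some l = b \<bullet> s" using l(5) st(2) t by simp
      show "tarr ((j g \<bullet> a) \<bullet> k \<bullet> Some l)" using l(6) xt by simp
    qed
    then have "Id2 K a0 \<star> l = \<gamma>" using l(3,4) st(1) by simp
    then have ex: "Id2 ?S' ?e \<star>\<^bsub>?S'\<^esub> fce ?F (x, r, t) = \<theta>" using l(1) \<gamma>(1) by simp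
    show "\<exists>!\<phi>. \<phi> \<in> cells ?S x r \<and> Id2 ?S' ?e \<star>\<^bsub>?S'\<^esub> fce ?F \<phi> = \<theta>"
    proof (rule ex1I[of _ "(x, r, t)"])
      show "(x, r, t) \<in> cells ?S x r \<and> Id2 ?S' ?e \<star>\<^bsub>?S'\<^esub> fce ?F (x, r, t) = \<theta>"
        using ex x r t tr by (simp add: hom_def slice_Ce_T)
      fix \<phi> assume \<phi>: "\<phi> \<in> cells ?S x r \<and> Id2 ?S' ?e \<star>\<^bsub>?S'\<^esub> fce ?F \<phi> = \<theta>"
      then obtain u where u: "\<phi> = (x, r, u)" by (cases \<phi>) (auto simp: hom_def)
      with \<phi> have u': "u \<in> Ce K" "j r \<bullet> Some u = j x" by (auto simp: hom_def slice_Ce_T)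
      obtain m where m: "fce ?F (x, r, u) = (?P x, ?P r, m)" "m \<in> Ce K" "j a0 \<bullet> Some m = Some (Id2 K a0 \<star> m)"
          "a \<bullet> k \<bullet> Some m = j a0 \<bullet> Some m" "b \<bullet> k \<bullet> Some m = Some u \<bullet> j (?Q x)"
        using char[OF u'] by blast
      have "Id2 K a0 \<star> m = \<gamma>" using \<phi> u m(1) \<gamma>(1) by simp
      then have "a \<bullet> k \<bullet> Some m = Some \<gamma>" using m by simp
      then have "Some u = t1"
        using T.sdpbk_eq(2)[OF D xq _ m(5) _ st] u' c by simp
      then show "\<phi> = (x, r, t)" using u t by simp
    qed
  qed
  then show ?thesis by blast
qed

text \<open>A right 2-adjoint exists if and only if there is a universal arrow at each \<open>g\<close>, and that is a
  distributivity pullback in the strong form around \<open>(f, g)\<close>.\<close>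

lemma exponentiable_iff: "exponentiable K pb f \<longleftrightarrow> T.expo (j f)"
proof
  assume E: "exponentiable K pb f"
  then have f: "f \<in> Ar K" by (simp add: exponentiable_def)
  obtain G where G: "right_two_adjoint (slice K (Cod K f)) (slice K (Dom K f)) (pullback_functor K pb f) G"
    using E by (auto simp: exponentiable_def)
  show "T.expo (j f)"
    unfolding T.expo_def
  proof (intro conjI allI impI)
    show "T.tight (j f)" using f by simp
    fix x assume x: "T.tight x \<and> tcd x = tdm (j f)"
    then obtain g where g: "g \<in> Ar K" "x = j g" using tight_obtain by metis
    then have "Cod K g = Dom K f" using x f by simp
    then show "\<exists>a b c. T.sdpbk (j f) x a b c"
      using adjoint_universal_arrow[OF slice_two_category slice_two_category G, of g] g f universal_arrow_sdpbk
      by auto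
  qed
next
  assume E: "T.expo (j f)"
  then have f: "f \<in> Ar K" by (simp add: T.expo_def)
  have "\<exists>U e. universal_arrow (slice K (Cod K f)) (slice K (Dom K f)) (pullback_functor K pb f) g U e"
    if "g \<in> Ob (slice K (Dom K f))" for g
  proof -
    have g: "g \<in> Ar K" "Cod K g = Dom K f" using that by auto
    then have "\<exists>a b c. T.sdpbk (j f) (j g) a b c" using E f unfolding T.expo_def by simp
    then show ?thesis using sdpbk_universal_arrow[OF f g] by blast
  qed
  then show "exponentiable K pb f"
    unfolding exponentiable_def
    using universal_arrows_adjoint[OF slice_two_category slice_two_category pullback_two_functor[OF f]] f by blast
qed

lemma exponentiable_idn: "X \<in> Ob K \<Longrightarrow> exponentiable K pb (Idn K X)"
  using T.expo_ide[of "j (Idn K X)"] by (simp add: exponentiable_iff tide_def j_Some)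

lemma exponentiable_pullback: "exponentiable K pb f \<Longrightarrow> is_pullback K f c x f' \<Longrightarrow> exponentiable K pb f'"
  unfolding exponentiable_iff is_pullback_iff by (rule T.expo_pullback)

lemma exponentiable_comp:
  assumes "exponentiable K pb f" "exponentiable K pb g" "Dom K g = Cod K f"
  shows "exponentiable K pb (g \<cdot> f)"
proof -
  have a: "f \<in> Ar K" "g \<in> Ar K" using assms by (auto simp: exponentiable_def)
  then show ?thesis
    using assms T.expo_comp[of "j f" "j g"] by (simp add: exponentiable_iff j_comp tarr_tcomp)
qed

text \<open>Exponentiability provides a distributivity pullback in the strong form, so the choice is obliged to
  return a distributivity pullback.\<close>

lemma chosen_dpbk:
  assumes "dpullback_choice K dpb" "exponentiable K pb f" "g \<in> Ar K" "Cod K g = Dom K f" "dpb f g = (a, b, c)"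
  shows "T.dpbk (j f) (j g) (j a) (j b) (j c)"
proof -
  have f: "f \<in> Ar K" using assms by (simp add: exponentiable_def)
  then obtain x y z where D: "T.sdpbk (j f) (j g) x y z"
    using assms unfolding exponentiable_iff T.expo_def by (metis j_cd j_dm tight_j)
  then have "T.tight x" "T.tight y" "T.tight z"
    using T.sdpbkD(2)[OF D] T.pbk_tight[OF T.sdpbkD(3)[OF D]] by auto
  then obtain x' y' z' where "x = j x'" "y = j y'" "z = j z'" using tight_obtain by metis
  then have "is_distributivity_pullback K f g (x', y', z')"
    using T.sdpbk_dpbk[OF D] f assms by (simp add: is_distributivity_pullback_iff)
  then have "is_distributivity_pullback K f g (dpb f g)"
    using assms(1) unfolding dpullback_choice_def by blast
  then show ?thesis using assms(5) by (simp add: is_distributivity_pullback_iff)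
qed

end

section \<open>2-categories of pairs\<close>

lemma fun_comp_eqI:
  assumes "\<And>x. x \<in> Ob A \<Longrightarrow> fob G (fob F x) = fob G' (fob F' x)"
    "\<And>f. f \<in> Ar A \<Longrightarrow> far G (far F f) = far G' (far F' f)"
    "\<And>\<alpha>. \<alpha> \<in> Ce A \<Longrightarrow> fce G (fce F \<alpha>) = fce G' (fce F' \<alpha>)"
  shows "fun_comp A G F = fun_comp A G' F'"
  using assms by (auto simp: fun_comp_def compose_def)

lemma fun_comp_eq_idI:
  assumes "\<And>x. x \<in> Ob A \<Longrightarrow> fob G (fob F x) = x"
    "\<And>f. f \<in> Ar A \<Longrightarrow> far G (far F f) = f"
    "\<And>\<alpha>. \<alpha> \<in> Ce A \<Longrightarrow> fce G (fce F \<alpha>) = \<alpha>"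
  shows "fun_comp A G F = fun_id A"
  using assms by (auto simp: fun_comp_def fun_id_def compose_def)

lemma fun_comp_simps [simp]:
  "x \<in> Ob A \<Longrightarrow> fob (fun_comp A G F) x = fob G (fob F x)"
  "f \<in> Ar A \<Longrightarrow> far (fun_comp A G F) f = far G (far F f)"
  "\<alpha> \<in> Ce A \<Longrightarrow> fce (fun_comp A G F) \<alpha> = fce G (fce F \<alpha>)"
  "x \<in> Ob A \<Longrightarrow> fob (fun_id A) x = x" "f \<in> Ar A \<Longrightarrow> far (fun_id A) f = f" "\<alpha> \<in> Ce A \<Longrightarrow> fce (fun_id A) \<alpha> = \<alpha>"
  "x \<in> Ob A \<Longrightarrow> fob (pairing A F F') x = (fob F x, fob F' x)"
  "f \<in> Ar A \<Longrightarrow> far (pairing A F F') f = (far F f, far F' f)"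
  "\<alpha> \<in> Ce A \<Longrightarrow> fce (pairing A F F') \<alpha> = (fce F \<alpha>, fce F' \<alpha>)"
  "xy \<in> Ob PP \<Longrightarrow> fob (proj1 PP) xy = fst xy" "fg \<in> Ar PP \<Longrightarrow> far (proj1 PP) fg = fst fg"
  "\<alpha>\<beta> \<in> Ce PP \<Longrightarrow> fce (proj1 PP) \<alpha>\<beta> = fst \<alpha>\<beta>"
  "xy \<in> Ob PP \<Longrightarrow> fob (proj2 PP) xy = snd xy" "fg \<in> Ar PP \<Longrightarrow> far (proj2 PP) fg = snd fg"
  "\<alpha>\<beta> \<in> Ce PP \<Longrightarrow> fce (proj2 PP) \<alpha>\<beta> = snd \<alpha>\<beta>"
  by (simp_all add: fun_comp_def fun_id_def compose_def pairing_def proj1_def proj2_def)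

lemma fun_comp_eqD:
  assumes "fun_comp A G F = fun_comp A G' F'"
  shows "x \<in> Ob A \<Longrightarrow> fob G (fob F x) = fob G' (fob F' x)"
    "f \<in> Ar A \<Longrightarrow> far G (far F f) = far G' (far F' f)"
    "\<alpha> \<in> Ce A \<Longrightarrow> fce G (fce F \<alpha>) = fce G' (fce F' \<alpha>)"
  using arg_cong[OF assms, of "\<lambda>H. fob H x"] arg_cong[OF assms, of "\<lambda>H. far H f"] arg_cong[OF assms, of "\<lambda>H. fce H \<alpha>"]
  by simp_all

lemma fun_comp_eq_idD:
  assumes "fun_comp A G F = fun_id A"
  shows "x \<in> Ob A \<Longrightarrow> fob G (fob F x) = x"
    "f \<in> Ar A \<Longrightarrow> far G (far F f) = f"
    "\<alpha> \<in> Ce A \<Longrightarrow> fce G (fce F \<alpha>) = \<alpha>"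
  using arg_cong[OF assms, of "\<lambda>H. fob H x"] arg_cong[OF assms, of "\<lambda>H. far H f"] arg_cong[OF assms, of "\<lambda>H. fce H \<alpha>"]
  by simp_all

lemma fibprod_simps [simp]:
  "(x, y) \<in> Ob (fibprod A B F G) \<longleftrightarrow> x \<in> Ob A \<and> y \<in> Ob B \<and> fob F x = fob G y"
  "(f, g) \<in> Ar (fibprod A B F G) \<longleftrightarrow> f \<in> Ar A \<and> g \<in> Ar B \<and> far F f = far G g"
  "(\<alpha>, \<beta>) \<in> Ce (fibprod A B F G) \<longleftrightarrow> \<alpha> \<in> Ce A \<and> \<beta> \<in> Ce B \<and> fce F \<alpha> = fce G \<beta>"
  "Dom (fibprod A B F G) (f, g) = (Dom A f, Dom B g)" "Cod (fibprod A B F G) (f, g) = (Cod A f, Cod B g)"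
  "Idn (fibprod A B F G) (x, y) = (Idn A x, Idn B y)"
  "Comp (fibprod A B F G) (f', g') (f, g) = (f' \<cdot>\<^bsub>A\<^esub> f, g' \<cdot>\<^bsub>B\<^esub> g)"
  "Src (fibprod A B F G) (\<alpha>, \<beta>) = (Src A \<alpha>, Src B \<beta>)" "Trg (fibprod A B F G) (\<alpha>, \<beta>) = (Trg A \<alpha>, Trg B \<beta>)"
  "Id2 (fibprod A B F G) (f, g) = (Id2 A f, Id2 B g)"
  "VComp (fibprod A B F G) (\<alpha>', \<beta>') (\<alpha>, \<beta>) = (\<alpha>' \<diamondop>\<^bsub>A\<^esub> \<alpha>, \<beta>' \<diamondop>\<^bsub>B\<^esub> \<beta>)"
  "HComp (fibprod A B F G) (\<alpha>', \<beta>') (\<alpha>, \<beta>) = (\<alpha>' \<star>\<^bsub>A\<^esub> \<alpha>, \<beta>' \<star>\<^bsub>B\<^esub> \<beta>)"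
  by (simp_all add: fibprod_def)

text \<open>Conditions under which pairs of arrows and 2-cells form a 2-category. Since \<open>R_iff\<close> reduces the
  condition on arrows to that on their identity 2-cells, they concern 2-cells only.\<close>

locale pair_data = two_category K for K :: "('o, 'a, 'c) twocat" (structure) +
  fixes Os :: "'x set" and d0 d1 :: "'x \<Rightarrow> 'o"
    and R :: "'x \<Rightarrow> 'x \<Rightarrow> 'a \<Rightarrow> 'a \<Rightarrow> bool" and S :: "'x \<Rightarrow> 'x \<Rightarrow> 'c \<Rightarrow> 'c \<Rightarrow> bool"
  assumes d_Ob: "x \<in> Os \<Longrightarrow> d0 x \<in> Ob K \<and> d1 x \<in> Ob K"
    and R_iff: "x \<in> Os \<Longrightarrow> y \<in> Os \<Longrightarrow> u \<in> hom K (d0 x) (d0 y) \<Longrightarrow> v \<in> hom K (d1 x) (d1 y) \<Longrightarrow>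
      R x y u v \<longleftrightarrow> S x y (Id2 K u) (Id2 K v)"
    and S_boundary: "x \<in> Os \<Longrightarrow> y \<in> Os \<Longrightarrow> \<alpha> \<in> cells K (d0 x) (d0 y) \<Longrightarrow> \<beta> \<in> cells K (d1 x) (d1 y) \<Longrightarrow> S x y \<alpha> \<beta> \<Longrightarrow>
      S x y (Id2 K (Src K \<alpha>)) (Id2 K (Src K \<beta>)) \<and> S x y (Id2 K (Trg K \<alpha>)) (Id2 K (Trg K \<beta>))"
    and S_idn: "x \<in> Os \<Longrightarrow> S x x (Id2 K (Idn K (d0 x))) (Id2 K (Idn K (d1 x)))"
    and S_hcomp: "x \<in> Os \<Longrightarrow> y \<in> Os \<Longrightarrow> z \<in> Os \<Longrightarrow> \<alpha> \<in> cells K (d0 x) (d0 y) \<Longrightarrow> \<beta> \<in> cells K (d1 x) (d1 y) \<Longrightarrow>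
      \<alpha>' \<in> cells K (d0 y) (d0 z) \<Longrightarrow> \<beta>' \<in> cells K (d1 y) (d1 z) \<Longrightarrow> S x y \<alpha> \<beta> \<Longrightarrow> S y z \<alpha>' \<beta>' \<Longrightarrow>
      S x z (\<alpha>' \<star> \<alpha>) (\<beta>' \<star> \<beta>)"
    and S_vcomp: "x \<in> Os \<Longrightarrow> y \<in> Os \<Longrightarrow> \<alpha> \<in> cells K (d0 x) (d0 y) \<Longrightarrow> \<beta> \<in> cells K (d1 x) (d1 y) \<Longrightarrow>
      \<alpha>' \<in> cells K (d0 x) (d0 y) \<Longrightarrow> \<beta>' \<in> cells K (d1 x) (d1 y) \<Longrightarrow> S x y \<alpha> \<beta> \<Longrightarrow> S x y \<alpha>' \<beta>' \<Longrightarrow>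
      Src K \<alpha>' = Trg K \<alpha> \<Longrightarrow> Src K \<beta>' = Trg K \<beta> \<Longrightarrow> S x y (\<alpha>' \<diamondop> \<alpha>) (\<beta>' \<diamondop> \<beta>)"
begin

abbreviation "PT \<equiv> pair_twocat K Os d0 d1 R S"

lemma PT_simps [simp]:
  "Ob PT = Os" "Dom PT (x, y, u, v) = x" "Cod PT (x, y, u, v) = y"
  "Idn PT x = (x, x, Idn K (d0 x), Idn K (d1 x))"
  "Comp PT (y', z, u', v') (x, y, u, v) = (x, z, u' \<cdot> u, v' \<cdot> v)"
  "Src PT (x, y, \<alpha>, \<beta>) = (x, y, Src K \<alpha>, Src K \<beta>)" "Trg PT (x, y, \<alpha>, \<beta>) = (x, y, Trg K \<alpha>, Trg K \<beta>)"
  "Id2 PT (x, y, u, v) = (x, y, Id2 K u, Id2 K v)"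
  "VComp PT (x', y', \<alpha>', \<beta>') (x, y, \<alpha>, \<beta>) = (x, y, \<alpha>' \<diamondop> \<alpha>, \<beta>' \<diamondop> \<beta>)"
  "HComp PT (y', z, \<alpha>', \<beta>') (x, y, \<alpha>, \<beta>) = (x, z, \<alpha>' \<star> \<alpha>, \<beta>' \<star> \<beta>)"
  by (simp_all add: pair_twocat_def Let_def)

lemma PT_Ar [simp]:
  "(x, y, u, v) \<in> Ar PT \<longleftrightarrow> x \<in> Os \<and> y \<in> Os \<and> u \<in> hom K (d0 x) (d0 y) \<and> v \<in> hom K (d1 x) (d1 y) \<and>
     S x y (Id2 K u) (Id2 K v)"
  using R_iff[of x y u v] by (auto simp: pair_twocat_def Let_def)

lemma cells_boundary:
  assumes "\<alpha> \<in> cells K X Y"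
  shows "\<alpha> \<in> Ce K" "Src K \<alpha> \<in> hom K X Y" "Trg K \<alpha> \<in> hom K X Y"
  using assms by (auto simp: hom_def)

lemma PT_Ce [simp]:
  "(x, y, \<alpha>, \<beta>) \<in> Ce PT \<longleftrightarrow> x \<in> Os \<and> y \<in> Os \<and> \<alpha> \<in> cells K (d0 x) (d0 y) \<and> \<beta> \<in> cells K (d1 x) (d1 y) \<and> S x y \<alpha> \<beta>"
    (is "?L \<longleftrightarrow> ?R")
proof
  assume ?L then show ?R by (auto simp: pair_twocat_def Let_def hom_def)
next
  assume r: ?R
  then have "R x y (Src K \<alpha>) (Src K \<beta>)" "R x y (Trg K \<alpha>) (Trg K \<beta>)"
    using R_iff S_boundary[of x y \<alpha> \<beta>] cells_boundary by metis+
  then show ?L using r by (auto simp: pair_twocat_def Let_def hom_def)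
qed

lemma id2_cells: "u \<in> hom K X Y \<Longrightarrow> Id2 K u \<in> cells K X Y"
  by (auto simp: hom_def)

lemma hcomp_cells: "\<alpha> \<in> cells K X Y \<Longrightarrow> \<beta> \<in> cells K Y Z \<Longrightarrow> \<beta> \<star> \<alpha> \<in> cells K X Z"
  by (auto simp: hom_def)

lemma vcomp_cells: "\<alpha> \<in> cells K X Y \<Longrightarrow> \<beta> \<in> cells K X Y \<Longrightarrow> Src K \<beta> = Trg K \<alpha> \<Longrightarrow> \<beta> \<diamondop> \<alpha> \<in> cells K X Y"
  by (auto simp: hom_def)

lemma PT_two_category: "two_category PT"
proof -
  have 1: "category PT"
  proof
    fix f assume "f \<in> Ar PT"
    then show "Dom PT f \<in> Ob PT" "Cod PT f \<in> Ob PT" by (cases f; simp)+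
  next
    fix x assume "x \<in> Ob PT"
    then show "Idn PT x \<in> hom PT x x"
      using d_Ob[of x] S_idn[of x] by (simp add: hom_def)
  next
    fix f g x y z assume f: "f \<in> hom PT x y" and g: "g \<in> hom PT y z"
    obtain u v u' v' where e: "f = (x, y, u, v)" "g = (y, z, u', v')"
      using f g by (cases f, cases g) (auto simp: hom_def[of PT])
    have uv: "x \<in> Os" "y \<in> Os" "z \<in> Os" "u \<in> hom K (d0 x) (d0 y)" "v \<in> hom K (d1 x) (d1 y)" "S x y (Id2 K u) (Id2 K v)"
        "u' \<in> hom K (d0 y) (d0 z)" "v' \<in> hom K (d1 y) (d1 z)" "S y z (Id2 K u') (Id2 K v')"
      using f g by (auto simp: e hom_def[of PT])
    have "Id2 K u' \<star> Id2 K u = Id2 K (u' \<cdot> u)" "Id2 K v' \<star> Id2 K v = Id2 K (v' \<cdot> v)"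
      using uv by (auto simp: hom_def)
    then have "S x z (Id2 K (u' \<cdot> u)) (Id2 K (v' \<cdot> v))"
      using S_hcomp[OF uv(1-3) id2_cells[OF uv(4)] id2_cells[OF uv(5)] id2_cells[OF uv(7)] id2_cells[OF uv(8)] uv(6,9)]
      by simp
    then show "g \<cdot>\<^bsub>PT\<^esub> f \<in> hom PT x z"
      using uv Comp_hom by (simp add: e hom_def[of PT])
  next
    fix f x y assume "f \<in> hom PT x y"
    then show "f \<cdot>\<^bsub>PT\<^esub> Idn PT x = f" "Idn PT y \<cdot>\<^bsub>PT\<^esub> f = f"
      by (cases f; auto simp: hom_def)+
  next
    fix f g h w x y z assume "f \<in> hom PT w x" "g \<in> hom PT x y" "h \<in> hom PT y z"
    then show "(h \<cdot>\<^bsub>PT\<^esub> g) \<cdot>\<^bsub>PT\<^esub> f = h \<cdot>\<^bsub>PT\<^esub> (g \<cdot>\<^bsub>PT\<^esub> f)"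
      by (cases f, cases g, cases h) (auto simp: hom_def comp_assoc)
  qed
  have 2: "category (vcat PT)"
  proof
    fix f assume f: "f \<in> Ar (vcat PT)"
    obtain x y \<alpha> \<beta> where e: "f = (x, y, \<alpha>, \<beta>)" by (cases f)
    show "Dom (vcat PT) f \<in> Ob (vcat PT)" "Cod (vcat PT) f \<in> Ob (vcat PT)"
      using f S_boundary[of x y \<alpha> \<beta>] cells_boundary[of \<alpha>] cells_boundary[of \<beta>] by (auto simp: e)
  next
    fix f assume "f \<in> Ob (vcat PT)"
    then show "Idn (vcat PT) f \<in> hom (vcat PT) f f"
      by (cases f) (auto simp: hom_def)
  next
    fix f g a b c assume f: "f \<in> hom (vcat PT) a b" and g: "g \<in> hom (vcat PT) b c"
    obtain x y \<alpha> \<beta> \<alpha>' \<beta>' where e: "f = (x, y, \<alpha>, \<beta>)" "g = (x, y, \<alpha>', \<beta>')" "Src K \<alpha>' = Trg K \<alpha>" "Src K \<beta>' = Trg K \<beta>"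
      using f g by (cases f, cases g) (auto simp: hom_def[of "vcat PT"])
    show "g \<cdot>\<^bsub>vcat PT\<^esub> f \<in> hom (vcat PT) a c"
      using f g S_vcomp[of x y \<alpha> \<beta> \<alpha>' \<beta>'] vcomp_cells[of \<alpha> _ _ \<alpha>'] vcomp_cells[of \<beta> _ _ \<beta>'] e(3,4) cells_boundary(1)
      by (auto simp: e(1,2) hom_def[of "vcat PT"])
  next
    fix f a b assume "f \<in> hom (vcat PT) a b"
    then show "f \<cdot>\<^bsub>vcat PT\<^esub> Idn (vcat PT) a = f" "Idn (vcat PT) b \<cdot>\<^bsub>vcat PT\<^esub> f = f"
      by (cases f; auto simp: hom_def)+
  next
    fix f g h a b c d assume "f \<in> hom (vcat PT) a b" "g \<in> hom (vcat PT) b c" "h \<in> hom (vcat PT) c d"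
    then show "(h \<cdot>\<^bsub>vcat PT\<^esub> g) \<cdot>\<^bsub>vcat PT\<^esub> f = h \<cdot>\<^bsub>vcat PT\<^esub> (g \<cdot>\<^bsub>vcat PT\<^esub> f)"
      using vertical.comp_assoc
      by (cases f, cases g, cases h) (auto simp: hom_def)
  qed
  have 3: "category (hcat PT)"
  proof
    fix f assume "f \<in> Ar (hcat PT)"
    then show "Dom (hcat PT) f \<in> Ob (hcat PT)" "Cod (hcat PT) f \<in> Ob (hcat PT)"
      by (cases f; simp)+
  next
    fix x assume "x \<in> Ob (hcat PT)"
    then show "Idn (hcat PT) x \<in> hom (hcat PT) x x"
      using d_Ob[of x] S_idn[of x] by (auto simp: hom_def)
  next
    fix f g x y z assume f: "f \<in> hom (hcat PT) x y" and g: "g \<in> hom (hcat PT) y z"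
    obtain u v u' v' where e: "f = (x, y, u, v)" "g = (y, z, u', v')"
      using f g by (cases f, cases g) (auto simp: hom_def[of "hcat PT"])
    show "g \<cdot>\<^bsub>hcat PT\<^esub> f \<in> hom (hcat PT) x z"
      using f g S_hcomp[of x y z u v u' v'] hcomp_cells by (auto simp: e hom_def[of "hcat PT"])
  next
    fix f a b assume "f \<in> hom (hcat PT) a b"
    then show "f \<cdot>\<^bsub>hcat PT\<^esub> Idn (hcat PT) a = f" "Idn (hcat PT) b \<cdot>\<^bsub>hcat PT\<^esub> f = f"
      by (cases f; auto simp: hom_def)+
  next
    fix f g h w x y z assume "f \<in> hom (hcat PT) w x" "g \<in> hom (hcat PT) x y" "h \<in> hom (hcat PT) y z"
    then show "(h \<cdot>\<^bsub>hcat PT\<^esub> g) \<cdot>\<^bsub>hcat PT\<^esub> f = h \<cdot>\<^bsub>hcat PT\<^esub> (g \<cdot>\<^bsub>hcat PT\<^esub> f)"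
      by (cases f, cases g, cases h) (auto simp: hom_def hcomp_assoc)
  qed
  show ?thesis
  proof (intro two_category.intro 1 2 3 two_category_axioms.intro)
    fix \<alpha> assume "\<alpha> \<in> Ce PT"
    then show "Dom PT (Trg PT \<alpha>) = Dom PT (Src PT \<alpha>) \<and> Cod PT (Trg PT \<alpha>) = Cod PT (Src PT \<alpha>)"
      by (cases \<alpha>) simp
  next
    fix \<alpha> \<beta> a b c assume "\<alpha> \<in> cells PT a b" "\<beta> \<in> cells PT b c"
    then show "Src PT (\<beta> \<star>\<^bsub>PT\<^esub> \<alpha>) = Src PT \<beta> \<cdot>\<^bsub>PT\<^esub> Src PT \<alpha>" "Trg PT (\<beta> \<star>\<^bsub>PT\<^esub> \<alpha>) = Trg PT \<beta> \<cdot>\<^bsub>PT\<^esub> Trg PT \<alpha>"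
      by (cases \<alpha>; cases \<beta>; auto simp: hom_def)+
  next
    fix f g a b c assume "f \<in> hom PT a b" "g \<in> hom PT b c"
    then show "Id2 PT g \<star>\<^bsub>PT\<^esub> Id2 PT f = Id2 PT (g \<cdot>\<^bsub>PT\<^esub> f)"
      by (cases f; cases g; auto simp: hom_def)
  next
    fix \<alpha> \<alpha>' \<beta> \<beta>' a b c
    assume h: "\<alpha> \<in> cells PT a b" "\<alpha>' \<in> cells PT a b" "\<beta> \<in> cells PT b c" "\<beta>' \<in> cells PT b c"
      "Trg PT \<alpha> = Src PT \<alpha>'" "Trg PT \<beta> = Src PT \<beta>'"
    obtain x x' y y' u u' w w' where e: "\<alpha> = (a, b, x, u)" "\<alpha>' = (a, b, x', u')" "\<beta> = (b, c, y, w)" "\<beta>' = (b, c, y', w')"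
      using h by (cases \<alpha>, cases \<alpha>', cases \<beta>, cases \<beta>') (auto simp: hom_def[of "hcat PT"])
    have "(y' \<diamondop> y) \<star> (x' \<diamondop> x) = (y' \<star> x') \<diamondop> (y \<star> x)"
      by (rule interchange[where X = "d0 a" and Y = "d0 b" and Z = "d0 c"])
        (use h in \<open>auto simp: e hom_def[of "hcat PT"]\<close>)
    moreover have "(w' \<diamondop> w) \<star> (u' \<diamondop> u) = (w' \<star> u') \<diamondop> (w \<star> u)"
      by (rule interchange[where X = "d1 a" and Y = "d1 b" and Z = "d1 c"])
        (use h in \<open>auto simp: e hom_def[of "hcat PT"]\<close>)
    ultimately show "(\<beta>' \<diamondop>\<^bsub>PT\<^esub> \<beta>) \<star>\<^bsub>PT\<^esub> (\<alpha>' \<diamondop>\<^bsub>PT\<^esub> \<alpha>) = (\<beta>' \<star>\<^bsub>PT\<^esub> \<alpha>') \<diamondop>\<^bsub>PT\<^esub> (\<beta> \<star>\<^bsub>PT\<^esub> \<alpha>)"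
      by (simp add: e)
  qed
qed

abbreviation "src \<equiv> pair_fst PT d0"
abbreviation "tgt \<equiv> pair_snd PT d1"

lemma src_tgt_simps [simp]:
  "x \<in> Os \<Longrightarrow> fob src x = d0 x" "(x, y, u, v) \<in> Ar PT \<Longrightarrow> far src (x, y, u, v) = u"
  "(x, y, \<alpha>, \<beta>) \<in> Ce PT \<Longrightarrow> fce src (x, y, \<alpha>, \<beta>) = \<alpha>"
  "x \<in> Os \<Longrightarrow> fob tgt x = d1 x" "(x, y, u, v) \<in> Ar PT \<Longrightarrow> far tgt (x, y, u, v) = v"
  "(x, y, \<alpha>, \<beta>) \<in> Ce PT \<Longrightarrow> fce tgt (x, y, \<alpha>, \<beta>) = \<beta>"
  by (simp_all add: pair_fst_def pair_snd_def)

lemma two_functor_src_tgt: "two_functor PT K src" "two_functor PT K tgt"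
proof -
  have tc: "two_category K" by unfold_locales
  note I = two_functorI[OF PT_two_category tc]
  interpret PT: two_category PT by (rule PT_two_category)
  show "two_functor PT K src"
  proof (rule I)
    show "fob src \<in> extensional (Ob PT)" "far src \<in> extensional (Ar PT)" "fce src \<in> extensional (Ce PT)"
      by (simp_all add: pair_fst_def)
    fix \<alpha> assume a: "\<alpha> \<in> Ce PT"
    obtain x y c d where e: "\<alpha> = (x, y, c, d)" by (cases \<alpha>)
    note s = PT.cell_arr(1,2)[OF a]
    show "fce src \<alpha> \<in> Ce K" "Src K (fce src \<alpha>) = far src (Src PT \<alpha>)" "Trg K (fce src \<alpha>) = far src (Trg PT \<alpha>)"
      using a s by (auto simp: e hom_def simp del: PT_Ar PT_Ce) (simp_all add: hom_def)
    fix \<beta> assume b: "\<beta> \<in> Ce PT"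
    obtain x' y' c' d' where e': "\<beta> = (x', y', c', d')" by (cases \<beta>)
    show "fce src (\<beta> \<star>\<^bsub>PT\<^esub> \<alpha>) = fce src \<beta> \<star> fce src \<alpha>" if "Dom PT (Src PT \<beta>) = Cod PT (Src PT \<alpha>)"
      using PT.hcomp_cell(1)[OF a b that] a b by (simp add: e e' del: PT_Ar PT_Ce)
    show "fce src (\<beta> \<diamondop>\<^bsub>PT\<^esub> \<alpha>) = fce src \<beta> \<diamondop> fce src \<alpha>" if "Src PT \<beta> = Trg PT \<alpha>"
      using PT.vcomp_cell(1)[OF a b that] a b by (simp add: e e' del: PT_Ar PT_Ce)
  next
    fix f assume f: "f \<in> Ar PT"
    obtain x y c d where e: "f = (x, y, c, d)" by (cases f)
    show "Dom K (far src f) = fob src (Dom PT f)" "Cod K (far src f) = fob src (Cod PT f)" "fce src (Id2 PT f) = Id2 K (far src f)"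
      using f PT.id2_cell(1)[OF f] by (simp_all add: e hom_def)
  next
    fix x assume x: "x \<in> Ob PT"
    show "fob src x \<in> Ob K" "far src (Idn PT x) = Idn K (fob src x)"
      using x PT.idn_arr(1)[OF x] d_Ob by (simp_all del: PT_Ar)
  qed
  show "two_functor PT K tgt"
  proof (rule I)
    show "fob tgt \<in> extensional (Ob PT)" "far tgt \<in> extensional (Ar PT)" "fce tgt \<in> extensional (Ce PT)"
      by (simp_all add: pair_snd_def)
    fix \<alpha> assume a: "\<alpha> \<in> Ce PT"
    obtain x y c d where e: "\<alpha> = (x, y, c, d)" by (cases \<alpha>)
    note s = PT.cell_arr(1,2)[OF a]
    show "fce tgt \<alpha> \<in> Ce K" "Src K (fce tgt \<alpha>) = far tgt (Src PT \<alpha>)" "Trg K (fce tgt \<alpha>) = far tgt (Trg PT \<alpha>)"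
      using a s by (auto simp: e hom_def simp del: PT_Ar PT_Ce) (simp_all add: hom_def)
    fix \<beta> assume b: "\<beta> \<in> Ce PT"
    obtain x' y' c' d' where e': "\<beta> = (x', y', c', d')" by (cases \<beta>)
    show "fce tgt (\<beta> \<star>\<^bsub>PT\<^esub> \<alpha>) = fce tgt \<beta> \<star> fce tgt \<alpha>" if "Dom PT (Src PT \<beta>) = Cod PT (Src PT \<alpha>)"
      using PT.hcomp_cell(1)[OF a b that] a b by (simp add: e e' del: PT_Ar PT_Ce)
    show "fce tgt (\<beta> \<diamondop>\<^bsub>PT\<^esub> \<alpha>) = fce tgt \<beta> \<diamondop> fce tgt \<alpha>" if "Src PT \<beta> = Trg PT \<alpha>"
      using PT.vcomp_cell(1)[OF a b that] a b by (simp add: e e' del: PT_Ar PT_Ce)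
  next
    fix f assume f: "f \<in> Ar PT"
    obtain x y c d where e: "f = (x, y, c, d)" by (cases f)
    show "Dom K (far tgt f) = fob tgt (Dom PT f)" "Cod K (far tgt f) = fob tgt (Cod PT f)" "fce tgt (Id2 PT f) = Id2 K (far tgt f)"
      using f PT.id2_cell(1)[OF f] by (simp_all add: e hom_def)
  next
    fix x assume x: "x \<in> Ob PT"
    show "fob tgt x \<in> Ob K" "far tgt (Idn PT x) = Idn K (fob tgt x)"
      using x PT.idn_arr(1)[OF x] d_Ob by (simp_all del: PT_Ar)
  qed
qed

end

section \<open>Double 2-category structures on 2-categories of pairs\<close>

context pair_data begin

abbreviation "PP \<equiv> fibprod PT PT src tgt"

text \<open>A double structure on a 2-category of pairs is given by its values on objects: an arrow or a 2-cell
  of pairs is determined by its end points and its two components, and the source and target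
  2-functors read off the components.\<close>

definition mk_ide :: "('o \<Rightarrow> 'x) \<Rightarrow> ('o, 'x, 'a, 'x \<times> 'x \<times> 'a \<times> 'a, 'c, 'x \<times> 'x \<times> 'c \<times> 'c) twofun" where
  "mk_ide i = \<lparr>fob = (\<lambda>X\<in>Ob K. i X), far = (\<lambda>u\<in>Ar K. (i (Dom K u), i (Cod K u), u, u)),
     fce = (\<lambda>\<alpha>\<in>Ce K. (i (Dom K (Src K \<alpha>)), i (Cod K (Src K \<alpha>)), \<alpha>, \<alpha>))\<rparr>"

definition mk_cmp :: "('x \<Rightarrow> 'x \<Rightarrow> 'x) \<Rightarrow> ('x \<times> 'x, 'x, ('x \<times> 'x \<times> 'a \<times> 'a) \<times> ('x \<times> 'x \<times> 'a \<times> 'a), 'x \<times> 'x \<times> 'a \<times> 'a,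
    ('x \<times> 'x \<times> 'c \<times> 'c) \<times> ('x \<times> 'x \<times> 'c \<times> 'c), 'x \<times> 'x \<times> 'c \<times> 'c) twofun" where
  "mk_cmp m = \<lparr>fob = (\<lambda>(y, x)\<in>Ob PP. m y x),
     far = (\<lambda>((y, y', v, w), (x, x', u, v'))\<in>Ar PP. (m y x, m y' x', u, w)),
     fce = (\<lambda>((y, y', \<beta>, \<gamma>), (x, x', \<alpha>, \<beta>'))\<in>Ce PP. (m y x, m y' x', \<alpha>, \<gamma>))\<rparr>"

text \<open>The requirements on the values on objects. Apart from the unit and associativity laws, they say that
  identities and composites are natural with respect to all 2-cells.\<close>

definition is_double :: "('o \<Rightarrow> 'x) \<Rightarrow> ('x \<Rightarrow> 'x \<Rightarrow> 'x) \<Rightarrow> bool" where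
  "is_double i m \<longleftrightarrow>
     (\<forall>X\<in>Ob K. i X \<in> Os \<and> d0 (i X) = X \<and> d1 (i X) = X) \<and>
     (\<forall>X\<in>Ob K. \<forall>Y\<in>Ob K. \<forall>\<alpha>\<in>cells K X Y. S (i X) (i Y) \<alpha> \<alpha>) \<and>
     (\<forall>y\<in>Os. \<forall>x\<in>Os. d0 y = d1 x \<longrightarrow> m y x \<in> Os \<and> d0 (m y x) = d0 x \<and> d1 (m y x) = d1 y) \<and>
     (\<forall>y\<in>Os. \<forall>x\<in>Os. \<forall>y'\<in>Os. \<forall>x'\<in>Os. d0 y = d1 x \<and> d0 y' = d1 x' \<longrightarrow>
        (\<forall>\<alpha>\<in>cells K (d0 x) (d0 x'). \<forall>\<beta>\<in>cells K (d1 x) (d1 x'). \<forall>\<gamma>\<in>cells K (d1 y) (d1 y').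
           S x x' \<alpha> \<beta> \<and> S y y' \<beta> \<gamma> \<longrightarrow> S (m y x) (m y' x') \<alpha> \<gamma>)) \<and>
     (\<forall>x\<in>Os. m (i (d1 x)) x = x \<and> m x (i (d0 x)) = x) \<and>
     (\<forall>z\<in>Os. \<forall>y\<in>Os. \<forall>x\<in>Os. d0 z = d1 y \<and> d0 y = d1 x \<longrightarrow> m (m z y) x = m z (m y x))"

lemma is_doubleD:
  assumes "is_double i m"
  shows "X \<in> Ob K \<Longrightarrow> i X \<in> Os" "X \<in> Ob K \<Longrightarrow> d0 (i X) = X" "X \<in> Ob K \<Longrightarrow> d1 (i X) = X"
    "X \<in> Ob K \<Longrightarrow> Y \<in> Ob K \<Longrightarrow> \<alpha> \<in> cells K X Y \<Longrightarrow> S (i X) (i Y) \<alpha> \<alpha>"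
    "y \<in> Os \<Longrightarrow> x \<in> Os \<Longrightarrow> d0 y = d1 x \<Longrightarrow> m y x \<in> Os"
    "y \<in> Os \<Longrightarrow> x \<in> Os \<Longrightarrow> d0 y = d1 x \<Longrightarrow> d0 (m y x) = d0 x"
    "y \<in> Os \<Longrightarrow> x \<in> Os \<Longrightarrow> d0 y = d1 x \<Longrightarrow> d1 (m y x) = d1 y"
    "y \<in> Os \<Longrightarrow> x \<in> Os \<Longrightarrow> y' \<in> Os \<Longrightarrow> x' \<in> Os \<Longrightarrow> d0 y = d1 x \<Longrightarrow> d0 y' = d1 x' \<Longrightarrow>
       \<alpha> \<in> cells K (d0 x) (d0 x') \<Longrightarrow> \<beta> \<in> cells K (d1 x) (d1 x') \<Longrightarrow> \<gamma> \<in> cells K (d1 y) (d1 y') \<Longrightarrow>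
       S x x' \<alpha> \<beta> \<Longrightarrow> S y y' \<beta> \<gamma> \<Longrightarrow> S (m y x) (m y' x') \<alpha> \<gamma>"
    "x \<in> Os \<Longrightarrow> m (i (d1 x)) x = x" "x \<in> Os \<Longrightarrow> m x (i (d0 x)) = x"
    "z \<in> Os \<Longrightarrow> y \<in> Os \<Longrightarrow> x \<in> Os \<Longrightarrow> d0 z = d1 y \<Longrightarrow> d0 y = d1 x \<Longrightarrow> m (m z y) x = m z (m y x)"
  using assms unfolding is_double_def by blast+

lemma PP_Ob: "(y, x) \<in> Ob PP \<longleftrightarrow> y \<in> Os \<and> x \<in> Os \<and> d0 y = d1 x"
  by auto

lemma PP_Ar: "((y, y', v, w), (x, x', u, v')) \<in> Ar PP \<longleftrightarrow> (y, y', v, w) \<in> Ar PT \<and> (x, x', u, v') \<in> Ar PT \<and> v = v'"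
  by (auto simp del: PT_Ar)

lemma PP_Ce: "((y, y', v, w), (x, x', u, v')) \<in> Ce PP \<longleftrightarrow> (y, y', v, w) \<in> Ce PT \<and> (x, x', u, v') \<in> Ce PT \<and> v = v'"
  by (auto simp del: PT_Ce)

lemma mk_cmp_simps [simp]:
  "(y, x) \<in> Ob PP \<Longrightarrow> fob (mk_cmp m) (y, x) = m y x"
  "((y, y', v, w), (x, x', u, v')) \<in> Ar PP \<Longrightarrow> far (mk_cmp m) ((y, y', v, w), (x, x', u, v')) = (m y x, m y' x', u, w)"
  "((y, y', \<beta>, \<gamma>), (x, x', \<alpha>, \<beta>')) \<in> Ce PP \<Longrightarrow> fce (mk_cmp m) ((y, y', \<beta>, \<gamma>), (x, x', \<alpha>, \<beta>')) = (m y x, m y' x', \<alpha>, \<gamma>)"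
  by (simp_all add: mk_cmp_def del: fibprod_simps)

lemma mk_ide_simps [simp]:
  "X \<in> Ob K \<Longrightarrow> fob (mk_ide i) X = i X"
  "u \<in> Ar K \<Longrightarrow> far (mk_ide i) u = (i (Dom K u), i (Cod K u), u, u)"
  "\<alpha> \<in> Ce K \<Longrightarrow> fce (mk_ide i) \<alpha> = (i (Dom K (Src K \<alpha>)), i (Cod K (Src K \<alpha>)), \<alpha>, \<alpha>)"
  by (simp_all add: mk_ide_def)

lemma PP_ArE:
  assumes "f \<in> Ar PP"
  obtains y y' x x' u v w where "f = ((y, y', v, w), (x, x', u, v))" "(y, y', v, w) \<in> Ar PT" "(x, x', u, v) \<in> Ar PT"
    "d0 y = d1 x" "d0 y' = d1 x'"
proof -
  obtain y y' v w x x' u v' where f: "f = ((y, y', v, w), (x, x', u, v'))" by (metis prod.exhaust)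
  then have "(y, y', v, w) \<in> Ar PT" "(x, x', u, v) \<in> Ar PT" "v' = v" using assms PP_Ar by auto
  moreover from this have "d0 y = d1 x" "d0 y' = d1 x'" by (auto simp: hom_def)
  ultimately show ?thesis using that f by simp
qed

lemma PP_CeE:
  assumes "f \<in> Ce PP"
  obtains y y' x x' u v w where "f = ((y, y', v, w), (x, x', u, v))" "(y, y', v, w) \<in> Ce PT" "(x, x', u, v) \<in> Ce PT"
    "d0 y = d1 x" "d0 y' = d1 x'"
proof -
  obtain y y' v w x x' u v' where f: "f = ((y, y', v, w), (x, x', u, v'))" by (metis prod.exhaust)
  then have "(y, y', v, w) \<in> Ce PT" "(x, x', u, v) \<in> Ce PT" "v' = v" using assms PP_Ce by auto
  moreover from this have "d0 y = d1 x" "d0 y' = d1 x'" by (auto simp: hom_def)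
  ultimately show ?thesis using that f by simp
qed

lemma mk_cmp_Ar:
  assumes D: "is_double i m" and "(y, y', v, w) \<in> Ar PT" "(x, x', u, v) \<in> Ar PT" "d0 y = d1 x" "d0 y' = d1 x'"
  shows "(m y x, m y' x', u, w) \<in> Ar PT"
  using assms is_doubleD(5-7)[OF D] is_doubleD(8)[OF D, of y x y' x' "Id2 K u" "Id2 K v" "Id2 K w"] id2_cells by simp

lemma mk_cmp_Ce:
  assumes D: "is_double i m" and "(y, y', v, w) \<in> Ce PT" "(x, x', u, v) \<in> Ce PT" "d0 y = d1 x" "d0 y' = d1 x'"
  shows "(m y x, m y' x', u, w) \<in> Ce PT"
  using assms is_doubleD(5-7)[OF D] is_doubleD(8)[OF D, of y x y' x' u v w] by simp

lemma mk_ide_Ar: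
  assumes D: "is_double i m" and "u \<in> Ar K"
  shows "(i (Dom K u), i (Cod K u), u, u) \<in> Ar PT"
  using assms is_doubleD(1-3)[OF D] is_doubleD(4)[OF D, of "Dom K u" "Cod K u" "Id2 K u"]
  by (simp add: hom_def Dom_Ob Cod_Ob)

lemma mk_ide_Ce:
  assumes D: "is_double i m" and "u \<in> Ce K"
  shows "(i (Dom K (Src K u)), i (Cod K (Src K u)), u, u) \<in> Ce PT"
  using assms is_doubleD(1-4)[OF D] by (simp add: hom_def Dom_Ob Cod_Ob)

lemma two_functor_mk_ide:
  assumes D: "is_double i m"
  shows "two_functor K PT (mk_ide i)"
proof (rule two_functorI)
  show "two_category K" by unfold_locales
  show "two_category PT" by (rule PT_two_category)
  show "fob (mk_ide i) \<in> extensional (Ob K)" "far (mk_ide i) \<in> extensional (Ar K)" "fce (mk_ide i) \<in> extensional (Ce K)"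
    by (simp_all add: mk_ide_def)
  fix \<alpha> assume a: "\<alpha> \<in> Ce K"
  show "fce (mk_ide i) \<alpha> \<in> Ce PT" using mk_ide_Ce[OF D a] a by simp
  show "Src PT (fce (mk_ide i) \<alpha>) = far (mk_ide i) (Src K \<alpha>)" "Trg PT (fce (mk_ide i) \<alpha>) = far (mk_ide i) (Trg K \<alpha>)"
    using a by simp_all
  fix \<beta> assume b: "\<beta> \<in> Ce K"
  show "fce (mk_ide i) (\<beta> \<star> \<alpha>) = fce (mk_ide i) \<beta> \<star>\<^bsub>PT\<^esub> fce (mk_ide i) \<alpha>" if "Dom K (Src K \<beta>) = Cod K (Src K \<alpha>)"
    using a b that by simp
  show "fce (mk_ide i) (\<beta> \<diamondop> \<alpha>) = fce (mk_ide i) \<beta> \<diamondop>\<^bsub>PT\<^esub> fce (mk_ide i) \<alpha>" if "Src K \<beta> = Trg K \<alpha>"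
    using a b that by simp
qed (use is_doubleD[OF D] in \<open>simp_all add: Dom_Ob Cod_Ob\<close>)

lemma two_functor_mk_cmp:
  assumes D: "is_double i m"
  shows "two_functor PP PT (mk_cmp m)"
proof -
  have ext: "fob (mk_cmp m) \<in> extensional (Ob PP)" "far (mk_cmp m) \<in> extensional (Ar PP)" "fce (mk_cmp m) \<in> extensional (Ce PP)"
    by (simp_all add: mk_cmp_def del: fibprod_simps)
  interpret PT: two_category PT by (rule PT_two_category)
  note del [simp del] = fibprod_simps(1-3) PT_Ar PT_Ce
  have ob: "fob (mk_cmp m) xy \<in> Ob PT" if xy: "xy \<in> Ob PP" for xy
  proof -
    obtain y x where e: "xy = (y, x)" by (cases xy)
    show ?thesis using xy is_doubleD(5)[OF D] mk_cmp_simps(1) PP_Ob by (simp add: e)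
  qed
  have ar: "far (mk_cmp m) f \<in> Ar PT \<and> Dom PT (far (mk_cmp m) f) = fob (mk_cmp m) (Dom PP f) \<and>
      Cod PT (far (mk_cmp m) f) = fob (mk_cmp m) (Cod PP f) \<and>
      fce (mk_cmp m) (Id2 PP f) = Id2 PT (far (mk_cmp m) f)" if f: "f \<in> Ar PP" for f
  proof -
    obtain y y' x x' u v w where e: "f = ((y, y', v, w), (x, x', u, v))" "(y, y', v, w) \<in> Ar PT" "(x, x', u, v) \<in> Ar PT"
      "d0 y = d1 x" "d0 y' = d1 x'" using PP_ArE[OF f] by metis
    have "(y, x) \<in> Ob PP" "(y', x') \<in> Ob PP" using e PP_Ob by (simp_all add: PT_Ar)
    moreover have "((y, y', Id2 K v, Id2 K w), (x, x', Id2 K u, Id2 K v)) \<in> Ce PP"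
      using PT.id2_cell(1)[OF e(2)] PT.id2_cell(1)[OF e(3)] PP_Ce by simp
    ultimately show ?thesis using f mk_cmp_Ar[OF D e(2-5)] by (simp add: e(1))
  qed
  have ce: "fce (mk_cmp m) f \<in> Ce PT \<and> Src PT (fce (mk_cmp m) f) = far (mk_cmp m) (Src PP f) \<and>
      Trg PT (fce (mk_cmp m) f) = far (mk_cmp m) (Trg PP f)" if f: "f \<in> Ce PP" for f
  proof -
    obtain y y' x x' u v w where e: "f = ((y, y', v, w), (x, x', u, v))" "(y, y', v, w) \<in> Ce PT" "(x, x', u, v) \<in> Ce PT"
      "d0 y = d1 x" "d0 y' = d1 x'" using PP_CeE[OF f] by metis
    have "((y, y', Src K v, Src K w), (x, x', Src K u, Src K v)) \<in> Ar PP"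
      "((y, y', Trg K v, Trg K w), (x, x', Trg K u, Trg K v)) \<in> Ar PP"
      using PT.cell_arr(1,2)[OF e(2)] PT.cell_arr(1,2)[OF e(3)] PP_Ar by simp_all
    then show ?thesis using f mk_cmp_Ce[OF D e(2-5)] by (simp add: e(1))
  qed
  have idn: "far (mk_cmp m) (Idn PP xy) = Idn PT (fob (mk_cmp m) xy)" if xy: "xy \<in> Ob PP" for xy
  proof -
    obtain y x where e: "xy = (y, x)" by (cases xy)
    have yx: "y \<in> Os" "x \<in> Os" "d0 y = d1 x" using xy PP_Ob e by auto
    have "((y, y, Idn K (d0 y), Idn K (d1 y)), (x, x, Idn K (d0 x), Idn K (d1 x))) \<in> Ar PP"
      using PT.idn_arr(1)[of y] PT.idn_arr(1)[of x] yx PP_Ar by simp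
    then show ?thesis using xy yx is_doubleD(6,7)[OF D, of y x] by (simp add: e)
  qed
  have comp: "far (mk_cmp m) (g \<cdot>\<^bsub>PP\<^esub> f) = far (mk_cmp m) g \<cdot>\<^bsub>PT\<^esub> far (mk_cmp m) f"
    if f: "f \<in> Ar PP" and g: "g \<in> Ar PP" and d: "Dom PP g = Cod PP f" for f g
  proof -
    obtain y y' x x' u v w where e: "f = ((y, y', v, w), (x, x', u, v))" "(y, y', v, w) \<in> Ar PT" "(x, x', u, v) \<in> Ar PT"
      "d0 y = d1 x" "d0 y' = d1 x'" using PP_ArE[OF f] by metis
    obtain z z' t t' a b c where e': "g = ((z, z', b, c), (t, t', a, b))" "(z, z', b, c) \<in> Ar PT" "(t, t', a, b) \<in> Ar PT"
      "d0 z = d1 t" "d0 z' = d1 t'" using PP_ArE[OF g] by metis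
    have zt: "z = y'" "t = x'" using d by (simp_all add: e e')
    have "((y, z', b \<cdot> v, c \<cdot> w), (x, t', a \<cdot> u, b \<cdot> v)) \<in> Ar PP"
      using PT.comp_arr(1)[OF e(2) e'(2)] PT.comp_arr(1)[OF e(3) e'(3)] PP_Ar zt by simp
    then show ?thesis using f g by (simp add: e(1) e'(1) zt)
  qed
  have vc: "fce (mk_cmp m) (g \<diamondop>\<^bsub>PP\<^esub> f) = fce (mk_cmp m) g \<diamondop>\<^bsub>PT\<^esub> fce (mk_cmp m) f"
    if f: "f \<in> Ce PP" and g: "g \<in> Ce PP" and d: "Src PP g = Trg PP f" for f g
  proof -
    obtain y y' x x' u v w where e: "f = ((y, y', v, w), (x, x', u, v))" "(y, y', v, w) \<in> Ce PT" "(x, x', u, v) \<in> Ce PT"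
      "d0 y = d1 x" "d0 y' = d1 x'" using PP_CeE[OF f] by metis
    obtain z z' t t' a b c where e': "g = ((z, z', b, c), (t, t', a, b))" "(z, z', b, c) \<in> Ce PT" "(t, t', a, b) \<in> Ce PT"
      "d0 z = d1 t" "d0 z' = d1 t'" using PP_CeE[OF g] by metis
    have "((y, y', b \<diamondop> v, c \<diamondop> w), (x, x', a \<diamondop> u, b \<diamondop> v)) \<in> Ce PP"
      using PT.vcomp_cell(1)[OF e(2) e'(2)] PT.vcomp_cell(1)[OF e(3) e'(3)] PP_Ce d by (simp add: e e')
    then show ?thesis using f g by (simp add: e(1) e'(1))
  qed
  have hc: "fce (mk_cmp m) (g \<star>\<^bsub>PP\<^esub> f) = fce (mk_cmp m) g \<star>\<^bsub>PT\<^esub> fce (mk_cmp m) f"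
    if f: "f \<in> Ce PP" and g: "g \<in> Ce PP" and d: "Dom PP (Src PP g) = Cod PP (Src PP f)" for f g
  proof -
    obtain y y' x x' u v w where e: "f = ((y, y', v, w), (x, x', u, v))" "(y, y', v, w) \<in> Ce PT" "(x, x', u, v) \<in> Ce PT"
      "d0 y = d1 x" "d0 y' = d1 x'" using PP_CeE[OF f] by metis
    obtain z z' t t' a b c where e': "g = ((z, z', b, c), (t, t', a, b))" "(z, z', b, c) \<in> Ce PT" "(t, t', a, b) \<in> Ce PT"
      "d0 z = d1 t" "d0 z' = d1 t'" using PP_CeE[OF g] by metis
    have zt: "z = y'" "t = x'" using d by (simp_all add: e e')
    have "((y, z', b \<star> v, c \<star> w), (x, t', a \<star> u, b \<star> v)) \<in> Ce PP"
      using PT.hcomp_cell(1)[OF e(2) e'(2)] PT.hcomp_cell(1)[OF e(3) e'(3)] PP_Ce zt by simp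
    then show ?thesis using f g by (simp add: e(1) e'(1) zt)
  qed
  show ?thesis
    unfolding two_functor_def is_functor_def hcat_simps vcat_simps
  proof (intro conjI ballI impI)
    show "fob (mk_cmp m) \<in> Ob PP \<rightarrow>\<^sub>E Ob PT" using ext ob unfolding PiE_def Pi_def by blast
    show "far (mk_cmp m) \<in> Ar PP \<rightarrow>\<^sub>E Ar PT" using ext ar unfolding PiE_def Pi_def by blast
    then show "far (mk_cmp m) \<in> Ar PP \<rightarrow>\<^sub>E Ar PT" .
    show "fce (mk_cmp m) \<in> Ce PP \<rightarrow>\<^sub>E Ce PT" using ext ce unfolding PiE_def Pi_def by blast
    then show "fce (mk_cmp m) \<in> Ce PP \<rightarrow>\<^sub>E Ce PT" .
    show "fob (mk_cmp m) \<in> Ob PP \<rightarrow>\<^sub>E Ob PT" using ext ob unfolding PiE_def Pi_def by blast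
  next
    fix f assume f: "f \<in> Ce PP"
    interpret PT: two_category PT by (rule PT_two_category)
    have s: "Src PP f \<in> Ar PP"
    proof -
      obtain y y' x x' u v w where e: "f = ((y, y', v, w), (x, x', u, v))" "(y, y', v, w) \<in> Ce PT" "(x, x', u, v) \<in> Ce PT"
        using PP_CeE[OF f] by metis
      then show ?thesis using PT.cell_arr(1)[OF e(2)] PT.cell_arr(1)[OF e(3)] PP_Ar by simp
    qed
    show "Dom PT (Src PT (fce (mk_cmp m) f)) = fob (mk_cmp m) (Dom PP (Src PP f))"
      "Cod PT (Src PT (fce (mk_cmp m) f)) = fob (mk_cmp m) (Cod PP (Src PP f))"
      using ce[OF f] ar[OF s] by simp_all
  next
    fix X assume X: "X \<in> Ob PP"
    have i: "Idn PP X \<in> Ar PP"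
    proof -
      obtain y x where e: "X = (y, x)" by (cases X)
      have yx: "y \<in> Os" "x \<in> Os" "d0 y = d1 x" using X PP_Ob e by auto
      show ?thesis using PT.idn_arr(1)[of y] PT.idn_arr(1)[of x] yx PP_Ar by (simp add: e)
    qed
    show "fce (mk_cmp m) (Id2 PP (Idn PP X)) = Id2 PT (Idn PT (fob (mk_cmp m) X))"
      using ar[OF i] idn[OF X] by simp
  qed (use ar ce idn comp vc hc in blast)+
qed

abbreviation "double I H \<equiv> \<lparr>D0 = K, D1 = PT, DSrc = src, DTgt = tgt, DIde = I, DCmp = H\<rparr>"

abbreviation "TT \<equiv> fibprod PT PP src (fun_comp PP tgt (proj1 PP))"

lemma dpairs_double: "dpairs (double I H) = PP" "dtriplets (double I H) = TT"
  by (simp_all add: dpairs_def dtriplets_def)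

lemma TT_ObE:
  assumes "t \<in> Ob TT"
  obtains x y z where "t = (z, y, x)" "z \<in> Os" "y \<in> Os" "x \<in> Os" "d0 z = d1 y" "d0 y = d1 x"
proof -
  obtain z q where t: "t = (z, q)" by (cases t)
  obtain y x where q: "q = (y, x)" by (cases q)
  have 1: "z \<in> Os" "q \<in> Ob PP" "fob src z = fob (fun_comp PP tgt (proj1 PP)) q"
    using assms fibprod_simps(1)[of z q PT PP src "fun_comp PP tgt (proj1 PP)"] by (simp_all add: t)
  then have "y \<in> Os" "x \<in> Os" "d0 y = d1 x" using q PP_Ob by auto
  moreover have "d0 z = d1 y"
    using 1 fun_comp_simps(1)[OF 1(2), of tgt "proj1 PP"] calculation by (simp add: q del: fibprod_simps)
  ultimately show ?thesis using 1 t q that by simp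
qed

lemma TT_ArE:
  assumes "t \<in> Ar TT"
  obtains x x' y y' z z' u v w s where "t = ((z, z', w, s), (y, y', v, w), (x, x', u, v))"
    "(z, z', w, s) \<in> Ar PT" "(y, y', v, w) \<in> Ar PT" "(x, x', u, v) \<in> Ar PT"
    "d0 z = d1 y" "d0 y = d1 x" "d0 z' = d1 y'" "d0 y' = d1 x'"
proof -
  obtain c q where t: "t = (c, q)" by (cases t)
  have 1: "c \<in> Ar PT" "q \<in> Ar PP" "far src c = far (fun_comp PP tgt (proj1 PP)) q"
    using assms fibprod_simps(2)[of c q PT PP src "fun_comp PP tgt (proj1 PP)"] by (simp_all add: t)
  obtain y y' x x' u v w where e: "q = ((y, y', v, w), (x, x', u, v))" "(y, y', v, w) \<in> Ar PT" "(x, x', u, v) \<in> Ar PT"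
      "d0 y = d1 x" "d0 y' = d1 x'" using PP_ArE[OF 1(2)] by metis
  obtain z z' w' s where c: "c = (z, z', w', s)" by (cases c)
  have "w' = w"
    using 1 fun_comp_simps(2)[OF 1(2), of tgt "proj1 PP"] e by (simp add: c del: fibprod_simps PT_Ar)
  moreover from this have "d0 z = d1 y" "d0 z' = d1 y'" using 1(1) e(2) c by (auto simp: hom_def)
  ultimately show ?thesis using that 1(1) c t e by simp
qed

lemma TT_CeE:
  assumes "t \<in> Ce TT"
  obtains x x' y y' z z' u v w s where "t = ((z, z', w, s), (y, y', v, w), (x, x', u, v))"
    "(z, z', w, s) \<in> Ce PT" "(y, y', v, w) \<in> Ce PT" "(x, x', u, v) \<in> Ce PT"
    "d0 z = d1 y" "d0 y = d1 x" "d0 z' = d1 y'" "d0 y' = d1 x'"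
proof -
  obtain c q where t: "t = (c, q)" by (cases t)
  have 1: "c \<in> Ce PT" "q \<in> Ce PP" "fce src c = fce (fun_comp PP tgt (proj1 PP)) q"
    using assms fibprod_simps(3)[of c q PT PP src "fun_comp PP tgt (proj1 PP)"] by (simp_all add: t)
  obtain y y' x x' u v w where e: "q = ((y, y', v, w), (x, x', u, v))" "(y, y', v, w) \<in> Ce PT" "(x, x', u, v) \<in> Ce PT"
      "d0 y = d1 x" "d0 y' = d1 x'" using PP_CeE[OF 1(2)] by metis
  obtain z z' w' s where c: "c = (z, z', w', s)" by (cases c)
  have "w' = w"
    using 1 fun_comp_simps(3)[OF 1(2), of tgt "proj1 PP"] e by (simp add: c del: fibprod_simps PT_Ce)
  moreover from this have "d0 z = d1 y" "d0 z' = d1 y'" using 1(1) e(2) c by (auto simp: hom_def)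
  ultimately show ?thesis using that 1(1) c t e by simp
qed

lemma TT_Ob_I: "z \<in> Os \<Longrightarrow> y \<in> Os \<Longrightarrow> x \<in> Os \<Longrightarrow> d0 z = d1 y \<Longrightarrow> d0 y = d1 x \<Longrightarrow> (z, y, x) \<in> Ob TT"
  using fun_comp_simps(1)[of "(y, x)" PP tgt "proj1 PP"] PP_Ob[of y x]
    fibprod_simps(1)[of z "(y, x)" PT PP src "fun_comp PP tgt (proj1 PP)"] by (simp del: fibprod_simps)

lemma double_2categoryI:
  assumes D: "is_double i m"
  shows "double_2category (double (mk_ide i) (mk_cmp m))"
proof -
  let ?I = "mk_ide i" and ?H = "mk_cmp m"
  note del [simp del] = fibprod_simps PT_Ar PT_Ce
  note [simp] = is_doubleD(1-3,5-7,9-10)[OF D] mk_ide_Ar[OF D] mk_ide_Ce[OF D] mk_cmp_Ar[OF D] mk_cmp_Ce[OF D] PP_Ob PP_Ar PP_Ce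
  have arP: "x \<in> Os \<and> y \<in> Os \<and> u \<in> Ar K \<and> v \<in> Ar K \<and> Dom K u = d0 x \<and> Cod K u = d0 y \<and> Dom K v = d1 x \<and> Cod K v = d1 y"
    if "(x, y, u, v) \<in> Ar PT" for x y u v
    using that by (simp add: PT_Ar hom_def)
  have ceP: "x \<in> Os \<and> y \<in> Os \<and> u \<in> Ce K \<and> v \<in> Ce K \<and> Dom K (Src K u) = d0 x \<and> Cod K (Src K u) = d0 y \<and>
      Dom K (Src K v) = d1 x \<and> Cod K (Src K v) = d1 y" if "(x, y, u, v) \<in> Ce PT" for x y u v
    using that by (simp add: PT_Ce hom_def)
  have tc: "two_category K" by unfold_locales
  have 1: "fun_comp K src ?I = fun_id K" "fun_comp K tgt ?I = fun_id K"
    by (rule fun_comp_eq_idI; simp add: Dom_Ob Cod_Ob)+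
  have 2: "fun_comp PP src ?H = fun_comp PP src (proj2 PP)" "fun_comp PP tgt ?H = fun_comp PP tgt (proj1 PP)"
  proof -
    have o: "(\<exists>y x. t = (y, x) \<and> y \<in> Os \<and> x \<in> Os \<and> d0 y = d1 x)" if "t \<in> Ob PP" for t
      using that by (cases t) simp
    show "fun_comp PP src ?H = fun_comp PP src (proj2 PP)" "fun_comp PP tgt ?H = fun_comp PP tgt (proj1 PP)"
      by (rule fun_comp_eqI; (elim PP_ArE PP_CeE)?; (drule o)?; auto)+
  qed
  have 3: "fun_comp PT ?H (pairing PT (fun_comp PT ?I tgt) (fun_id PT)) = fun_id PT"
    "fun_comp PT ?H (pairing PT (fun_id PT) (fun_comp PT ?I src)) = fun_id PT"
  proof -
    have l: "x \<in> Os \<Longrightarrow> d0 x \<in> Ob K" "x \<in> Os \<Longrightarrow> d1 x \<in> Ob K" for x using d_Ob by auto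
    have a: "far ?I v = (i (d1 x), i (d1 y), v, v)" "far ?I u = (i (d0 x), i (d0 y), u, u)"
      "(i (d1 x), i (d1 y), v, v) \<in> Ar PT" "(i (d0 x), i (d0 y), u, u) \<in> Ar PT"
      if "(x, y, u, v) \<in> Ar PT" for x y u v
      using arP[OF that] mk_ide_Ar[OF D, of u] mk_ide_Ar[OF D, of v] by auto
    have c: "fce ?I v = (i (d1 x), i (d1 y), v, v)" "fce ?I u = (i (d0 x), i (d0 y), u, u)"
      "(i (d1 x), i (d1 y), v, v) \<in> Ce PT" "(i (d0 x), i (d0 y), u, u) \<in> Ce PT"
      if "(x, y, u, v) \<in> Ce PT" for x y u v
      using ceP[OF that] mk_ide_Ce[OF D, of u] mk_ide_Ce[OF D, of v] by auto
    show "fun_comp PT ?H (pairing PT (fun_comp PT ?I tgt) (fun_id PT)) = fun_id PT"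
    proof (rule fun_comp_eq_idI)
      fix f assume f: "f \<in> Ar PT"
      obtain x y u v where e: "f = (x, y, u, v)" by (cases f)
      show "far ?H (far (pairing PT (fun_comp PT ?I tgt) (fun_id PT)) f) = f"
        using f a[of x y u v] arP[of x y u v] by (simp add: e)
    next
      fix f assume f: "f \<in> Ce PT"
      obtain x y u v where e: "f = (x, y, u, v)" by (cases f)
      show "fce ?H (fce (pairing PT (fun_comp PT ?I tgt) (fun_id PT)) f) = f"
        using f c[of x y u v] ceP[of x y u v] by (simp add: e)
    qed (simp add: l)
    show "fun_comp PT ?H (pairing PT (fun_id PT) (fun_comp PT ?I src)) = fun_id PT"
    proof (rule fun_comp_eq_idI)
      fix f assume f: "f \<in> Ar PT"
      obtain x y u v where e: "f = (x, y, u, v)" by (cases f)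
      show "far ?H (far (pairing PT (fun_id PT) (fun_comp PT ?I src)) f) = f"
        using f a[of x y u v] arP[of x y u v] by (simp add: e)
    next
      fix f assume f: "f \<in> Ce PT"
      obtain x y u v where e: "f = (x, y, u, v)" by (cases f)
      show "fce ?H (fce (pairing PT (fun_id PT) (fun_comp PT ?I src)) f) = f"
        using f c[of x y u v] ceP[of x y u v] by (simp add: e)
    qed (simp add: l)
  qed
  have 4: "fun_comp TT ?H (pairing TT (fun_comp TT ?H (pairing TT (proj1 TT) (fun_comp TT (proj1 PP) (proj2 TT))))
        (fun_comp TT (proj2 PP) (proj2 TT))) =
      fun_comp TT ?H (pairing TT (proj1 TT) (fun_comp TT ?H (proj2 TT)))"
  proof (rule fun_comp_eqI)
    fix t assume t: "t \<in> Ob TT"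
    then show "fob ?H (fob (pairing TT (fun_comp TT ?H (pairing TT (proj1 TT) (fun_comp TT (proj1 PP) (proj2 TT))))
        (fun_comp TT (proj2 PP) (proj2 TT))) t) =
      fob ?H (fob (pairing TT (proj1 TT) (fun_comp TT ?H (proj2 TT))) t)"
    proof (elim TT_ObE)
      fix x y z assume z: "t = (z, y, x)" "z \<in> Os" "y \<in> Os" "x \<in> Os" "d0 z = d1 y" "d0 y = d1 x"
      show ?thesis using t[unfolded z(1)] z(2-) is_doubleD(11)[OF D, of z y x] by (simp add: z(1))
    qed
  next
    fix t assume t: "t \<in> Ar TT"
    then obtain x x' y y' z z' u v w s where e: "t = ((z, z', w, s), (y, y', v, w), (x, x', u, v))"
      and m: "(z, z', w, s) \<in> Ar PT" "(y, y', v, w) \<in> Ar PT" "(x, x', u, v) \<in> Ar PT"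
      and d: "d0 z = d1 y" "d0 y = d1 x" "d0 z' = d1 y'" "d0 y' = d1 x'"
      by (elim TT_ArE)
    have mm: "(m z y, m z' y', v, s) \<in> Ar PT" "(m y x, m y' x', u, w) \<in> Ar PT"
      using mk_cmp_Ar[OF D m(1,2) d(1,3)] mk_cmp_Ar[OF D m(2,3) d(2,4)] by auto
    show "far ?H (far (pairing TT (fun_comp TT ?H (pairing TT (proj1 TT) (fun_comp TT (proj1 PP) (proj2 TT))))
        (fun_comp TT (proj2 PP) (proj2 TT))) t) =
      far ?H (far (pairing TT (proj1 TT) (fun_comp TT ?H (proj2 TT))) t)"
      using t[unfolded e] m mm d arP[OF m(1)] arP[OF m(2)] arP[OF m(3)] is_doubleD(11)[OF D]
      by (simp add: e)
  next
    fix t assume t: "t \<in> Ce TT"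
    then obtain x x' y y' z z' u v w s where e: "t = ((z, z', w, s), (y, y', v, w), (x, x', u, v))"
      and m: "(z, z', w, s) \<in> Ce PT" "(y, y', v, w) \<in> Ce PT" "(x, x', u, v) \<in> Ce PT"
      and d: "d0 z = d1 y" "d0 y = d1 x" "d0 z' = d1 y'" "d0 y' = d1 x'"
      by (elim TT_CeE)
    have mm: "(m z y, m z' y', v, s) \<in> Ce PT" "(m y x, m y' x', u, w) \<in> Ce PT"
      using mk_cmp_Ce[OF D m(1,2) d(1,3)] mk_cmp_Ce[OF D m(2,3) d(2,4)] by auto
    show "fce ?H (fce (pairing TT (fun_comp TT ?H (pairing TT (proj1 TT) (fun_comp TT (proj1 PP) (proj2 TT))))
        (fun_comp TT (proj2 PP) (proj2 TT))) t) =
      fce ?H (fce (pairing TT (proj1 TT) (fun_comp TT ?H (proj2 TT))) t)"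
      using t[unfolded e] m mm d ceP[OF m(1)] ceP[OF m(2)] ceP[OF m(3)] is_doubleD(11)[OF D]
      by (simp add: e)
  qed
  show ?thesis
    unfolding double_2category_def internal_graph_def Let_def dpairs_double
    using tc PT_two_category two_functor_src_tgt two_functor_mk_ide[OF D] two_functor_mk_cmp[OF D] 1 2 3 4
    by simp
qed

text \<open>The components of the values of \<open>I\<close> and \<open>H\<close> on arrows and 2-cells are forced by the equations for
  source and target, and the equations between objects are those for the laws.\<close>

lemma double_2categoryD:
  assumes D: "double_2category (double I H)"
  defines "i \<equiv> fob I" and "m \<equiv> \<lambda>y x. fob H (y, x)"
  shows "I = mk_ide i" "H = mk_cmp m" "is_double i m"
proof -
  note del [simp del] = fibprod_simps PT_Ar PT_Ce
  note D' = D[unfolded double_2category_def internal_graph_def Let_def dpairs_double, simplified]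
  have FI: "two_functor K PT I" and FH: "two_functor PP PT H" using D' by auto
  note I = two_functorD[OF FI] and H = two_functorD[OF FH]
  have s: "fun_comp K src I = fun_id K" "fun_comp K tgt I = fun_id K"
    "fun_comp PP src H = fun_comp PP src (proj2 PP)" "fun_comp PP tgt H = fun_comp PP tgt (proj1 PP)"
    using D' by auto
  note s1 = fun_comp_eq_idD[OF s(1)] and s2 = fun_comp_eq_idD[OF s(2)]
  note s3 = fun_comp_eqD[OF s(3)] and s4 = fun_comp_eqD[OF s(4)]
  have u: "fun_comp PT H (pairing PT (fun_comp PT I tgt) (fun_id PT)) = fun_id PT"
    "fun_comp PT H (pairing PT (fun_id PT) (fun_comp PT I src)) = fun_id PT"
    using D' by auto
  have as: "fun_comp TT H (pairing TT (fun_comp TT H (pairing TT (proj1 TT) (fun_comp TT (proj1 PP) (proj2 TT))))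
        (fun_comp TT (proj2 PP) (proj2 TT))) =
      fun_comp TT H (pairing TT (proj1 TT) (fun_comp TT H (proj2 TT)))"
    using D' by auto
  have iO: "i X \<in> Os" "d0 (i X) = X" "d1 (i X) = X" if "X \<in> Ob K" for X
    using I(1)[of X] s1(1)[of X] s2(1)[of X] that by (simp_all add: i_def)
  have ifar: "far I u = (i (Dom K u), i (Cod K u), u, u)" if f: "u \<in> Ar K" for u
  proof -
    obtain a b c d where e: "far I u = (a, b, c, d)" by (cases "far I u")
    then show ?thesis using I(2-4)[OF f] s1(2)[OF f] s2(2)[OF f] by (simp add: i_def)
  qed
  have ifce: "fce I u = (i (Dom K (Src K u)), i (Cod K (Src K u)), u, u)" if f: "u \<in> Ce K" for u
  proof -
    obtain a b c d where e: "fce I u = (a, b, c, d)" by (cases "fce I u")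
    then show ?thesis using I(5-6)[OF f] ifar[of "Src K u"] f s1(3)[OF f] s2(3)[OF f] by simp
  qed
  show Im: "I = mk_ide i"
  proof (rule twofun.equality)
    show "fob I = fob (mk_ide i)" using I(13) by (auto simp: mk_ide_def i_def extensional_def)
    show "far I = far (mk_ide i)"
      by (rule extensionalityI[OF I(14)]) (simp_all add: mk_ide_def ifar)
    show "fce I = fce (mk_ide i)"
      by (rule extensionalityI[OF I(15)]) (simp_all add: mk_ide_def ifce)
  qed simp
  have mO: "m y x \<in> Os" "d0 (m y x) = d0 x" "d1 (m y x) = d1 y" if "y \<in> Os" "x \<in> Os" "d0 y = d1 x" for y x
    using H(1)[of "(y, x)"] s3(1)[of "(y, x)"] s4(1)[of "(y, x)"] that by (simp_all add: m_def PP_Ob)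
  have hfar: "far H ((y, y', v, w), (x, x', u, v)) = (m y x, m y' x', u, w)"
    if f: "((y, y', v, w), (x, x', u, v)) \<in> Ar PP" for y y' v w x x' u
  proof -
    obtain a b c d where e: "far H ((y, y', v, w), (x, x', u, v)) = (a, b, c, d)" by (cases "far H ((y, y', v, w), (x, x', u, v))")
    have "(y, y', v, w) \<in> Ar PT" "(x, x', u, v) \<in> Ar PT" using f PP_Ar by auto
    then show ?thesis using e f H(2-4)[OF f] s3(2)[OF f] s4(2)[OF f] by (simp add: m_def fibprod_simps(4,5))
  qed
  have hfce: "fce H ((y, y', v, w), (x, x', u, v)) = (m y x, m y' x', u, w)"
    if f: "((y, y', v, w), (x, x', u, v)) \<in> Ce PP" for y y' v w x x' u
  proof -
    obtain a b c d where e: "fce H ((y, y', v, w), (x, x', u, v)) = (a, b, c, d)" by (cases "fce H ((y, y', v, w), (x, x', u, v))")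
    have p: "(y, y', v, w) \<in> Ce PT" "(x, x', u, v) \<in> Ce PT" using f PP_Ce by auto
    interpret PT: two_category PT by (rule PT_two_category)
    have "((y, y', Src K v, Src K w), (x, x', Src K u, Src K v)) \<in> Ar PP"
      using PT.cell_arr(1)[OF p(1)] PT.cell_arr(1)[OF p(2)] PP_Ar by simp
    then show ?thesis using e f p H(5-6)[OF f] hfar s3(3)[OF f] s4(3)[OF f] by (simp add: fibprod_simps(8))
  qed
  show Hm: "H = mk_cmp m"
  proof (rule twofun.equality)
    show "fob H = fob (mk_cmp m)"
      by (rule extensionalityI[OF H(13)]) (auto simp: mk_cmp_def m_def)
    show "far H = far (mk_cmp m)"
    proof (rule extensionalityI[OF H(14)])
      show "far (mk_cmp m) \<in> extensional (Ar PP)" by (simp add: mk_cmp_def)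
      show "far H t = far (mk_cmp m) t" if "t \<in> Ar PP" for t
        using PP_ArE[OF that] that hfar mk_cmp_simps(2) by metis
    qed
    show "fce H = fce (mk_cmp m)"
    proof (rule extensionalityI[OF H(15)])
      show "fce (mk_cmp m) \<in> extensional (Ce PP)" by (simp add: mk_cmp_def)
      show "fce H t = fce (mk_cmp m) t" if "t \<in> Ce PP" for t
        using PP_CeE[OF that] that hfce mk_cmp_simps(3) by metis
    qed
  qed simp
  show "is_double i m"
    unfolding is_double_def
  proof (intro conjI ballI impI)
    show "i X \<in> Os" "d0 (i X) = X" "d1 (i X) = X" if "X \<in> Ob K" for X using iO that by auto
    show "S (i X) (i Y) \<alpha> \<alpha>" if "\<alpha> \<in> cells K X Y" for X Y \<alpha>
      using I(5)[of \<alpha>] ifce[of \<alpha>] that by (simp add: hom_def PT_Ce)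
    fix y x assume yx: "y \<in> Os" "x \<in> Os"
    show "m y x \<in> Os" "d0 (m y x) = d0 x" "d1 (m y x) = d1 y" if "d0 y = d1 x" using mO yx that by auto
    show "m (i (d1 x)) x = x"
      using fun_comp_eq_idD(1)[OF u(1), of x] yx d_Ob[of x] by (simp add: m_def i_def)
    show "m x (i (d0 x)) = x"
      using fun_comp_eq_idD(1)[OF u(2), of x] yx d_Ob[of x] by (simp add: m_def i_def)
    show "m (m z y) x = m z (m y x)" if z: "z \<in> Os" "d0 z = d1 y \<and> d0 y = d1 x" for z
    proof -
      have "(z, y, x) \<in> Ob TT" "(y, x) \<in> Ob PP" using TT_Ob_I z yx PP_Ob by auto
      then show ?thesis using fun_comp_eqD(1)[OF as, of "(z, y, x)"] by (simp add: m_def)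
    qed
    fix y' x' \<alpha> \<beta> \<gamma>
    assume h: "y' \<in> Os" "x' \<in> Os" "d0 y = d1 x \<and> d0 y' = d1 x'" "\<alpha> \<in> cells K (d0 x) (d0 x')"
      "\<beta> \<in> cells K (d1 x) (d1 x')" "\<gamma> \<in> cells K (d1 y) (d1 y')" "S x x' \<alpha> \<beta> \<and> S y y' \<beta> \<gamma>"
    then have "((y, y', \<beta>, \<gamma>), (x, x', \<alpha>, \<beta>)) \<in> Ce PP"
      using yx by (simp add: PP_Ce PT_Ce)
    then show "S (m y x) (m y' x') \<alpha> \<gamma>"
      using H(5) hfce PT_Ce by metis
  qed
qed

lemma mk_ide_cong: "(\<And>X. X \<in> Ob K \<Longrightarrow> i X = i' X) \<Longrightarrow> mk_ide i = mk_ide i'"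
  unfolding mk_ide_def by (auto simp: Dom_Ob Cod_Ob intro!: restrict_ext)

lemma mk_cmp_cong:
  assumes e: "\<And>y x. y \<in> Os \<Longrightarrow> x \<in> Os \<Longrightarrow> d0 y = d1 x \<Longrightarrow> m y x = m' y x"
  shows "mk_cmp m = mk_cmp m'"
proof -
  interpret PT: two_category PT by (rule PT_two_category)
  note del [simp del] = fibprod_simps(1-3)
  have "(case t of (y, x) \<Rightarrow> m y x) = (case t of (y, x) \<Rightarrow> m' y x)" if "t \<in> Ob PP" for t
    using that e PP_Ob by (cases t) simp
  moreover have "(case t of ((y, y', v, w), (x, x', u, v')) \<Rightarrow> (m y x, m y' x', u, w)) =
      (case t of ((y, y', v, w), (x, x', u, v')) \<Rightarrow> (m' y x, m' y' x', u, w))" if t: "t \<in> Ar PP" for t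
    by (rule PP_ArE[OF t]) (auto simp: PT_Ar e)
  moreover have "(case t of ((y, y', v, w), (x, x', u, v')) \<Rightarrow> (m y x, m y' x', u, w)) =
      (case t of ((y, y', v, w), (x, x', u, v')) \<Rightarrow> (m' y x, m' y' x', u, w))" if t: "t \<in> Ce PP" for t
    by (rule PP_CeE[OF t]) (auto simp: PT_Ce e)
  ultimately show ?thesis
    unfolding mk_cmp_def by (auto intro!: restrict_ext)
qed

lemma is_double_cong:
  assumes D: "is_double i m" and i: "\<And>X. X \<in> Ob K \<Longrightarrow> i X = i' X"
    and m: "\<And>y x. y \<in> Os \<Longrightarrow> x \<in> Os \<Longrightarrow> d0 y = d1 x \<Longrightarrow> m y x = m' y x"
  shows "is_double i' m'"
proof -
  note I = is_doubleD[OF D]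
  have u: "m' (i' (d1 x)) x = x" "m' x (i' (d0 x)) = x" if x: "x \<in> Os" for x
    using I(1-3,9,10) i m d_Ob[OF x] x by metis+
  have a: "m' (m' z y) x = m' z (m' y x)" if "z \<in> Os" "y \<in> Os" "x \<in> Os" "d0 z = d1 y" "d0 y = d1 x" for z y x
    using I(5)[OF that(1,2,4)] I(6)[OF that(1,2,4)] I(5)[OF that(2,3,5)] I(7)[OF that(2,3,5)] I(11)[OF that]
      m[OF that(1,2,4)] m[OF that(2,3,5)] m[OF I(5)[OF that(1,2,4)] that(3)] m[OF that(1) I(5)[OF that(2,3,5)]] that
    by simp
  show ?thesis
    unfolding is_double_def
  proof (intro conjI ballI impI)
    fix y x y' x' \<alpha> \<beta> \<gamma>
    assume *: "y \<in> Os" "x \<in> Os" "y' \<in> Os" "x' \<in> Os" "d0 y = d1 x \<and> d0 y' = d1 x'" "\<alpha> \<in> cells K (d0 x) (d0 x')"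
      "\<beta> \<in> cells K (d1 x) (d1 x')" "\<gamma> \<in> cells K (d1 y) (d1 y')" "S x x' \<alpha> \<beta> \<and> S y y' \<beta> \<gamma>"
    then show "S (m' y x) (m' y' x') \<alpha> \<gamma>"
      using I(8)[OF *(1-4) _ _ *(6-8)] m[OF *(1,2)] m[OF *(3,4)] by simp
  next
    fix X assume X: "X \<in> Ob K"
    show "i' X \<in> Os" "d0 (i' X) = X" "d1 (i' X) = X" using I(1-3)[OF X] i[OF X] by simp_all
    fix Y \<alpha> assume "Y \<in> Ob K" "\<alpha> \<in> cells K X Y"
    then show "S (i' X) (i' Y) \<alpha> \<alpha>" using I(4)[OF X] i[OF X] i by metis
  next
    fix y x assume *: "y \<in> Os" "x \<in> Os" "d0 y = d1 x"
    then show "m' y x \<in> Os" "d0 (m' y x) = d0 x" "d1 (m' y x) = d1 y"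
      using I(5-7)[OF *] m[OF *] by simp_all
  qed (use u a in blast)+
qed

end

section \<open>Arrows and p-fibrations\<close>

context two_category begin

lemma square_iff:
  assumes "f \<in> Ar K" "g \<in> Ar K" "u \<in> hom K (Dom K f) (Dom K g)" "v \<in> hom K (Cod K f) (Cod K g)"
  shows "Id2 K g \<star> Id2 K u = Id2 K v \<star> Id2 K f \<longleftrightarrow> g \<cdot> u = v \<cdot> f"
  using assms id2_inj[of "g \<cdot> u" "v \<cdot> f"] by (auto simp: hom_def)

lemma triangle_iff:
  assumes "f \<in> Ar K" "g \<in> Ar K" "u \<in> hom K (Dom K f) (Dom K g)"
  shows "Id2 K g \<star> Id2 K u = Id2 K f \<longleftrightarrow> g \<cdot> u = f"
  using assms id2_inj[of "g \<cdot> u" f] by (auto simp: hom_def)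

lemma square_boundary:
  assumes "f \<in> Ar K" "g \<in> Ar K" "\<alpha> \<in> cells K (Dom K f) (Dom K g)" "\<beta> \<in> cells K (Cod K f) (Cod K g)"
    and e: "Id2 K g \<star> \<alpha> = \<beta> \<star> Id2 K f"
  shows "Id2 K g \<star> Id2 K (Src K \<alpha>) = Id2 K (Src K \<beta>) \<star> Id2 K f"
    "Id2 K g \<star> Id2 K (Trg K \<alpha>) = Id2 K (Trg K \<beta>) \<star> Id2 K f"
  using arg_cong[OF e, of "Src K"] arg_cong[OF e, of "Trg K"] assms(1-4) by (auto simp: hom_def)

lemma triangle_boundary:
  assumes "f \<in> Ar K" "g \<in> Ar K" "\<alpha> \<in> cells K (Dom K f) (Dom K g)" and e: "Id2 K g \<star> \<alpha> = Id2 K f"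
  shows "Id2 K g \<star> Id2 K (Src K \<alpha>) = Id2 K f" "Id2 K g \<star> Id2 K (Trg K \<alpha>) = Id2 K f"
  using arg_cong[OF e, of "Src K"] arg_cong[OF e, of "Trg K"] assms(1-3) by (auto simp: hom_def)

lemma square_hcomp:
  assumes "f \<in> Ar K" "g \<in> Ar K" "h \<in> Ar K" "\<alpha> \<in> cells K (Dom K f) (Dom K g)" "\<beta> \<in> cells K (Cod K f) (Cod K g)"
    "\<alpha>' \<in> cells K (Dom K g) (Dom K h)" "\<beta>' \<in> cells K (Cod K g) (Cod K h)"
    and e: "Id2 K g \<star> \<alpha> = \<beta> \<star> Id2 K f" and e': "Id2 K h \<star> \<alpha>' = \<beta>' \<star> Id2 K g"
  shows "Id2 K h \<star> (\<alpha>' \<star> \<alpha>) = (\<beta>' \<star> \<beta>) \<star> Id2 K f"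
proof -
  have "Id2 K h \<star> (\<alpha>' \<star> \<alpha>) = (Id2 K h \<star> \<alpha>') \<star> \<alpha>" using assms(1-7) by (simp add: hom_def hcomp_assoc)
  also have "\<dots> = \<beta>' \<star> (Id2 K g \<star> \<alpha>)" unfolding e' using assms(1-7) by (simp add: hom_def hcomp_assoc)
  also have "\<dots> = (\<beta>' \<star> \<beta>) \<star> Id2 K f" unfolding e using assms(1-7) by (simp add: hom_def hcomp_assoc)
  finally show ?thesis .
qed

lemma triangle_hcomp:
  assumes "f \<in> Ar K" "g \<in> Ar K" "h \<in> Ar K" "\<alpha> \<in> cells K (Dom K f) (Dom K g)" "\<alpha>' \<in> cells K (Dom K g) (Dom K h)"
    and e: "Id2 K g \<star> \<alpha> = Id2 K f" and e': "Id2 K h \<star> \<alpha>' = Id2 K g" "Cod K h = Cod K g"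
  shows "Id2 K h \<star> (\<alpha>' \<star> \<alpha>) = Id2 K f"
proof -
  have "Id2 K h \<star> (\<alpha>' \<star> \<alpha>) = (Id2 K h \<star> \<alpha>') \<star> \<alpha>" using assms(1-5) by (simp add: hom_def hcomp_assoc)
  also have "\<dots> = Id2 K f" using e e' by simp
  finally show ?thesis .
qed

lemma square_vcomp:
  assumes "f \<in> Ar K" "g \<in> Ar K" "\<alpha> \<in> cells K (Dom K f) (Dom K g)" "\<beta> \<in> cells K (Cod K f) (Cod K g)"
    "\<alpha>' \<in> cells K (Dom K f) (Dom K g)" "\<beta>' \<in> cells K (Cod K f) (Cod K g)"
    and e: "Id2 K g \<star> \<alpha> = \<beta> \<star> Id2 K f" and e': "Id2 K g \<star> \<alpha>' = \<beta>' \<star> Id2 K f"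
    and s: "Src K \<alpha>' = Trg K \<alpha>" "Src K \<beta>' = Trg K \<beta>"
  shows "Id2 K g \<star> (\<alpha>' \<diamondop> \<alpha>) = (\<beta>' \<diamondop> \<beta>) \<star> Id2 K f"
  using whisker_vcomp(1)[of \<alpha> \<alpha>' g] whisker_vcomp(2)[of \<beta> \<beta>' f] assms(1-6) e e' s by (auto simp: hom_def)

lemma triangle_vcomp:
  assumes "f \<in> Ar K" "g \<in> Ar K" "\<alpha> \<in> cells K (Dom K f) (Dom K g)" "\<alpha>' \<in> cells K (Dom K f) (Dom K g)"
    and e: "Id2 K g \<star> \<alpha> = Id2 K f" and e': "Id2 K g \<star> \<alpha>' = Id2 K f" and s: "Src K \<alpha>' = Trg K \<alpha>"
  shows "Id2 K g \<star> (\<alpha>' \<diamondop> \<alpha>) = Id2 K f"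
  using whisker_vcomp(1)[of \<alpha> \<alpha>' g] assms(1-4) e e' s by (auto simp: hom_def)

lemma is_pullback_types:
  assumes "is_pullback K p v u f"
  shows "p \<in> Ar K" "v \<in> Ar K" "u \<in> Ar K" "f \<in> Ar K" "Dom K u = Dom K f" "Cod K f = Dom K v" "Cod K u = Dom K p"
    "Cod K v = Cod K p" "p \<cdot> u = v \<cdot> f"
  using assms by (auto simp: is_pullback_def hom_def)

end

locale arrows_2category = two_category K for K :: "('o, 'a, 'c) twocat" (structure)
begin

sublocale Arr: pair_data K "Ar K" "Dom K" "Cod K" "\<lambda>f g u v. g \<cdot> u = v \<cdot> f" "\<lambda>f g \<alpha> \<beta>. Id2 K g \<star> \<alpha> = \<beta> \<star> Id2 K f"
proof
qed (use square_iff square_boundary square_hcomp square_vcomp in \<open>simp_all add: Dom_Ob Cod_Ob\<close>)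

lemma arrow2cat_eq: "arrow2cat K = Arr.PT"
  by (simp add: arrow2cat_def)

lemma is_double_arrows: "Arr.is_double (Idn K) (\<lambda>g f. g \<cdot> f)"
  unfolding Arr.is_double_def
proof (intro conjI ballI impI)
  fix g f g' f' \<alpha> \<beta> \<gamma>
  assume h: "g \<in> Ar K" "f \<in> Ar K" "g' \<in> Ar K" "f' \<in> Ar K" "Dom K g = Cod K f \<and> Dom K g' = Cod K f'"
    "\<alpha> \<in> cells K (Dom K f) (Dom K f')" "\<beta> \<in> cells K (Cod K f) (Cod K f')" "\<gamma> \<in> cells K (Cod K g) (Cod K g')"
    and e: "Id2 K f' \<star> \<alpha> = \<beta> \<star> Id2 K f \<and> Id2 K g' \<star> \<beta> = \<gamma> \<star> Id2 K g"
  have "Id2 K (g' \<cdot> f') \<star> \<alpha> = Id2 K g' \<star> (Id2 K f' \<star> \<alpha>)"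
    using h by (auto simp: hom_def hcomp_assoc id2_hcomp[symmetric] simp del: id2_hcomp)
  also have "\<dots> = (Id2 K g' \<star> \<beta>) \<star> Id2 K f"
    unfolding conjunct1[OF e] using h by (auto simp: hom_def hcomp_assoc)
  also have "\<dots> = (\<gamma> \<star> Id2 K g) \<star> Id2 K f" using e by simp
  also have "\<dots> = \<gamma> \<star> Id2 K (g \<cdot> f)"
    using h by (auto simp: hom_def hcomp_assoc id2_hcomp[symmetric] simp del: id2_hcomp)
  finally show "Id2 K (g' \<cdot> f') \<star> \<alpha> = \<gamma> \<star> Id2 K (g \<cdot> f)" .
next
  fix h g f assume "h \<in> Ar K" "g \<in> Ar K" "f \<in> Ar K" "Dom K h = Cod K g \<and> Dom K g = Cod K f"
  then show "(h \<cdot> g) \<cdot> f = h \<cdot> g \<cdot> f" by (simp add: comp_assoc)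
qed (auto simp: hom_def)

lemma DK_eq: "DK K = Arr.double (Arr.mk_ide (Idn K)) (Arr.mk_cmp (\<lambda>g f. g \<cdot> f))"
  by (simp add: DK_def Let_def arrow2cat_eq Arr.mk_ide_def Arr.mk_cmp_def)

lemma double_2category_DK: "double_2category (DK K)"
  unfolding DK_eq by (rule Arr.double_2categoryI[OF is_double_arrows])

end

locale fibrations = arrows_2category +
  fixes p :: 'b
begin

abbreviation "fib \<equiv> {(f, u, v). is_pullback K p v u f}"

abbreviation (input) "fdm \<equiv> \<lambda>(f, u, v). Dom K f"
abbreviation (input) "fcd \<equiv> \<lambda>(f, u, v). Cod K f"
abbreviation (input) "fsq \<equiv> \<lambda>(f1, u1, v1) (f2, u2, v2) u v. f2 \<cdot> u = v \<cdot> f1 \<and> u2 \<cdot> u = u1 \<and> v2 \<cdot> v = v1"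
abbreviation (input) "fcl \<equiv> \<lambda>(f1, u1, v1) (f2, u2, v2) \<alpha> \<beta>.
  Id2 K f2 \<star> \<alpha> = \<beta> \<star> Id2 K f1 \<and> Id2 K u2 \<star> \<alpha> = Id2 K u1 \<and> Id2 K v2 \<star> \<beta> = Id2 K v1"

sublocale Fib: pair_data K fib fdm fcd fsq fcl
proof
  fix x assume "x \<in> fib"
  then obtain f u v where x: "x = (f, u, v)" "is_pullback K p v u f" by auto
  note t = is_pullback_types[OF x(2)]
  show "(fdm x) \<in> Ob K \<and> (fcd x) \<in> Ob K"
    using t by (simp add: x Dom_Ob Cod_Ob)
  show "fcl x x
      (Id2 K (Idn K (fdm x))) (Id2 K (Idn K (fcd x)))"
    using t by (simp add: x)
  fix y assume "y \<in> fib"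
  then obtain f' u' v' where y: "y = (f', u', v')" "is_pullback K p v' u' f'" by auto
  note t' = is_pullback_types[OF y(2)]
  {
    fix s r assume "s \<in> hom K (fdm x) (fdm y)"
      "r \<in> hom K (fcd x) (fcd y)"
    then have "s \<in> hom K (Dom K f) (Dom K f')" "r \<in> hom K (Cod K f) (Cod K f')" by (simp_all add: x y)
    then show "fsq x y s r =
      fcl x
       y (Id2 K s) (Id2 K r)"
      using square_iff[of f f' s r] triangle_iff[of u u' s] triangle_iff[of v v' r] t t' by (simp add: x y)
  next
    fix \<alpha> \<beta> assume "\<alpha> \<in> cells K (fdm x) (fdm y)"
      "\<beta> \<in> cells K (fcd x) (fcd y)"
    then have ab: "\<alpha> \<in> cells K (Dom K f) (Dom K f')" "\<beta> \<in> cells K (Cod K f) (Cod K f')" by (simp_all add: x y)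
    assume "fcl x
       y \<alpha> \<beta>"
    then have s: "Id2 K f' \<star> \<alpha> = \<beta> \<star> Id2 K f" "Id2 K u' \<star> \<alpha> = Id2 K u" "Id2 K v' \<star> \<beta> = Id2 K v" by (simp_all add: x y)
    show "fcl x
       y (Id2 K (Src K \<alpha>)) (Id2 K (Src K \<beta>)) \<and>
      fcl x
       y (Id2 K (Trg K \<alpha>)) (Id2 K (Trg K \<beta>))"
      using square_boundary[OF t(4) t'(4) ab s(1)] triangle_boundary[of u u' \<alpha>] triangle_boundary[of v v' \<beta>] s ab t t'
      by (simp add: x y del: id2_hcomp)
    fix \<alpha>' \<beta>' assume "\<alpha>' \<in> cells K (fdm x) (fdm y)"
      "\<beta>' \<in> cells K (fcd x) (fcd y)"
    then have ab': "\<alpha>' \<in> cells K (Dom K f) (Dom K f')" "\<beta>' \<in> cells K (Cod K f) (Cod K f')" by (simp_all add: x y)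
    assume "fcl x
       y \<alpha>' \<beta>'" "Src K \<alpha>' = Trg K \<alpha>" "Src K \<beta>' = Trg K \<beta>"
    then show "fcl x
       y (\<alpha>' \<diamondop> \<alpha>) (\<beta>' \<diamondop> \<beta>)"
      using square_vcomp[of f f' \<alpha> \<beta> \<alpha>' \<beta>'] triangle_vcomp[of u u' \<alpha> \<alpha>'] triangle_vcomp[of v v' \<beta> \<beta>'] s ab ab' t t'
      by (simp add: x y)
  next
    fix z assume "z \<in> fib"
    then obtain f'' u'' v'' where z: "z = (f'', u'', v'')" "is_pullback K p v'' u'' f''" by auto
    note t'' = is_pullback_types[OF z(2)]
    fix \<alpha> \<beta> assume "\<alpha> \<in> cells K (fdm x) (fdm y)"
      "\<beta> \<in> cells K (fcd x) (fcd y)"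
    then have ab: "\<alpha> \<in> cells K (Dom K f) (Dom K f')" "\<beta> \<in> cells K (Cod K f) (Cod K f')" by (simp_all add: x y)
    fix \<alpha>' \<beta>' assume "\<alpha>' \<in> cells K (fdm y) (fdm z)"
      "\<beta>' \<in> cells K (fcd y) (fcd z)"
    then have ab': "\<alpha>' \<in> cells K (Dom K f') (Dom K f'')" "\<beta>' \<in> cells K (Cod K f') (Cod K f'')" by (simp_all add: y z)
    assume "fcl x
       y \<alpha> \<beta>"
      "fcl y
       z \<alpha>' \<beta>'"
    then show "fcl x
       z (\<alpha>' \<star> \<alpha>) (\<beta>' \<star> \<beta>)"
      using square_hcomp[of f f' f'' \<alpha> \<beta> \<alpha>' \<beta>'] triangle_hcomp[of u u' u'' \<alpha> \<alpha>'] triangle_hcomp[of v v' v'' \<beta> \<beta>'] ab ab' t t' t''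
      by (simp add: x y z)
  }
qed

lemma pfib2cat_eq: "pfib2cat K p = Fib.PT"
  by (simp add: pfib2cat_def)

lemma with_structure_eq: "with_structure (Dp K p) I H = Fib.double I H"
  by (simp add: with_structure_def Dp_def pfib2cat_eq)

lemma two_functor_Up1: "two_functor Fib.PT Arr.PT (Up1 K p)"
proof (rule two_functorI[OF Fib.PT_two_category Arr.PT_two_category])
  interpret PT: two_category Fib.PT by (rule Fib.PT_two_category)
  show "fob (Up1 K p) \<in> extensional (Ob Fib.PT)" "far (Up1 K p) \<in> extensional (Ar Fib.PT)" "fce (Up1 K p) \<in> extensional (Ce Fib.PT)"
    by (simp_all add: Up1_def pfib2cat_eq)
  have ob: "fob (Up1 K p) x = fst x" if "x \<in> Ob Fib.PT" for x
    using that by (cases x) (simp add: Up1_def pfib2cat_eq)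
  have ar: "far (Up1 K p) (x, y, u, v) = (fst x, fst y, u, v)" if "(x, y, u, v) \<in> Ar Fib.PT" for x y u v
    using that by (cases x; cases y) (simp add: Up1_def pfib2cat_eq del: Fib.PT_Ar)
  have ce: "fce (Up1 K p) (x, y, u, v) = (fst x, fst y, u, v)" if "(x, y, u, v) \<in> Ce Fib.PT" for x y u v
    using that by (cases x; cases y) (simp add: Up1_def pfib2cat_eq del: Fib.PT_Ce)
  note del [simp del] = Fib.PT_Ar Fib.PT_Ce
  show "fob (Up1 K p) x \<in> Ob Arr.PT" if x: "x \<in> Ob Fib.PT" for x
    using that ob[OF x] is_pullback_types(4) by (cases x) auto
  show "far (Up1 K p) (Idn Fib.PT x) = Idn Arr.PT (fob (Up1 K p) x)" if x: "x \<in> Ob Fib.PT" for x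
    using that ob[OF x] PT.idn_arr(1)[OF x] ar by (cases x) auto
  show "Dom Arr.PT (far (Up1 K p) f) = fob (Up1 K p) (Dom Fib.PT f)"
    "Cod Arr.PT (far (Up1 K p) f) = fob (Up1 K p) (Cod Fib.PT f)"
    "fce (Up1 K p) (Id2 Fib.PT f) = Id2 Arr.PT (far (Up1 K p) f)" if f: "f \<in> Ar Fib.PT" for f
  proof -
    obtain x y u v where e: "f = (x, y, u, v)" by (cases f)
    have "x \<in> Ob Fib.PT" "y \<in> Ob Fib.PT" using PT.Dom_Ob[OF f] PT.Cod_Ob[OF f] by (simp_all add: e)
    then show "Dom Arr.PT (far (Up1 K p) f) = fob (Up1 K p) (Dom Fib.PT f)"
      "Cod Arr.PT (far (Up1 K p) f) = fob (Up1 K p) (Cod Fib.PT f)"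
      "fce (Up1 K p) (Id2 Fib.PT f) = Id2 Arr.PT (far (Up1 K p) f)"
      using f ar[of x y u v] ob PT.id2_cell(1)[OF f] ce by (simp_all add: e del: Fib.PT_simps(1))
  qed
  fix \<alpha> assume a: "\<alpha> \<in> Ce Fib.PT"
  obtain x y u v where e: "\<alpha> = (x, y, u, v)" by (cases \<alpha>)
  obtain f1 u1 v1 f2 u2 v2 where xy: "x = (f1, u1, v1)" "y = (f2, u2, v2)" by (cases x; cases y)
  have xyt: "f1 \<in> Ar K" "f2 \<in> Ar K"
    using a is_pullback_types(4) by (auto simp: e xy Fib.PT_Ce)
  show "fce (Up1 K p) \<alpha> \<in> Ce Arr.PT"
    using a ce[of x y u v] xyt by (simp add: e) (simp add: Fib.PT_Ce xy)
  show "Src Arr.PT (fce (Up1 K p) \<alpha>) = far (Up1 K p) (Src Fib.PT \<alpha>)"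
    "Trg Arr.PT (fce (Up1 K p) \<alpha>) = far (Up1 K p) (Trg Fib.PT \<alpha>)"
    using a ce[of x y u v] PT.cell_arr(1,2)[OF a] ar by (simp_all add: e)
  fix \<beta> assume b: "\<beta> \<in> Ce Fib.PT"
  obtain x' y' u' v' where e': "\<beta> = (x', y', u', v')" by (cases \<beta>)
  show "fce (Up1 K p) (\<beta> \<star>\<^bsub>Fib.PT\<^esub> \<alpha>) = fce (Up1 K p) \<beta> \<star>\<^bsub>Arr.PT\<^esub> fce (Up1 K p) \<alpha>"
    if "Dom Fib.PT (Src Fib.PT \<beta>) = Cod Fib.PT (Src Fib.PT \<alpha>)"
    using PT.hcomp_cell(1)[OF a b that] a b ce by (simp add: e e')
  show "fce (Up1 K p) (\<beta> \<diamondop>\<^bsub>Fib.PT\<^esub> \<alpha>) = fce (Up1 K p) \<beta> \<diamondop>\<^bsub>Arr.PT\<^esub> fce (Up1 K p) \<alpha>"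
    if "Src Fib.PT \<beta> = Trg Fib.PT \<alpha>"
    using PT.vcomp_cell(1)[OF a b that] a b ce by (simp add: e e')
qed

lemma two_functor_fun_id: "two_functor K K (fun_id K)"
  by (rule two_functorI) (unfold_locales, (simp add: fun_id_def Dom_Ob Cod_Ob)+)

lemma Up1_simps:
  "x \<in> fib \<Longrightarrow> fob (Up1 K p) x = fst x"
  "(x, y, u, v) \<in> Ar Fib.PT \<Longrightarrow> far (Up1 K p) (x, y, u, v) = (fst x, fst y, u, v)"
  "(x, y, \<alpha>, \<beta>) \<in> Ce Fib.PT \<Longrightarrow> fce (Up1 K p) (x, y, \<alpha>, \<beta>) = (fst x, fst y, \<alpha>, \<beta>)"
  by (cases x; cases y; simp add: Up1_def pfib2cat_eq del: Fib.PT_Ar Fib.PT_Ce)+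

text \<open>The forgetful 2-functor does not change the two components of an arrow or a 2-cell. So it preserves the
  double structures as soon as it does on objects, where this is the condition on first components.\<close>

lemma double_structures_iff:
  "(I, H) \<in> double_structures K p \<longleftrightarrow>
    (\<exists>i m. I = Fib.mk_ide i \<and> H = Fib.mk_cmp m \<and> Fib.is_double i m \<and> (\<forall>X\<in>Ob K. fst (i X) = Idn K X) \<and>
      (\<forall>y\<in>fib. \<forall>x\<in>fib. Dom K (fst y) = Cod K (fst x) \<longrightarrow> fst (m y x) = fst y \<cdot> fst x))" (is "?L \<longleftrightarrow> ?R")
proof
  assume L: ?L
  let ?i = "fob I" and ?m = "\<lambda>y x. fob H (y, x)"
  have d: "double_2category (Fib.double I H)"
    and f: "double_2functor (Fib.double I H) (DK K) (fun_id K) (Up1 K p)"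
    using L by (simp_all add: double_structures_def with_structure_eq)
  note D = Fib.double_2categoryD[OF d]
  have 1: "fun_comp K (Up1 K p) I = fun_comp K (Arr.mk_ide (Idn K)) (fun_id K)"
    and 2: "fun_comp Fib.PP (Up1 K p) H = fun_comp Fib.PP (Arr.mk_cmp (\<lambda>g f. g \<cdot> f))
         (pairing Fib.PP (fun_comp Fib.PP (Up1 K p) (proj1 Fib.PP)) (fun_comp Fib.PP (Up1 K p) (proj2 Fib.PP)))"
    using f unfolding double_2functor_def DK_eq Fib.dpairs_double by simp_all
  have "fst (?i X) = Idn K X" if X: "X \<in> Ob K" for X
    using fun_comp_eqD(1)[OF 1 X] X Up1_simps(1)[OF Fib.is_doubleD(1)[OF D(3) X]] by simp
  moreover have "fst (?m y x) = fst y \<cdot> fst x" if yx: "y \<in> fib" "x \<in> fib" "Dom K (fst y) = Cod K (fst x)" for y x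
  proof -
    have d: "fdm y = fcd x"
      using yx by (cases y; cases x) simp
    then have P: "(y, x) \<in> Ob Fib.PP" using yx Fib.PP_Ob by blast
    have A: "(fst y, fst x) \<in> Ob Arr.PP"
      using yx is_pullback_types(4) by (cases y; cases x) auto
    show ?thesis
      using fun_comp_eqD(1)[OF 2 P] P A Up1_simps(1)[OF Fib.is_doubleD(5)[OF D(3) yx(1,2) d]] Up1_simps(1)[OF yx(1)]
        Up1_simps(1)[OF yx(2)]
      by (simp del: fibprod_simps)
  qed
  ultimately show ?R using D by blast
next
  assume ?R
  then obtain i m where im: "I = Fib.mk_ide i" "H = Fib.mk_cmp m" "Fib.is_double i m"
    and i: "\<And>X. X \<in> Ob K \<Longrightarrow> fst (i X) = Idn K X"
    and m: "\<And>y x. y \<in> fib \<Longrightarrow> x \<in> fib \<Longrightarrow> Dom K (fst y) = Cod K (fst x) \<Longrightarrow> fst (m y x) = fst y \<cdot> fst x"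
    by blast
  note D = Fib.double_2categoryI[OF im(3)]
  note del [simp del] = fibprod_simps Fib.PT_Ar Fib.PT_Ce Arr.PT_Ar Arr.PT_Ce
  interpret A: two_category Arr.PT by (rule Arr.PT_two_category)
  interpret P: two_category Fib.PT by (rule Fib.PT_two_category)
  have uob: "fst x \<in> Ar K" "Dom K (fst x) = (fdm x)" "Cod K (fst x) = (fcd x)"
    if "x \<in> fib" for x
    using that is_pullback_types(4) by (cases x; auto)+
  have uar: "(fst x, fst y, u, v) \<in> Ar Arr.PT" if "(x, y, u, v) \<in> Ar Fib.PT" for x y u v
    using two_functorD(2)[OF two_functor_Up1 that] Up1_simps(2)[OF that] by simp
  have uce: "(fst x, fst y, u, v) \<in> Ce Arr.PT" if "(x, y, u, v) \<in> Ce Fib.PT" for x y u v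
    using two_functorD(5)[OF two_functor_Up1 that] Up1_simps(3)[OF that] by simp
  have 1: "fun_comp Fib.PT Arr.src (Up1 K p) = fun_comp Fib.PT (fun_id K) Fib.src"
    "fun_comp Fib.PT Arr.tgt (Up1 K p) = fun_comp Fib.PT (fun_id K) Fib.tgt"
  proof -
    have k: "u \<in> Ar K" "v \<in> Ar K" if "(x, y, u, v) \<in> Ar Fib.PT" for x y u v
      using that by (simp_all add: Fib.PT_Ar hom_def)
    have k2: "u \<in> Ce K" "v \<in> Ce K" if "(x, y, u, v) \<in> Ce Fib.PT" for x y u v
      using that by (simp_all add: Fib.PT_Ce hom_def)
    show "fun_comp Fib.PT Arr.src (Up1 K p) = fun_comp Fib.PT (fun_id K) Fib.src"
    proof (rule fun_comp_eqI)
      fix x assume x: "x \<in> Ob Fib.PT"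
      obtain f u v where e: "x = (f, u, v)" by (cases x)
      show "fob Arr.src (fob (Up1 K p) x) = fob (fun_id K) (fob Fib.src x)"
        using x uob[of x] Up1_simps(1)[of x] Fib.d_Ob[of x] by (simp add: e)
    next
      fix f assume f: "f \<in> Ar Fib.PT"
      obtain x y u v where e: "f = (x, y, u, v)" by (cases f)
      show "far Arr.src (far (Up1 K p) f) = far (fun_id K) (far Fib.src f)"
        using f uar[of x y u v] k[of x y u v] Up1_simps(2) by (simp add: e)
    next
      fix f assume f: "f \<in> Ce Fib.PT"
      obtain x y u v where e: "f = (x, y, u, v)" by (cases f)
      show "fce Arr.src (fce (Up1 K p) f) = fce (fun_id K) (fce Fib.src f)"
        using f uce[of x y u v] k2[of x y u v] Up1_simps(3) by (simp add: e)
    qed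
    show "fun_comp Fib.PT Arr.tgt (Up1 K p) = fun_comp Fib.PT (fun_id K) Fib.tgt"
    proof (rule fun_comp_eqI)
      fix x assume x: "x \<in> Ob Fib.PT"
      obtain f u v where e: "x = (f, u, v)" by (cases x)
      show "fob Arr.tgt (fob (Up1 K p) x) = fob (fun_id K) (fob Fib.tgt x)"
        using x uob[of x] Up1_simps(1)[of x] Fib.d_Ob[of x] by (simp add: e)
    next
      fix f assume f: "f \<in> Ar Fib.PT"
      obtain x y u v where e: "f = (x, y, u, v)" by (cases f)
      show "far Arr.tgt (far (Up1 K p) f) = far (fun_id K) (far Fib.tgt f)"
        using f uar[of x y u v] k[of x y u v] Up1_simps(2) by (simp add: e)
    next
      fix f assume f: "f \<in> Ce Fib.PT"
      obtain x y u v where e: "f = (x, y, u, v)" by (cases f)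
      show "fce Arr.tgt (fce (Up1 K p) f) = fce (fun_id K) (fce Fib.tgt f)"
        using f uce[of x y u v] k2[of x y u v] Up1_simps(3) by (simp add: e)
    qed
  qed
  have 2: "fun_comp K (Up1 K p) I = fun_comp K (Arr.mk_ide (Idn K)) (fun_id K)"
  proof (rule fun_comp_eqI)
    fix X assume X: "X \<in> Ob K"
    then show "fob (Up1 K p) (fob I X) = fob (Arr.mk_ide (Idn K)) (fob (fun_id K) X)"
      using Up1_simps(1)[OF Fib.is_doubleD(1)[OF im(3) X]] i by (simp add: im)
  next
    fix f assume f: "f \<in> Ar K"
    then show "far (Up1 K p) (far I f) = far (Arr.mk_ide (Idn K)) (far (fun_id K) f)"
      using Up1_simps(2)[OF Fib.mk_ide_Ar[OF im(3) f]] i by (simp add: im Dom_Ob Cod_Ob)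
  next
    fix f assume f: "f \<in> Ce K"
    then show "fce (Up1 K p) (fce I f) = fce (Arr.mk_ide (Idn K)) (fce (fun_id K) f)"
      using Up1_simps(3)[OF Fib.mk_ide_Ce[OF im(3) f]] i by (simp add: im Dom_Ob Cod_Ob)
  qed
  have 3: "fun_comp Fib.PP (Up1 K p) H = fun_comp Fib.PP (Arr.mk_cmp (\<lambda>g f. g \<cdot> f))
         (pairing Fib.PP (fun_comp Fib.PP (Up1 K p) (proj1 Fib.PP)) (fun_comp Fib.PP (Up1 K p) (proj2 Fib.PP)))"
  proof (rule fun_comp_eqI)
    fix t assume t: "t \<in> Ob Fib.PP"
    obtain y x where e: "t = (y, x)" by (cases t)
    have yx: "y \<in> fib" "x \<in> fib" "fdm y = fcd x"
      using t[unfolded e Fib.PP_Ob] by blast+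
    then have d: "Dom K (fst y) = Cod K (fst x)" using uob by simp
    have "(fst y, fst x) \<in> Ob Arr.PP" using uob[OF yx(1)] uob[OF yx(2)] d Arr.PP_Ob by blast
    then show "fob (Up1 K p) (fob H t) = fob (Arr.mk_cmp (\<lambda>g f. g \<cdot> f)) (fob (pairing Fib.PP (fun_comp Fib.PP (Up1 K p) (proj1 Fib.PP)) (fun_comp Fib.PP (Up1 K p) (proj2 Fib.PP))) t)"
      using t Up1_simps(1)[OF Fib.is_doubleD(5)[OF im(3) yx]] Up1_simps(1)[OF yx(1)] Up1_simps(1)[OF yx(2)] m[OF yx(1,2) d]
      by (simp add: im e)
  next
    fix t assume t: "t \<in> Ar Fib.PP"
    obtain y y' x x' u v w where e: "t = ((y, y', v, w), (x, x', u, v))" "(y, y', v, w) \<in> Ar Fib.PT" "(x, x', u, v) \<in> Ar Fib.PT"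
      "fdm y = fcd x"
      "fdm y' = fcd x'" by (rule Fib.PP_ArE[OF t]) (rule that)
    have o: "y \<in> fib" "x \<in> fib" "y' \<in> fib" "x' \<in> fib"
      using P.Dom_Ob[OF e(2)] P.Dom_Ob[OF e(3)] P.Cod_Ob[OF e(2)] P.Cod_Ob[OF e(3)] by (simp_all only: Fib.PT_simps)
    have A: "((fst y, fst y', v, w), (fst x, fst x', u, v)) \<in> Ar Arr.PP"
      using uar[OF e(2)] uar[OF e(3)] Arr.PP_Ar by blast
    show "far (Up1 K p) (far H t) = far (Arr.mk_cmp (\<lambda>g f. g \<cdot> f)) (far (pairing Fib.PP (fun_comp Fib.PP (Up1 K p) (proj1 Fib.PP)) (fun_comp Fib.PP (Up1 K p) (proj2 Fib.PP))) t)"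
      using t[unfolded e(1)] Up1_simps(2)[OF Fib.mk_cmp_Ar[OF im(3) e(2-5)]] Up1_simps(2)[OF e(2)] Up1_simps(2)[OF e(3)] A
        m[OF o(1,2)] m[OF o(3,4)] e(4,5) uob(2)[OF o(1)] uob(3)[OF o(2)] uob(2)[OF o(3)] uob(3)[OF o(4)]
      by (simp add: im e(1))
  next
    fix t assume t: "t \<in> Ce Fib.PP"
    obtain y y' x x' u v w where e: "t = ((y, y', v, w), (x, x', u, v))" "(y, y', v, w) \<in> Ce Fib.PT" "(x, x', u, v) \<in> Ce Fib.PT"
      "fdm y = fcd x"
      "fdm y' = fcd x'" by (rule Fib.PP_CeE[OF t]) (rule that)
    have o: "y \<in> fib" "x \<in> fib" "y' \<in> fib" "x' \<in> fib"
      using e(2,3) Fib.PT_Ce by blast+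
    have A: "((fst y, fst y', v, w), (fst x, fst x', u, v)) \<in> Ce Arr.PP"
      using uce[OF e(2)] uce[OF e(3)] Arr.PP_Ce by blast
    show "fce (Up1 K p) (fce H t) = fce (Arr.mk_cmp (\<lambda>g f. g \<cdot> f)) (fce (pairing Fib.PP (fun_comp Fib.PP (Up1 K p) (proj1 Fib.PP)) (fun_comp Fib.PP (Up1 K p) (proj2 Fib.PP))) t)"
      using t[unfolded e(1)] Up1_simps(3)[OF Fib.mk_cmp_Ce[OF im(3) e(2-5)]] Up1_simps(3)[OF e(2)] Up1_simps(3)[OF e(3)] A
        m[OF o(1,2)] m[OF o(3,4)] e(4,5) uob(2)[OF o(1)] uob(3)[OF o(2)] uob(2)[OF o(3)] uob(3)[OF o(4)]
      by (simp add: im e(1))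
  qed
  have "double_2functor (Fib.double I H) (DK K) (fun_id K) (Up1 K p)"
    unfolding double_2functor_def
    using D double_2category_DK two_functor_fun_id two_functor_Up1 1 2 3
    by (simp add: DK_eq Fib.dpairs_double im)
  then show ?L using D by (simp add: double_structures_def with_structure_eq im)
qed

end

section \<open>Composites of polynomials over the terminal object\<close>

locale fibration_polynomials = fibrations K p + chosen_pullbacks K pb
  for K :: "('o, 'a, 'c) twocat" (structure) and p :: 'a and pb :: "'a \<Rightarrow> 'a \<Rightarrow> 'a \<times> 'a" +
  fixes dpb :: "'a \<Rightarrow> 'a \<Rightarrow> 'a \<times> 'a \<times> 'a" and one :: 'o
  assumes dchoice: "dpullback_choice K dpb" and terminal: "is_terminal K one" and expo_p: "exponentiable K pb p"
begin

sublocale poly_ops K pb dpb .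

abbreviation tobang :: "'o \<Rightarrow> 'a" where "tobang X \<equiv> bang K X one"

lemma one_Ob: "one \<in> Ob K"
  using terminal by (simp add: is_terminal_def)

lemma tobang:
  assumes "X \<in> Ob K"
  shows "tobang X \<in> Ar K" "Dom K (tobang X) = X" "Cod K (tobang X) = one"
proof -
  have "\<exists>!h. h \<in> hom K X one" using terminal assms by (simp add: is_terminal_def)
  from theI'[OF this] show "tobang X \<in> Ar K" "Dom K (tobang X) = X" "Cod K (tobang X) = one"
    by (auto simp: bang_def hom_def)
qed

lemma into_one_eq:
  assumes "tarr x" "tarr y" "tcd x = one" "tcd y = one" "tdm x = tdm y"
  shows "x = y"
proof -
  obtain \<alpha> \<beta> where e: "x = Some \<alpha>" "y = Some \<beta>" "\<alpha> \<in> Ce K" "\<beta> \<in> Ce K" using assms(1,2) by (auto simp: tarr_def)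
  let ?X = "Dom K (Src K \<alpha>)"
  have "?X \<in> Ob K" using e by (simp add: Dom_Ob)
  then have "\<exists>!\<theta>. \<theta> \<in> cells K ?X one" using terminal by (simp add: is_terminal_def)
  moreover have "\<alpha> \<in> cells K ?X one" "\<beta> \<in> cells K ?X one" using assms e by (auto simp: hom_def)
  ultimately show ?thesis using e by blast
qed

lemma into_one_arr_eq: "f \<in> Ar K \<Longrightarrow> g \<in> Ar K \<Longrightarrow> Cod K f = one \<Longrightarrow> Cod K g = one \<Longrightarrow> Dom K f = Dom K g \<Longrightarrow> f = g"
  using into_one_eq[of "j f" "j g"] j_inj by simp

text \<open>With tight \<open>s\<close> and \<open>t\<close> this is a morphism of p-fibrations, and in general a 2-cell between such
  morphisms.\<close>

definition fmap :: "'a \<times> 'a \<times> 'a \<Rightarrow> 'a \<times> 'a \<times> 'a \<Rightarrow> 'c option \<Rightarrow> 'c option \<Rightarrow> bool" where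
  "fmap x y s t = (case (x, y) of ((f, u, v), (f', u', v')) \<Rightarrow>
     j f' \<bullet> s = t \<bullet> j f \<and> j u' \<bullet> s = j u \<and> j v' \<bullet> t = j v)"

lemma fmap_iff [simp]: "fmap (f, u, v) (f', u', v') s t \<longleftrightarrow> j f' \<bullet> s = t \<bullet> j f \<and> j u' \<bullet> s = j u \<and> j v' \<bullet> t = j v"
  by (simp add: fmap_def)

lemma fmap_comp: "fmap x y s t \<Longrightarrow> fmap y z s' t' \<Longrightarrow> fmap x z (s' \<bullet> s) (t' \<bullet> t)"
  by (cases x; cases y; cases z) (simp, metis T.assoc)

definition opoly :: "'a poly \<Rightarrow> bool" where
  "opoly q \<longleftrightarrow> q \<in> polynomials K pb \<and> Cod K (fst q) = one \<and> Cod K (snd (snd q)) = one"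

text \<open>The middle arrow of a composite \<open>q \<circ> r\<close> consists of two steps. The upper one is a pullback of the middle
  arrow of \<open>q\<close> and the lower one is a pullback of the middle arrow of \<open>r\<close>.\<close>

definition up :: "'a poly \<Rightarrow> 'a poly \<Rightarrow> 'a \<times> 'a \<times> 'a" where
  "up q r = (let D = cdata q r in (ee D, pr2 D \<cdot> eps D, rr D))"

definition lo :: "'a poly \<Rightarrow> 'a poly \<Rightarrow> 'a \<times> 'a \<times> 'a" where
  "lo q r = (let D = cdata q r in (hF D, hA D, pr1 D \<cdot> eps D))"

lemma opolyD:
  assumes "opoly (q1, q2, q3)"
  shows "q1 \<in> Ar K" "q2 \<in> Ar K" "q3 \<in> Ar K" "Dom K q1 = Dom K q2" "Cod K q2 = Dom K q3"
    "exponentiable K pb q2" "Cod K q1 = one" "Cod K q3 = one"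
  using assms by (auto simp: opoly_def polynomials_def)

context
  fixes q1 q2 q3 p1 p2 p3 :: 'a and D :: "'a polycomp"
  assumes q: "opoly (q1, q2, q3)" and r: "opoly (p1, p2, p3)" and D: "D = cdata (q1, q2, q3) (p1, p2, p3)"
begin

lemma cdata_eqs:
  "pb p3 q1 = (pr1 D, pr2 D)" "dpb q2 (pr2 D) = (eps D, ee D, rr D)" "pb p2 (pr1 D \<cdot> eps D) = (hA D, hF D)"
  using D by (auto simp: cdata_def Let_def split: prod.splits)

lemma cdata_P: "T.pbk (j p3) (j q1) (j (pr1 D)) (j (pr2 D))"
  using chosen_pbk[of p3 q1] opolyD[OF q] opolyD[OF r] by (simp add: cdata_eqs)

lemma cdata_P_types:
  "pr1 D \<in> Ar K" "pr2 D \<in> Ar K" "Cod K (pr1 D) = Cod K p2" "Cod K (pr2 D) = Dom K q2" "Dom K (pr1 D) = Dom K (pr2 D)"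
proof -
  note t = T.pbk_types[OF cdata_P]
  then show a: "pr1 D \<in> Ar K" "pr2 D \<in> Ar K" by simp_all
  show "Cod K (pr1 D) = Cod K p2" "Cod K (pr2 D) = Dom K q2" "Dom K (pr1 D) = Dom K (pr2 D)"
    using t a opolyD[OF q] opolyD[OF r] by simp_all
qed

lemma cdata_D: "T.dpbk (j q2) (j (pr2 D)) (j (eps D)) (j (ee D)) (j (rr D))"
  using chosen_dpbk[OF dchoice, of q2 "pr2 D"] cdata_P_types opolyD[OF q] cdata_eqs(2) by simp

lemma cdata_D_types:
  "eps D \<in> Ar K" "ee D \<in> Ar K" "rr D \<in> Ar K" "Cod K (eps D) = Dom K (pr2 D)" "Dom K (eps D) = Dom K (ee D)"
  "Cod K (ee D) = Dom K (rr D)" "Cod K (rr D) = Cod K q2"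
proof -
  note t = T.pbk_types[OF T.dpbkD(3)[OF cdata_D]]
  have a: "eps D \<in> Ar K" "ee D \<in> Ar K" "rr D \<in> Ar K" using T.dpbkD(2)[OF cdata_D] t by simp_all
  then show "eps D \<in> Ar K" "ee D \<in> Ar K" "rr D \<in> Ar K" by simp_all
  show "Cod K (eps D) = Dom K (pr2 D)" "Dom K (eps D) = Dom K (ee D)"
    using t(3,8) T.dm_comp[OF t(3)] a cdata_P_types by (simp_all add: tarr_tcomp)
  show "Cod K (ee D) = Dom K (rr D)" "Cod K (rr D) = Cod K q2" using t a opolyD[OF q] by simp_all
qed

lemma cdata_j: "j (pr1 D \<cdot> eps D) = j (pr1 D) \<bullet> j (eps D)" "j (pr2 D \<cdot> eps D) = j (pr2 D) \<bullet> j (eps D)"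
  using cdata_P_types cdata_D_types by (simp_all add: j_comp)

lemma cdata_H: "T.pbk (j p2) (j (pr1 D) \<bullet> j (eps D)) (j (hA D)) (j (hF D))"
  using chosen_pbk[of p2 "pr1 D \<cdot> eps D"] opolyD[OF r] cdata_P_types cdata_D_types cdata_j by (simp add: cdata_eqs)

lemma up_fibre: "is_pullback K q2 (rr D) (pr2 D \<cdot> eps D) (ee D)"
  using T.dpbkD(3)[OF cdata_D] by (simp add: is_pullback_iff cdata_j)

lemma lo_fibre: "is_pullback K p2 (pr1 D \<cdot> eps D) (hA D) (hF D)"
  using cdata_H by (simp add: is_pullback_iff cdata_j)

lemma cdata_H_types: "hA D \<in> Ar K" "hF D \<in> Ar K" "Cod K (hF D) = Dom K (ee D)" "Dom K (hA D) = Dom K (hF D)" "Cod K (hA D) = Dom K p2"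
  using is_pullback_types[OF lo_fibre] cdata_P_types cdata_D_types by simp_all

lemma up_lo: "up (q1, q2, q3) (p1, p2, p3) = (ee D, pr2 D \<cdot> eps D, rr D)"
    "lo (q1, q2, q3) (p1, p2, p3) = (hF D, hA D, pr1 D \<cdot> eps D)"
  using D by (simp_all add: up_def lo_def Let_def)

text \<open>The two steps of a composite of polynomials are terminal among composable pairs of pullbacks of the two
  middle arrows. The legs of the polynomials impose no condition, because their codomain is terminal.\<close>

lemma up_lo_universal:
  assumes "is_pullback K q2 v2 u2 f2" "is_pullback K p2 v1 u1 f1" "Dom K f2 = Cod K f1"
  shows "\<exists>!(n0, n1, n2). fmap (f2, u2, v2) (ee D, pr2 D \<cdot> eps D, rr D) n1 n2 \<and>
     fmap (f1, u1, v1) (hF D, hA D, pr1 D \<cdot> eps D) n0 n1"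
proof -
  note t = is_pullback_types[OF assms(1)] is_pullback_types[OF assms(2)]
  note q' = opolyD[OF q] and r' = opolyD[OF r]
  have "\<exists>!(n0, n1, n2). j (ee D) \<bullet> n1 = n2 \<bullet> j f2 \<and> j (hF D) \<bullet> n0 = n1 \<bullet> j f1 \<and>
     j (pr2 D) \<bullet> j (eps D) \<bullet> n1 = j u2 \<and> j (rr D) \<bullet> n2 = j v2 \<and> j (hA D) \<bullet> n0 = j u1 \<and> j (pr1 D) \<bullet> j (eps D) \<bullet> n1 = j v1"
  proof (rule T.composite_terminal[OF _ cdata_P _ cdata_D cdata_H])
    show "x = y" if "tarr x" "tarr y" "tcd x = one" "tcd y = one" "tdm x = tdm y" for x y
      using into_one_eq that by blast
    show "T.pbk (j q2) (j v2) (j u2) (j f2)" "T.pbk (j p2) (j v1) (j u1) (j f1)"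
      using assms by (simp_all add: is_pullback_iff)
  qed (use t q' r' assms(3) in \<open>simp_all add: tarr_tcomp\<close>)
  then show ?thesis
    by (simp add: cdata_j T.assoc conj_ac)
qed

lemma up_lo_lift:
  assumes "is_pullback K q2 v2 u2 f2" "is_pullback K p2 v1 u1 f1" "Dom K f2 = Cod K f1"
  obtains n0 n1 n2 where "n0 \<in> Ar K" "n1 \<in> Ar K" "n2 \<in> Ar K"
    "fmap (f2, u2, v2) (ee D, pr2 D \<cdot> eps D, rr D) (j n1) (j n2)"
    "fmap (f1, u1, v1) (hF D, hA D, pr1 D \<cdot> eps D) (j n0) (j n1)"
proof -
  note t = is_pullback_types[OF assms(1)] is_pullback_types[OF assms(2)]
  note u = up_lo_universal[OF assms]
  obtain n0 n1 n2 where n: "fmap (f2, u2, v2) (ee D, pr2 D \<cdot> eps D, rr D) n1 n2"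
    "fmap (f1, u1, v1) (hF D, hA D, pr1 D \<cdot> eps D) n0 n1" using u by blast
  have tt: "ttight (j x) = j x" for x by simp
  have "fmap (f2, u2, v2) (ee D, pr2 D \<cdot> eps D, rr D) (ttight n1) (ttight n2)"
    "fmap (f1, u1, v1) (hF D, hA D, pr1 D \<cdot> eps D) (ttight n0) (ttight n1)"
    using n by (simp_all del: ttrg_simps) (metis tt T.tighten_comp)+
  then have "(ttight n0, ttight n1, ttight n2) = (n0, n1, n2)" using u n by blast
  moreover have "tarr n0" "tarr n1" "tarr n2"
    using n t by (simp_all del: ttrg_simps) (metis T.arr_comp j_arr)+
  ultimately have "T.tight n0" "T.tight n1" "T.tight n2" by (auto simp: T.tight_def)
  then obtain m0 m1 m2 where "n0 = j m0" "n1 = j m1" "n2 = j m2" "m0 \<in> Ar K" "m1 \<in> Ar K" "m2 \<in> Ar K"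
    by (metis tight_obtain)
  with n that show ?thesis by blast
qed

lemma pcomp_eq: "pcomp (q1, q2, q3) (p1, p2, p3) = (p1 \<cdot> hA D, ee D \<cdot> hF D, q3 \<cdot> rr D)"
  by (simp add: pcomp_def Let_def D)

lemma pcomp_opoly: "opoly (pcomp (q1, q2, q3) (p1, p2, p3))"
proof -
  note q' = opolyD[OF q] and r' = opolyD[OF r]
  have "exponentiable K pb (ee D \<cdot> hF D)"
    using exponentiable_comp exponentiable_pullback[OF r'(6) lo_fibre] exponentiable_pullback[OF q'(6) up_fibre] cdata_H_types
    by simp
  then show ?thesis
    unfolding pcomp_eq opoly_def polynomials_def
    using q' r' cdata_H_types cdata_D_types by simp
qed

end

lemma polycellsD:
  assumes "((p1, p2, p3), (q1, q2, q3), f0, f1) \<in> polycells K pb"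
  shows "f0 \<in> Ar K" "f1 \<in> Ar K" "Dom K f0 = Dom K p2" "Cod K f0 = Dom K q2" "Dom K f1 = Cod K p2" "Cod K f1 = Cod K q2"
    "is_pullback K q2 f1 f0 p2"
  using assms by (auto simp: polycells_def hom_def)

text \<open>The 2-cells turn the steps of the composite of the source polynomials into pullbacks of the middle
  arrows of the target polynomials. The horizontal composite is the comparison with the terminal such
  pair.\<close>

lemma phcomp_char:
  assumes \<phi>: "((p1, p2, p3), (p1', p2', p3'), f0, f1) \<in> polycells K pb"
    and \<psi>: "((q1, q2, q3), (q1', q2', q3'), g0, g1) \<in> polycells K pb"
    and o: "opoly (p1, p2, p3)" "opoly (p1', p2', p3')" "opoly (q1, q2, q3)" "opoly (q1', q2', q3')"
    and D: "D = cdata (q1, q2, q3) (p1, p2, p3)"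
  obtains h0 s h1 where
    "phcomp ((q1, q2, q3), (q1', q2', q3'), g0, g1) ((p1, p2, p3), (p1', p2', p3'), f0, f1) =
      (pcomp (q1, q2, q3) (p1, p2, p3), pcomp (q1', q2', q3') (p1', p2', p3'), h0, h1)"
    "h0 \<in> Ar K" "s \<in> Ar K" "h1 \<in> Ar K"
    "fmap (ee D, g0 \<cdot> (pr2 D \<cdot> eps D), g1 \<cdot> rr D) (up (q1', q2', q3') (p1', p2', p3')) (j s) (j h1)"
    "fmap (hF D, f0 \<cdot> hA D, f1 \<cdot> (pr1 D \<cdot> eps D)) (lo (q1', q2', q3') (p1', p2', p3')) (j h0) (j s)"
proof -
  define D' where "D' = cdata (q1', q2', q3') (p1', p2', p3')"
  note f = polycellsD[OF \<phi>] and g = polycellsD[OF \<psi>]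
  note P = cdata_P_types[OF o(3,1) D] and P' = cdata_P_types[OF o(4,2) D'_def]
  note E = cdata_D_types[OF o(3,1) D] and E' = cdata_D_types[OF o(4,2) D'_def]
  note H = cdata_H_types[OF o(3,1) D] and H' = cdata_H_types[OF o(4,2) D'_def]
  note J = cdata_j[OF o(3,1) D] and J' = cdata_j[OF o(4,2) D'_def]
  note o1 = opolyD[OF o(1)] and o2 = opolyD[OF o(2)] and o3 = opolyD[OF o(3)] and o4 = opolyD[OF o(4)]
  define t where "t = pb_lift K (pr1 D') (pr2 D') (f1 \<cdot> pr1 D) (g0 \<cdot> pr2 D)"
  have jf: "j (f1 \<cdot> pr1 D) = j f1 \<bullet> j (pr1 D)" "j (g0 \<cdot> pr2 D) = j g0 \<bullet> j (pr2 D)"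
    "f1 \<cdot> pr1 D \<in> Ar K" "g0 \<cdot> pr2 D \<in> Ar K"
    using f g P by (simp_all add: j_comp)
  have e: "j p3' \<bullet> j (f1 \<cdot> pr1 D) = j q1' \<bullet> j (g0 \<cdot> pr2 D)" "tarr (j p3' \<bullet> j (f1 \<cdot> pr1 D))"
  proof -
    show a: "tarr (j p3' \<bullet> j (f1 \<cdot> pr1 D))" using f P o2 by (simp add: tarr_tcomp)
    have b: "tarr (j q1' \<bullet> j (g0 \<cdot> pr2 D))" using g P o4 by (simp add: tarr_tcomp)
    show "j p3' \<bullet> j (f1 \<cdot> pr1 D) = j q1' \<bullet> j (g0 \<cdot> pr2 D)"
      by (rule into_one_eq[OF a b])
        (use T.dm_comp[OF a] T.dm_comp[OF b] T.cd_comp[OF a] T.cd_comp[OF b] f g P o2 o4 in simp_all)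
  qed
  note t = pb_lift[OF cdata_P[OF o(4,2) D'_def] jf(3,4) e, folded t_def, unfolded jf(1,2)]
  have dt: "Dom K t = Dom K (pr1 D)" "Cod K t = Dom K (pr1 D')"
  proof -
    have e: "j (pr1 D') \<bullet> j t = j (f1 \<cdot> pr1 D)" using t(2) jf(1) by simp
    show "Cod K t = Dom K (pr1 D')" using j_comp_eq(4)[OF e jf(3)] by simp
    show "Dom K t = Dom K (pr1 D)"
      using j_comp_eq(1,4)[OF e jf(3)] comp_arr(2)[of t "pr1 D'"] comp_arr(2)[of "pr1 D" f1] t(1) P P' f by simp
  qed
  have te: "t \<cdot> eps D \<in> Ar K" "j (t \<cdot> eps D) = j t \<bullet> j (eps D)" using t dt E P by (simp_all add: j_comp)
  have gr: "j (g1 \<cdot> rr D) = j g1 \<bullet> j (rr D)" "g1 \<cdot> rr D \<in> Ar K" using g E by (simp_all add: j_comp)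
  have "T.pbk (j q2') (j g1 \<bullet> j (rr D)) (j g0 \<bullet> (j (pr2 D) \<bullet> j (eps D))) (j (ee D))"
    using T.pbk_paste[of "j q2'" "j g1" "j g0" "j q2" "j (rr D)" "j (pr2 D) \<bullet> j (eps D)" "j (ee D)"]
      g(7) up_fibre[OF o(3,1) D] by (simp add: is_pullback_iff J)
  then have "T.pbk (j q2') (j (g1 \<cdot> rr D)) (j (pr2 D') \<bullet> j (t \<cdot> eps D)) (j (ee D))"
    using t te gr by (metis T.assoc)
  then have ob: "(t \<cdot> eps D, ee D, g1 \<cdot> rr D) \<in> Ob (dtriples K q2' (pr2 D'))"
    using dtriples_Ob_iff[of "pr2 D'"] P' te by simp
  have "is_distributivity_pullback K q2' (pr2 D') (eps D', ee D', rr D')"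
    using is_distributivity_pullback_iff cdata_D[OF o(4,2) D'_def] P' o4 by simp
  then have "is_terminal (dtriples K q2' (pr2 D')) (eps D', ee D', rr D')"
    by (simp add: is_distributivity_pullback_def)
  then have "\<exists>!h. h \<in> hom (dtriples K q2' (pr2 D')) (t \<cdot> eps D, ee D, g1 \<cdot> rr D) (eps D', ee D', rr D')"
    using ob by (simp add: is_terminal_def)
  from theI'[OF this] have "bang (dtriples K q2' (pr2 D')) (t \<cdot> eps D, ee D, g1 \<cdot> rr D) (eps D', ee D', rr D')
      \<in> hom (dtriples K q2' (pr2 D')) (t \<cdot> eps D, ee D, g1 \<cdot> rr D) (eps D', ee D', rr D')"
    unfolding bang_def .
  then obtain s h1 where b: "bang (dtriples K q2' (pr2 D')) (t \<cdot> eps D, ee D, g1 \<cdot> rr D) (eps D', ee D', rr D') =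
       ((t \<cdot> eps D, ee D, g1 \<cdot> rr D), (eps D', ee D', rr D'), s, h1)"
    and s: "s \<in> Ar K" "h1 \<in> Ar K" "j (eps D') \<bullet> j s = j (t \<cdot> eps D)" "j (ee D') \<bullet> j s = j h1 \<bullet> j (ee D)"
      "j (rr D') \<bullet> j h1 = j (g1 \<cdot> rr D)"
    using dtriples_hom[of "pr2 D'"] P' by auto
  define h0 where "h0 = pb_lift K (hA D') (hF D') (f0 \<cdot> hA D) (s \<cdot> hF D)"
  have ds: "Dom K s = Dom K (eps D)"
    using j_comp_eq(1,4)[OF s(3) te(1)] comp_arr(2)[of s "eps D'"] comp_arr(2)[of "eps D" t] s(1) t(1) dt E E' P by simp
  have jh: "j (f0 \<cdot> hA D) = j f0 \<bullet> j (hA D)" "f0 \<cdot> hA D \<in> Ar K" "j (s \<cdot> hF D) = j s \<bullet> j (hF D)" "s \<cdot> hF D \<in> Ar K"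
    using f H s ds E by (simp_all add: j_comp)
  have pe: "(j (pr1 D') \<bullet> j (eps D')) \<bullet> j s = j f1 \<bullet> (j (pr1 D) \<bullet> j (eps D))"
    using s(3) te t by (metis T.assoc)
  have pe2: "(j (pr2 D') \<bullet> j (eps D')) \<bullet> j s = j g0 \<bullet> (j (pr2 D) \<bullet> j (eps D))"
    using s(3) te t by (metis T.assoc)
  have c1': "j p2' \<bullet> j f0 = j f1 \<bullet> j p2" using T.pbk_comm f(7) by (simp add: is_pullback_iff)
  have c2': "j p2 \<bullet> j (hA D) = (j (pr1 D) \<bullet> j (eps D)) \<bullet> j (hF D)" using T.pbk_comm[OF cdata_H[OF o(3,1) D]] .
  have eh: "j p2' \<bullet> j (f0 \<cdot> hA D) = (j (pr1 D') \<bullet> j (eps D')) \<bullet> j (s \<cdot> hF D)"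
    using c1' c2' pe unfolding jh by (metis T.assoc)
  have ah: "tarr (j p2' \<bullet> j (f0 \<cdot> hA D))" using f H o2 by (simp add: tarr_tcomp)
  have Hp: "T.pbk (j p2') (j (pr1 D' \<cdot> eps D')) (j (hA D')) (j (hF D'))"
    using cdata_H[OF o(4,2) D'_def] by (simp add: J')
  note h0 = pb_lift[OF Hp jh(2,4) eh[folded J'] ah, folded h0_def, unfolded jh(1,3)]
  have ph: "phcomp ((q1, q2, q3), (q1', q2', q3'), g0, g1) ((p1, p2, p3), (p1', p2', p3'), f0, f1) =
      (pcomp (q1, q2, q3) (p1, p2, p3), pcomp (q1', q2', q3') (p1', p2', p3'), h0, h1)"
    by (simp add: phcomp_def Let_def D[symmetric] D'_def[symmetric] t_def[symmetric] b h0_def)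
  have "fmap (ee D, g0 \<cdot> (pr2 D \<cdot> eps D), g1 \<cdot> rr D) (ee D', pr2 D' \<cdot> eps D', rr D') (j s) (j h1)"
    using s pe2 g P E j_comp[of "pr2 D \<cdot> eps D" g0] by (simp add: J J' gr)
  moreover have "fmap (hF D, f0 \<cdot> hA D, f1 \<cdot> (pr1 D \<cdot> eps D)) (hF D', hA D', pr1 D' \<cdot> eps D') (j h0) (j s)"
    using h0 pe f P E j_comp[of "pr1 D \<cdot> eps D" f1] by (simp add: J J' jh)
  ultimately show ?thesis
    using that[OF ph h0(1) s(1,2)] by (simp add: up_lo[OF o(4,2) D'_def])
qed

end

section \<open>Operations on p-fibrations induced by units and multiplications\<close>

context fibration_polynomials begin

abbreviation "M \<equiv> end_poly K one p"
abbreviation "DM \<equiv> cdata M M"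
abbreviation "unit_cell \<eta>0 \<eta>1 \<equiv> (pid one, M, \<eta>0, \<eta>1)"
abbreviation "mult_cell \<mu>0 \<mu>1 \<equiv> (pcomp M M, M, \<mu>0, \<mu>1)"

lemma p_arr: "p \<in> Ar K"
  using expo_p by (simp add: exponentiable_def)

lemma M_eq: "M = (tobang (Dom K p), p, tobang (Cod K p))"
  by (simp add: end_poly_def)

lemma opoly_M: "opoly M"
  using tobang[of "Dom K p"] tobang[of "Cod K p"] p_arr expo_p
  by (simp add: M_eq opoly_def polynomials_def Dom_Ob Cod_Ob)

lemma opoly_id: "opoly (pid one)"
  using one_Ob exponentiable_idn by (simp add: pid_def opoly_def polynomials_def)

lemmas opoly_M' = opoly_M[unfolded M_eq] and opoly_id' = opoly_id[unfolded pid_def]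

lemma DM_eq: "DM = cdata (tobang (Dom K p), p, tobang (Cod K p)) (tobang (Dom K p), p, tobang (Cod K p))"
  by (simp add: M_eq)

lemmas DM_types = cdata_P_types[OF opoly_M' opoly_M' DM_eq] cdata_D_types[OF opoly_M' opoly_M' DM_eq]
  cdata_H_types[OF opoly_M' opoly_M' DM_eq]
lemmas DM_up = up_fibre[OF opoly_M' opoly_M' DM_eq]
lemmas DM_lo = lo_fibre[OF opoly_M' opoly_M' DM_eq]
lemmas DM_up_lo = up_lo[OF opoly_M' opoly_M' DM_eq, folded M_eq]
lemmas DM_universal = up_lo_universal[OF opoly_M' opoly_M' DM_eq, folded DM_up_lo]
lemmas DM_lift = up_lo_lift[OF opoly_M' opoly_M' DM_eq]

lemma fmap_unique:
  assumes "(f2, u2, v2) \<in> fib" "(f1, u1, v1) \<in> fib" "Dom K f2 = Cod K f1"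
    "fmap (f2, u2, v2) (up M M) n1 n2" "fmap (f1, u1, v1) (lo M M) n0 n1"
    "fmap (f2, u2, v2) (up M M) n1' n2'" "fmap (f1, u1, v1) (lo M M) n0' n1'"
  shows "n0 = n0'" "n1 = n1'" "n2 = n2'"
proof -
  have "(n0, n1, n2) = (n0', n1', n2')"
    using DM_universal[of v2 u2 f2 v1 u1 f1] assms by auto
  then show "n0 = n0'" "n1 = n1'" "n2 = n2'" by auto
qed

lemma fmap_pbk:
  assumes x: "is_pullback K q v u f" and y: "is_pullback K q v' u' f'"
    and s: "s \<in> Ar K" "t \<in> Ar K" "fmap (f, u, v) (f', u', v') (j s) (j t)"
  shows "T.pbk (j f') (j t) (j s) (j f)"
proof (rule T.pbk_cancel)
  show "T.pbk (j q) (j v') (j u') (j f')" using y by (simp add: is_pullback_iff)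
  show "T.pbk (j q) (j v' \<bullet> j t) (j u' \<bullet> j s) (j f)" using x s by (simp add: is_pullback_iff)
qed (use s in simp_all)

lemma fmap_arrows:
  assumes x: "is_pullback K q v u f" and y: "is_pullback K q v' u' f'"
    and s: "s \<in> Ar K" "t \<in> Ar K" "fmap (f, u, v) (f', u', v') (j s) (j t)"
  shows "Dom K s = Dom K f" "Cod K s = Dom K f'" "Dom K t = Cod K f" "Cod K t = Cod K f'"
proof -
  note P = T.pbk_types[OF fmap_pbk[OF assms]] and t = is_pullback_types[OF x] is_pullback_types[OF y]
  show "Dom K s = Dom K f" "Cod K s = Dom K f'" "Dom K t = Cod K f" "Cod K t = Cod K f'"
    using P t s by simp_all
qed

text \<open>The structure \<open>(\<eta>0, \<eta>1)\<close> on the identity of the terminal object, pulled back to the identity of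
  \<open>X\<close>.\<close>

definition uni :: "'a \<Rightarrow> 'a \<Rightarrow> 'o \<Rightarrow> 'a \<times> 'a \<times> 'a" where
  "uni \<eta>0 \<eta>1 X = (Idn K X, \<eta>0 \<cdot> tobang X, \<eta>1 \<cdot> tobang X)"

text \<open>The structure \<open>(\<mu>0, \<mu>1)\<close> on the composite of the terminal pair of p-fibrations, pulled back along the
  comparison of the pair \<open>(y, x)\<close> with the terminal one. The choice operator selects this comparison,
  which is unique.\<close>

definition cmp :: "'a \<Rightarrow> 'a \<Rightarrow> 'a \<times> 'a \<times> 'a \<Rightarrow> 'a \<times> 'a \<times> 'a \<Rightarrow> 'a \<times> 'a \<times> 'a" where
  "cmp \<mu>0 \<mu>1 y x =
    (let (n0, n1, n2) = SOME (n0, n1, n2). n0 \<in> Ar K \<and> n1 \<in> Ar K \<and> n2 \<in> Ar K \<and>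
       fmap y (up M M) (j n1) (j n2) \<and> fmap x (lo M M) (j n0) (j n1)
     in (fst y \<cdot> fst x, \<mu>0 \<cdot> n0, \<mu>1 \<cdot> n2))"

context
  fixes \<mu>0 \<mu>1 assumes mu: "is_pullback K p \<mu>1 \<mu>0 (ee DM \<cdot> hF DM)"
begin

lemma cmp_obtain:
  assumes y: "(f2, u2, v2) \<in> fib" and x: "(f1, u1, v1) \<in> fib" and d: "Dom K f2 = Cod K f1"
  obtains n0 n1 n2 where "n0 \<in> Ar K" "n1 \<in> Ar K" "n2 \<in> Ar K"
    "fmap (f2, u2, v2) (up M M) (j n1) (j n2)" "fmap (f1, u1, v1) (lo M M) (j n0) (j n1)"
    "cmp \<mu>0 \<mu>1 (f2, u2, v2) (f1, u1, v1) = (f2 \<cdot> f1, \<mu>0 \<cdot> n0, \<mu>1 \<cdot> n2)"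
    "j (f2 \<cdot> f1) = j f2 \<bullet> j f1" "j (\<mu>0 \<cdot> n0) = j \<mu>0 \<bullet> j n0" "j (\<mu>1 \<cdot> n2) = j \<mu>1 \<bullet> j n2"
    "is_pullback K p (\<mu>1 \<cdot> n2) (\<mu>0 \<cdot> n0) (f2 \<cdot> f1)"
proof -
  let ?Q = "\<lambda>(n0, n1, n2). n0 \<in> Ar K \<and> n1 \<in> Ar K \<and> n2 \<in> Ar K \<and>
       fmap (f2, u2, v2) (up M M) (j n1) (j n2) \<and> fmap (f1, u1, v1) (lo M M) (j n0) (j n1)"
  have y': "is_pullback K p v2 u2 f2" and x': "is_pullback K p v1 u1 f1" using y x by auto
  note t = is_pullback_types[OF y'] is_pullback_types[OF x'] and m = is_pullback_types[OF mu]
  have "\<exists>n. ?Q n"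
  proof -
    obtain n0 n1 n2 where "n0 \<in> Ar K" "n1 \<in> Ar K" "n2 \<in> Ar K"
      "fmap (f2, u2, v2) (ee DM, pr2 DM \<cdot> eps DM, rr DM) (j n1) (j n2)"
      "fmap (f1, u1, v1) (hF DM, hA DM, pr1 DM \<cdot> eps DM) (j n0) (j n1)"
      by (rule DM_lift[OF y' x' d]) (rule that)
    then show ?thesis unfolding DM_up_lo by blast
  qed
  then have "?Q (SOME n. ?Q n)" by (rule someI_ex)
  moreover obtain n0 n1 n2 where n: "(SOME n. ?Q n) = (n0, n1, n2)"
    by (rule prod_cases3[of "SOME n. ?Q n"]) (rule that)
  ultimately have Q: "n0 \<in> Ar K" "n1 \<in> Ar K" "n2 \<in> Ar K"
    "fmap (f2, u2, v2) (up M M) (j n1) (j n2)" "fmap (f1, u1, v1) (lo M M) (j n0) (j n1)" by auto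
  note a2 = fmap_arrows[OF y' DM_up Q(2,3) Q(4)[unfolded DM_up_lo]]
  note a1 = fmap_arrows[OF x' DM_lo Q(1,2) Q(5)[unfolded DM_up_lo]]
  have J: "j (f2 \<cdot> f1) = j f2 \<bullet> j f1" "j (\<mu>0 \<cdot> n0) = j \<mu>0 \<bullet> j n0" "j (\<mu>1 \<cdot> n2) = j \<mu>1 \<bullet> j n2"
    "j (ee DM \<cdot> hF DM) = j (ee DM) \<bullet> j (hF DM)"
    using Q t m a1 a2 d DM_types by (simp_all add: j_comp)
  have "T.pbk (j (ee DM) \<bullet> j (hF DM)) (j n2) (j n0) (j f2 \<bullet> j f1)"
    using T.pbk_vpaste fmap_pbk[OF x' DM_lo Q(1,2) Q(5)[unfolded DM_up_lo]]
      fmap_pbk[OF y' DM_up Q(2,3) Q(4)[unfolded DM_up_lo]] by blast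
  then have "is_pullback K p (\<mu>1 \<cdot> n2) (\<mu>0 \<cdot> n0) (f2 \<cdot> f1)"
    using T.pbk_paste mu unfolding is_pullback_iff J by blast
  moreover have "cmp \<mu>0 \<mu>1 (f2, u2, v2) (f1, u1, v1) = (f2 \<cdot> f1, \<mu>0 \<cdot> n0, \<mu>1 \<cdot> n2)"
    unfolding cmp_def n by simp
  ultimately show ?thesis using that Q J by blast
qed

lemma cmp_fib:
  assumes "(f2, u2, v2) \<in> fib" "(f1, u1, v1) \<in> fib" "Dom K f2 = Cod K f1"
  shows "cmp \<mu>0 \<mu>1 (f2, u2, v2) (f1, u1, v1) \<in> fib" "fst (cmp \<mu>0 \<mu>1 (f2, u2, v2) (f1, u1, v1)) = f2 \<cdot> f1"
  by (rule cmp_obtain[OF assms]; simp)+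

lemma cmp_eq:
  assumes "(f2, u2, v2) \<in> fib" "(f1, u1, v1) \<in> fib" "Dom K f2 = Cod K f1"
    "fmap (f2, u2, v2) (up M M) n1 n2" "fmap (f1, u1, v1) (lo M M) n0 n1"
  obtains u v where "cmp \<mu>0 \<mu>1 (f2, u2, v2) (f1, u1, v1) = (f2 \<cdot> f1, u, v)" "j u = j \<mu>0 \<bullet> n0" "j v = j \<mu>1 \<bullet> n2" "u \<in> Ar K" "v \<in> Ar K"
proof -
  obtain m0 m1 m2 where m: "m0 \<in> Ar K" "m1 \<in> Ar K" "m2 \<in> Ar K"
    "fmap (f2, u2, v2) (up M M) (j m1) (j m2)" "fmap (f1, u1, v1) (lo M M) (j m0) (j m1)"
    "cmp \<mu>0 \<mu>1 (f2, u2, v2) (f1, u1, v1) = (f2 \<cdot> f1, \<mu>0 \<cdot> m0, \<mu>1 \<cdot> m2)"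
    "j (f2 \<cdot> f1) = j f2 \<bullet> j f1" "j (\<mu>0 \<cdot> m0) = j \<mu>0 \<bullet> j m0" "j (\<mu>1 \<cdot> m2) = j \<mu>1 \<bullet> j m2"
    "is_pullback K p (\<mu>1 \<cdot> m2) (\<mu>0 \<cdot> m0) (f2 \<cdot> f1)"
    by (rule cmp_obtain[OF assms(1-3)]) (rule that)
  note e = fmap_unique[OF assms(1-3) m(4,5) assms(4,5)]
  show ?thesis using that[OF m(6)] m(8,9) e is_pullback_types[OF m(10)] by simp
qed

text \<open>The comparison of \<open>(f2, f1)\<close> with the terminal pair is that of \<open>(f2', f1')\<close> composed with
  \<open>(k0, k1, k2)\<close>.\<close>

lemma cmp_natural:
  assumes y: "(f2, u2, v2) \<in> fib" and x: "(f1, u1, v1) \<in> fib" and d: "Dom K f2 = Cod K f1"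
    and y': "(f2', u2', v2') \<in> fib" and x': "(f1', u1', v1') \<in> fib" and d': "Dom K f2' = Cod K f1'"
    and k: "fmap (f1, u1, v1) (f1', u1', v1') k0 k1" "fmap (f2, u2, v2) (f2', u2', v2') k1 k2"
  shows "fmap (cmp \<mu>0 \<mu>1 (f2, u2, v2) (f1, u1, v1)) (cmp \<mu>0 \<mu>1 (f2', u2', v2') (f1', u1', v1')) k0 k2"
proof -
  obtain n0 n1 n2 where n: "n0 \<in> Ar K" "n1 \<in> Ar K" "n2 \<in> Ar K"
    "fmap (f2, u2, v2) (up M M) (j n1) (j n2)" "fmap (f1, u1, v1) (lo M M) (j n0) (j n1)"
    "cmp \<mu>0 \<mu>1 (f2, u2, v2) (f1, u1, v1) = (f2 \<cdot> f1, \<mu>0 \<cdot> n0, \<mu>1 \<cdot> n2)"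
    "j (f2 \<cdot> f1) = j f2 \<bullet> j f1" "j (\<mu>0 \<cdot> n0) = j \<mu>0 \<bullet> j n0" "j (\<mu>1 \<cdot> n2) = j \<mu>1 \<bullet> j n2"
    "is_pullback K p (\<mu>1 \<cdot> n2) (\<mu>0 \<cdot> n0) (f2 \<cdot> f1)"
    by (rule cmp_obtain[OF y x d]) (rule that)
  obtain m0 m1 m2 where m: "m0 \<in> Ar K" "m1 \<in> Ar K" "m2 \<in> Ar K"
    "fmap (f2', u2', v2') (up M M) (j m1) (j m2)" "fmap (f1', u1', v1') (lo M M) (j m0) (j m1)"
    "cmp \<mu>0 \<mu>1 (f2', u2', v2') (f1', u1', v1') = (f2' \<cdot> f1', \<mu>0 \<cdot> m0, \<mu>1 \<cdot> m2)"
    "j (f2' \<cdot> f1') = j f2' \<bullet> j f1'" "j (\<mu>0 \<cdot> m0) = j \<mu>0 \<bullet> j m0" "j (\<mu>1 \<cdot> m2) = j \<mu>1 \<bullet> j m2"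
    "is_pullback K p (\<mu>1 \<cdot> m2) (\<mu>0 \<cdot> m0) (f2' \<cdot> f1')"
    by (rule cmp_obtain[OF y' x' d']) (rule that)
  have e: "j n0 = j m0 \<bullet> k0" "j n2 = j m2 \<bullet> k2"
    using fmap_unique[OF y x d n(4,5) fmap_comp[OF k(2) m(4)] fmap_comp[OF k(1) m(5)]] by auto
  have "j (f2' \<cdot> f1') \<bullet> k0 = k2 \<bullet> j (f2 \<cdot> f1)"
    using k unfolding n(7) m(7) fmap_iff by (metis T.assoc)
  then show ?thesis
    unfolding n(6) m(6) fmap_iff n(8,9) m(8,9) e by (simp add: T.assoc)
qed

end

lemma fmap_cells:
  assumes "is_pullback K p v u f" "is_pullback K p v' u' f'" "\<alpha> \<in> cells K (Dom K f) (Dom K f')" "\<beta> \<in> cells K (Cod K f) (Cod K f')"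
  shows "(Id2 K f' \<star> \<alpha> = \<beta> \<star> Id2 K f \<and> Id2 K u' \<star> \<alpha> = Id2 K u \<and> Id2 K v' \<star> \<beta> = Id2 K v) \<longleftrightarrow>
    fmap (f, u, v) (f', u', v') (Some \<alpha>) (Some \<beta>)"
proof -
  note t = is_pullback_types[OF assms(1)] is_pullback_types[OF assms(2)]
  show ?thesis using assms(3,4) t by (auto simp: hom_def j_Some Some_comp)
qed

context
  fixes \<eta>0 \<eta>1 assumes eta: "is_pullback K p \<eta>1 \<eta>0 (Idn K one)"
begin

lemma eta_types: "\<eta>0 \<in> Ar K" "\<eta>1 \<in> Ar K" "Dom K \<eta>0 = one" "Dom K \<eta>1 = one"
  using is_pullback_types[OF eta] one_Ob by auto

lemma uni_j:
  assumes "X \<in> Ob K"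
  shows "j (\<eta>0 \<cdot> tobang X) = j \<eta>0 \<bullet> j (tobang X)" "j (\<eta>1 \<cdot> tobang X) = j \<eta>1 \<bullet> j (tobang X)"
  using eta_types tobang[OF assms] by (simp_all add: j_comp)

lemma ide_fibre:
  assumes X: "X \<in> Ob K"
  shows "is_pullback K (Idn K one) (tobang X) (tobang X) (Idn K X)"
proof -
  have "j (Idn K X) = tide X" "j (Idn K one) = tide one" using X one_Ob by (simp_all add: tide_def j_Some)
  then show ?thesis
    using T.pbk_ide[of "j (tobang X)"] tobang[OF X] by (simp add: is_pullback_iff)
qed

lemma uni_fib:
  assumes X: "X \<in> Ob K"
  shows "uni \<eta>0 \<eta>1 X \<in> fib"
proof -
  have "T.pbk (j p) (j \<eta>1 \<bullet> j (tobang X)) (j \<eta>0 \<bullet> j (tobang X)) (j (Idn K X))"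
    using T.pbk_paste[of "j p" "j \<eta>1" "j \<eta>0" "j (Idn K one)"] eta ide_fibre[OF X] by (simp add: is_pullback_iff)
  then show ?thesis using uni_j[OF X] by (simp add: uni_def is_pullback_iff)
qed

lemma uni_natural:
  assumes k: "tarr k" "tdm k = X" "tcd k = Y"
  shows "fmap (uni \<eta>0 \<eta>1 X) (uni \<eta>0 \<eta>1 Y) k k"
proof -
  obtain \<alpha> where a: "k = Some \<alpha>" "\<alpha> \<in> Ce K" using k by (auto simp: tarr_def)
  have X: "X \<in> Ob K" and Y: "Y \<in> Ob K" using k a Dom_Ob Cod_Ob by auto
  have b: "j (tobang Y) \<bullet> k = j (tobang X)"
  proof (rule into_one_eq)
    show a: "tarr (j (tobang Y) \<bullet> k)" using k tobang[OF Y] by (simp add: tarr_tcomp)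
    show "tcd (j (tobang Y) \<bullet> k) = one" "tdm (j (tobang Y) \<bullet> k) = tdm (j (tobang X))"
      using T.cd_comp[OF a] T.dm_comp[OF a] tobang[OF Y] tobang[OF X] k by simp_all
  qed (use tobang[OF X] in simp_all)
  have i: "j (Idn K Y) = tide Y" "j (Idn K X) = tide X" using X Y by (simp_all add: tide_def j_Some)
  show ?thesis
    using T.comp_ide[OF k(1)] T.ide_comp[OF k(1)] b k
    by (simp add: uni_def uni_j[OF X] uni_j[OF Y] i T.assoc)
qed

context
  fixes \<mu>0 \<mu>1 assumes mu: "is_pullback K p \<mu>1 \<mu>0 (ee DM \<cdot> hF DM)"
begin

text \<open>The structures are pulled back from terminal ones, which makes them natural.\<close>

lemma is_double_iff:
  "Fib.is_double (uni \<eta>0 \<eta>1) (cmp \<mu>0 \<mu>1) \<longleftrightarrow>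
     (\<forall>f u v. (f, u, v) \<in> fib \<longrightarrow> cmp \<mu>0 \<mu>1 (uni \<eta>0 \<eta>1 (Cod K f)) (f, u, v) = (f, u, v) \<and>
        cmp \<mu>0 \<mu>1 (f, u, v) (uni \<eta>0 \<eta>1 (Dom K f)) = (f, u, v)) \<and>
     (\<forall>f3 u3 v3 f2 u2 v2 f1 u1 v1. (f3, u3, v3) \<in> fib \<and> (f2, u2, v2) \<in> fib \<and> (f1, u1, v1) \<in> fib \<and>
        Dom K f3 = Cod K f2 \<and> Dom K f2 = Cod K f1 \<longrightarrow>
        cmp \<mu>0 \<mu>1 (cmp \<mu>0 \<mu>1 (f3, u3, v3) (f2, u2, v2)) (f1, u1, v1) =
        cmp \<mu>0 \<mu>1 (f3, u3, v3) (cmp \<mu>0 \<mu>1 (f2, u2, v2) (f1, u1, v1)))" (is "?L \<longleftrightarrow> ?U \<and> ?A")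
proof
  assume L: ?L
  note D = Fib.is_doubleD[OF L]
  have ?U using D(9,10) by force
  moreover have ?A using D(11) by force
  ultimately show "?U \<and> ?A" by blast
next
  assume R: "?U \<and> ?A"
  have Sf: "fcl x y \<alpha> \<beta>
      \<longleftrightarrow> fmap x y (Some \<alpha>) (Some \<beta>)"
    if "x \<in> fib" "y \<in> fib" "\<alpha> \<in> cells K (fdm x) (fdm y)" "\<beta> \<in> cells K (fcd x) (fcd y)" for x y \<alpha> \<beta>
    using that fmap_cells by (cases x; cases y) (simp del: fmap_iff)
  have u: "uni \<eta>0 \<eta>1 X \<in> fib \<and> fdm (uni \<eta>0 \<eta>1 X) = X \<and> fcd (uni \<eta>0 \<eta>1 X) = X" if "X \<in> Ob K" for X
    using uni_fib[OF that] that by (simp add: uni_def)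
  have c: "cmp \<mu>0 \<mu>1 y x \<in> fib \<and> fdm (cmp \<mu>0 \<mu>1 y x) = fdm x \<and> fcd (cmp \<mu>0 \<mu>1 y x) = fcd y"
    if h: "y \<in> fib" "x \<in> fib" "fdm y = fcd x" for y x
  proof -
    obtain f2 u2 v2 f1 u1 v1 where e: "y = (f2, u2, v2)" "x = (f1, u1, v1)" by (cases y; cases x)
    have d: "Dom K f2 = Cod K f1" using h by (simp add: e)
    have a: "f2 \<in> Ar K" "f1 \<in> Ar K" using h is_pullback_types(4) by (auto simp: e)
    obtain f u v where f: "cmp \<mu>0 \<mu>1 y x = (f, u, v)" by (cases "cmp \<mu>0 \<mu>1 y x")
    have "(f, u, v) \<in> fib" "f = f2 \<cdot> f1"
      using cmp_fib[OF mu h(1)[unfolded e] h(2)[unfolded e] d] f[unfolded e] by simp_all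
    then show ?thesis using a d f[unfolded e] unfolding e by simp
  qed
  show ?L
    unfolding Fib.is_double_def
  proof (intro conjI ballI impI)
    show "uni \<eta>0 \<eta>1 X \<in> fib" "fdm (uni \<eta>0 \<eta>1 X) = X" "fcd (uni \<eta>0 \<eta>1 X) = X" if "X \<in> Ob K" for X
      by (rule conjunct1[OF u[OF that]] conjunct1[OF conjunct2[OF u[OF that]]] conjunct2[OF conjunct2[OF u[OF that]]])+
  next
    fix X Y \<alpha> assume X: "X \<in> Ob K" and Y: "Y \<in> Ob K" and a: "\<alpha> \<in> cells K X Y"
    have f: "fmap (uni \<eta>0 \<eta>1 X) (uni \<eta>0 \<eta>1 Y) (Some \<alpha>) (Some \<alpha>)" using uni_natural a by (simp add: hom_def)
    have a': "\<alpha> \<in> cells K (fdm (uni \<eta>0 \<eta>1 X)) (fdm (uni \<eta>0 \<eta>1 Y))" "\<alpha> \<in> cells K (fcd (uni \<eta>0 \<eta>1 X)) (fcd (uni \<eta>0 \<eta>1 Y))"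
      using u[OF X] u[OF Y] a by (simp_all only:)
    show "fcl (uni \<eta>0 \<eta>1 X) (uni \<eta>0 \<eta>1 Y) \<alpha> \<alpha>"
      by (rule iffD2[OF Sf[OF conjunct1[OF u[OF X]] conjunct1[OF u[OF Y]] a'] f])
  next
    fix y x assume y: "y \<in> fib" and x: "x \<in> fib"
    show "cmp \<mu>0 \<mu>1 y x \<in> fib" "fdm (cmp \<mu>0 \<mu>1 y x) = fdm x" "fcd (cmp \<mu>0 \<mu>1 y x) = fcd y" if "fdm y = fcd x"
      by (rule conjunct1[OF c[OF y x that]] conjunct1[OF conjunct2[OF c[OF y x that]]] conjunct2[OF conjunct2[OF c[OF y x that]]])+
    show "cmp \<mu>0 \<mu>1 (uni \<eta>0 \<eta>1 (fcd x)) x = x" "cmp \<mu>0 \<mu>1 x (uni \<eta>0 \<eta>1 (fdm x)) = x"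
      using R x by (cases x; simp)+
    show "cmp \<mu>0 \<mu>1 (cmp \<mu>0 \<mu>1 z y) x = cmp \<mu>0 \<mu>1 z (cmp \<mu>0 \<mu>1 y x)"
      if z: "z \<in> fib" "fdm z = fcd y \<and> fdm y = fcd x" for z
    proof -
      obtain f3 u3 v3 f2 u2 v2 f1 u1 v1 where e: "z = (f3, u3, v3)" "y = (f2, u2, v2)" "x = (f1, u1, v1)"
        by (cases z; cases y; cases x)
      show ?thesis using R z x y unfolding e by auto
    qed
    fix y' x' \<alpha> \<beta> \<gamma>
    assume y': "y' \<in> fib" and x': "x' \<in> fib" and d: "fdm y = fcd x \<and> fdm y' = fcd x'"
      and a: "\<alpha> \<in> cells K (fdm x) (fdm x')" and b: "\<beta> \<in> cells K (fcd x) (fcd x')" and g: "\<gamma> \<in> cells K (fcd y) (fcd y')"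
      and S: "fcl x x' \<alpha> \<beta>
        \<and> fcl y y' \<beta> \<gamma>"
    have b': "\<beta> \<in> cells K (fdm y) (fdm y')" using b d by (simp only:)
    have s: "fmap x x' (Some \<alpha>) (Some \<beta>)" "fmap y y' (Some \<beta>) (Some \<gamma>)"
      by (rule iffD1[OF Sf[OF x x' a b] conjunct1[OF S]], rule iffD1[OF Sf[OF y y' b' g] conjunct2[OF S]])
    have f: "fmap (cmp \<mu>0 \<mu>1 y x) (cmp \<mu>0 \<mu>1 y' x') (Some \<alpha>) (Some \<gamma>)"
    proof -
      obtain f2 u2 v2 f1 u1 v1 where e: "y = (f2, u2, v2)" "x = (f1, u1, v1)" by (cases y; cases x)
      obtain f2' u2' v2' f1' u1' v1' where e': "y' = (f2', u2', v2')" "x' = (f1', u1', v1')" by (cases y'; cases x')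
      have dd: "Dom K f2 = Cod K f1" "Dom K f2' = Cod K f1'" using d by (simp_all add: e e')
      show ?thesis
        using cmp_natural[OF mu y[unfolded e] x[unfolded e] dd(1) y'[unfolded e'] x'[unfolded e'] dd(2)] s unfolding e e' by blast
    qed
    note cy = c[OF y x conjunct1[OF d]] and cy' = c[OF y' x' conjunct2[OF d]]
    have ag: "\<alpha> \<in> cells K (fdm (cmp \<mu>0 \<mu>1 y x)) (fdm (cmp \<mu>0 \<mu>1 y' x'))" "\<gamma> \<in> cells K (fcd (cmp \<mu>0 \<mu>1 y x)) (fcd (cmp \<mu>0 \<mu>1 y' x'))"
      using cy cy' a g by (simp_all only:)
    show "fcl (cmp \<mu>0 \<mu>1 y x) (cmp \<mu>0 \<mu>1 y' x') \<alpha> \<gamma>"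
      by (rule iffD2[OF Sf[OF conjunct1[OF cy] conjunct1[OF cy'] ag] f])
  qed
qed

end

end

end

section \<open>The unit laws\<close>

context fibration_polynomials begin

lemma j_idn: "X \<in> Ob K \<Longrightarrow> j (Idn K X) = tide X"
  by (simp add: tide_def j_Some)

lemma j_idn_left: "tarr x \<Longrightarrow> tcd x = X \<Longrightarrow> X \<in> Ob K \<Longrightarrow> j (Idn K X) \<bullet> x = x"
  and j_idn_right: "tarr x \<Longrightarrow> tdm x = X \<Longrightarrow> X \<in> Ob K \<Longrightarrow> x \<bullet> j (Idn K X) = x"
  using T.ide_comp[of x] T.comp_ide[of x] by (simp_all add: j_idn)

lemma tobang_comp:
  assumes f: "f \<in> Ar K" and g: "g \<in> Ar K" "Cod K g = one" "Dom K g = Dom K f"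
  shows "j (tobang (Cod K f)) \<bullet> j f = j g"
proof (rule into_one_eq)
  have X: "Cod K f \<in> Ob K" using f by (simp add: Cod_Ob)
  show a: "tarr (j (tobang (Cod K f)) \<bullet> j f)" using tobang[OF X] f by (simp add: tarr_tcomp)
  show "tarr (j g)" "tcd (j (tobang (Cod K f)) \<bullet> j f) = one" "tcd (j g) = one" "tdm (j (tobang (Cod K f)) \<bullet> j f) = tdm (j g)"
    using T.cd_comp[OF a] T.dm_comp[OF a] tobang[OF X] f g by simp_all
qed

lemma polycellI:
  assumes "opoly (p1, p2, p3)" "opoly (q1, q2, q3)" "is_pullback K q2 f1 f0 p2"
  shows "((p1, p2, p3), (q1, q2, q3), f0, f1) \<in> polycells K pb"
proof -
  note o1 = opolyD[OF assms(1)] and o2 = opolyD[OF assms(2)] and t = is_pullback_types[OF assms(3)]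
  have "q1 \<cdot> f0 = p1" by (rule into_one_arr_eq) (use o1 o2 t in simp_all)
  moreover have "q3 \<cdot> f1 = p3" by (rule into_one_arr_eq) (use o1 o2 t in simp_all)
  ultimately show ?thesis
    using assms o1 o2 t by (simp add: polycells_def opoly_def hom_def)
qed

abbreviation "generic \<equiv> (p, Idn K (Dom K p), Idn K (Cod K p))"

lemma generic_fib: "generic \<in> fib"
proof -
  have "T.pbk (j p) (j (Idn K (Cod K p))) (j (Idn K (Dom K p))) (j p)"
    using T.pbk_sym[OF T.pbk_ide[of "j p"]] p_arr by (simp add: j_idn Dom_Ob Cod_Ob)
  then show ?thesis by (simp add: is_pullback_iff)
qed

lemma pid2_M: "pid2 M = (M, M, Idn K (Dom K p), Idn K (Cod K p))"
  by (simp add: pid2_def M_eq Let_def)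

lemma pid2_M_cell: "((tobang (Dom K p), p, tobang (Cod K p)), (tobang (Dom K p), p, tobang (Cod K p)),
    Idn K (Dom K p), Idn K (Cod K p)) \<in> polycells K pb"
  using polycellI[OF opoly_M' opoly_M'] generic_fib by simp

lemma pid_eq: "pid one = (Idn K one, Idn K one, Idn K one)"
  by (simp add: pid_def)

context
  fixes \<eta>0 \<eta>1 \<mu>0 \<mu>1
  assumes eta: "is_pullback K p \<eta>1 \<eta>0 (Idn K one)" and mu: "is_pullback K p \<mu>1 \<mu>0 (ee DM \<cdot> hF DM)"
begin

lemma eta_polycell: "((Idn K one, Idn K one, Idn K one), (tobang (Dom K p), p, tobang (Cod K p)), \<eta>0, \<eta>1) \<in> polycells K pb"
  by (rule polycellI[OF opoly_id' opoly_M' eta])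

text \<open>The monad law says that the composite of the two steps of \<open>1 \<circ> M\<close>, the upper one being equipped with the
  structure induced by \<open>\<eta>\<close>, has the structure given by the left unit isomorphism. The pair formed by a
  p-fibration \<open>x\<close> and the identity of its codomain maps to this pair, so by naturality the law for \<open>x\<close>
  follows. Conversely, this pair maps to the one formed by \<open>p\<close> and the identity of its codomain, where
  the law determines the structure.\<close>

lemma left_unit_iff:
  "pvcomp (mult_cell \<mu>0 \<mu>1) (phcomp (unit_cell \<eta>0 \<eta>1) (pid2 M)) = plunit M \<longleftrightarrow>
     (\<forall>f u v. (f, u, v) \<in> fib \<longrightarrow> cmp \<mu>0 \<mu>1 (uni \<eta>0 \<eta>1 (Cod K f)) (f, u, v) = (f, u, v))" (is "?L \<longleftrightarrow> ?R")
proof -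
  define D where "D = cdata (Idn K one, Idn K one, Idn K one) (tobang (Dom K p), p, tobang (Cod K p))"
  note P = cdata_P_types[OF opoly_id' opoly_M' D_def] and E = cdata_D_types[OF opoly_id' opoly_M' D_def]
    and H = cdata_H_types[OF opoly_id' opoly_M' D_def] and J = cdata_j[OF opoly_id' opoly_M' D_def]
    and uf = up_fibre[OF opoly_id' opoly_M' D_def] and lf = lo_fibre[OF opoly_id' opoly_M' D_def]
  note ot = one_Ob idn_arr[OF one_Ob] and pt = p_arr Dom_Ob[OF p_arr] Cod_Ob[OF p_arr]
  note et = is_pullback_types[OF eta] and mt = is_pullback_types[OF mu]
  let ?a = "pr1 D \<cdot> eps D" and ?b = "pr2 D \<cdot> eps D"
  have ab: "?a \<in> Ar K" "Dom K ?a = Dom K (ee D)" "Cod K ?a = Cod K p" "?b \<in> Ar K" "Dom K ?b = Dom K (ee D)" "Cod K ?b = one"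
    using P E ot by simp_all
  have idf: "Idn K (Dom K p) \<cdot> hA D = hA D" "Idn K (Cod K p) \<cdot> ?a = ?a" using H ab by simp_all
  obtain h0 s h1 where h: "phcomp (unit_cell \<eta>0 \<eta>1) (pid2 M) = (pcomp (pid one) M, pcomp M M, h0, h1)"
    "h0 \<in> Ar K" "s \<in> Ar K" "h1 \<in> Ar K"
    "fmap (ee D, \<eta>0 \<cdot> ?b, \<eta>1 \<cdot> rr D) (up M M) (j s) (j h1)"
    "fmap (hF D, hA D, ?a) (lo M M) (j h0) (j s)"
    by (rule phcomp_char[OF pid2_M_cell eta_polycell opoly_M' opoly_M' opoly_id' opoly_M' D_def,
          folded M_eq pid_eq, folded pid2_M, unfolded idf]) (rule that)
  \<comment> \<open>\<open>ee D\<close> is a pullback of an identity, hence invertible\<close>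
  have "T.pbk (tide (tcd (j (rr D)))) (j (rr D)) (j ?b) (j (ee D))"
    using uf E ot by (simp add: is_pullback_iff j_idn)
  then obtain i' where i': "T.tight i'" "j (ee D) \<bullet> i' = tide (tdm (j (rr D)))" "i' \<bullet> j (ee D) = tide (tdm (j (ee D)))"
    by (rule T.pbk_ide_inverse) (use E in simp_all)
  then obtain i where i: "i \<in> Ar K" "i' = j i" by (metis tight_obtain)
  have ie: "i \<cdot> ee D = Idn K (Dom K (ee D))" "Cod K (ee D) = Dom K i"
    using j_comp_eq[of i "ee D" "Idn K (Dom K (ee D))"] i' i E by (simp_all add: Dom_Ob j_idn)
  have ei: "ee D \<cdot> i = Idn K (Dom K (rr D))" "Dom K (ee D) = Cod K i"
    using j_comp_eq[of "ee D" i "Idn K (Dom K (rr D))"] i' i E by (simp_all add: Dom_Ob j_idn)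
  let ?g = "?a \<cdot> i"
  have g: "?g \<in> Ar K" "Dom K ?g = Cod K (ee D)" "Cod K ?g = Cod K p" "?g \<cdot> ee D = ?a"
    using ab ie ei i E by (simp_all add: comp_assoc)
  have the: "(THE f1. f1 \<in> hom K (Cod K (ee D)) (Cod K p) \<and> f1 \<cdot> ee D = ?a) = ?g"
  proof (rule the_equality)
    show "?g \<in> hom K (Cod K (ee D)) (Cod K p) \<and> ?g \<cdot> ee D = ?a" using g by (simp add: hom_def)
    fix f1 assume f: "f1 \<in> hom K (Cod K (ee D)) (Cod K p) \<and> f1 \<cdot> ee D = ?a"
    then have "f1 \<in> Ar K" "Dom K f1 = Cod K (ee D)" by (auto simp: hom_def)
    then have "(f1 \<cdot> ee D) \<cdot> i = f1" using E ei i by (simp add: comp_assoc)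
    then show "f1 = ?g" using f by simp
  qed
  have pl: "plunit M = (pcomp (pid one) M, M, hA D, ?g)"
    using tobang(3)[of "Cod K p"] pt the by (simp add: plunit_def M_eq pid_eq Let_def D_def)
  have jg: "j ?g \<bullet> j (ee D) = j ?a" using g E by (simp add: j_comp[symmetric])
  have jb: "j (\<eta>0 \<cdot> ?b) = j \<eta>0 \<bullet> j ?b" "j (\<eta>1 \<cdot> rr D) = j \<eta>1 \<bullet> j (rr D)"
    using et ot ab E by (simp_all add: j_comp)
  have zf: "(ee D, \<eta>0 \<cdot> ?b, \<eta>1 \<cdot> rr D) \<in> fib"
    using T.pbk_paste[of "j p" "j \<eta>1" "j \<eta>0" "j (Idn K one)" "j (rr D)" "j ?b" "j (ee D)"] eta uf
    by (simp add: is_pullback_iff jb)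
  have lfib: "(hF D, hA D, ?a) \<in> fib" using lf by simp
  have dd: "Dom K (ee D) = Cod K (hF D)" using H by simp
  obtain u v where uv: "cmp \<mu>0 \<mu>1 (ee D, \<eta>0 \<cdot> ?b, \<eta>1 \<cdot> rr D) (hF D, hA D, ?a) = (ee D \<cdot> hF D, u, v)"
    "j u = j \<mu>0 \<bullet> j h0" "j v = j \<mu>1 \<bullet> j h1" "u \<in> Ar K" "v \<in> Ar K"
    by (rule cmp_eq[OF mu zf lfib dd h(5,6)]) (rule that)
  have u: "\<mu>0 \<cdot> h0 = u" "\<mu>1 \<cdot> h1 = v" using j_comp_eq(1) uv by metis+
  have L: "?L \<longleftrightarrow> u = hA D \<and> v = ?g"
    unfolding h(1) pl pvcomp_def by (simp add: u)
  show ?thesis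
  proof
    assume ?L
    then have uv': "cmp \<mu>0 \<mu>1 (ee D, \<eta>0 \<cdot> ?b, \<eta>1 \<cdot> rr D) (hF D, hA D, ?a) = (ee D \<cdot> hF D, hA D, ?g)"
      using L uv by simp
    show ?R
    proof (intro allI impI)
      fix f a b assume x: "(f, a, b) \<in> fib"
      then have x': "is_pullback K p b a f" by simp
      note xt = is_pullback_types[OF x']
      let ?Y = "Cod K f"
      have Y: "?Y \<in> Ob K" by (rule Cod_Ob[OF xt(4)])
      note b = tobang[OF Y]
      have yd: "Dom K (Idn K ?Y) = Cod K f" using Y by simp
      obtain n0 n1 n2 where n: "n0 \<in> Ar K" "n1 \<in> Ar K" "n2 \<in> Ar K"
        "fmap (Idn K ?Y, tobang ?Y, tobang ?Y) (ee D, ?b, rr D) (j n1) (j n2)" "fmap (f, a, b) (hF D, hA D, ?a) (j n0) (j n1)"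
        by (rule up_lo_lift[OF opoly_id' opoly_M' D_def ide_fibre[OF eta Y] x' yd]) (rule that)
      have m: "fmap (uni \<eta>0 \<eta>1 ?Y) (ee D, \<eta>0 \<cdot> ?b, \<eta>1 \<cdot> rr D) (j n1) (j n2)"
        using n(4) by (simp add: uni_def uni_j[OF eta Y] jb T.assoc)
      obtain y1 y2 where U: "uni \<eta>0 \<eta>1 ?Y = (Idn K ?Y, y1, y2)" by (simp add: uni_def)
      have uf: "(Idn K ?Y, y1, y2) \<in> fib" using uni_fib[OF eta Y] U by simp
      obtain u' v' where c: "cmp \<mu>0 \<mu>1 (Idn K ?Y, y1, y2) (f, a, b) = (Idn K ?Y \<cdot> f, u', v')"
        using cmp_fib(2)[OF mu uf x yd] by (metis fst_conv surj_pair)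
      have cf: "(Idn K ?Y \<cdot> f, u', v') \<in> fib" using cmp_fib(1)[OF mu uf x yd] c by simp
      have "fmap (Idn K ?Y \<cdot> f, u', v') (ee D \<cdot> hF D, hA D, ?g) (j n0) (j n2)"
        using cmp_natural[OF mu uf x yd zf lfib dd n(5) m[unfolded U]] uv' c by simp
      then have e: "j (hA D) \<bullet> j n0 = j u'" "j ?g \<bullet> j n2 = j v'" by simp_all
      have n2d: "Dom K n2 = ?Y"
        using fmap_arrows(3)[OF ide_fibre[OF eta Y] \<open>is_pullback K (Idn K one) (rr D) ?b (ee D)\<close> n(2,3,4)] Y by simp
      have "j n2 = j (ee D) \<bullet> j n1" using n(4) n2d n(3) Y j_idn_right[of "j n2" ?Y] by simp
      then have "j ?g \<bullet> j n2 = j ?a \<bullet> j n1" using jg by (metis T.assoc)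
      then have "j v' = j b" "j u' = j a" using e n(5) by simp_all
      moreover have "u' \<in> Ar K" "v' \<in> Ar K" using is_pullback_types(2,3)[of p v' u' "Idn K ?Y \<cdot> f"] cf by simp_all
      ultimately have "v' = b" "u' = a" using j_inj by blast+
      then show "cmp \<mu>0 \<mu>1 (uni \<eta>0 \<eta>1 ?Y) (f, a, b) = (f, a, b)" using c U xt by simp
    qed
  next
    assume R: ?R
    have B: "Cod K p \<in> Ob K" using pt by simp
    have law: "cmp \<mu>0 \<mu>1 (uni \<eta>0 \<eta>1 (Cod K p)) generic = generic" using R generic_fib by blast
    obtain y1 y2 where U: "uni \<eta>0 \<eta>1 (Cod K p) = (Idn K (Cod K p), y1, y2)" by (simp add: uni_def)
    have uf': "(Idn K (Cod K p), y1, y2) \<in> fib" using uni_fib[OF eta B] U by simp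
    have du: "Dom K (Idn K (Cod K p)) = Cod K p" using B by simp
    have m1: "fmap (hF D, hA D, ?a) generic (j (hA D)) (j ?a)"
      using T.pbk_comm lf H ab pt by (simp add: is_pullback_iff j_idn_left)
    have "j (tobang (Cod K p)) \<bullet> j ?a = j ?b" "j (tobang (Cod K p)) \<bullet> j ?g = j (rr D)"
      using tobang_comp[of ?a ?b] tobang_comp[of ?g "rr D"] ab g E ot by simp_all
    then have m2: "fmap (ee D, \<eta>0 \<cdot> ?b, \<eta>1 \<cdot> rr D) (uni \<eta>0 \<eta>1 (Cod K p)) (j ?a) (j ?g)"
      using jg ab B by (simp add: uni_def uni_j[OF eta B] jb T.assoc j_idn_left)
    have "fmap (ee D \<cdot> hF D, u, v) generic (j (hA D)) (j ?g)"
      using cmp_natural[OF mu zf lfib dd uf' generic_fib du m1 m2[unfolded U]] U uv(1) law by simp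
    then have "j (hA D) = j u" "j ?g = j v" using H g pt j_idn_left by simp_all
    then show ?L using L j_inj H g by metis
  qed
qed

text \<open>The argument for the left unit law, with the identity below the p-fibration.\<close>

lemma right_unit_iff:
  "pvcomp (mult_cell \<mu>0 \<mu>1) (phcomp (pid2 M) (unit_cell \<eta>0 \<eta>1)) = prunit M \<longleftrightarrow>
     (\<forall>f u v. (f, u, v) \<in> fib \<longrightarrow> cmp \<mu>0 \<mu>1 (f, u, v) (uni \<eta>0 \<eta>1 (Dom K f)) = (f, u, v))" (is "?L \<longleftrightarrow> ?R")
proof -
  define D where "D = cdata (tobang (Dom K p), p, tobang (Cod K p)) (Idn K one, Idn K one, Idn K one)"
  note P = cdata_P_types[OF opoly_M' opoly_id' D_def] and E = cdata_D_types[OF opoly_M' opoly_id' D_def]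
    and H = cdata_H_types[OF opoly_M' opoly_id' D_def] and J = cdata_j[OF opoly_M' opoly_id' D_def]
    and uf = up_fibre[OF opoly_M' opoly_id' D_def] and lf = lo_fibre[OF opoly_M' opoly_id' D_def]
  note ot = one_Ob idn_arr[OF one_Ob] and pt = p_arr Dom_Ob[OF p_arr] Cod_Ob[OF p_arr]
  note et = is_pullback_types[OF eta] and mt = is_pullback_types[OF mu]
  let ?a = "pr1 D \<cdot> eps D" and ?b = "pr2 D \<cdot> eps D"
  have ab: "?a \<in> Ar K" "Dom K ?a = Dom K (ee D)" "Cod K ?a = one" "?b \<in> Ar K" "Dom K ?b = Dom K (ee D)" "Cod K ?b = Dom K p"
    using P E ot by simp_all
  have idf: "Idn K (Dom K p) \<cdot> ?b = ?b" "Idn K (Cod K p) \<cdot> rr D = rr D" using E ab by simp_all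
  obtain h0 s h1 where h: "phcomp (pid2 M) (unit_cell \<eta>0 \<eta>1) = (pcomp M (pid one), pcomp M M, h0, h1)"
    "h0 \<in> Ar K" "s \<in> Ar K" "h1 \<in> Ar K"
    "fmap (ee D, ?b, rr D) (up M M) (j s) (j h1)"
    "fmap (hF D, \<eta>0 \<cdot> hA D, \<eta>1 \<cdot> ?a) (lo M M) (j h0) (j s)"
    by (rule phcomp_char[OF eta_polycell pid2_M_cell opoly_id' opoly_M' opoly_M' opoly_M' D_def,
          folded M_eq pid_eq, folded pid2_M, unfolded idf]) (rule that)
  let ?k = "?b \<cdot> hF D"
  have k: "?k \<in> Ar K" "pr2 D \<cdot> eps D \<cdot> hF D = ?k" "j ?k = j ?b \<bullet> j (hF D)" "Dom K ?k = Dom K (hF D)" "Cod K ?k = Dom K p"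
    using P E H by (simp_all add: comp_assoc) (simp add: comp_assoc[symmetric] j_comp)
  have pl: "prunit M = (pcomp M (pid one), M, ?k, rr D)"
    using tobang(3)[of "Dom K p"] pt k(2) by (simp add: prunit_def M_eq pid_eq Let_def D_def)
  have jb: "j (\<eta>0 \<cdot> hA D) = j \<eta>0 \<bullet> j (hA D)" "j (\<eta>1 \<cdot> ?a) = j \<eta>1 \<bullet> j ?a"
    using et ot ab H by (simp_all add: j_comp)
  have zf: "(hF D, \<eta>0 \<cdot> hA D, \<eta>1 \<cdot> ?a) \<in> fib"
    using T.pbk_paste[of "j p" "j \<eta>1" "j \<eta>0" "j (Idn K one)" "j ?a" "j (hA D)" "j (hF D)"] eta lf
    by (simp add: is_pullback_iff jb)
  have ufib: "(ee D, ?b, rr D) \<in> fib" using uf by simp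
  have dd: "Dom K (ee D) = Cod K (hF D)" using H by simp
  obtain u v where uv: "cmp \<mu>0 \<mu>1 (ee D, ?b, rr D) (hF D, \<eta>0 \<cdot> hA D, \<eta>1 \<cdot> ?a) = (ee D \<cdot> hF D, u, v)"
    "j u = j \<mu>0 \<bullet> j h0" "j v = j \<mu>1 \<bullet> j h1" "u \<in> Ar K" "v \<in> Ar K"
    by (rule cmp_eq[OF mu ufib zf dd h(5,6)]) (rule that)
  have u: "\<mu>0 \<cdot> h0 = u" "\<mu>1 \<cdot> h1 = v" using j_comp_eq(1) uv by metis+
  have L: "?L \<longleftrightarrow> u = ?k \<and> v = rr D"
    unfolding h(1) pl pvcomp_def by (simp add: u)
  show ?thesis
  proof
    assume ?L
    then have uv': "cmp \<mu>0 \<mu>1 (ee D, ?b, rr D) (hF D, \<eta>0 \<cdot> hA D, \<eta>1 \<cdot> ?a) = (ee D \<cdot> hF D, ?k, rr D)"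
      using L uv by simp
    show ?R
    proof (intro allI impI)
      fix f a b assume x: "(f, a, b) \<in> fib"
      then have x': "is_pullback K p b a f" by simp
      note xt = is_pullback_types[OF x']
      let ?Y = "Dom K f"
      have Y: "?Y \<in> Ob K" by (rule Dom_Ob[OF xt(4)])
      have yd: "Dom K f = Cod K (Idn K ?Y)" using Y by simp
      obtain n0 n1 n2 where n: "n0 \<in> Ar K" "n1 \<in> Ar K" "n2 \<in> Ar K"
        "fmap (f, a, b) (ee D, ?b, rr D) (j n1) (j n2)" "fmap (Idn K ?Y, tobang ?Y, tobang ?Y) (hF D, hA D, ?a) (j n0) (j n1)"
        by (rule up_lo_lift[OF opoly_M' opoly_id' D_def x' ide_fibre[OF eta Y] yd]) (rule that)
      have m: "fmap (uni \<eta>0 \<eta>1 ?Y) (hF D, \<eta>0 \<cdot> hA D, \<eta>1 \<cdot> ?a) (j n0) (j n1)"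
        using n(5) by (simp add: uni_def uni_j[OF eta Y] jb T.assoc)
      obtain y1 y2 where U: "uni \<eta>0 \<eta>1 ?Y = (Idn K ?Y, y1, y2)" by (simp add: uni_def)
      have uf': "(Idn K ?Y, y1, y2) \<in> fib" using uni_fib[OF eta Y] U by simp
      obtain u' v' where c: "cmp \<mu>0 \<mu>1 (f, a, b) (Idn K ?Y, y1, y2) = (f \<cdot> Idn K ?Y, u', v')"
        using cmp_fib(2)[OF mu x uf' yd] by (metis fst_conv surj_pair)
      have cf: "(f \<cdot> Idn K ?Y, u', v') \<in> fib" using cmp_fib(1)[OF mu x uf' yd] c by simp
      have "fmap (f \<cdot> Idn K ?Y, u', v') (ee D \<cdot> hF D, ?k, rr D) (j n0) (j n2)"
        using cmp_natural[OF mu x uf' yd ufib zf dd m[unfolded U] n(4)] uv' c by simp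
      then have e: "j ?k \<bullet> j n0 = j u'" "j (rr D) \<bullet> j n2 = j v'" by simp_all
      have n1d: "Dom K n1 = ?Y"
        using fmap_arrows(3)[OF ide_fibre[OF eta Y] lf n(1,2,5)] Y by simp
      have "j (hF D) \<bullet> j n0 = j n1" using n(5) n1d n(2) Y j_idn_right[of "j n1" ?Y] by simp
      then have "j ?k \<bullet> j n0 = j ?b \<bullet> j n1" using k(3) by (metis T.assoc)
      then have "j v' = j b" "j u' = j a" using e n(4) by simp_all
      moreover have "u' \<in> Ar K" "v' \<in> Ar K" using is_pullback_types(2,3)[of p v' u' "f \<cdot> Idn K ?Y"] cf by simp_all
      ultimately have "v' = b" "u' = a" using j_inj by blast+
      then show "cmp \<mu>0 \<mu>1 (f, a, b) (uni \<eta>0 \<eta>1 ?Y) = (f, a, b)" using c U xt by simp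
    qed
  next
    assume R: ?R
    have B: "Dom K p \<in> Ob K" using pt by simp
    have law: "cmp \<mu>0 \<mu>1 generic (uni \<eta>0 \<eta>1 (Dom K p)) = generic" using R generic_fib by blast
    obtain y1 y2 where U: "uni \<eta>0 \<eta>1 (Dom K p) = (Idn K (Dom K p), y1, y2)" by (simp add: uni_def)
    have uf': "(Idn K (Dom K p), y1, y2) \<in> fib" using uni_fib[OF eta B] U by simp
    have du: "Dom K p = Cod K (Idn K (Dom K p))" using B by simp
    have m1: "fmap (ee D, ?b, rr D) generic (j ?b) (j (rr D))"
      using T.pbk_comm uf E ab pt by (simp add: is_pullback_iff j_idn_left)
    have "j (tobang (Dom K p)) \<bullet> j ?k = j (hA D)" "j (tobang (Dom K p)) \<bullet> j ?b = j ?a"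
      using tobang_comp[of ?k "hA D"] tobang_comp[of ?b ?a] ab k H ot by simp_all
    moreover have idk: "j (Idn K (Dom K p)) \<bullet> j ?b \<bullet> j (hF D) = j ?b \<bullet> j (hF D)"
      unfolding k(3)[symmetric] by (rule j_idn_left) (use k(1,5) B in simp_all)
    ultimately have m2: "fmap (hF D, \<eta>0 \<cdot> hA D, \<eta>1 \<cdot> ?a) (uni \<eta>0 \<eta>1 (Dom K p)) (j ?k) (j ?b)"
      using k idk by (simp add: uni_def uni_j[OF eta B] jb T.assoc)
    have "fmap (ee D \<cdot> hF D, u, v) generic (j ?k) (j (rr D))"
      using cmp_natural[OF mu ufib zf dd generic_fib uf' du m2[unfolded U] m1] U uv(1) law by simp
    then have "j ?k = j u" "j (rr D) = j v" using k(1,4,5) E pt j_idn_left by simp_all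
    then show ?L using L j_inj k E by metis
  qed
qed

end

end

section \<open>The associativity law\<close>

context fibration_polynomials begin

lemma fmap_j_iff:
  assumes x: "is_pullback K q v u f" and y: "is_pullback K q v' u' f'" and st: "s \<in> Ar K" "t \<in> Ar K"
  shows "fmap (f, u, v) (f', u', v') (j s) (j t) \<longleftrightarrow>
    s \<in> hom K (Dom K f) (Dom K f') \<and> t \<in> hom K (Cod K f) (Cod K f') \<and> f' \<cdot> s = t \<cdot> f \<and> u' \<cdot> s = u \<and> v' \<cdot> t = v"
    (is "?L \<longleftrightarrow> ?R")
proof
  note xt = is_pullback_types[OF x] and yt = is_pullback_types[OF y]
  assume L: ?L
  note d = fmap_arrows[OF x y st L]
  have "j (f' \<cdot> s) = j (t \<cdot> f)" "j (u' \<cdot> s) = j u" "j (v' \<cdot> t) = j v"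
    using L d xt yt st by (simp_all add: j_comp)
  then have "f' \<cdot> s = t \<cdot> f" "u' \<cdot> s = u" "v' \<cdot> t = v"
    using d xt yt st by (blast intro: j_inj comp_arr(1) sym)+
  then show ?R using d st by (simp add: hom_def)
next
  note xt = is_pullback_types[OF x] and yt = is_pullback_types[OF y]
  assume R: ?R
  then have d: "Dom K s = Dom K f" "Cod K s = Dom K f'" "Dom K t = Cod K f" "Cod K t = Cod K f'"
    and e: "f' \<cdot> s = t \<cdot> f" "u' \<cdot> s = u" "v' \<cdot> t = v"
    by (simp_all add: hom_def)
  have "j f' \<bullet> j s = j (f' \<cdot> s)" "j t \<bullet> j f = j (t \<cdot> f)" "j u' \<bullet> j s = j (u' \<cdot> s)" "j v' \<bullet> j t = j (v' \<cdot> t)"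
    by (rule j_comp[symmetric]; use xt yt st d in simp)+
  then show ?L unfolding fmap_iff e by metis
qed

abbreviation "MM \<equiv> (tobang (Dom K p) \<cdot> hA DM, ee DM \<cdot> hF DM, tobang (Cod K p) \<cdot> rr DM)"

lemma pcomp_MM: "pcomp M M = MM"
  using pcomp_eq[OF opoly_M' opoly_M' DM_eq] by (simp add: M_eq)

lemma opoly_MM: "opoly MM"
  using pcomp_opoly[OF opoly_M' opoly_M' DM_eq] pcomp_MM by (simp add: M_eq)

text \<open>The comparison with the terminal pair makes the composite of two p-fibrations a pullback of the middle
  arrow of \<open>M \<circ> M\<close>.\<close>

lemma composite_fibre:
  assumes "is_pullback K p v2 u2 f2" "is_pullback K p v1 u1 f1" "Dom K f2 = Cod K f1"
  obtains k0 k1 k2 where "k0 \<in> Ar K" "k1 \<in> Ar K" "k2 \<in> Ar K"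
    "fmap (f2, u2, v2) (up M M) (j k1) (j k2)" "fmap (f1, u1, v1) (lo M M) (j k0) (j k1)"
    "is_pullback K (ee DM \<cdot> hF DM) k2 k0 (f2 \<cdot> f1)" "j (f2 \<cdot> f1) = j f2 \<bullet> j f1"
proof -
  obtain k0 k1 k2 where k: "k0 \<in> Ar K" "k1 \<in> Ar K" "k2 \<in> Ar K"
    "fmap (f2, u2, v2) (ee DM, pr2 DM \<cdot> eps DM, rr DM) (j k1) (j k2)"
    "fmap (f1, u1, v1) (hF DM, hA DM, pr1 DM \<cdot> eps DM) (j k0) (j k1)"
    by (rule DM_lift[OF assms]) (rule that)
  have J: "j (ee DM \<cdot> hF DM) = j (ee DM) \<bullet> j (hF DM)" "j (f2 \<cdot> f1) = j f2 \<bullet> j f1"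
    using DM_types is_pullback_types[OF assms(1)] is_pullback_types[OF assms(2)] assms(3) by (simp_all add: j_comp)
  have "T.pbk (j (ee DM) \<bullet> j (hF DM)) (j k2) (j k0) (j f2 \<bullet> j f1)"
    using T.pbk_vpaste fmap_pbk[OF assms(2) DM_lo k(1,2,5)] fmap_pbk[OF assms(1) DM_up k(2,3,4)] by blast
  then have "is_pullback K (ee DM \<cdot> hF DM) k2 k0 (f2 \<cdot> f1)" unfolding is_pullback_iff J .
  then show ?thesis by (rule that[OF k(1-3) k(4,5)[folded DM_up_lo] _ J(2)])
qed

text \<open>The upper step of \<open>(M \<circ> M) \<circ> M\<close> is a pullback of the middle arrow of \<open>M \<circ> M\<close>; pulling back the two
  steps of the latter splits it in two. The resulting three p-fibrations receive a map from every
  composable triple: compare its upper two members with the terminal pair, use the universal property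
  of the outer composite, and lift the object in the middle through the pullback \<open>(m, n)\<close>.\<close>

lemma left_ladder:
  defines "D \<equiv> cdata MM (tobang (Dom K p), p, tobang (Cod K p))"
  defines "z \<equiv> pr2 D \<cdot> eps D" and "m \<equiv> fst (pb (ee DM) (rr D))" and "n \<equiv> snd (pb (ee DM) (rr D))"
  defines "y \<equiv> pb_lift K m n (hF DM \<cdot> z) (ee D)"
  defines "l1 \<equiv> (hF D, hA D, pr1 D \<cdot> eps D)" and "l2 \<equiv> (y, hA DM \<cdot> z, pr1 DM \<cdot> eps DM \<cdot> m)"
    and "l3 \<equiv> (n, pr2 DM \<cdot> eps DM \<cdot> m, rr DM \<cdot> rr D)"
  shows "l1 \<in> fib" "l2 \<in> fib" "l3 \<in> fib" "Dom K n = Cod K y" "Dom K y = Cod K (hF D)" "n \<cdot> y = ee D"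
    "fmap l3 (up M M) (j m) (j (rr D))" "fmap l2 (lo M M) (j z) (j m)"
    "\<And>f3 u3 v3 f2 u2 v2 f1 u1 v1. (f3, u3, v3) \<in> fib \<Longrightarrow> (f2, u2, v2) \<in> fib \<Longrightarrow> (f1, u1, v1) \<in> fib \<Longrightarrow>
        Dom K f3 = Cod K f2 \<Longrightarrow> Dom K f2 = Cod K f1 \<Longrightarrow>
        \<exists>n0 n1 n2 n3. fmap (f1, u1, v1) l1 n0 n1 \<and> fmap (f2, u2, v2) l2 n1 n2 \<and> fmap (f3, u3, v3) l3 n2 n3"
proof -
  have De: "D = cdata MM (tobang (Dom K p), p, tobang (Cod K p))" by (simp add: D_def)
  note P = cdata_P_types[OF opoly_MM opoly_M' De] and E = cdata_D_types[OF opoly_MM opoly_M' De]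
    and H = cdata_H_types[OF opoly_MM opoly_M' De]
    and uf = up_fibre[OF opoly_MM opoly_M' De, folded z_def] and lf = lo_fibre[OF opoly_MM opoly_M' De]
  note DT = DM_types and oM = opolyD[OF opoly_MM]
  have z: "z \<in> Ar K" "Dom K z = Dom K (ee D)" "Cod K z = Dom K (hF DM)"
    using P E DT by (simp_all add: z_def)
  let ?a = "pr1 DM \<cdot> eps DM" and ?b = "pr2 DM \<cdot> eps DM"
  have ab: "?a \<in> Ar K" "Dom K ?a = Dom K (ee DM)" "?b \<in> Ar K" "Dom K ?b = Dom K (ee DM)"
    using DT by simp_all
  have Q: "T.pbk (j (ee DM)) (j (rr D)) (j m) (j n)"
    unfolding m_def n_def using chosen_pbk[of "ee DM" "rr D"] DT E by simp
  note Qt = T.pbk_types[OF Q]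
  have mn: "m \<in> Ar K" "n \<in> Ar K" "Cod K m = Dom K (ee DM)" "Cod K n = Dom K (rr D)" "Dom K m = Dom K n"
    using Qt DT E by simp_all
  have J: "j (hF DM \<cdot> z) = j (hF DM) \<bullet> j z" "hF DM \<cdot> z \<in> Ar K" "j (ee DM \<cdot> hF DM) = j (ee DM) \<bullet> j (hF DM)"
    "j (hA DM \<cdot> z) = j (hA DM) \<bullet> j z" "pr1 DM \<cdot> eps DM \<cdot> m = ?a \<cdot> m" "pr2 DM \<cdot> eps DM \<cdot> m = ?b \<cdot> m"
    "j (?a \<cdot> m) = j ?a \<bullet> j m" "j (?b \<cdot> m) = j ?b \<bullet> j m" "j (rr DM \<cdot> rr D) = j (rr DM) \<bullet> j (rr D)"
    using z DT ab mn E by (simp_all add: j_comp comp_assoc T.assoc)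
  have up: "T.pbk (j (ee DM) \<bullet> j (hF DM)) (j (rr D)) (j z) (j (ee D))"
    using uf by (simp add: is_pullback_iff J)
  have ye: "j (ee DM) \<bullet> j (hF DM \<cdot> z) = j (rr D) \<bullet> j (ee D)" "tarr (j (ee DM) \<bullet> j (hF DM \<cdot> z))"
    using T.pbk_comm[OF up] T.pbk_arr[OF up] unfolding J by (simp_all add: T.assoc)
  note y = pb_lift[OF Q J(2) E(2) ye, folded y_def, unfolded J]
  have yK: "n \<cdot> y = ee D" "Dom K n = Cod K y" using j_comp_eq[OF y(3) E(2)] by simp_all
  have yd: "Dom K y = Dom K (ee D)" using comp_arr(2)[of y n] y(1) mn yK by simp
  have sq: "T.pbk (j (hF DM)) (j m) (j z) (j y)"
    using T.pbk_vcancel[OF Q, of "j (hF DM)" "j z" "j y"] up y DT by simp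
  have upp: "T.pbk (j p) (j (rr DM)) (j ?b) (j (ee DM))" and lop: "T.pbk (j p) (j ?a) (j (hA DM)) (j (hF DM))"
    using DM_up DM_lo by (simp_all add: is_pullback_iff)
  show "l1 \<in> fib" using lf by (simp add: l1_def)
  show "l2 \<in> fib" using T.pbk_paste[OF lop sq] by (simp add: l2_def is_pullback_iff J)
  show "l3 \<in> fib" using T.pbk_paste[OF upp Q] by (simp add: l3_def is_pullback_iff J)
  show "Dom K n = Cod K y" "n \<cdot> y = ee D" by (fact yK)+
  show "Dom K y = Cod K (hF D)" using yd H by simp
  show "fmap l3 (up M M) (j m) (j (rr D))"
    using T.pbk_comm[OF Q] by (simp add: l3_def DM_up_lo J)
  show "fmap l2 (lo M M) (j z) (j m)"
    using y by (simp add: l2_def DM_up_lo J)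
  fix f3 u3 v3 f2 u2 v2 f1 u1 v1
  assume f3: "(f3, u3, v3) \<in> fib" and f2: "(f2, u2, v2) \<in> fib" and f1: "(f1, u1, v1) \<in> fib"
    and d: "Dom K f3 = Cod K f2" "Dom K f2 = Cod K f1"
  have p3: "is_pullback K p v3 u3 f3" and p2: "is_pullback K p v2 u2 f2" and p1: "is_pullback K p v1 u1 f1"
    using f3 f2 f1 by simp_all
  note t3 = is_pullback_types[OF p3] and t2 = is_pullback_types[OF p2]
  obtain k0 k1 k2 where k: "k0 \<in> Ar K" "k1 \<in> Ar K" "k2 \<in> Ar K"
    "fmap (f3, u3, v3) (up M M) (j k1) (j k2)" "fmap (f2, u2, v2) (lo M M) (j k0) (j k1)"
    "is_pullback K (ee DM \<cdot> hF DM) k2 k0 (f3 \<cdot> f2)" "j (f3 \<cdot> f2) = j f3 \<bullet> j f2"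
    by (rule composite_fibre[OF p3 p2 d(1)]) (rule that)
  have d2: "Dom K (f3 \<cdot> f2) = Cod K f1" using t3 t2 d by simp
  obtain i0 i1 i2 where i: "i0 \<in> Ar K" "i1 \<in> Ar K" "i2 \<in> Ar K"
    "fmap (f3 \<cdot> f2, k0, k2) (ee D, pr2 D \<cdot> eps D, rr D) (j i1) (j i2)"
    "fmap (f1, u1, v1) (hF D, hA D, pr1 D \<cdot> eps D) (j i0) (j i1)"
    by (rule up_lo_lift[OF opoly_MM opoly_M' De k(6) p1 d2]) (rule that)
  have K: "j (ee DM) \<bullet> j k1 = j k2 \<bullet> j f3" "j ?b \<bullet> j k1 = j u3" "j (rr DM) \<bullet> j k2 = j v3"
    "j (hF DM) \<bullet> j k0 = j k1 \<bullet> j f2" "j (hA DM) \<bullet> j k0 = j u2" "j ?a \<bullet> j k1 = j v2"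
    using k(4,5) by (simp_all add: DM_up_lo)
  have I: "j (ee D) \<bullet> j i1 = j i2 \<bullet> j f3 \<bullet> j f2" "j z \<bullet> j i1 = j k0" "j (rr D) \<bullet> j i2 = j k2"
    using i(4) by (simp_all add: z_def k(7))
  have "j (ee DM) \<bullet> j k1 = j (rr D) \<bullet> (j i2 \<bullet> j f3)" using K I by (metis T.assoc)
  moreover have "tarr (j (ee DM) \<bullet> j k1)"
  proof -
    have "tarr (j ?b \<bullet> j k1)" using K t3 by simp
    then show ?thesis using ab DT k(2) by (simp add: tarr_tcomp)
  qed
  ultimately obtain w where w: "j m \<bullet> w = j k1" "j n \<bullet> w = j i2 \<bullet> j f3" using T.pbk_lift[OF Q] by blast
  have "j y \<bullet> j i1 = w \<bullet> j f2"
  proof (rule T.pbk_eq[OF Q])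
    show "j m \<bullet> j y \<bullet> j i1 = j m \<bullet> w \<bullet> j f2" using y I w K by (metis T.assoc)
    show "j n \<bullet> j y \<bullet> j i1 = j n \<bullet> w \<bullet> j f2" using y I w by (metis T.assoc)
    have "j m \<bullet> j y \<bullet> j i1 = j (hF DM) \<bullet> j k0" using y I by (metis T.assoc)
    moreover have "tarr (j (hF DM) \<bullet> j k0)"
    proof -
      have "tarr (j (hA DM) \<bullet> j k0)" using K t2 by simp
      then show ?thesis using DT k(1) by (simp add: tarr_tcomp)
    qed
    ultimately show "tarr (j m \<bullet> j y \<bullet> j i1)" by simp
  qed
  then have "fmap (f2, u2, v2) l2 (j i1) w"
    using K I w by (simp add: l2_def J T.assoc)
  moreover have "fmap (f3, u3, v3) l3 w (j i2)"
    using K I w by (simp add: l3_def J T.assoc)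
  moreover have "fmap (f1, u1, v1) l1 (j i0) (j i1)" using i(5) by (simp add: l1_def)
  ultimately show "\<exists>n0 n1 n2 n3. fmap (f1, u1, v1) l1 n0 n1 \<and> fmap (f2, u2, v2) l2 n1 n2 \<and> fmap (f3, u3, v3) l3 n2 n3"
    by blast
qed

text \<open>The same for \<open>M \<circ> (M \<circ> M)\<close>, whose lower step is split. Uniqueness is included, because the associativity
  isomorphism is defined as the unique map of ladders.\<close>

lemma right_ladder:
  defines "D \<equiv> cdata (tobang (Dom K p), p, tobang (Cod K p)) MM"
  defines "w \<equiv> pr1 D \<cdot> eps D"
  defines "m \<equiv> fst (pb (ee DM) w)" and "n \<equiv> snd (pb (ee DM) w)"
  defines "y \<equiv> pb_lift K m n (hF DM \<cdot> hA D) (hF D)"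
  defines "r1 \<equiv> (y, hA DM \<cdot> hA D, pr1 DM \<cdot> eps DM \<cdot> m)" and "r2 \<equiv> (n, pr2 DM \<cdot> eps DM \<cdot> m, rr DM \<cdot> w)"
    and "r3 \<equiv> (ee D, pr2 D \<cdot> eps D, rr D)"
  shows "r1 \<in> fib" "r2 \<in> fib" "r3 \<in> fib" "Dom K (ee D) = Cod K n" "Dom K n = Cod K y" "n \<cdot> y = hF D"
    "fmap r2 (up M M) (j m) (j w)" "fmap r1 (lo M M) (j (hA D)) (j m)"
    "\<And>f3 u3 v3 f2 u2 v2 f1 u1 v1. (f3, u3, v3) \<in> fib \<Longrightarrow> (f2, u2, v2) \<in> fib \<Longrightarrow> (f1, u1, v1) \<in> fib \<Longrightarrow>
        Dom K f3 = Cod K f2 \<Longrightarrow> Dom K f2 = Cod K f1 \<Longrightarrow>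
        \<exists>n0\<in>Ar K. \<exists>n1\<in>Ar K. \<exists>n2\<in>Ar K. \<exists>n3\<in>Ar K. fmap (f1, u1, v1) r1 (j n0) (j n1) \<and> fmap (f2, u2, v2) r2 (j n1) (j n2) \<and>
          fmap (f3, u3, v3) r3 (j n2) (j n3) \<and>
          (\<forall>m0 m1 m2 m3. fmap (f1, u1, v1) r1 m0 m1 \<and> fmap (f2, u2, v2) r2 m1 m2 \<and> fmap (f3, u3, v3) r3 m2 m3 \<longrightarrow>
            m0 = j n0 \<and> m1 = j n1 \<and> m2 = j n2 \<and> m3 = j n3)"
proof -
  have De: "D = cdata (tobang (Dom K p), p, tobang (Cod K p)) MM" by (simp add: D_def)
  note P = cdata_P_types[OF opoly_M' opoly_MM De] and E = cdata_D_types[OF opoly_M' opoly_MM De]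
    and H = cdata_H_types[OF opoly_M' opoly_MM De]
    and uf = up_fibre[OF opoly_M' opoly_MM De] and lf = lo_fibre[OF opoly_M' opoly_MM De, folded w_def]
  note DT = DM_types and oM = opolyD[OF opoly_MM]
  have w: "w \<in> Ar K" "Dom K w = Dom K (ee D)" "Cod K w = Cod K (ee DM)"
    using P E DT by (simp_all add: w_def)
  let ?a = "pr1 DM \<cdot> eps DM" and ?b = "pr2 DM \<cdot> eps DM"
  have ab: "?a \<in> Ar K" "Dom K ?a = Dom K (ee DM)" "?b \<in> Ar K" "Dom K ?b = Dom K (ee DM)"
    using DT by simp_all
  have Q: "T.pbk (j (ee DM)) (j w) (j m) (j n)"
    unfolding m_def n_def using chosen_pbk[of "ee DM" w] DT w by simp
  note Qt = T.pbk_types[OF Q]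
  have mn: "m \<in> Ar K" "n \<in> Ar K" "Cod K m = Dom K (ee DM)" "Cod K n = Dom K w" "Dom K m = Dom K n"
    using Qt DT w by simp_all
  have H1: "Cod K (hA D) = Dom K (hF DM)" using H DT by simp
  have J: "j (hF DM \<cdot> hA D) = j (hF DM) \<bullet> j (hA D)" "hF DM \<cdot> hA D \<in> Ar K" "j (ee DM \<cdot> hF DM) = j (ee DM) \<bullet> j (hF DM)"
    "j (hA DM \<cdot> hA D) = j (hA DM) \<bullet> j (hA D)" "pr1 DM \<cdot> eps DM \<cdot> m = ?a \<cdot> m" "pr2 DM \<cdot> eps DM \<cdot> m = ?b \<cdot> m"
    "j (?a \<cdot> m) = j ?a \<bullet> j m" "j (?b \<cdot> m) = j ?b \<bullet> j m" "j (rr DM \<cdot> w) = j (rr DM) \<bullet> j w"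
    using w DT ab mn H H1 by (simp_all add: j_comp comp_assoc T.assoc)
  have lo: "T.pbk (j (ee DM) \<bullet> j (hF DM)) (j w) (j (hA D)) (j (hF D))"
    using lf by (simp add: is_pullback_iff J)
  have ye: "j (ee DM) \<bullet> j (hF DM \<cdot> hA D) = j w \<bullet> j (hF D)" "tarr (j (ee DM) \<bullet> j (hF DM \<cdot> hA D))"
    using T.pbk_comm[OF lo] T.pbk_arr[OF lo] unfolding J by (simp_all add: T.assoc)
  note y = pb_lift[OF Q J(2) H(2) ye, folded y_def, unfolded J]
  have yK: "n \<cdot> y = hF D" "Dom K n = Cod K y" using j_comp_eq[OF y(3) H(2)] by simp_all
  have sq: "T.pbk (j (hF DM)) (j m) (j (hA D)) (j y)"
    using T.pbk_vcancel[OF Q, of "j (hF DM)" "j (hA D)" "j y"] lo y DT by simp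
  have upp: "T.pbk (j p) (j (rr DM)) (j ?b) (j (ee DM))" and lop: "T.pbk (j p) (j ?a) (j (hA DM)) (j (hF DM))"
    using DM_up DM_lo by (simp_all add: is_pullback_iff)
  show "r3 \<in> fib" using uf by (simp add: r3_def)
  show "r1 \<in> fib" using T.pbk_paste[OF lop sq] by (simp add: r1_def is_pullback_iff J)
  show "r2 \<in> fib" using T.pbk_paste[OF upp Q] by (simp add: r2_def is_pullback_iff J)
  show "Dom K n = Cod K y" "n \<cdot> y = hF D" by (fact yK)+
  show "Dom K (ee D) = Cod K n" using mn w by simp
  show "fmap r2 (up M M) (j m) (j w)"
    using T.pbk_comm[OF Q] by (simp add: r2_def DM_up_lo J)
  show "fmap r1 (lo M M) (j (hA D)) (j m)"
    using y by (simp add: r1_def DM_up_lo J)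
  fix f3 u3 v3 f2 u2 v2 f1 u1 v1
  assume f3: "(f3, u3, v3) \<in> fib" and f2: "(f2, u2, v2) \<in> fib" and f1: "(f1, u1, v1) \<in> fib"
    and d: "Dom K f3 = Cod K f2" "Dom K f2 = Cod K f1"
  have p3: "is_pullback K p v3 u3 f3" and p2: "is_pullback K p v2 u2 f2" and p1: "is_pullback K p v1 u1 f1"
    using f3 f2 f1 by simp_all
  note t2 = is_pullback_types[OF p2] and t1 = is_pullback_types[OF p1]
  obtain k0 k1 k2 where k: "k0 \<in> Ar K" "k1 \<in> Ar K" "k2 \<in> Ar K"
    "fmap (f2, u2, v2) (up M M) (j k1) (j k2)" "fmap (f1, u1, v1) (lo M M) (j k0) (j k1)"
    "is_pullback K (ee DM \<cdot> hF DM) k2 k0 (f2 \<cdot> f1)" "j (f2 \<cdot> f1) = j f2 \<bullet> j f1"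
    by (rule composite_fibre[OF p2 p1 d(2)]) (rule that)
  have d2: "Dom K f3 = Cod K (f2 \<cdot> f1)" using t2 t1 d by simp
  obtain i0 i1 i2 where i: "i0 \<in> Ar K" "i1 \<in> Ar K" "i2 \<in> Ar K"
    "fmap (f3, u3, v3) (ee D, pr2 D \<cdot> eps D, rr D) (j i1) (j i2)"
    "fmap (f2 \<cdot> f1, k0, k2) (hF D, hA D, pr1 D \<cdot> eps D) (j i0) (j i1)"
    by (rule up_lo_lift[OF opoly_M' opoly_MM De p3 k(6) d2]) (rule that)
  have K: "j (ee DM) \<bullet> j k1 = j k2 \<bullet> j f2" "j ?b \<bullet> j k1 = j u2" "j (rr DM) \<bullet> j k2 = j v2"
    "j (hF DM) \<bullet> j k0 = j k1 \<bullet> j f1" "j (hA DM) \<bullet> j k0 = j u1" "j ?a \<bullet> j k1 = j v1"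
    using k(4,5) by (simp_all add: DM_up_lo)
  have I: "j (hF D) \<bullet> j i0 = j i1 \<bullet> j f2 \<bullet> j f1" "j (hA D) \<bullet> j i0 = j k0" "j w \<bullet> j i1 = j k2"
    using i(5) by (simp_all add: w_def k(7))
  have "j (ee DM) \<bullet> j k1 = j w \<bullet> (j i1 \<bullet> j f2)" using K I by (metis T.assoc)
  moreover have "tarr (j (ee DM) \<bullet> j k1)"
  proof -
    have "tarr (j ?b \<bullet> j k1)" using K t2 by simp
    then show ?thesis using ab DT k(2) by (simp add: tarr_tcomp)
  qed
  ultimately obtain x where x: "j m \<bullet> x = j k1" "j n \<bullet> x = j i1 \<bullet> j f2" using T.pbk_lift[OF Q] by blast
  have hk: "tarr (j (hF DM) \<bullet> j k0)"
  proof -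
    have "tarr (j (hA DM) \<bullet> j k0)" using K t1 by simp
    then show ?thesis using DT k(1) by (simp add: tarr_tcomp)
  qed
  have "j y \<bullet> j i0 = x \<bullet> j f1"
  proof (rule T.pbk_eq[OF Q])
    show "j m \<bullet> j y \<bullet> j i0 = j m \<bullet> x \<bullet> j f1" using y I x K by (metis T.assoc)
    show "j n \<bullet> j y \<bullet> j i0 = j n \<bullet> x \<bullet> j f1" using y I x by (metis T.assoc)
    have "j m \<bullet> j y \<bullet> j i0 = j (hF DM) \<bullet> j k0" using y I by (metis T.assoc)
    then show "tarr (j m \<bullet> j y \<bullet> j i0)" using hk by simp
  qed
  then have 1: "fmap (f1, u1, v1) r1 (j i0) x"
    using K I x by (simp add: r1_def J T.assoc)
  have 2: "fmap (f2, u2, v2) r2 x (j i1)"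
    using K I x by (simp add: r2_def J T.assoc)
  have 3: "fmap (f3, u3, v3) r3 (j i1) (j i2)" using i(4) by (simp add: r3_def)
  have uni: "m0 = j i0 \<and> m1 = x \<and> m2 = j i1 \<and> m3 = j i2"
    if h: "fmap (f1, u1, v1) r1 m0 m1" "fmap (f2, u2, v2) r2 m1 m2" "fmap (f3, u3, v3) r3 m2 m3" for m0 m1 m2 m3
  proof -
    have h1: "j y \<bullet> m0 = m1 \<bullet> j f1" "j (hA DM) \<bullet> j (hA D) \<bullet> m0 = j u1" "j ?a \<bullet> j m \<bullet> m1 = j v1"
      using h(1) by (simp_all add: r1_def J T.assoc)
    have h2: "j n \<bullet> m1 = m2 \<bullet> j f2" "j ?b \<bullet> j m \<bullet> m1 = j u2" "j (rr DM) \<bullet> j w \<bullet> m2 = j v2"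
      using h(2) by (simp_all add: r2_def J T.assoc)
    have a1: "fmap (f1, u1, v1) (lo M M) (j (hA D) \<bullet> m0) (j m \<bullet> m1)"
      unfolding DM_up_lo fmap_iff using h1 y by (metis T.assoc)
    have a2: "fmap (f2, u2, v2) (up M M) (j m \<bullet> m1) (j w \<bullet> m2)"
      unfolding DM_up_lo fmap_iff using h2 T.pbk_comm[OF Q] by (metis T.assoc)
    note e = fmap_unique[OF f2 f1 d(2) a2 a1 k(4,5)]
    have b: "fmap (f2 \<cdot> f1, k0, k2) (hF D, hA D, pr1 D \<cdot> eps D) m0 m2"
      unfolding fmap_iff w_def[symmetric] k(7) using h1 h2 y e by (metis T.assoc)
    have "(m0, m2, m3) = (j i0, j i1, j i2)"
      using up_lo_universal[OF opoly_M' opoly_MM De p3 k(6) d2] h(3)[unfolded r3_def] b i(4,5) by blast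
    then have m: "m0 = j i0" "m2 = j i1" "m3 = j i2" by auto
    have "m1 = x"
    proof (rule T.pbk_eq[OF Q])
      show "j m \<bullet> m1 = j m \<bullet> x" using e x by simp
      show "j n \<bullet> m1 = j n \<bullet> x" using h2 x m by simp
      show "tarr (j m \<bullet> m1)" using e k by simp
    qed
    with m show ?thesis by blast
  qed
  have "T.tight x"
  proof -
    have "T.tight (j i1 \<bullet> j f2)"
    proof (rule T.tight_comp)
      show "tarr (j i1 \<bullet> j f2)" using x T.arr_comp
        by (metis (no_types) T.pbk_types(8)[OF Q] T.pbk_types(4)[OF Q] j_arr k(2))
    qed (use i t2 in simp_all)
    then show ?thesis using T.pbk_lift_tight[OF Q x] k by simp
  qed
  then obtain x' where x': "x' \<in> Ar K" "x = j x'" by (metis tight_obtain)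
  show "\<exists>n0\<in>Ar K. \<exists>n1\<in>Ar K. \<exists>n2\<in>Ar K. \<exists>n3\<in>Ar K. fmap (f1, u1, v1) r1 (j n0) (j n1) \<and> fmap (f2, u2, v2) r2 (j n1) (j n2) \<and>
          fmap (f3, u3, v3) r3 (j n2) (j n3) \<and>
          (\<forall>m0 m1 m2 m3. fmap (f1, u1, v1) r1 m0 m1 \<and> fmap (f2, u2, v2) r2 m1 m2 \<and> fmap (f3, u3, v3) r3 m2 m3 \<longrightarrow>
            m0 = j n0 \<and> m1 = j n1 \<and> m2 = j n2 \<and> m3 = j n3)"
    using 1 2 3 uni unfolding x'(2) by (intro bexI[OF _ i(1)] bexI[OF _ x'(1)] bexI[OF _ i(2)] bexI[OF _ i(3)]) blast
qed

end

context fibration_polynomials begin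

lemma j_comp3:
  assumes "f \<in> Ar K" "g \<in> Ar K" "h \<in> Ar K" "a \<in> Ar K" "j f \<bullet> j g \<bullet> j h = j a"
  shows "f \<cdot> g \<cdot> h = a"
proof -
  have "tarr (j g \<bullet> j h)" using assms by (metis T.arr_comp j_arr)
  then have "j g \<bullet> j h = j (g \<cdot> h)" "g \<cdot> h \<in> Ar K" using assms by (simp_all add: tarr_tcomp j_comp)
  then show ?thesis using j_comp_eq(1)[of f "g \<cdot> h" a] assms by simp
qed

context
  fixes \<mu>0 \<mu>1 assumes mu: "is_pullback K p \<mu>1 \<mu>0 (ee DM \<cdot> hF DM)"
begin

lemma mu_polycell: "(MM, (tobang (Dom K p), p, tobang (Cod K p)), \<mu>0, \<mu>1) \<in> polycells K pb"
  by (rule polycellI[OF opoly_MM opoly_M' mu])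

text \<open>The composite \<open>(l3 l2) l1\<close> of the left ladder carries the structure that is the left-hand side of the
  monad law, and \<open>r3 (r2 r1)\<close> carries that of the right-hand side before precomposition with the
  associativity isomorphism. This isomorphism is the comparison of the ladders, so by naturality the
  right-hand side is the structure of \<open>l3 (l2 l1)\<close>. Hence the monad law is associativity for the left
  ladder. Every composable triple maps to it, and naturality transports associativity.\<close>

lemma assoc_iff:
  "pvcomp (mult_cell \<mu>0 \<mu>1) (phcomp (mult_cell \<mu>0 \<mu>1) (pid2 M)) =
     pvcomp (mult_cell \<mu>0 \<mu>1) (pvcomp (phcomp (pid2 M) (mult_cell \<mu>0 \<mu>1)) (passoc M M M)) \<longleftrightarrow>
   (\<forall>f3 u3 v3 f2 u2 v2 f1 u1 v1. (f3, u3, v3) \<in> fib \<and> (f2, u2, v2) \<in> fib \<and> (f1, u1, v1) \<in> fib \<and>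
      Dom K f3 = Cod K f2 \<and> Dom K f2 = Cod K f1 \<longrightarrow>
      cmp \<mu>0 \<mu>1 (cmp \<mu>0 \<mu>1 (f3, u3, v3) (f2, u2, v2)) (f1, u1, v1) = cmp \<mu>0 \<mu>1 (f3, u3, v3) (cmp \<mu>0 \<mu>1 (f2, u2, v2) (f1, u1, v1)))"
  (is "?L \<longleftrightarrow> ?R")
proof -
  define DL where "DL = cdata MM (tobang (Dom K p), p, tobang (Cod K p))"
  define zL where "zL = pr2 DL \<cdot> eps DL"
  define mL where "mL = fst (pb (ee DM) (rr DL))"
  define nL where "nL = snd (pb (ee DM) (rr DL))"
  define yL where "yL = pb_lift K mL nL (hF DM \<cdot> zL) (ee DL)"
  define l1 where "l1 = (hF DL, hA DL, pr1 DL \<cdot> eps DL)"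
  define l2 where "l2 = (yL, hA DM \<cdot> zL, pr1 DM \<cdot> eps DM \<cdot> mL)"
  define l3 where "l3 = (nL, pr2 DM \<cdot> eps DM \<cdot> mL, rr DM \<cdot> rr DL)"
  note LL = left_ladder[folded DL_def, folded zL_def mL_def nL_def, folded yL_def, folded l1_def l2_def l3_def]
  define DR where "DR = cdata (tobang (Dom K p), p, tobang (Cod K p)) MM"
  define wR where "wR = pr1 DR \<cdot> eps DR"
  define mR where "mR = fst (pb (ee DM) wR)"
  define nR where "nR = snd (pb (ee DM) wR)"
  define yR where "yR = pb_lift K mR nR (hF DM \<cdot> hA DR) (hF DR)"
  define r1 where "r1 = (yR, hA DM \<cdot> hA DR, pr1 DM \<cdot> eps DM \<cdot> mR)"
  define r2 where "r2 = (nR, pr2 DM \<cdot> eps DM \<cdot> mR, rr DM \<cdot> wR)"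
  define r3 where "r3 = (ee DR, pr2 DR \<cdot> eps DR, rr DR)"
  note RR = right_ladder[folded DR_def, folded wR_def, folded mR_def nR_def, folded yR_def, folded r1_def r2_def r3_def]
  have DLe: "cdata (pcomp M M) M = DL" and DRe: "cdata M (pcomp M M) = DR"
    unfolding DL_def DR_def pcomp_MM unfolding M_eq by (rule refl)+
  have La: "ladder_left M M M = \<lparr>y1 = hF DL, y2 = yL, y3 = nL, a1 = hA DL, a2 = hA DM \<cdot> zL, a3 = pr2 DM \<cdot> eps DM \<cdot> mL,
      c1 = pr1 DL \<cdot> eps DL, c2 = pr1 DM \<cdot> eps DM \<cdot> mL, c3 = rr DM \<cdot> rr DL\<rparr>"
    unfolding ladder_left_def Let_def case_prod_unfold DLe yL_def zL_def mL_def nL_def by (rule refl)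
  have Ra: "ladder_right M M M = \<lparr>y1 = yR, y2 = nR, y3 = ee DR, a1 = hA DM \<cdot> hA DR, a2 = pr2 DM \<cdot> eps DM \<cdot> mR,
      a3 = pr2 DR \<cdot> eps DR, c1 = pr1 DM \<cdot> eps DM \<cdot> mR, c2 = rr DM \<cdot> wR, c3 = rr DR\<rparr>"
    unfolding ladder_right_def Let_def case_prod_unfold DRe yR_def wR_def mR_def nR_def by (rule refl)
  note lf = LL(1)[unfolded l1_def] LL(2)[unfolded l2_def] LL(3)[unfolded l3_def]
  note rf = RR(1)[unfolded r1_def] RR(2)[unfolded r2_def] RR(3)[unfolded r3_def]
  have fibD: "\<And>f u v. (f, u, v) \<in> fib \<Longrightarrow> is_pullback K p v u f" by simp
  note lp = fibD[OF lf(1)] fibD[OF lf(2)] fibD[OF lf(3)] and rp = fibD[OF rf(1)] fibD[OF rf(2)] fibD[OF rf(3)]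
  have LM: "ladder_map K (ladder_left M M M) (ladder_right M M M) n0 n1 n2 n3 \<longleftrightarrow>
      fmap l1 r1 (j n0) (j n1) \<and> fmap l2 r2 (j n1) (j n2) \<and> fmap l3 r3 (j n2) (j n3)"
    if "n0 \<in> Ar K" "n1 \<in> Ar K" "n2 \<in> Ar K" "n3 \<in> Ar K" for n0 n1 n2 n3
    unfolding l1_def l2_def l3_def r1_def r2_def r3_def
      fmap_j_iff[OF lp(1) rp(1) that(1,2)] fmap_j_iff[OF lp(2) rp(2) that(2,3)] fmap_j_iff[OF lp(3) rp(3) that(3,4)]
      ladder_map_def La Ra ladder.simps LL(4,5) RR(4,5)
    by blast
  have "ladder_map K (ladder_left M M M) (ladder_right M M M) n0 n1 n2 n3 \<Longrightarrow>
      n0 \<in> Ar K \<and> n1 \<in> Ar K \<and> n2 \<in> Ar K \<and> n3 \<in> Ar K" for n0 n1 n2 n3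
    by (simp add: ladder_map_def hom_def)
  note LMt = this
  note RRL = RR(9)[OF lf(3,2,1) LL(4,5), folded l1_def l2_def l3_def]
  obtain n0 n1 n2 n3 where n: "n0 \<in> Ar K" "n1 \<in> Ar K" "n2 \<in> Ar K" "n3 \<in> Ar K"
    and nf: "fmap l1 r1 (j n0) (j n1)" "fmap l2 r2 (j n1) (j n2)" "fmap l3 r3 (j n2) (j n3)"
    and nu: "\<And>m0 m1 m2 m3. fmap l1 r1 m0 m1 \<Longrightarrow> fmap l2 r2 m1 m2 \<Longrightarrow> fmap l3 r3 m2 m3 \<Longrightarrow>
            m0 = j n0 \<and> m1 = j n1 \<and> m2 = j n2 \<and> m3 = j n3"
    using RRL by blast
  have "(THE (n0, n1, n2, n3). ladder_map K (ladder_left M M M) (ladder_right M M M) n0 n1 n2 n3) = (n0, n1, n2, n3)"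
  proof (rule the_equality)
    show "case (n0, n1, n2, n3) of (n0, n1, n2, n3) \<Rightarrow> ladder_map K (ladder_left M M M) (ladder_right M M M) n0 n1 n2 n3"
      using LM[OF n] nf by blast
    fix k assume "case k of (n0, n1, n2, n3) \<Rightarrow> ladder_map K (ladder_left M M M) (ladder_right M M M) n0 n1 n2 n3"
    then obtain k0 k1 k2 k3 where k: "k = (k0, k1, k2, k3)"
      "ladder_map K (ladder_left M M M) (ladder_right M M M) k0 k1 k2 k3" by (cases k) auto
    note kt = LMt[OF k(2)]
    then have "fmap l1 r1 (j k0) (j k1)" "fmap l2 r2 (j k1) (j k2)" "fmap l3 r3 (j k2) (j k3)"
      using LM[of k0 k1 k2 k3] k(2) by blast+
    then have "j k0 = j n0 \<and> j k1 = j n1 \<and> j k2 = j n2 \<and> j k3 = j n3" by (rule nu)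
    then show "k = (n0, n1, n2, n3)" using k(1) kt n j_inj by blast
  qed
  then have pa: "passoc M M M = (pcomp (pcomp M M) M, pcomp M (pcomp M M), n0, n3)"
    by (simp add: passoc_def)
  note DT = DM_types and mt = is_pullback_types[OF mu]
  have J2: "s \<cdot> t = u" if "j u = j s \<bullet> j t" "u \<in> Ar K" for s t u
    using j_comp_eq(1) that by metis
  \<comment> \<open>the structure on \<open>(l3 l2) l1\<close> is \<open>\<mu>\<close> composed with the horizontal composite \<open>\<mu> M\<close>\<close>
  obtain uL vL where L1: "cmp \<mu>0 \<mu>1 (nL, pr2 DM \<cdot> eps DM \<cdot> mL, rr DM \<cdot> rr DL) (yL, hA DM \<cdot> zL, pr1 DM \<cdot> eps DM \<cdot> mL) = (nL \<cdot> yL, uL, vL)"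
    "j uL = j \<mu>0 \<bullet> j zL" "j vL = j \<mu>1 \<bullet> j (rr DL)" "uL \<in> Ar K" "vL \<in> Ar K"
    by (rule cmp_eq[OF mu lf(3,2) LL(4) LL(7)[unfolded l3_def] LL(8)[unfolded l2_def]]) (rule that)
  have uL: "\<mu>0 \<cdot> zL = uL" "\<mu>1 \<cdot> rr DL = vL" using J2 L1 by blast+
  have L1': "cmp \<mu>0 \<mu>1 l3 l2 = (ee DL, uL, vL)" using L1(1) unfolding LL(6) l3_def l2_def .
  note HL = cdata_H_types[OF opoly_MM opoly_M' DL_def] and PL = cdata_P_types[OF opoly_MM opoly_M' DL_def]
    and EL = cdata_D_types[OF opoly_MM opoly_M' DL_def]
  note HR = cdata_H_types[OF opoly_M' opoly_MM DR_def] and PR = cdata_P_types[OF opoly_M' opoly_MM DR_def]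
    and ER = cdata_D_types[OF opoly_M' opoly_MM DR_def]
  have idL: "Idn K (Dom K p) \<cdot> hA DL = hA DL" "Idn K (Cod K p) \<cdot> (pr1 DL \<cdot> eps DL) = pr1 DL \<cdot> eps DL"
    using HL PL EL by simp_all
  have idR: "Idn K (Dom K p) \<cdot> (pr2 DR \<cdot> eps DR) = pr2 DR \<cdot> eps DR" "Idn K (Cod K p) \<cdot> rr DR = rr DR"
    using PR ER by simp_all
  obtain h0 s h1 where h: "phcomp (mult_cell \<mu>0 \<mu>1) (pid2 M) = (pcomp (pcomp M M) M, pcomp M M, h0, h1)"
    "h0 \<in> Ar K" "s \<in> Ar K" "h1 \<in> Ar K"
    "fmap (ee DL, uL, vL) (up M M) (j s) (j h1)"
    "fmap (hF DL, hA DL, pr1 DL \<cdot> eps DL) (lo M M) (j h0) (j s)"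
    by (rule phcomp_char[OF pid2_M_cell mu_polycell opoly_M' opoly_M' opoly_MM opoly_M' DL_def,
          folded M_eq pcomp_MM, folded pid2_M zL_def, unfolded idL uL]) (rule that)
  have fL: "(ee DL, uL, vL) \<in> fib" using cmp_fib(1)[OF mu lf(3,2) LL(4)] L1'[unfolded l3_def l2_def] by simp
  have dL: "Dom K (ee DL) = Cod K (hF DL)" using HL by simp
  obtain aL bL where L2: "cmp \<mu>0 \<mu>1 (ee DL, uL, vL) (hF DL, hA DL, pr1 DL \<cdot> eps DL) = (ee DL \<cdot> hF DL, aL, bL)"
    "j aL = j \<mu>0 \<bullet> j h0" "j bL = j \<mu>1 \<bullet> j h1" "aL \<in> Ar K" "bL \<in> Ar K"
    by (rule cmp_eq[OF mu fL lf(1) dL h(5,6)]) (rule that)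
  have aL: "\<mu>0 \<cdot> h0 = aL" "\<mu>1 \<cdot> h1 = bL" using J2 L2 by blast+
  \<comment> \<open>the structure on \<open>r3 (r2 r1)\<close> is \<open>\<mu>\<close> composed with the horizontal composite \<open>M \<mu>\<close>\<close>
  obtain uR vR where R1: "cmp \<mu>0 \<mu>1 (nR, pr2 DM \<cdot> eps DM \<cdot> mR, rr DM \<cdot> wR) (yR, hA DM \<cdot> hA DR, pr1 DM \<cdot> eps DM \<cdot> mR) = (nR \<cdot> yR, uR, vR)"
    "j uR = j \<mu>0 \<bullet> j (hA DR)" "j vR = j \<mu>1 \<bullet> j wR" "uR \<in> Ar K" "vR \<in> Ar K"
    by (rule cmp_eq[OF mu rf(2,1) RR(5) RR(7)[unfolded r2_def] RR(8)[unfolded r1_def]]) (rule that)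
  have uR: "\<mu>0 \<cdot> hA DR = uR" "\<mu>1 \<cdot> wR = vR" using J2 R1 by blast+
  have R1': "cmp \<mu>0 \<mu>1 r2 r1 = (hF DR, uR, vR)" using R1(1) unfolding RR(6) r2_def r1_def .
  obtain k0 t k1 where k: "phcomp (pid2 M) (mult_cell \<mu>0 \<mu>1) = (pcomp M (pcomp M M), pcomp M M, k0, k1)"
    "k0 \<in> Ar K" "t \<in> Ar K" "k1 \<in> Ar K"
    "fmap (ee DR, pr2 DR \<cdot> eps DR, rr DR) (up M M) (j t) (j k1)"
    "fmap (hF DR, uR, vR) (lo M M) (j k0) (j t)"
    by (rule phcomp_char[OF mu_polycell pid2_M_cell opoly_MM opoly_M' opoly_M' opoly_M' DR_def,
          folded M_eq pcomp_MM, folded pid2_M wR_def, unfolded idR uR]) (rule that)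
  have fR: "(hF DR, uR, vR) \<in> fib" using cmp_fib(1)[OF mu rf(2,1) RR(5)] R1'[unfolded r2_def r1_def] by simp
  have dR: "Dom K (ee DR) = Cod K (hF DR)" using HR by simp
  obtain aR bR where R2: "cmp \<mu>0 \<mu>1 (ee DR, pr2 DR \<cdot> eps DR, rr DR) (hF DR, uR, vR) = (ee DR \<cdot> hF DR, aR, bR)"
    "j aR = j \<mu>0 \<bullet> j k0" "j bR = j \<mu>1 \<bullet> j k1" "aR \<in> Ar K" "bR \<in> Ar K"
    by (rule cmp_eq[OF mu rf(3) fR dR k(5,6)]) (rule that)
  \<comment> \<open>by naturality the structure on \<open>l3 (l2 l1)\<close> is the previous one composed with the comparison of ladders\<close>
  obtain uM vM where M1: "cmp \<mu>0 \<mu>1 (yL, hA DM \<cdot> zL, pr1 DM \<cdot> eps DM \<cdot> mL) (hF DL, hA DL, pr1 DL \<cdot> eps DL) = (yL \<cdot> hF DL, uM, vM)"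
    using cmp_fib(2)[OF mu lf(2,1) LL(5)] by (metis fst_conv surj_pair)
  have fM: "(yL \<cdot> hF DL, uM, vM) \<in> fib" using cmp_fib(1)[OF mu lf(2,1) LL(5)] M1 by simp
  have yLt: "yL \<in> Ar K" "nL \<in> Ar K" using is_pullback_types(4)[OF lp(2)] is_pullback_types(4)[OF lp(3)] by simp_all
  have dM: "Dom K nL = Cod K (yL \<cdot> hF DL)" using LL(4,5) yLt HL by simp
  obtain aM bM where M2: "cmp \<mu>0 \<mu>1 (nL, pr2 DM \<cdot> eps DM \<cdot> mL, rr DM \<cdot> rr DL) (yL \<cdot> hF DL, uM, vM) = (nL \<cdot> yL \<cdot> hF DL, aM, bM)"
    using cmp_fib(2)[OF mu lf(3) fM dM] by (metis fst_conv surj_pair)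
  have abM: "aM \<in> Ar K" "bM \<in> Ar K"
    using cmp_fib(1)[OF mu lf(3) fM dM] is_pullback_types(2,3)[of p bM aM] unfolding M2 by simp_all
  have M3: "fmap (yL \<cdot> hF DL, uM, vM) (hF DR, uR, vR) (j n0) (j n2)"
    using cmp_natural[OF mu lf(2,1) LL(5) rf(2,1) RR(5) nf(1)[unfolded l1_def r1_def] nf(2)[unfolded l2_def r2_def]]
    unfolding M1 R1 RR(6) .
  have "fmap (nL \<cdot> yL \<cdot> hF DL, aM, bM) (ee DR \<cdot> hF DR, aR, bR) (j n0) (j n3)"
    using cmp_natural[OF mu lf(3) fM dM rf(3) fR dR M3 nf(3)[unfolded l3_def r3_def]]
    unfolding M2 R2 .
  then have "j aR \<bullet> j n0 = j aM" "j bR \<bullet> j n3 = j bM" by simp_all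
  then have e: "\<mu>0 \<cdot> k0 \<cdot> n0 = aM" "\<mu>1 \<cdot> k1 \<cdot> n3 = bM"
    using j_comp3 mt(2,3) k(2,4) n(1,4) abM unfolding R2(2,3) T.assoc by blast+
  have nyf: "nL \<cdot> yL \<cdot> hF DL = ee DL \<cdot> hF DL"
    using comp_assoc[of "hF DL" yL nL] LL(4,5,6) yLt HL by simp
  have Lq: "?L \<longleftrightarrow> aL = aM \<and> bL = bM"
    unfolding h(1) k(1) pa pvcomp_def by (simp add: aL e)
  have law: "cmp \<mu>0 \<mu>1 (cmp \<mu>0 \<mu>1 l3 l2) l1 = (ee DL \<cdot> hF DL, aL, bL)" "cmp \<mu>0 \<mu>1 l3 (cmp \<mu>0 \<mu>1 l2 l1) = (ee DL \<cdot> hF DL, aM, bM)"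
    using L2(1) M2 nyf M1 unfolding L1' by (simp_all add: l1_def l2_def l3_def)
  show ?thesis
  proof
    assume ?R
    then have "cmp \<mu>0 \<mu>1 (cmp \<mu>0 \<mu>1 l3 l2) l1 = cmp \<mu>0 \<mu>1 l3 (cmp \<mu>0 \<mu>1 l2 l1)"
      unfolding l1_def l2_def l3_def using lf LL(4,5) by blast
    then show ?L using Lq law by simp
  next
    assume ?L
    then have eq: "cmp \<mu>0 \<mu>1 (cmp \<mu>0 \<mu>1 l3 l2) l1 = cmp \<mu>0 \<mu>1 l3 (cmp \<mu>0 \<mu>1 l2 l1)" using Lq law by simp
    show ?R
    proof (intro allI impI)
      fix f3 u3 v3 f2 u2 v2 f1 u1 v1
      assume a: "(f3, u3, v3) \<in> fib \<and> (f2, u2, v2) \<in> fib \<and> (f1, u1, v1) \<in> fib \<and> Dom K f3 = Cod K f2 \<and> Dom K f2 = Cod K f1"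
      then have f3: "(f3, u3, v3) \<in> fib" and f2: "(f2, u2, v2) \<in> fib" and f1: "(f1, u1, v1) \<in> fib"
        and d: "Dom K f3 = Cod K f2" "Dom K f2 = Cod K f1" by blast+
      note t3 = is_pullback_types[OF fibD[OF f3]] and t2 = is_pullback_types[OF fibD[OF f2]] and t1 = is_pullback_types[OF fibD[OF f1]]
      obtain k0 k1 k2 k3 where k: "fmap (f1, u1, v1) l1 k0 k1" "fmap (f2, u2, v2) l2 k1 k2" "fmap (f3, u3, v3) l3 k2 k3"
        using LL(9)[OF f3 f2 f1 d] by blast
      note k' = k(1)[unfolded l1_def] k(2)[unfolded l2_def] k(3)[unfolded l3_def]
      obtain u32 v32 where c32: "cmp \<mu>0 \<mu>1 (f3, u3, v3) (f2, u2, v2) = (f3 \<cdot> f2, u32, v32)"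
        using cmp_fib(2)[OF mu f3 f2 d(1)] by (metis fst_conv surj_pair)
      obtain u21 v21 where c21: "cmp \<mu>0 \<mu>1 (f2, u2, v2) (f1, u1, v1) = (f2 \<cdot> f1, u21, v21)"
        using cmp_fib(2)[OF mu f2 f1 d(2)] by (metis fst_conv surj_pair)
      have f32: "(f3 \<cdot> f2, u32, v32) \<in> fib" "Dom K (f3 \<cdot> f2) = Cod K f1"
        using cmp_fib(1)[OF mu f3 f2 d(1)] c32 d t3 t2 by simp_all
      have f21: "(f2 \<cdot> f1, u21, v21) \<in> fib" "Dom K f3 = Cod K (f2 \<cdot> f1)"
        using cmp_fib(1)[OF mu f2 f1 d(2)] c21 d t1 t2 by simp_all
      obtain a b where c: "cmp \<mu>0 \<mu>1 (f3 \<cdot> f2, u32, v32) (f1, u1, v1) = ((f3 \<cdot> f2) \<cdot> f1, a, b)"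
        using cmp_fib(2)[OF mu f32(1) f1 f32(2)] by (metis fst_conv surj_pair)
      obtain a' b' where c': "cmp \<mu>0 \<mu>1 (f3, u3, v3) (f2 \<cdot> f1, u21, v21) = (f3 \<cdot> f2 \<cdot> f1, a', b')"
        using cmp_fib(2)[OF mu f3 f21] by (metis fst_conv surj_pair)
      have ab: "a \<in> Ar K" "b \<in> Ar K" "a' \<in> Ar K" "b' \<in> Ar K"
        using is_pullback_types(2,3)[OF fibD[OF cmp_fib(1)[OF mu f32(1) f1 f32(2), unfolded c]]]
          is_pullback_types(2,3)[OF fibD[OF cmp_fib(1)[OF mu f3 f21, unfolded c']]] by simp_all
      have m1: "fmap (f3 \<cdot> f2, u32, v32) (ee DL, uL, vL) k1 k3"
        using cmp_natural[OF mu f3 f2 d(1) lf(3,2) LL(4) k'(2,3)] unfolding c32 L1 LL(6) .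
      have m2: "fmap (f2 \<cdot> f1, u21, v21) (yL \<cdot> hF DL, uM, vM) k0 k2"
        using cmp_natural[OF mu f2 f1 d(2) lf(2,1) LL(5) k'(1,2)] unfolding c21 M1 .
      have "fmap ((f3 \<cdot> f2) \<cdot> f1, a, b) (ee DL \<cdot> hF DL, aL, bL) k0 k3"
        using cmp_natural[OF mu f32(1) f1 f32(2) fL lf(1) dL k'(1) m1] unfolding c L2 .
      moreover have "fmap (f3 \<cdot> f2 \<cdot> f1, a', b') (ee DL \<cdot> hF DL, aL, bL) k0 k3"
        using cmp_natural[OF mu f3 f21 lf(3) fM dM m2 k'(3)] eq law unfolding c' M2 nyf by simp
      ultimately have "j a = j a'" "j b = j b'" by simp_all
      then have "a = a'" "b = b'" using ab j_inj by blast+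
      moreover have "(f3 \<cdot> f2) \<cdot> f1 = f3 \<cdot> f2 \<cdot> f1" using d t1 t2 t3 by (simp add: comp_assoc)
      ultimately show "cmp \<mu>0 \<mu>1 (cmp \<mu>0 \<mu>1 (f3, u3, v3) (f2, u2, v2)) (f1, u1, v1) = cmp \<mu>0 \<mu>1 (f3, u3, v3) (cmp \<mu>0 \<mu>1 (f2, u2, v2) (f1, u1, v1))"
        unfolding c32 c21 c c' by simp
    qed
  qed
qed

end

end

section \<open>The correspondence\<close>

context fibration_polynomials begin

context
  fixes \<eta>0 \<eta>1 \<mu>0 \<mu>1
  assumes eta: "is_pullback K p \<eta>1 \<eta>0 (Idn K one)" and mu: "is_pullback K p \<mu>1 \<mu>0 (ee DM \<cdot> hF DM)"
begin

lemma monad_iff_double: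
  "is_monad Poly one M (unit_cell \<eta>0 \<eta>1) (mult_cell \<mu>0 \<mu>1) \<longleftrightarrow> Fib.is_double (uni \<eta>0 \<eta>1) (cmp \<mu>0 \<mu>1)"
proof -
  have "M \<in> polynomials K pb" "one \<in> Ob K" "Cod K (fst M) = one" "Cod K (snd (snd M)) = one"
    using opoly_M one_Ob by (simp_all add: opoly_def)
  then have "is_monad Poly one M (unit_cell \<eta>0 \<eta>1) (mult_cell \<mu>0 \<mu>1) \<longleftrightarrow>
      pvcomp (mult_cell \<mu>0 \<mu>1) (phcomp (mult_cell \<mu>0 \<mu>1) (pid2 M)) =
        pvcomp (mult_cell \<mu>0 \<mu>1) (pvcomp (phcomp (pid2 M) (mult_cell \<mu>0 \<mu>1)) (passoc M M M)) \<and>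
      pvcomp (mult_cell \<mu>0 \<mu>1) (phcomp (unit_cell \<eta>0 \<eta>1) (pid2 M)) = plunit M \<and>
      pvcomp (mult_cell \<mu>0 \<mu>1) (phcomp (pid2 M) (unit_cell \<eta>0 \<eta>1)) = prunit M"
    using eta_polycell[OF eta mu, folded M_eq pid_eq] mu_polycell[OF mu, folded M_eq pcomp_MM]
    by (simp add: is_monad_def Poly_def case_prod_unfold)
  then show ?thesis
    unfolding is_double_iff[OF eta mu] assoc_iff[OF mu] left_unit_iff[OF eta mu] right_unit_iff[OF eta mu] by blast
qed

lemma uni_one: "uni \<eta>0 \<eta>1 one = (Idn K one, \<eta>0, \<eta>1)"
proof -
  have "tobang one = Idn K one"
    by (rule into_one_arr_eq) (use tobang[OF one_Ob] one_Ob in simp_all)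
  then show ?thesis using eta_types[OF eta] by (simp add: uni_def)
qed

lemma cmp_up_lo: "cmp \<mu>0 \<mu>1 (up M M) (lo M M) = (ee DM \<cdot> hF DM, \<mu>0, \<mu>1)"
proof -
  note DT = DM_types and t = is_pullback_types[OF mu]
  have f: "(ee DM, pr2 DM \<cdot> eps DM, rr DM) \<in> fib" "(hF DM, hA DM, pr1 DM \<cdot> eps DM) \<in> fib"
    using DM_up DM_lo by simp_all
  have d: "Dom K (ee DM) = Cod K (hF DM)" using DT by simp
  have 1: "fmap (ee DM, pr2 DM \<cdot> eps DM, rr DM) (up M M) (j (Idn K (Dom K (ee DM)))) (j (Idn K (Dom K (rr DM))))"
    unfolding DM_up_lo
    by (subst fmap_j_iff[OF DM_up DM_up]) (use DT in \<open>simp_all add: Dom_Ob hom_def\<close>)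
  have 2: "fmap (hF DM, hA DM, pr1 DM \<cdot> eps DM) (lo M M) (j (Idn K (Dom K (hF DM)))) (j (Idn K (Dom K (ee DM))))"
    unfolding DM_up_lo
    by (subst fmap_j_iff[OF DM_lo DM_lo]) (use DT in \<open>simp_all add: Dom_Ob hom_def\<close>)
  obtain u v where uv: "cmp \<mu>0 \<mu>1 (ee DM, pr2 DM \<cdot> eps DM, rr DM) (hF DM, hA DM, pr1 DM \<cdot> eps DM) = (ee DM \<cdot> hF DM, u, v)"
    "j u = j \<mu>0 \<bullet> j (Idn K (Dom K (hF DM)))" "j v = j \<mu>1 \<bullet> j (Idn K (Dom K (rr DM)))" "u \<in> Ar K" "v \<in> Ar K"
    by (rule cmp_eq[OF mu f d 1 2]) (rule that)
  have "j u = j \<mu>0" "j v = j \<mu>1"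
    unfolding uv(2,3) by (rule j_idn_right; use t DT in \<open>simp add: Dom_Ob\<close>)+
  then show ?thesis using uv t j_inj unfolding DM_up_lo by metis
qed

end

text \<open>A 2-cell between polynomials contains the statement that its square is a pullback, which is a
  p-fibration structure on the middle arrow of the source.\<close>

lemma monad_cells:
  assumes "is_monad Poly one M \<eta> \<mu>"
  obtains \<eta>0 \<eta>1 \<mu>0 \<mu>1 where "\<eta> = (unit_cell \<eta>0 \<eta>1)" "\<mu> = (mult_cell \<mu>0 \<mu>1)"
    "is_pullback K p \<eta>1 \<eta>0 (Idn K one)" "is_pullback K p \<mu>1 \<mu>0 (ee DM \<cdot> hF DM)"
proof -
  have h: "\<eta> \<in> polycells K pb" "fst \<eta> = pid one" "fst (snd \<eta>) = M" "\<mu> \<in> polycells K pb" "fst \<mu> = pcomp M M" "fst (snd \<mu>) = M"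
    using assms by (simp_all add: is_monad_def Poly_def case_prod_unfold)
  then have e: "\<eta> = (pid one, M, fst (snd (snd \<eta>)), snd (snd (snd \<eta>)))" "\<mu> = (pcomp M M, M, fst (snd (snd \<mu>)), snd (snd (snd \<mu>)))"
    by (metis prod.collapse)+
  show ?thesis
  proof (rule that[OF e])
    show "is_pullback K p (snd (snd (snd \<eta>))) (fst (snd (snd \<eta>))) (Idn K one)"
      using polycellsD(7) h(1) e(1) unfolding pid_eq M_eq by metis
    show "is_pullback K p (snd (snd (snd \<mu>))) (fst (snd (snd \<mu>))) (ee DM \<cdot> hF DM)"
      using polycellsD(7) h(4) e(2)[unfolded pcomp_MM] unfolding M_eq by metis
  qed
qed

text \<open>The Yoneda argument: naturality along \<open>X \<rightarrow> 1\<close> expresses the identities by the one at the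
  terminal object, and naturality along comparisons with the terminal pair expresses composites by the
  composite of that pair.\<close>

lemma double_structure_obtain:
  assumes "(I, H) \<in> double_structures K p"
  obtains \<eta>0 \<eta>1 \<mu>0 \<mu>1 where "is_pullback K p \<eta>1 \<eta>0 (Idn K one)" "is_pullback K p \<mu>1 \<mu>0 (ee DM \<cdot> hF DM)"
    "I = Fib.mk_ide (uni \<eta>0 \<eta>1)" "H = Fib.mk_cmp (cmp \<mu>0 \<mu>1)" "Fib.is_double (uni \<eta>0 \<eta>1) (cmp \<mu>0 \<mu>1)"
proof -
  obtain i m where IH: "I = Fib.mk_ide i" "H = Fib.mk_cmp m" and D: "Fib.is_double i m"
    and i: "\<And>X. X \<in> Ob K \<Longrightarrow> fst (i X) = Idn K X"
    and m: "\<And>y x. y \<in> fib \<Longrightarrow> x \<in> fib \<Longrightarrow> Dom K (fst y) = Cod K (fst x) \<Longrightarrow> fst (m y x) = fst y \<cdot> fst x"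
    using assms unfolding double_structures_iff by blast
  note DD = Fib.is_doubleD[OF D]
  obtain \<eta>0 \<eta>1 where e: "i one = (Idn K one, \<eta>0, \<eta>1)" using i[OF one_Ob] by (metis prod.collapse)
  have eta: "is_pullback K p \<eta>1 \<eta>0 (Idn K one)" using DD(1)[OF one_Ob] e by simp
  have uf: "up M M \<in> fib" "lo M M \<in> fib" using DM_up DM_lo by (simp_all add: DM_up_lo)
  have ud: "Dom K (fst (up M M)) = Cod K (fst (lo M M))" "fst (up M M) = ee DM" "fst (lo M M) = hF DM"
    using DM_types by (simp_all add: DM_up_lo)
  have ud': "(fdm (up M M)) = (fcd (lo M M))"
    using ud(1) by (simp add: case_prod_unfold)
  obtain \<mu>0 \<mu>1 where g: "m (up M M) (lo M M) = (ee DM \<cdot> hF DM, \<mu>0, \<mu>1)"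
    using m[OF uf ud(1)] ud(2,3) by (metis prod.collapse)
  have mu: "is_pullback K p \<mu>1 \<mu>0 (ee DM \<cdot> hF DM)" using DD(5)[OF uf ud'] g by simp
  have iu: "i X = uni \<eta>0 \<eta>1 X" if X: "X \<in> Ob K" for X
  proof -
    obtain a b where ab: "i X = (Idn K X, a, b)" using i[OF X] by (metis prod.collapse)
    have px: "is_pullback K p b a (Idn K X)" using DD(1)[OF X] ab by simp
    note b = tobang[OF X]
    have c: "Id2 K (tobang X) \<in> cells K X one" using b by (simp add: hom_def)
    have "fmap (i X) (i one) (Some (Id2 K (tobang X))) (Some (Id2 K (tobang X)))"
      using DD(4)[OF X one_Ob c] unfolding ab e prod.case
      by (subst fmap_cells[OF px eta, symmetric]) (use c X one_Ob in simp_all)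
    then have "fmap (Idn K X, a, b) (Idn K one, \<eta>0, \<eta>1) (j (tobang X)) (j (tobang X))"
      unfolding ab e j_Some[OF b(1)] .
    then have "\<eta>0 \<cdot> tobang X = a" "\<eta>1 \<cdot> tobang X = b"
      using fmap_j_iff[OF px eta b(1) b(1)] by blast+
    then show ?thesis by (simp add: ab uni_def)
  qed
  have mc: "m y x = cmp \<mu>0 \<mu>1 y x" if y: "y \<in> fib" and x: "x \<in> fib"
    and d: "fdm y = fcd x" for y x
  proof -
    obtain f2 u2 v2 f1 u1 v1 where yx: "y = (f2, u2, v2)" "x = (f1, u1, v1)" by (cases y; cases x)
    have y': "(f2, u2, v2) \<in> fib" and x': "(f1, u1, v1) \<in> fib" and d': "Dom K f2 = Cod K f1"
      using y x d by (simp_all add: yx)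
    have py: "is_pullback K p v2 u2 f2" and px: "is_pullback K p v1 u1 f1" using y' x' by simp_all
    obtain a b where ab: "m y x = (f2 \<cdot> f1, a, b)" using m[OF y x] d' yx by (metis fst_conv prod.collapse)
    obtain n0 n1 n2 where n: "n0 \<in> Ar K" "n1 \<in> Ar K" "n2 \<in> Ar K"
      "fmap (f2, u2, v2) (up M M) (j n1) (j n2)" "fmap (f1, u1, v1) (lo M M) (j n0) (j n1)"
      "cmp \<mu>0 \<mu>1 (f2, u2, v2) (f1, u1, v1) = (f2 \<cdot> f1, \<mu>0 \<cdot> n0, \<mu>1 \<cdot> n2)"
      by (rule cmp_obtain[OF mu y' x' d']) (rule that)
    note n2 = fmap_arrows[OF py DM_up n(2,3) n(4)[unfolded DM_up_lo]] and n1 = fmap_arrows[OF px DM_lo n(1,2) n(5)[unfolded DM_up_lo]]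
    have c: "Id2 K n0 \<in> cells K (Dom K f1) (Dom K (hF DM))" "Id2 K n1 \<in> cells K (Cod K f1) (Cod K (hF DM))"
      "Id2 K n1 \<in> cells K (Dom K f2) (Dom K (ee DM))" "Id2 K n2 \<in> cells K (Cod K f2) (Cod K (ee DM))"
      using n n1 n2 by (simp_all add: hom_def)
    have pm: "is_pullback K p b a (f2 \<cdot> f1)" using DD(5)[OF y x d] ab by simp
    have "fmap (m y x) (m (up M M) (lo M M)) (Some (Id2 K n0)) (Some (Id2 K n2))"
    proof -
      have *: "Id2 K (hF DM) \<star> Id2 K n0 = Id2 K n1 \<star> Id2 K f1 \<and> Id2 K (hA DM) \<star> Id2 K n0 = Id2 K u1 \<and> Id2 K (pr1 DM \<cdot> eps DM) \<star> Id2 K n1 = Id2 K v1"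
        "Id2 K (ee DM) \<star> Id2 K n1 = Id2 K n2 \<star> Id2 K f2 \<and> Id2 K (pr2 DM \<cdot> eps DM) \<star> Id2 K n1 = Id2 K u2 \<and> Id2 K (rr DM) \<star> Id2 K n2 = Id2 K v2"
        using n(4,5) fmap_cells[OF px DM_lo c(1,2)] fmap_cells[OF py DM_up c(3,4)]
        unfolding DM_up_lo j_Some[OF n(1)] j_Some[OF n(2)] j_Some[OF n(3)] by blast+
      have "Id2 K (ee DM \<cdot> hF DM) \<star> Id2 K n0 = Id2 K n2 \<star> Id2 K (f2 \<cdot> f1) \<and> Id2 K \<mu>0 \<star> Id2 K n0 = Id2 K a \<and> Id2 K \<mu>1 \<star> Id2 K n2 = Id2 K b"
        using DD(8)[OF y x uf d ud', of "Id2 K n0" "Id2 K n1" "Id2 K n2"] c *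
        unfolding g ab unfolding yx DM_up_lo prod.case by blast
      then show ?thesis
        unfolding ab g
        by (subst fmap_cells[OF pm mu, symmetric]) (use n n1 n2 DM_types is_pullback_types[OF px] is_pullback_types[OF py] d' in \<open>simp_all add: hom_def\<close>)
    qed
    then have "fmap (f2 \<cdot> f1, a, b) (ee DM \<cdot> hF DM, \<mu>0, \<mu>1) (j n0) (j n2)"
      unfolding ab g j_Some[OF n(1)] j_Some[OF n(3)] .
    then have "\<mu>0 \<cdot> n0 = a" "\<mu>1 \<cdot> n2 = b"
      using fmap_j_iff[OF pm mu n(1,3)] by blast+
    then show ?thesis using ab n(6) yx by simp
  qed
  show ?thesis
  proof (rule that[OF eta mu])
    show "I = Fib.mk_ide (uni \<eta>0 \<eta>1)" unfolding IH(1) by (rule Fib.mk_ide_cong[OF iu])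
    show "H = Fib.mk_cmp (cmp \<mu>0 \<mu>1)" unfolding IH(2) by (rule Fib.mk_cmp_cong[OF mc])
    show "Fib.is_double (uni \<eta>0 \<eta>1) (cmp \<mu>0 \<mu>1)" by (rule Fib.is_double_cong[OF D iu mc])
  qed
qed

lemma double_structureI:
  assumes eta: "is_pullback K p \<eta>1 \<eta>0 (Idn K one)" and mu: "is_pullback K p \<mu>1 \<mu>0 (ee DM \<cdot> hF DM)"
    and D: "Fib.is_double (uni \<eta>0 \<eta>1) (cmp \<mu>0 \<mu>1)"
  shows "(Fib.mk_ide (uni \<eta>0 \<eta>1), Fib.mk_cmp (cmp \<mu>0 \<mu>1)) \<in> double_structures K p"
proof -
  have m: "fst (cmp \<mu>0 \<mu>1 y x) = fst y \<cdot> fst x" if "y \<in> fib" "x \<in> fib" "Dom K (fst y) = Cod K (fst x)" for y x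
    using cmp_fib(2)[OF mu] that by (cases y; cases x) simp
  show ?thesis
    unfolding double_structures_iff
  proof (intro exI conjI ballI impI)
    show "Fib.is_double (uni \<eta>0 \<eta>1) (cmp \<mu>0 \<mu>1)" by (rule D)
    show "fst (uni \<eta>0 \<eta>1 X) = Idn K X" for X by (simp add: uni_def)
  qed (rule refl, rule refl, rule m)
qed

end

context fibration_polynomials begin

definition double_of_monad where
  "double_of_monad s = (Fib.mk_ide (uni (fst (snd (snd (fst s)))) (snd (snd (snd (fst s))))),
     Fib.mk_cmp (cmp (fst (snd (snd (snd s)))) (snd (snd (snd (snd s))))))"

lemma double_of_monad_eq:
  "double_of_monad ((a, b, \<eta>0, \<eta>1), (c, d, \<mu>0, \<mu>1)) = (Fib.mk_ide (uni \<eta>0 \<eta>1), Fib.mk_cmp (cmp \<mu>0 \<mu>1))"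
  by (simp only: double_of_monad_def fst_conv snd_conv)

lemma bij_double_of_monad: "bij_betw double_of_monad (monad_structures K pb dpb one p) (double_structures K p)"
  unfolding bij_betw_def
proof
  have up_lo_PP: "(up M M, lo M M) \<in> Ob Fib.PP"
    using DM_up DM_lo DM_types unfolding Fib.PP_Ob by (simp add: DM_up_lo)
  show "inj_on double_of_monad (monad_structures K pb dpb one p)"
  proof (rule inj_onI)
    fix s s' assume s: "s \<in> monad_structures K pb dpb one p" "s' \<in> monad_structures K pb dpb one p"
      and e: "double_of_monad s = double_of_monad s'"
    obtain \<eta> \<mu> \<eta>' \<mu>' where ss: "s = (\<eta>, \<mu>)" "s' = (\<eta>', \<mu>')" by (cases s; cases s')
    then have M: "is_monad Poly one M \<eta> \<mu>" "is_monad Poly one M \<eta>' \<mu>'" using s by (simp_all add: monad_structures_def)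
    obtain \<eta>0 \<eta>1 \<mu>0 \<mu>1 where c: "\<eta> = unit_cell \<eta>0 \<eta>1" "\<mu> = mult_cell \<mu>0 \<mu>1"
      and eta: "is_pullback K p \<eta>1 \<eta>0 (Idn K one)" and mu: "is_pullback K p \<mu>1 \<mu>0 (ee DM \<cdot> hF DM)"
      by (rule monad_cells[OF M(1)]) (rule that)
    obtain \<eta>0' \<eta>1' \<mu>0' \<mu>1' where c': "\<eta>' = unit_cell \<eta>0' \<eta>1'" "\<mu>' = mult_cell \<mu>0' \<mu>1'"
      and eta': "is_pullback K p \<eta>1' \<eta>0' (Idn K one)" and mu': "is_pullback K p \<mu>1' \<mu>0' (ee DM \<cdot> hF DM)"
      by (rule monad_cells[OF M(2)]) (rule that)
    have "(Fib.mk_ide (uni \<eta>0 \<eta>1), Fib.mk_cmp (cmp \<mu>0 \<mu>1)) = (Fib.mk_ide (uni \<eta>0' \<eta>1'), Fib.mk_cmp (cmp \<mu>0' \<mu>1'))"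
      by (rule e[unfolded ss c c' double_of_monad_eq])
    then have I: "Fib.mk_ide (uni \<eta>0 \<eta>1) = Fib.mk_ide (uni \<eta>0' \<eta>1')"
      and H: "Fib.mk_cmp (cmp \<mu>0 \<mu>1) = Fib.mk_cmp (cmp \<mu>0' \<mu>1')"
      by (simp_all only: prod.inject)
    have "uni \<eta>0 \<eta>1 one = uni \<eta>0' \<eta>1' one"
      by (rule arg_cong[OF I, of "\<lambda>F. fob F one", unfolded Fib.mk_ide_simps(1)[OF one_Ob]])
    moreover have "cmp \<mu>0 \<mu>1 (up M M) (lo M M) = cmp \<mu>0' \<mu>1' (up M M) (lo M M)"
      by (rule arg_cong[OF H, of "\<lambda>F. fob F (up M M, lo M M)", unfolded Fib.mk_cmp_simps(1)[OF up_lo_PP]])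
    ultimately show "s = s'"
      unfolding uni_one[OF eta mu] uni_one[OF eta' mu'] cmp_up_lo[OF eta mu] cmp_up_lo[OF eta' mu']
      by (simp add: ss c c')
  qed
  show "double_of_monad ` monad_structures K pb dpb one p = double_structures K p"
  proof (intro equalityI subsetI)
    fix d assume "d \<in> double_of_monad ` monad_structures K pb dpb one p"
    then obtain \<eta> \<mu> where d: "d = double_of_monad (\<eta>, \<mu>)" and M: "is_monad Poly one M \<eta> \<mu>"
      by (auto simp: monad_structures_def)
    obtain \<eta>0 \<eta>1 \<mu>0 \<mu>1 where c: "\<eta> = unit_cell \<eta>0 \<eta>1" "\<mu> = mult_cell \<mu>0 \<mu>1"
      and eta: "is_pullback K p \<eta>1 \<eta>0 (Idn K one)" and mu: "is_pullback K p \<mu>1 \<mu>0 (ee DM \<cdot> hF DM)"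
      by (rule monad_cells[OF M]) (rule that)
    show "d \<in> double_structures K p"
      using double_structureI[OF eta mu] M monad_iff_double[OF eta mu] unfolding d c double_of_monad_eq by blast
  next
    fix d assume d: "d \<in> double_structures K p"
    obtain I H where IH: "d = (I, H)" by (cases d)
    obtain \<eta>0 \<eta>1 \<mu>0 \<mu>1 where *: "is_pullback K p \<eta>1 \<eta>0 (Idn K one)" "is_pullback K p \<mu>1 \<mu>0 (ee DM \<cdot> hF DM)"
      "I = Fib.mk_ide (uni \<eta>0 \<eta>1)" "H = Fib.mk_cmp (cmp \<mu>0 \<mu>1)" "Fib.is_double (uni \<eta>0 \<eta>1) (cmp \<mu>0 \<mu>1)"
      by (rule double_structure_obtain[OF d[unfolded IH]]) (rule that)
    have "(unit_cell \<eta>0 \<eta>1, mult_cell \<mu>0 \<mu>1) \<in> monad_structures K pb dpb one p"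
      using monad_iff_double[OF *(1,2)] *(5) by (simp add: monad_structures_def)
    moreover have "double_of_monad (unit_cell \<eta>0 \<eta>1, mult_cell \<mu>0 \<mu>1) = d"
      unfolding IH *(3,4) by (rule double_of_monad_eq)
    ultimately show "d \<in> double_of_monad ` monad_structures K pb dpb one p" by force
  qed
qed

end

theorem theorem5p4p1:
  fixes K :: "('o, 'a, 'c) twocat"
    and pb :: "'a \<Rightarrow> 'a \<Rightarrow> 'a \<times> 'a"
    and dpb :: "'a \<Rightarrow> 'a \<Rightarrow> 'a \<times> 'a \<times> 'a"
    and one E B :: 'o and p :: 'a
  assumes "two_category K"
    and "has_finite_limits K"
    and "pullback_choice K pb"
    and "dpullback_choice K dpb"
    and "is_terminal K one"
    and "p \<in> hom K E B"
    and "exponentiable K pb p"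
  shows "\<exists>\<Phi>. bij_betw \<Phi> (monad_structures K pb dpb one p) (double_structures K p)"
proof -
  interpret two_category K by (rule assms(1))
  interpret fibration_polynomials K p pb dpb one
    proof
    show "\<And>f g. f \<in> Ar K \<Longrightarrow> g \<in> Ar K \<Longrightarrow> Cod K f = Cod K g \<Longrightarrow> \<exists>a b. is_pullback K f g a b"
      by (rule pullbacks_exist[OF assms(2)])
  qed (rule assms)+
  show ?thesis using bij_double_of_monad by blast
qed

end
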